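(* Let $n\ge1$, $d\ge0$. The ring $A:=\mathbb{C}[\binom{\langle n\rangle}{n}_d]/\langle I_{d,n}+L_{d,n}\rangle$ is an algebra with straightening law on the doset $\mathcal D_{d,n}$, via the map sending $(\hat\gamma,\check\gamma)^{(a)}\in\mathcal D_{d,n}$ to the class of $p^{(a)}_\gamma$, where $\gamma$ is the Northeast element of $\pi_n^{-1}(\hat\gamma,\check\gamma)$.
   Context: Notation: $\langle n\rangle=\{\bar n<\dots<\bar1<1<\dots<n\}$ with $\bar\imath=-i$; $\binom{\langle n\rangle}{n}$ is the set of $n$-element subsets $\alpha=\{\alpha_1<\dots<\alpha_n\}$; $\binom{\langle n\rangle}{n}_d=\{\alpha^{(a)}\mid 0\le a\le d\}$ ordered by $\alpha^{(a)}\le\beta^{(b)}$ iff $a\le b$ and $\alpha_i\le\beta_{b-a+i}$ for $i=1,\dots,n-b+a$. $\mathbb{C}[\binom{\langle n\rangle}{n}_d]$ is the polynomial ring in variables $p^{(a)}_\alpha$, viewed as coordinates on $(S^d\mathbb{C}^2)^*\otimes\bigwedge^n\mathbb{C}^{2n}$ (the coefficient of $s^at^{d-a}$ in the $\alpha$-th Pl\"ucker form), with $\mathbb{C}^{2n}$ having basis $e_{\bar n},\dots,e_n$. $I_{d,n}$ is the homogeneous ideal of the Drinfel'd Grassmannian $\mathcal Q_d(n,2n)$, the closure in $\mathbb P((S^d\mathbb{C}^2)^*\otimes\bigwedge^n\mathbb{C}^{2n})$ of the set of degree-$d$ maps $\mathbb P^1\to\mathrm{Gr}(n,2n)$ written as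 tuples of degree-$d$ binary forms (their Pl\"ucker coordinates). $L_{d,n}$ is spanned by the linear forms $\sum_{i\in[n]:\{i,\bar\imath\}\cap\beta=\emptyset}\epsilon_i\,p^{(a)}_{\beta\cup\{\bar\imath,i\}}$ for $0\le a\le d$ and $(n-2)$-subsets $\beta=\{\beta_1<\dots<\beta_{n-2}\}\subseteq\langle n\rangle$, $\epsilon_i$ being the sign of the permutation sorting $(\bar\imath,i,\beta_1,\dots,\beta_{n-2})$ (these are $u^av^{d-a}\otimes\Omega\wedge e^*_\beta$ with $\Omega=\sum e^*_{\bar\imath}\wedge e^*_i$). Partitions: $\alpha$ corresponds to the partition in the $n\times n$ square cut out by the lattice path from the lower-left to the upper-right corner whose $j$-th step is upward iff the $j$-th smallest element of $\langle n\rangle$ is in $\alpha$ (boxes between the path and the top and left edges); $\wedge,\vee$ are intersection/union, $\alpha^t$ the transpose; $\pi_n(\gamma)=(\gamma\wedge\gamma^t,\gamma\vee\gamma^t)$. $\alpha$ is Northeast if for each box $(r,c)$ of its partition with $r>c$ (row from top, column from left), $(c,r)$ is also a box; each nonempty fiber of $\pi_n$ contains exactly one Northeast element. $\mathcal P_{d,n}$: the subposet of $\alpha^{(a)}$ with $\alpha$ containing exactly one of $i,\bar\imath$ for each $i\in[n]$ (symmetric partitions). $\mathcal D_{d,n}=\{(\hat\gamma,\check\gamma)^{(a)}:=(\hat\gamma^{(a)},\check\gamma^{(a)})\mid (\hat\gamma,\check\gamma)\in\pi_n(\binom{\langle n\rangle}{n}),\ 0\le a\le d\}$; equivalently, pairs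 of symmetric partitions $\hat\gamma\subseteq\check\gamma$ on the same level with the same Durfee square. Doset axioms and order: $\Delta_{\mathcal P}\subseteq\mathcal D\subseteq\{(x,y)\mid x\le y\}$, with $(x,z)\in\mathcal D$ iff $(x,y),(y,z)\in\mathcal D$ whenever $x\le y\le z$; $(x,y)\le(z,w)$ iff $y\le z$. Algebra with straightening law on $\mathcal D$: a graded $\mathbb{C}$-algebra with an injection $\mathcal D\to A_1$, $(x,y)\mapsto p_{(x,y)}$, such that (1) the $p_{(x,y)}$ generate $A$; (2) standard monomials $p_{(x_1,y_1)}\cdots p_{(x_k,y_k)}$ with $x_1\le y_1\le x_2\le\dots\le y_k$ form a basis; (3) in the expansion of any monomial in distinct standard monomials, each appearing index sequence $(x_{j1},y_{j1},\dots)$ is lexicographically smaller than that of the original monomial; (4) if $x_1\le x_2\le x_3\le x_4$ and $(x_{\sigma(1)},x_{\sigma(2)}),(x_{\sigma(3)},x_{\sigma(4)})\in\mathcal D$ for some $\sigma\in S_4$, then $p_{(x_{\sigma(1)},x_{\sigma(2)})}p_{(x_{\sigma(3)},x_{\sigma(4)})}=\pm p_{(x_1,x_2)}p_{(x_3,x_4)}+$ a combination of other quadratic standard monomials. *)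

theory Defs
  imports Complex_Main "HOL-Library.Poly_Mapping" "HOL-Combinatorics.Permutations"
begin

definition angle :: "nat \<Rightarrow> int set" where
  "angle n = {- int n .. int n} - {0}"

definition nsub :: "nat \<Rightarrow> int set set" where
  "nsub n = {\<alpha>. \<alpha> \<subseteq> angle n \<and> card \<alpha> = n}"

definition elt :: "int set \<Rightarrow> nat \<Rightarrow> int" where
  "elt \<alpha> i = sorted_list_of_set \<alpha> ! (i - 1)"

text \<open>Partition (Young diagram inside the n x n square) of alpha, as a set of boxes
  (row from top, column from left), cut out by the lattice path whose j-th step is
  up iff the j-th smallest element of <n> lies in alpha.  Box (r,c) lies above-left of
  the path iff the number of up-steps before the c-th right-step is at most n - r.\<close>
definition box :: "nat \<Rightarrow> int set \<Rightarrow> (nat \<times> nat) set" where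
  "box n \<alpha> = {(r, c). 1 \<le> r \<and> r \<le> n \<and> 1 \<le> c \<and> c \<le> n \<and>
      card {x \<in> \<alpha>. x < elt (angle n - \<alpha>) c} + r \<le> n}"

definition transp :: "(nat \<times> nat) set \<Rightarrow> (nat \<times> nat) set" where
  "transp B = {(c, r). (r, c) \<in> B}"

definition northeast :: "nat \<Rightarrow> int set \<Rightarrow> bool" where
  "northeast n \<alpha> \<longleftrightarrow> (\<forall>r c. (r, c) \<in> box n \<alpha> \<and> r > c \<longrightarrow> (c, r) \<in> box n \<alpha>)"

definition pi_rel :: "nat \<Rightarrow> int set \<Rightarrow> int set \<Rightarrow> int set \<Rightarrow> bool" where
  "pi_rel n \<gamma> gh gc \<longleftrightarrow> gh \<in> nsub n \<and> gc \<in> nsub n \<and>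
     box n gh = box n \<gamma> \<inter> transp (box n \<gamma>) \<and> box n gc = box n \<gamma> \<union> transp (box n \<gamma>)"

definition symm :: "nat \<Rightarrow> int set \<Rightarrow> bool" where
  "symm n \<alpha> \<longleftrightarrow> (\<forall>i \<in> {1..n}. (int i \<in> \<alpha>) \<noteq> (- int i \<in> \<alpha>))"

type_synonym lv = "int set \<times> nat"   \<comment> \<open>alpha^(a) is the pair (alpha, a)\<close>

definition LevPos :: "nat \<Rightarrow> nat \<Rightarrow> lv set" where
  "LevPos d n = {(\<alpha>, a). \<alpha> \<in> nsub n \<and> a \<le> d}"

definition le_lv :: "nat \<Rightarrow> lv \<Rightarrow> lv \<Rightarrow> bool" where
  "le_lv n x y \<longleftrightarrow> (case x of (\<alpha>, a) \<Rightarrow> case y of (\<beta>, b) \<Rightarrow>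
      a \<le> b \<and> (\<forall>i. 1 \<le> i \<and> i + (b - a) \<le> n \<longrightarrow> elt \<alpha> i \<le> elt \<beta> (b - a + i)))"

definition less_lv :: "nat \<Rightarrow> lv \<Rightarrow> lv \<Rightarrow> bool" where
  "less_lv n x y \<longleftrightarrow> le_lv n x y \<and> x \<noteq> y"

definition PP :: "nat \<Rightarrow> nat \<Rightarrow> lv set" where
  "PP d n = {(\<alpha>, a) \<in> LevPos d n. symm n \<alpha>}"

definition Dos :: "nat \<Rightarrow> nat \<Rightarrow> (lv \<times> lv) set" where
  "Dos d n = {((gh, a), (gc, a)) | gh gc a. a \<le> d \<and> (\<exists>\<gamma> \<in> nsub n. pi_rel n \<gamma> gh gc)}"

definition is_doset :: "lv set \<Rightarrow> (lv \<Rightarrow> lv \<Rightarrow> bool) \<Rightarrow> (lv \<times> lv) set \<Rightarrow> bool" where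
  "is_doset P le D \<longleftrightarrow>
     (\<forall>x \<in> P. (x, x) \<in> D) \<and> (\<forall>(x, y) \<in> D. x \<in> P \<and> y \<in> P \<and> le x y) \<and>
     (\<forall>x \<in> P. \<forall>y \<in> P. \<forall>z \<in> P. le x y \<and> le y z \<longrightarrow>
        ((x, z) \<in> D \<longleftrightarrow> (x, y) \<in> D \<and> (y, z) \<in> D))"

type_synonym pol = "((lv \<Rightarrow>\<^sub>0 nat) \<Rightarrow>\<^sub>0 complex)"

definition var :: "lv \<Rightarrow> pol" where
  "var v = Poly_Mapping.single (Poly_Mapping.single v 1) 1"

definition const :: "complex \<Rightarrow> pol" where
  "const c = Poly_Mapping.single 0 c"

definition Ring :: "nat \<Rightarrow> nat \<Rightarrow> pol set" where
  "Ring d n = {f :: pol. \<forall>m \<in> Poly_Mapping.keys f. Poly_Mapping.keys m \<subseteq> LevPos d n}"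

definition peval :: "(lv \<Rightarrow> complex) \<Rightarrow> pol \<Rightarrow> complex" where
  "peval c f = (\<Sum>m \<in> Poly_Mapping.keys f. Poly_Mapping.lookup f m * (\<Prod>v \<in> Poly_Mapping.keys m. c v ^ Poly_Mapping.lookup m v))"

definition mdeg :: "(lv \<Rightarrow>\<^sub>0 nat) \<Rightarrow> nat" where
  "mdeg m = (\<Sum>v \<in> Poly_Mapping.keys m. Poly_Mapping.lookup m v)"

definition homcomp :: "nat \<Rightarrow> pol \<Rightarrow> pol" where
  "homcomp k f = (\<Sum>m \<in> {m \<in> Poly_Mapping.keys f. mdeg m = k}. Poly_Mapping.single m (Poly_Mapping.lookup f m))"

definition idl :: "pol set \<Rightarrow> pol set \<Rightarrow> pol set" where
  "idl R G = {sum_list (map (\<lambda>(g, h). g * h) xs) | xs. \<forall>(g, h) \<in> set xs. g \<in> R \<and> h \<in> G}"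

definition pform :: "nat \<Rightarrow> (lv \<Rightarrow> complex) \<Rightarrow> int set \<Rightarrow> complex \<Rightarrow> complex \<Rightarrow> complex" where
  "pform d c \<alpha> s t = (\<Sum>a \<le> d. c (\<alpha>, a) * s ^ a * t ^ (d - a))"

text \<open>Pluecker coordinate (maximal minor on the columns alpha, in increasing order)
  of an n x 2n complex matrix with rows 0..n-1 and columns indexed by <n>.\<close>
definition plucker :: "nat \<Rightarrow> (nat \<Rightarrow> int \<Rightarrow> complex) \<Rightarrow> int set \<Rightarrow> complex" where
  "plucker n M \<alpha> = (\<Sum>p \<in> {p. p permutes {..<n}}.
       of_int (sign p) * (\<Prod>i<n. M i (sorted_list_of_set \<alpha> ! p i)))"

text \<open>Coefficient vectors (in the affine cone) of degree-d maps P^1 -> Gr(n,2n): tuples of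
  degree-d binary forms which at every point [s:t] of P^1 are the (nonzero) Pluecker
  coordinates of a point of Gr(n,2n).\<close>
definition MapCone :: "nat \<Rightarrow> nat \<Rightarrow> (lv \<Rightarrow> complex) set" where
  "MapCone d n = {c. \<forall>s t. (s, t) \<noteq> (0, 0) \<longrightarrow>
      (\<exists>\<alpha> \<in> nsub n. pform d c \<alpha> s t \<noteq> 0) \<and>
      (\<exists>M. \<forall>\<alpha> \<in> nsub n. pform d c \<alpha> s t = plucker n M \<alpha>)}"

text \<open>Homogeneous ideal of the closure Q_d(n,2n): polynomials vanishing on the cone.\<close>
definition Iid :: "nat \<Rightarrow> nat \<Rightarrow> pol set" where
  "Iid d n = {f \<in> Ring d n. \<forall>c \<in> MapCone d n. peval c f = 0}"

definition inversions :: "int list \<Rightarrow> nat" where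
  "inversions xs = card {(j, k). j < k \<and> k < length xs \<and> xs ! k < xs ! j}"

definition sortsign :: "int list \<Rightarrow> complex" where
  "sortsign xs = (-1) ^ inversions xs"

definition lform :: "nat \<Rightarrow> int set \<Rightarrow> nat \<Rightarrow> pol" where
  "lform n \<beta> a = (\<Sum>i \<in> {i \<in> {1..n}. int i \<notin> \<beta> \<and> - int i \<notin> \<beta>}.
      const (sortsign ([- int i, int i] @ sorted_list_of_set \<beta>)) * var (\<beta> \<union> {- int i, int i}, a))"

definition Lgens :: "nat \<Rightarrow> nat \<Rightarrow> pol set" where
  "Lgens d n = {lform n \<beta> a | \<beta> a. \<beta> \<subseteq> angle n \<and> card \<beta> + 2 = n \<and> a \<le> d}"

definition Jid :: "nat \<Rightarrow> nat \<Rightarrow> pol set" where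
  "Jid d n = idl (Ring d n) (Iid d n \<union> Lgens d n)"

definition pD :: "nat \<Rightarrow> lv \<times> lv \<Rightarrow> pol" where
  "pD n xy = var (THE \<gamma>. \<gamma> \<in> nsub n \<and> northeast n \<gamma> \<and> pi_rel n \<gamma> (fst (fst xy)) (fst (snd xy)),
                  snd (fst xy))"

definition flat :: "(lv \<times> lv) list \<Rightarrow> lv list" where
  "flat ps = concat (map (\<lambda>(x, y). [x, y]) ps)"

definition standard :: "nat \<Rightarrow> (lv \<times> lv) list \<Rightarrow> bool" where
  "standard n ps \<longleftrightarrow> successively (le_lv n) (flat ps)"

definition mono :: "nat \<Rightarrow> (lv \<times> lv) list \<Rightarrow> pol" where
  "mono n ps = prod_list (map (pD n) ps)"

definition StdSeqs :: "nat \<Rightarrow> nat \<Rightarrow> (lv \<times> lv) list set" where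
  "StdSeqs d n = {ps. set ps \<subseteq> Dos d n \<and> standard n ps}"

definition lincomb :: "nat \<Rightarrow> (lv \<times> lv) list set \<Rightarrow> ((lv \<times> lv) list \<Rightarrow> complex) \<Rightarrow> pol" where
  "lincomb n S c = (\<Sum>s \<in> S. const (c s) * mono n s)"

definition lexless :: "nat \<Rightarrow> lv list \<Rightarrow> lv list \<Rightarrow> bool" where
  "lexless n xs ys \<longleftrightarrow> length xs = length ys \<and>
     (\<exists>j < length xs. take j xs = take j ys \<and> less_lv n (xs ! j) (ys ! j))"

text \<open>A := C[<n>_d]/J is an algebra with straightening law on the doset D via pD,
  stated in terms of the polynomial ring modulo the ideal J.\<close>
definition is_ASL :: "nat \<Rightarrow> nat \<Rightarrow> bool" where
  "is_ASL d n \<longleftrightarrow>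
    (let R = Ring d n; J = Jid d n; D = Dos d n; le = le_lv n in
     \<comment> \<open>D is a doset in <n>_d over P_{d,n}\<close>
     is_doset (PP d n) le D \<and>
     \<comment> \<open>A is graded: J is homogeneous\<close>
     (\<forall>f \<in> J. \<forall>k. homcomp k f \<in> J) \<and>
     \<comment> \<open>the map D -> A_1 is well-defined and injective\<close>
     (\<forall>u \<in> D. pD n u \<in> R) \<and>
     (\<forall>u \<in> D. \<forall>v \<in> D. u \<noteq> v \<longrightarrow> pD n u - pD n v \<notin> J) \<and>
     \<comment> \<open>(1) generation\<close>
     (\<forall>f \<in> R. \<exists>S c. finite S \<and> (\<forall>s \<in> S. set s \<subseteq> D) \<and> f - lincomb n S c \<in> J) \<and>
     \<comment> \<open>(2) standard monomials form a basis: spanning and linear independence\<close>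
     (\<forall>f \<in> R. \<exists>S c. finite S \<and> S \<subseteq> StdSeqs d n \<and> f - lincomb n S c \<in> J) \<and>
     (\<forall>S c. finite S \<and> S \<subseteq> StdSeqs d n \<and> lincomb n S c \<in> J \<longrightarrow> (\<forall>s \<in> S. c s = 0)) \<and>
     \<comment> \<open>(3) expansion of a non-standard monomial involves only lex-smaller sequences\<close>
     (\<forall>ps. set ps \<subseteq> D \<and> \<not> standard n ps \<longrightarrow>
        (\<forall>S c. finite S \<and> S \<subseteq> StdSeqs d n \<and> mono n ps - lincomb n S c \<in> J \<longrightarrow>
           (\<forall>s \<in> S. c s \<noteq> 0 \<longrightarrow> lexless n (flat s) (flat ps)))) \<and>
     \<comment> \<open>(4) quadratic straightening\<close>
     (\<forall>x1 x2 x3 x4 \<sigma>. let xs = [x1, x2, x3, x4] in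
        le x1 x2 \<and> le x2 x3 \<and> le x3 x4 \<and> \<sigma> permutes {..<4} \<and>
        (xs ! \<sigma> 0, xs ! \<sigma> 1) \<in> D \<and> (xs ! \<sigma> 2, xs ! \<sigma> 3) \<in> D \<longrightarrow>
        (x1, x2) \<in> D \<and> (x3, x4) \<in> D \<and>
        (\<exists>\<epsilon> \<in> {1, -1}. \<exists>S c. finite S \<and>
            S \<subseteq> {s \<in> StdSeqs d n. length s = 2} - {[(x1, x2), (x3, x4)]} \<and>
            pD n (xs ! \<sigma> 0, xs ! \<sigma> 1) * pD n (xs ! \<sigma> 2, xs ! \<sigma> 3)
              - const \<epsilon> * (pD n (x1, x2) * pD n (x3, x4)) - lincomb n S c \<in> J)))"

end

theory Submission
  imports Defs "Jordan_Normal_Form.Determinant"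
begin

text \<open>
  An element of the poset is a pair of integer step functions on {0..n}. Starting from the single point with only
  the top coordinate nonzero, the one-parameter subgroups of the simple affine roots of type C sweep out a family
  of maps from the projective line to the Lagrangian Grassmannian, graded by the step function bounding the
  support; the ideal vanishes on all of it. Letting the parameters tend to 0 degenerates a
  relation among monomials on one member of the family to a relation on the preceding one, and for standard
  monomials no information is lost. This yields linear independence, the lexicographic bound on
  the terms of a quadratic straightening relation, and the coefficient 1 or -1 in the fourth axiom.

  For spanning, the linear relations express every variable by Northeast ones and identify a variable with its
  transpose up to sign. A product of two maps of minors that agree on the diagonal s = X has an alternating sum
  divisible by a power of X - s; its coefficients give quadratic relations on the Grassmannian of maps that
  straighten any incomparable pair. Since an adjacent nonstandard pair can be replaced by lexicographically smaller
  ones, and the poset is well-founded, every monomial straightens.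
\<close>

subsection \<open>The polynomial ring and its ideals\<close>

text \<open>Nothing is known in advance about the quotient: the ideal generated by
  \<open>Iid\<close> and \<open>Lgens\<close> is not shown to be the vanishing ideal of a variety.
  It is squeezed instead. Independence uses only that its elements vanish on one explicit family,
  spanning uses only explicit relations lying in it. The spanning side does not see the
  lexicographic order, because the exchange relations control merely the level and the sum of the
  entries of a set; it supplies some finite expansion of a nonstandard pair, and evaluation on the
  family decides which standard pairs can carry a nonzero coefficient. A member of the family whose
  bound \<open>W\<close> has \<open>W n < 0\<close> has a base point at s = 0 and is not a map of
  degree d. Membership in the cone of maps is therefore available for \<open>W n = 0\<close>, and
  the other bounds are reached from the largest one by letting a parameter tend to 0. Alternation
  produces factors such as (b - a)! and numbers of permutations, and averaging the linear relations
  produces further integers; all of them are inverted, which uses characteristic zero.\<close>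

definition mono_eval :: "(lv \<Rightarrow> complex) \<Rightarrow> (lv \<Rightarrow>\<^sub>0 nat) \<Rightarrow> complex" where
  "mono_eval c m = (\<Prod>v \<in> Poly_Mapping.keys m. c v ^ Poly_Mapping.lookup m v)"

lemma mono_eval_superset:
  assumes "finite A" "Poly_Mapping.keys m \<subseteq> A"
  shows "mono_eval c m = (\<Prod>v\<in>A. c v ^ Poly_Mapping.lookup m v)"
  unfolding mono_eval_def
  by (rule prod.mono_neutral_left) (use assms in \<open>auto simp: in_keys_iff\<close>)

lemma mono_eval_add: "mono_eval c (m + m') = mono_eval c m * mono_eval c m'"
proof -
  let ?A = "Poly_Mapping.keys m \<union> Poly_Mapping.keys m'"
  have "finite ?A" "Poly_Mapping.keys (m + m') \<subseteq> ?A" using keys_add[of m m'] by auto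
  then show ?thesis
    by (simp add: mono_eval_superset[of ?A] lookup_add power_add prod.distrib)
qed

lemma peval_superset:
  assumes "finite A" "Poly_Mapping.keys f \<subseteq> A"
  shows "peval c f = (\<Sum>m\<in>A. Poly_Mapping.lookup f m * mono_eval c m)"
  unfolding peval_def mono_eval_def
  by (rule sum.mono_neutral_left) (use assms in \<open>auto simp: in_keys_iff\<close>)

lemma peval_add: "peval c (f + g) = peval c f + peval c g"
proof -
  let ?A = "Poly_Mapping.keys f \<union> Poly_Mapping.keys g"
  have "finite ?A" "Poly_Mapping.keys (f + g) \<subseteq> ?A" using keys_add[of f g] by auto
  then show ?thesis
    by (simp add: peval_superset[of ?A] lookup_add algebra_simps sum.distrib)
qed

lemma peval_zero [simp]: "peval c 0 = 0"
  by (simp add: peval_def)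

lemma peval_sum: "peval c (sum F A) = (\<Sum>x\<in>A. peval c (F x))"
  by (induction A rule: infinite_finite_induct) (auto simp: peval_add)

lemma peval_single: "peval c (Poly_Mapping.single m a) = a * mono_eval c m"
  by (simp add: peval_def mono_eval_def)

lemma pol_eq_sum_single:
  "f = (\<Sum>m\<in>Poly_Mapping.keys f. Poly_Mapping.single m (Poly_Mapping.lookup f m))" for f :: "'a \<Rightarrow>\<^sub>0 'b::comm_monoid_add"
  by (rule poly_mapping_eqI)
    (auto simp: lookup_sum lookup_single when_def sum.delta in_keys_iff)

lemma peval_mult: "peval c (f * g) = peval c f * peval c g"
proof -
  let ?s = "\<lambda>f. (\<Sum>m\<in>Poly_Mapping.keys f. Poly_Mapping.single m (Poly_Mapping.lookup f m)) :: pol"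
  have "peval c (?s f * ?s g) = peval c (?s f) * peval c (?s g)"
    by (simp add: sum_product peval_sum mult_single peval_single mono_eval_add algebra_simps)
  then show ?thesis using pol_eq_sum_single[of f] pol_eq_sum_single[of g] by simp
qed

lemma peval_const [simp]: "peval c (const a) = a"
  by (simp add: const_def peval_single mono_eval_def)

lemma peval_var [simp]: "peval c (var v) = c v"
  by (simp add: var_def peval_single mono_eval_def)

lemma peval_diff: "peval c (f - g) = peval c f - peval c g"
  using peval_add[of c "f - g" g] by simp

lemma const_mult: "const (a * b) = const a * const b"
  by (simp add: const_def mult_single)
lemma const_add: "const (a + b) = const a + const b"
  by (simp add: const_def single_add)
lemma const_0 [simp]: "const 0 = 0" by (simp add: const_def)
lemma const_1 [simp]: "const 1 = 1" by (simp add: const_def)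
lemma const_uminus: "const (- a) = - const a"
  by (simp add: const_def single_uminus)

section \<open>Homogeneous components\<close>

lemma peval_scale: "peval (\<lambda>v. l * c v) (f :: pol) = (\<Sum>k\<in>mdeg ` Poly_Mapping.keys f. l ^ k * peval c (homcomp k f))"
proof -
  have m: "mono_eval (\<lambda>v. l * c v) m = l ^ mdeg m * mono_eval c m" for m
    by (simp add: mono_eval_def mdeg_def power_mult_distrib prod.distrib power_sum)
  have "peval (\<lambda>v. l * c v) f = (\<Sum>m\<in>Poly_Mapping.keys f. l ^ mdeg m * (Poly_Mapping.lookup f m * mono_eval c m))"
    by (simp add: peval_superset[of "Poly_Mapping.keys f"] m algebra_simps)
  also have "\<dots> = (\<Sum>k\<in>mdeg ` Poly_Mapping.keys f. \<Sum>m\<in>{m \<in> Poly_Mapping.keys f. mdeg m = k}. l ^ mdeg m * (Poly_Mapping.lookup f m * mono_eval c m))"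
    by (rule sum.image_gen) simp
  also have "\<dots> = (\<Sum>k\<in>mdeg ` Poly_Mapping.keys f. l ^ k * peval c (homcomp k f))"
    by (rule sum.cong) (auto simp: homcomp_def peval_sum peval_single sum_distrib_left intro!: sum.cong)
  finally show ?thesis .
qed

lemma mdeg_add: "mdeg (m + m') = mdeg m + mdeg m'"
proof -
  let ?A = "Poly_Mapping.keys m \<union> Poly_Mapping.keys m'"
  have s: "mdeg k = (\<Sum>v\<in>?A. Poly_Mapping.lookup k v)" if "Poly_Mapping.keys k \<subseteq> ?A" for k
    unfolding mdeg_def by (rule sum.mono_neutral_left) (use that in \<open>auto simp: in_keys_iff\<close>)
  show ?thesis using keys_add[of m m'] by (simp add: s lookup_add sum.distrib)
qed

lemma lookup_homcomp: "Poly_Mapping.lookup (homcomp k f) m = (if mdeg m = k then Poly_Mapping.lookup f m else 0)"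
proof -
  have "Poly_Mapping.lookup (homcomp k f) m = (\<Sum>m'\<in>{m \<in> Poly_Mapping.keys f. mdeg m = k}. if m' = m then Poly_Mapping.lookup f m' else 0)"
    by (auto simp: homcomp_def lookup_sum lookup_single when_def)
  also have "\<dots> = (if mdeg m = k then Poly_Mapping.lookup f m else 0)"
    by (subst sum.delta) (auto simp: in_keys_iff)
  finally show ?thesis .
qed

lemma homcomp_add: "homcomp k (f + g) = homcomp k f + homcomp k g"
  by (rule poly_mapping_eqI) (auto simp: lookup_homcomp lookup_add)

lemma homcomp_0 [simp]: "homcomp k 0 = 0"
  by (rule poly_mapping_eqI) (auto simp: lookup_homcomp)

lemma homcomp_sum: "homcomp k (sum F A) = (\<Sum>x\<in>A. homcomp k (F x))"
  by (induction A rule: infinite_finite_induct) (auto simp: homcomp_add)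

lemma homcomp_single: "homcomp k (Poly_Mapping.single m a) = (if mdeg m = k then Poly_Mapping.single m a else 0)"
  by (rule poly_mapping_eqI) (auto simp: lookup_homcomp lookup_single when_def)

lemma keys_homcomp: "Poly_Mapping.keys (homcomp k f) = {m \<in> Poly_Mapping.keys f. mdeg m = k}"
  by (auto simp: in_keys_iff lookup_homcomp split: if_splits)

lemma homcomp_mult_homogeneous:
  assumes "\<And>m. m \<in> Poly_Mapping.keys h \<Longrightarrow> mdeg m = e"
  shows "homcomp k (g * h) = (if e \<le> k then homcomp (k - e) g * h else 0)"
proof -
  let ?s = "\<lambda>f. (\<Sum>m\<in>Poly_Mapping.keys f. Poly_Mapping.single m (Poly_Mapping.lookup f m)) :: pol"
  have "homcomp k (?s g * ?s h) = (if e \<le> k then homcomp (k - e) (?s g) * ?s h else 0)"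
    by (auto simp: sum_product homcomp_sum mult_single homcomp_single mdeg_add assms if_distrib
        cong: if_cong intro!: sum.cong)
  then show ?thesis using pol_eq_sum_single[of g] pol_eq_sum_single[of h] by simp
qed

lemma Ring_0 [simp]: "0 \<in> Ring d n" by (simp add: Ring_def)
lemma Ring_const [simp]: "const a \<in> Ring d n" by (auto simp: Ring_def const_def)
lemma Ring_1 [simp]: "1 \<in> Ring d n" using Ring_const[of 1] by simp
lemma Ring_var: "v \<in> LevPos d n \<Longrightarrow> var v \<in> Ring d n" by (auto simp: Ring_def var_def)
lemma Ring_add: "f \<in> Ring d n \<Longrightarrow> g \<in> Ring d n \<Longrightarrow> f + g \<in> Ring d n"
  using keys_add[of f g] by (auto simp: Ring_def)
lemma Ring_mult: "f \<in> Ring d n \<Longrightarrow> g \<in> Ring d n \<Longrightarrow> f * g \<in> Ring d n"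
  unfolding Ring_def
proof (safe)
  fix m x y assume a: "\<forall>m\<in>Poly_Mapping.keys f. Poly_Mapping.keys m \<subseteq> LevPos d n"
    "\<forall>m\<in>Poly_Mapping.keys g. Poly_Mapping.keys m \<subseteq> LevPos d n"
    "m \<in> Poly_Mapping.keys (f * g)" "(x, y) \<in> Poly_Mapping.keys m"
  then obtain p q where "p \<in> Poly_Mapping.keys f" "q \<in> Poly_Mapping.keys g" "m = p + q"
    using keys_mult[of f g] by blast
  then show "(x, y) \<in> LevPos d n" using a keys_add[of p q] by blast
qed
lemma Ring_sum: "(\<And>x. x \<in> A \<Longrightarrow> F x \<in> Ring d n) \<Longrightarrow> sum F A \<in> Ring d n"
  by (induction A rule: infinite_finite_induct) (auto simp: Ring_add)
lemma Ring_prod_list: "(\<And>x. x \<in> set xs \<Longrightarrow> x \<in> Ring d n) \<Longrightarrow> prod_list xs \<in> Ring d n"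
  by (induction xs) (auto simp: Ring_mult)
lemma Ring_homcomp: "f \<in> Ring d n \<Longrightarrow> homcomp k f \<in> Ring d n"
  by (auto simp: Ring_def keys_homcomp)

lemma single_eq_prod_var:
  "Poly_Mapping.single m a = const a * (\<Prod>v\<in>Poly_Mapping.keys m. var v ^ Poly_Mapping.lookup m v)"
proof -
  have pw: "var v ^ k = Poly_Mapping.single (Poly_Mapping.single v k) 1" for v k
    by (induction k) (auto simp: var_def mult_single single_add[symmetric])
  have "(\<Prod>v\<in>A. var v ^ Poly_Mapping.lookup m v) = Poly_Mapping.single (\<Sum>v\<in>A. Poly_Mapping.single v (Poly_Mapping.lookup m v)) 1"
    for A by (induction A rule: infinite_finite_induct) (auto simp: pw mult_single)
  then show ?thesis using pol_eq_sum_single[of m]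
    by (simp add: const_def mult_single)
qed

lemma Ring_induct [consumes 1, case_names const var add mult]:
  assumes f: "f \<in> Ring d n"
    and c: "\<And>a. P (const a)" and v: "\<And>v. v \<in> LevPos d n \<Longrightarrow> P (var v)"
    and add: "\<And>f g. f \<in> Ring d n \<Longrightarrow> g \<in> Ring d n \<Longrightarrow> P f \<Longrightarrow> P g \<Longrightarrow> P (f + g)"
    and mult: "\<And>f g. f \<in> Ring d n \<Longrightarrow> g \<in> Ring d n \<Longrightarrow> P f \<Longrightarrow> P g \<Longrightarrow> P (f * g)"
  shows "P f"
proof -
  let ?Q = "\<lambda>f. f \<in> Ring d n \<and> P f"
  have Q1: "?Q 1" using c[of 1] by simp
  have Q0: "?Q 0" using c[of 0] by simp
  have pw: "?Q (var v ^ k)" if "v \<in> LevPos d n" for v k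
    by (induction k) (use Q1 v[OF that] Ring_var[OF that] mult Ring_mult in auto)
  have pr: "?Q (\<Prod>v\<in>A. var v ^ k v)" if "A \<subseteq> LevPos d n" for A k
    using that by (induction A rule: infinite_finite_induct) (use Q1 pw mult Ring_mult in auto)
  have sg: "?Q (Poly_Mapping.single m a)" if "Poly_Mapping.keys m \<subseteq> LevPos d n" for m a
  proof -
    define r where "r = (\<Prod>v\<in>Poly_Mapping.keys m. var v ^ Poly_Mapping.lookup m v)"
    have "?Q r" unfolding r_def by (rule pr[OF that])
    then have "?Q (const a * r)" using c[of a] mult[of "const a" r] Ring_mult[of "const a" d n r] by simp
    then show ?thesis unfolding r_def using single_eq_prod_var[of m a] by simp
  qed
  have "?Q (\<Sum>m\<in>A. Poly_Mapping.single m (Poly_Mapping.lookup f m))" if "A \<subseteq> Poly_Mapping.keys f" for A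
    using that
  proof (induction A rule: infinite_finite_induct)
    case (insert m A)
    have "Poly_Mapping.keys m \<subseteq> LevPos d n" using insert f by (auto simp: Ring_def)
    from sg[OF this] insert show ?case by (auto intro: add Ring_add)
  qed (use Q0 in auto)
  from this[OF subset_refl] show ?thesis by (simp only: pol_eq_sum_single[symmetric])
qed

section \<open>The ideal generated by the relations, and its homogeneity\<close>

lemma Jid_0: "0 \<in> Jid d n"
  unfolding Jid_def idl_def by (rule CollectI, rule exI[of _ "[]"]) auto

lemma Jid_gen:
  assumes "g \<in> Ring d n" "h \<in> Iid d n \<union> Lgens d n" shows "g * h \<in> Jid d n"
  unfolding Jid_def idl_def by (rule CollectI, rule exI[of _ "[(g, h)]"]) (use assms in auto)

lemma Jid_add: "f \<in> Jid d n \<Longrightarrow> g \<in> Jid d n \<Longrightarrow> f + g \<in> Jid d n"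
  unfolding Jid_def idl_def
proof (safe)
  fix xs ys :: "(pol \<times> pol) list"
  assume "\<forall>(g, h)\<in>set xs. g \<in> Ring d n \<and> h \<in> Iid d n \<union> Lgens d n"
    "\<forall>(g, h)\<in>set ys. g \<in> Ring d n \<and> h \<in> Iid d n \<union> Lgens d n"
  then show "\<exists>zs. (\<Sum>(g, h)\<leftarrow>xs. g * h) + (\<Sum>(g, h)\<leftarrow>ys. g * h) = (\<Sum>(g, h)\<leftarrow>zs. g * h) \<and>
      (\<forall>(g, h)\<in>set zs. g \<in> Ring d n \<and> h \<in> Iid d n \<union> Lgens d n)"
    by (intro exI[of _ "xs @ ys"]) auto
qed

lemma Jid_induct [consumes 1, case_names zero add]:
  assumes "f \<in> Jid d n" and "P 0"
    and "\<And>g h f. g \<in> Ring d n \<Longrightarrow> h \<in> Iid d n \<union> Lgens d n \<Longrightarrow> f \<in> Jid d n \<Longrightarrow> P f \<Longrightarrow> P (g * h + f)"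
  shows "P f"
proof -
  obtain xs where xs: "f = (\<Sum>(g, h)\<leftarrow>xs. g * h)" "\<forall>(g, h)\<in>set xs. g \<in> Ring d n \<and> h \<in> Iid d n \<union> Lgens d n"
    using assms(1) unfolding Jid_def idl_def by auto
  have "P (\<Sum>(g, h)\<leftarrow>xs. g * h) \<and> (\<Sum>(g, h)\<leftarrow>xs. g * h) \<in> Jid d n"
    using xs(2) by (induction xs) (use assms(2,3) Jid_0 Jid_add Jid_gen in auto)
  then show ?thesis using xs by simp
qed

lemma Jid_mult: "f \<in> Jid d n \<Longrightarrow> r \<in> Ring d n \<Longrightarrow> r * f \<in> Jid d n"
proof (induction rule: Jid_induct)
  case (add g h f)
  have "r * (g * h + f) = (r * g) * h + r * f" by (simp add: algebra_simps)
  then show ?case using add by (auto intro!: Jid_add Jid_gen Ring_mult)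
qed (simp add: Jid_0)

lemma Jid_const_mult: "f \<in> Jid d n \<Longrightarrow> const a * f \<in> Jid d n"
  by (rule Jid_mult) auto
lemma Jid_uminus: "f \<in> Jid d n \<Longrightarrow> - f \<in> Jid d n"
  using Jid_const_mult[of f d n "-1"] by (simp add: const_uminus)
lemma Jid_diff: "f \<in> Jid d n \<Longrightarrow> g \<in> Jid d n \<Longrightarrow> f - g \<in> Jid d n"
  using Jid_add[of f d n "-g"] Jid_uminus by simp
lemma Jid_sum: "(\<And>x. x \<in> A \<Longrightarrow> F x \<in> Jid d n) \<Longrightarrow> sum F A \<in> Jid d n"
  by (induction A rule: infinite_finite_induct) (auto simp: Jid_0 Jid_add)
lemma Iid_Jid: "f \<in> Iid d n \<Longrightarrow> f \<in> Jid d n"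
  using Jid_gen[of 1 d n f] by simp
lemma Lgens_Jid: "f \<in> Lgens d n \<Longrightarrow> f \<in> Jid d n"
  using Jid_gen[of 1 d n f] by simp

lemma Iid_mult: "f \<in> Iid d n \<Longrightarrow> r \<in> Ring d n \<Longrightarrow> r * f \<in> Iid d n"
  by (auto simp: Iid_def peval_mult Ring_mult)

lemma plucker_scale_row:
  assumes "n \<ge> 1"
  shows "plucker n (\<lambda>i x. if i = 0 then l * M i x else M i x) \<alpha> = l * plucker n M \<alpha>"
proof -
  have "(\<Prod>i<n. if i = 0 then l * F i else F i) = l * (\<Prod>i<n. F i)" for F :: "nat \<Rightarrow> complex"
    using assms prod.remove[of "{..<n}" 0 F] prod.remove[of "{..<n}" 0 "\<lambda>i. if i = 0 then l * F i else F i"]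
    by (auto intro!: prod.cong)
  then show ?thesis unfolding plucker_def sum_distrib_left by (auto simp: algebra_simps intro!: sum.cong)
qed

lemma MapCone_scale:
  assumes "n \<ge> 1" "c \<in> MapCone d n" "l \<noteq> 0" shows "(\<lambda>v. l * c v) \<in> MapCone d n"
proof -
  have p: "pform d (\<lambda>v. l * c v) \<alpha> s t = l * pform d c \<alpha> s t" for \<alpha> s t
    by (simp add: pform_def sum_distrib_left algebra_simps)
  show ?thesis unfolding MapCone_def mem_Collect_eq p
  proof (intro allI impI conjI)
    fix s t :: complex assume st: "(s, t) \<noteq> (0, 0)"
    then show "\<exists>\<alpha>\<in>nsub n. l * pform d c \<alpha> s t \<noteq> 0" using assms unfolding MapCone_def by auto
    obtain M where "\<forall>\<alpha>\<in>nsub n. pform d c \<alpha> s t = plucker n M \<alpha>"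
      using st assms(2) unfolding MapCone_def by blast
    then show "\<exists>M. \<forall>\<alpha>\<in>nsub n. l * pform d c \<alpha> s t = plucker n M \<alpha>"
      by (intro exI[of _ "\<lambda>i x. if i = 0 then l * M i x else M i x"]) (simp add: plucker_scale_row[OF assms(1)] del: One_nat_def)
  qed
qed

text \<open>A polynomial with infinitely many roots is zero. Only nonzero \<open>l\<close> are
  assumed, because scalings of a cone point and the coordinate s of a family member are available
  only there.\<close>

lemma power_sum_zero_imp_coeff_zero:
  fixes a :: "nat \<Rightarrow> complex"
  assumes "finite K" "\<And>l. l \<noteq> 0 \<Longrightarrow> (\<Sum>k\<in>K. l ^ k * a k) = 0" "k \<in> K"
  shows "a k = 0"
proof -
  define p where "p = (\<Sum>k\<in>K. monom (a k) k)"
  have pp: "poly p l = (\<Sum>k\<in>K. l ^ k * a k)" for l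
    by (simp add: p_def poly_sum poly_monom mult.commute)
  have "p = 0"
  proof (rule ccontr)
    assume "p \<noteq> 0"
    then have "finite {x. poly p x = 0}" by (rule poly_roots_finite)
    moreover have "UNIV - {0} \<subseteq> {x. poly p x = 0}" using assms(2) by (auto simp: pp)
    ultimately have "finite (UNIV - {0::complex})" by (rule rev_finite_subset)
    then show False using infinite_UNIV_char_0[where 'a=complex] by simp
  qed
  then have "coeff p k = 0" by simp
  then show ?thesis using assms(1,3) by (simp add: p_def coeff_sum sum.delta)
qed

text \<open>The cone of maps is stable under nonzero scalars, so \<open>f\<close> vanishes at all
  multiples of a point; as a polynomial in the scalar, this value has the homogeneous components as
  coefficients.\<close>

lemma Iid_homogeneous:
  assumes "n \<ge> 1" "f \<in> Iid d n" shows "homcomp k f \<in> Iid d n"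
proof (cases "k \<in> mdeg ` Poly_Mapping.keys f")
  case True
  have "peval c (homcomp k f) = 0" if c: "c \<in> MapCone d n" for c
  proof (rule power_sum_zero_imp_coeff_zero[OF _ _ True])
    fix l :: complex assume "l \<noteq> 0"
    then have "peval (\<lambda>v. l * c v) f = 0"
      using MapCone_scale[OF assms(1) c] assms(2) unfolding Iid_def by blast
    then show "(\<Sum>k\<in>mdeg ` Poly_Mapping.keys f. l ^ k * peval c (homcomp k f)) = 0"
      by (simp only: peval_scale)
  qed simp
  then show ?thesis using assms(2) by (auto simp: Iid_def Ring_homcomp)
next
  case False
  then have "homcomp k f = 0"
    by (intro poly_mapping_eqI) (force simp: lookup_homcomp in_keys_iff)
  then show ?thesis by (simp add: Iid_def)
qed

lemma Jid_homogeneous: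
  assumes "n \<ge> 1" "f \<in> Jid d n" shows "homcomp k f \<in> Jid d n"
  using assms(2)
proof (induction rule: Jid_induct)
  case (add g h f)
  have "homcomp k (g * h) \<in> Jid d n"
  \<comment> \<open>The generators need different arguments. For \<open>h\<close> in
    \<open>Iid\<close> the whole product lies in \<open>Iid\<close>, which is closed under
    components; an element of \<open>Lgens\<close> is a linear form, so a component of the product
    is a component of \<open>g\<close> times \<open>h\<close>.\<close>
  proof (cases "h \<in> Iid d n")
    case True
    then show ?thesis using Iid_homogeneous Iid_mult Iid_Jid add assms(1) by blast
  next
    case False
    then have h: "h \<in> Lgens d n" using add by auto
    have "mdeg m = 1" if "m \<in> Poly_Mapping.keys h" for m
    proof -
      obtain \<beta> a where "h = lform n \<beta> a" using h by (auto simp: Lgens_def)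
      then have "m \<in> Poly_Mapping.keys (lform n \<beta> a)" using that by simp
      then obtain i where "m \<in> Poly_Mapping.keys (const (sortsign ([- int i, int i] @ sorted_list_of_set \<beta>)) * var (\<beta> \<union> {- int i, int i}, a))"
        unfolding lform_def using keys_sum by fastforce
      then show ?thesis
        by (auto simp: const_def var_def mult_single mdeg_def split: if_splits)
    qed
    then have "homcomp k (g * h) = (if 1 \<le> k then homcomp (k - 1) g * h else 0)"
      by (rule homcomp_mult_homogeneous)
    moreover have "homcomp (k - 1) g * h \<in> Jid d n"
      by (intro Jid_mult Lgens_Jid[OF h] Ring_homcomp add)
    ultimately show ?thesis by (simp add: Jid_0)
  qed
  then show ?case using add by (simp add: homcomp_add Jid_add)
qed (simp add: Jid_0)

subsection \<open>Step functions attached to subsets\<close>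

text \<open>Cut at its middle, the lattice path of alpha consists of two halves, which hI and hJ record as step
  functions lowered by the level a. In these terms the order is the reversed pointwise order of pairs,
  transposition exchanges hI and hJ, the map \<open>\<pi>\<^sub>n\<close> takes maximum and minimum, and alpha is Northeast
  iff hJ is below hI. Both functions are set to 0 beyond n, so that they can be compared as functions.\<close>

definition nneg :: "nat \<Rightarrow> int set \<Rightarrow> nat \<Rightarrow> nat" where
  "nneg n \<gamma> j = card {i \<in> {j<..n}. - int i \<in> \<gamma>}"

definition npos :: "nat \<Rightarrow> int set \<Rightarrow> nat \<Rightarrow> nat" where
  "npos n \<gamma> j = card {i \<in> {j<..n}. int i \<notin> \<gamma>}"

definition hI :: "nat \<Rightarrow> lv \<Rightarrow> nat \<Rightarrow> int" where
  "hI n x j = (if j \<le> n then int (nneg n (fst x) j) - int (snd x) else 0)"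

definition hJ :: "nat \<Rightarrow> lv \<Rightarrow> nat \<Rightarrow> int" where
  "hJ n x j = (if j \<le> n then int (npos n (fst x) j) - int (snd x) else 0)"

text \<open>The graphs that occur: to the right a value stays or drops by one, and
  \<open>U n\<close> is minus the level.\<close>

definition stp :: "nat \<Rightarrow> nat \<Rightarrow> (nat \<Rightarrow> int) \<Rightarrow> bool" where
  "stp d n U \<longleftrightarrow> (\<forall>j<n. U j = U (Suc j) \<or> U j = U (Suc j) + 1) \<and> (\<forall>j>n. U j = 0) \<and>
     - int d \<le> U n \<and> U n \<le> 0"

definition dec :: "nat \<Rightarrow> (nat \<Rightarrow> int) \<Rightarrow> (nat \<Rightarrow> int) \<Rightarrow> lv" where
  "dec n U V = ({- int i |i. i \<in> {1..n} \<and> U (i - 1) \<noteq> U i} \<union> {int i |i. i \<in> {1..n} \<and> V (i - 1) = V i},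
     nat (- U n))"

text \<open>Agreement at 0 says that the set has n elements, namely as many negative elements as
  missing positive ones; at n both values are minus the common level.\<close>

definition paired :: "nat \<Rightarrow> nat \<Rightarrow> (nat \<Rightarrow> int) \<Rightarrow> (nat \<Rightarrow> int) \<Rightarrow> bool" where
  "paired d n U V \<longleftrightarrow> stp d n U \<and> stp d n V \<and> U 0 = V 0 \<and> U n = V n"

lemma angle_iff: "x \<in> angle n \<longleftrightarrow> x \<noteq> 0 \<and> \<bar>x\<bar> \<le> int n"
  by (auto simp: angle_def)

lemma finite_angle [simp]: "finite (angle n)" by (simp add: angle_def)

lemma nsub_finite: "\<gamma> \<in> nsub n \<Longrightarrow> finite \<gamma>"
  by (auto simp: nsub_def intro: finite_subset)

lemma card_split_sign:
  assumes "\<gamma> \<subseteq> angle n"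
  shows "card \<gamma> + npos n \<gamma> 0 = nneg n \<gamma> 0 + n"
proof -
  have f: "finite \<gamma>" by (rule finite_subset[OF assms finite_angle])
  have "\<gamma> = (\<lambda>i. - int i) ` {i \<in> {0<..n}. - int i \<in> \<gamma>} \<union> int ` {i \<in> {0<..n}. int i \<in> \<gamma>}"
  proof (rule Set.set_eqI)
    fix x show "x \<in> \<gamma> \<longleftrightarrow> x \<in> (\<lambda>i. - int i) ` {i \<in> {0<..n}. - int i \<in> \<gamma>} \<union> int ` {i \<in> {0<..n}. int i \<in> \<gamma>}"
    proof
      assume x: "x \<in> \<gamma>"
      then have "x \<noteq> 0" "\<bar>x\<bar> \<le> int n" using assms angle_iff by auto
      then show "x \<in> (\<lambda>i. - int i) ` {i \<in> {0<..n}. - int i \<in> \<gamma>} \<union> int ` {i \<in> {0<..n}. int i \<in> \<gamma>}"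
        using x by (cases "x > 0") (auto intro!: image_eqI[where x = "nat \<bar>x\<bar>"])
    qed auto
  qed
  moreover have "card ((\<lambda>i. - int i) ` {i \<in> {0<..n}. - int i \<in> \<gamma>} \<union> int ` {i \<in> {0<..n}. int i \<in> \<gamma>})
     = nneg n \<gamma> 0 + card {i \<in> {0<..n}. int i \<in> \<gamma>}"
    by (subst card_Un_disjoint) (auto simp: nneg_def card_image inj_on_def)
  moreover have "card {i \<in> {0<..n}. int i \<in> \<gamma>} + npos n \<gamma> 0 = n"
    unfolding npos_def
    by (subst card_Un_disjoint[symmetric]) (auto simp: intro!: arg_cong[where f = card, of _ "{0<..n}", simplified])
  ultimately show ?thesis by simp
qed

lemma nsub_npos_0: "\<gamma> \<in> nsub n \<Longrightarrow> npos n \<gamma> 0 = nneg n \<gamma> 0"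
  using card_split_sign[of \<gamma> n] by (auto simp: nsub_def)

lemma nneg_le: "nneg n \<gamma> j \<le> n - j"
proof -
  have "nneg n \<gamma> j \<le> card {j<..n}" unfolding nneg_def by (intro card_mono) auto
  then show ?thesis by simp
qed

lemma npos_le: "npos n \<gamma> j \<le> n - j"
proof -
  have "npos n \<gamma> j \<le> card {j<..n}" unfolding npos_def by (intro card_mono) auto
  then show ?thesis by simp
qed

lemma filter_insert_set:
  "{i \<in> insert a A. P i} = (if P a then insert a {i \<in> A. P i} else {i \<in> A. P i})"
  by auto

lemma greaterThanAtMost_insert: "j < n \<Longrightarrow> {j<..n} = insert (Suc j) {Suc j<..n}" for j n :: nat
  by auto

lemma nneg_step: "j < n \<Longrightarrow> nneg n \<gamma> j = nneg n \<gamma> (Suc j) + (if - int (Suc j) \<in> \<gamma> then 1 else 0)"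
  unfolding nneg_def by (subst greaterThanAtMost_insert, assumption, subst filter_insert_set) simp
lemma npos_step: "j < n \<Longrightarrow> npos n \<gamma> j = npos n \<gamma> (Suc j) + (if int (Suc j) \<in> \<gamma> then 0 else 1)"
  unfolding npos_def by (subst greaterThanAtMost_insert, assumption, subst filter_insert_set) simp

lemma nneg_n [simp]: "nneg n \<gamma> n = 0" by (simp add: nneg_def)
lemma npos_n [simp]: "npos n \<gamma> n = 0" by (simp add: npos_def)

lemma paired_h: "x \<in> LevPos d n \<Longrightarrow> paired d n (hI n x) (hJ n x)"
  by (auto simp: paired_def stp_def hI_def hJ_def LevPos_def nneg_step npos_step nsub_npos_0)

lemma hI_end [simp]: "hI n x n = - int (snd x)" by (simp add: hI_def)
lemma hJ_end [simp]: "hJ n x n = - int (snd x)" by (simp add: hJ_def)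

lemma dec_h: assumes "x \<in> LevPos d n" shows "dec n (hI n x) (hJ n x) = x"
proof -
  obtain \<gamma> a where x: "x = (\<gamma>, a)" by (cases x)
  have g: "\<gamma> \<subseteq> angle n" using assms x by (auto simp: LevPos_def nsub_def)
  have 1: "hI n x (i - 1) \<noteq> hI n x i \<longleftrightarrow> - int i \<in> \<gamma>" if "i \<in> {1..n}" for i
    using nneg_step[of "i - 1" n \<gamma>] that by (cases i) (auto simp: hI_def x simp del: of_nat_Suc)
  have 2: "hJ n x (i - 1) = hJ n x i \<longleftrightarrow> int i \<in> \<gamma>" if "i \<in> {1..n}" for i
    using npos_step[of "i - 1" n \<gamma>] that by (cases i) (auto simp: hJ_def x simp del: of_nat_Suc)
  have "{- int i |i. i \<in> {1..n} \<and> hI n x (i - 1) \<noteq> hI n x i} \<union> {int i |i. i \<in> {1..n} \<and> hJ n x (i - 1) = hJ n x i} = \<gamma>"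
  proof (rule Set.set_eqI)
    fix y
    show "y \<in> {- int i |i. i \<in> {1..n} \<and> hI n x (i - 1) \<noteq> hI n x i} \<union> {int i |i. i \<in> {1..n} \<and> hJ n x (i - 1) = hJ n x i} \<longleftrightarrow> y \<in> \<gamma>"
    proof
      assume y: "y \<in> \<gamma>"
      then have *: "y \<noteq> 0" "\<bar>y\<bar> \<le> int n" using g angle_iff by auto
      show "y \<in> {- int i |i. i \<in> {1..n} \<and> hI n x (i - 1) \<noteq> hI n x i} \<union> {int i |i. i \<in> {1..n} \<and> hJ n x (i - 1) = hJ n x i}"
      proof (cases "y > 0")
        case True
        then have "y = int (nat y)" "nat y \<in> {1..n}" using * by auto
        then show ?thesis using 2[of "nat y"] y by auto
      next
        case False
        then have "y = - int (nat (- y))" "nat (- y) \<in> {1..n}" using * by auto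
        then show ?thesis using 1[of "nat (- y)"] y by auto
      qed
    qed (use 1 2 in auto)
  qed
  then show ?thesis by (simp add: dec_def x)
qed

lemma stp_card:
  assumes "\<And>j. j < n \<Longrightarrow> U j = U (Suc j) \<or> U j = U (Suc j) + (1::int)" "j \<le> n"
  shows "int (card {i \<in> {j<..n}. U (i - 1) \<noteq> U i}) = U j - U n"
  using assms(2)
proof (induction j rule: inc_induct)
  case (step j)
  have "{i \<in> {j<..n}. U (i - 1) \<noteq> U i} = {i \<in> {Suc j<..n}. U (i - 1) \<noteq> U i} \<union> (if U j \<noteq> U (Suc j) then {Suc j} else {})"
    by (subst greaterThanAtMost_insert[OF step(2)], subst filter_insert_set) simp
  then have "card {i \<in> {j<..n}. U (i - 1) \<noteq> U i} = card {i \<in> {Suc j<..n}. U (i - 1) \<noteq> U i} + (if U j \<noteq> U (Suc j) then 1 else 0)"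
    by (simp only:) simp
  then show ?case using step(3) assms(1)[OF step(2)] by (cases "U j = U (Suc j)") simp_all
qed simp

lemma h_dec:
  assumes "paired d n U V"
  shows "dec n U V \<in> LevPos d n" "hI n (dec n U V) = U" "hJ n (dec n U V) = V"
proof -
  note p = assms[unfolded paired_def stp_def]
  let ?g = "fst (dec n U V)"
  have g: "?g \<subseteq> angle n" by (auto simp: dec_def angle_iff)
  have "{i \<in> {j<..n}. - int i \<in> ?g} = {i \<in> {j<..n}. U (i - 1) \<noteq> U i}" for j
    by (auto simp: dec_def)
  then have 1: "int (nneg n ?g j) = U j - U n" if "j \<le> n" for j
    using stp_card[of n U j] p that by (simp add: nneg_def)
  have "{i \<in> {j<..n}. int i \<notin> ?g} = {i \<in> {j<..n}. V (i - 1) \<noteq> V i}" for j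
    by (auto simp: dec_def)
  then have 2: "int (npos n ?g j) = V j - V n" if "j \<le> n" for j
    using stp_card[of n V j] p that by (simp add: npos_def)
  have s: "int (snd (dec n U V)) = - U n" using p by (simp add: dec_def)
  show "hI n (dec n U V) = U" "hJ n (dec n U V) = V"
    using 1 2 s p by (auto simp: hI_def hJ_def)
  have "card ?g = n" using card_split_sign[OF g] 1[of 0] 2[of 0] p by simp
  then show "dec n U V \<in> LevPos d n" using g s p by (auto simp: LevPos_def nsub_def dec_def)
qed

lemma LevPos_eqI:
  "x \<in> LevPos d n \<Longrightarrow> y \<in> LevPos d n \<Longrightarrow> hI n x = hI n y \<Longrightarrow> hJ n x = hJ n y \<Longrightarrow> x = y"
  by (metis dec_h)

section \<open>The order in terms of counting functions\<close>

lemma elt_le_iff: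
  assumes "finite A" "1 \<le> i" "i \<le> card A"
  shows "elt A i \<le> x \<longleftrightarrow> i \<le> card {y \<in> A. y \<le> x}"
proof -
  let ?xs = "sorted_list_of_set A"
  have len: "length ?xs = card A" and st: "set ?xs = A" using assms by auto
  have sw: "?xs ! p < ?xs ! q" if "p < q" "q < card A" for p q
    using sorted_wrt_nth_less[OF sorted_list_of_set.strict_sorted_key_list_of_set[of A]] that len by simp
  have inj: "inj_on ((!) ?xs) {..<card A}"
    by (rule inj_onI) (metis sw lessThan_iff linorder_neqE_nat less_irrefl)
  show ?thesis
  proof
    assume "elt A i \<le> x"
    then have x: "?xs ! (i - 1) \<le> x" by (simp add: elt_def)
    have "?xs ! p \<le> x \<and> ?xs ! p \<in> A" if "p < i" for p
    proof -
      have "?xs ! p \<le> ?xs ! (i - 1)" using sw[of p "i - 1"] that assms(2,3) by (cases "p = i - 1") (auto simp: less_imp_le)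
      then show ?thesis using x nth_mem[of p ?xs] len st that assms by auto
    qed
    then have "(!) ?xs ` {..<i} \<subseteq> {y \<in> A. y \<le> x}" by auto
    then have "card ((!) ?xs ` {..<i}) \<le> card {y \<in> A. y \<le> x}" using assms by (intro card_mono) auto
    moreover have "card ((!) ?xs ` {..<i}) = i"
      using inj_on_subset[OF inj, of "{..<i}"] assms by (simp add: card_image)
    ultimately show "i \<le> card {y \<in> A. y \<le> x}" by simp
  next
    assume i: "i \<le> card {y \<in> A. y \<le> x}"
    show "elt A i \<le> x"
    proof (rule ccontr)
      assume n: "\<not> elt A i \<le> x"
      have "{y \<in> A. y \<le> x} \<subseteq> (!) ?xs ` {..<i - 1}"
      proof
        fix y assume y: "y \<in> {y \<in> A. y \<le> x}"
        then obtain p where p: "p < card A" "?xs ! p = y" using st len by (metis (mono_tags, lifting) in_set_conv_nth mem_Collect_eq)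
        have "p < i - 1"
        proof (rule ccontr)
          assume "\<not> p < i - 1"
          then have "?xs ! (i - 1) \<le> ?xs ! p" using sw[of "i - 1" p] p by (cases "p = i - 1") auto
          then show False using n y p by (auto simp: elt_def)
        qed
        then show "y \<in> (!) ?xs ` {..<i - 1}" using p by auto
      qed
      then have "card {y \<in> A. y \<le> x} \<le> i - 1"
        using order_trans[OF card_mono[OF finite_imageI[OF finite_lessThan]] card_image_le[OF finite_lessThan]]
        by (metis card_lessThan)
      then show False using i assms by simp
    qed
  qed
qed

text \<open>An entry with index k is at most x iff at least k elements are at most x. Entrywise
  comparison with a shift thus becomes comparison of counting functions in the opposite direction,
  with slack \<open>D\<close>.\<close>

lemma elt_shift_le_iff:
  assumes "finite A" "finite B" "card A = n" "card B = n"
  shows "(\<forall>i. 1 \<le> i \<and> i + D \<le> n \<longrightarrow> elt A i \<le> elt B (D + i)) \<longleftrightarrow>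
    (\<forall>x. card {y \<in> B. y \<le> x} \<le> card {y \<in> A. y \<le> x} + D)" (is "?L \<longleftrightarrow> ?R")
proof
  assume L: ?L
  show ?R
  proof
    fix x
    let ?m = "card {y \<in> B. y \<le> x}"
    have m: "?m \<le> n" using assms by (metis (no_types, lifting) card_mono mem_Collect_eq subsetI)
    show "?m \<le> card {y \<in> A. y \<le> x} + D"
    proof (cases "?m \<le> D")
      case False
      then have "1 \<le> ?m - D \<and> (?m - D) + D \<le> n" using m by simp
      then have "elt A (?m - D) \<le> elt B (D + (?m - D))" using L by blast
      also have "\<dots> \<le> x" using elt_le_iff[of B ?m x] assms False m by simp
      finally show ?thesis using elt_le_iff[of A "?m - D" x] assms False m by simp
    qed simp
  qed
next
  assume R: ?R
  show ?L
  proof (intro allI impI)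
    fix i assume i: "1 \<le> i \<and> i + D \<le> n"
    have "D + i \<le> card {y \<in> B. y \<le> elt B (D + i)}" using elt_le_iff[of B "D + i"] assms i by auto
    also have "\<dots> \<le> card {y \<in> A. y \<le> elt B (D + i)} + D" using R by blast
    finally show "elt A i \<le> elt B (D + i)" using elt_le_iff[of A i] assms i by auto
  qed
qed

lemma count_neg: 
  assumes "\<gamma> \<subseteq> angle n" "j \<le> n"
  shows "card {y \<in> \<gamma>. y < - int j} = nneg n \<gamma> j"
proof -
  have "{y \<in> \<gamma>. y < - int j} = (\<lambda>i. - int i) ` {i \<in> {j<..n}. - int i \<in> \<gamma>}"
  proof (rule Set.set_eqI)
    fix y show "y \<in> {y \<in> \<gamma>. y < - int j} \<longleftrightarrow> y \<in> (\<lambda>i. - int i) ` {i \<in> {j<..n}. - int i \<in> \<gamma>}"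
    proof
      assume y: "y \<in> {y \<in> \<gamma>. y < - int j}"
      then have "\<bar>y\<bar> \<le> int n" using assms angle_iff by auto
      then show "y \<in> (\<lambda>i. - int i) ` {i \<in> {j<..n}. - int i \<in> \<gamma>}" using y
        by (intro image_eqI[where x = "nat (- y)"]) auto
    qed auto
  qed
  then show ?thesis by (simp add: card_image inj_on_def nneg_def)
qed

lemma count_pos:
  assumes "\<gamma> \<in> nsub n" "j \<le> n"
  shows "card {y \<in> \<gamma>. y \<le> int j} = j + npos n \<gamma> j"
proof -
  have g: "\<gamma> \<subseteq> angle n" "card \<gamma> = n" using assms(1) by (auto simp: nsub_def)
  have f: "finite \<gamma>" by (rule nsub_finite[OF assms(1)])
  have "{y \<in> \<gamma>. y > int j} = int ` {i \<in> {j<..n}. int i \<in> \<gamma>}"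
  proof (rule Set.set_eqI)
    fix y show "y \<in> {y \<in> \<gamma>. y > int j} \<longleftrightarrow> y \<in> int ` {i \<in> {j<..n}. int i \<in> \<gamma>}"
    proof
      assume y: "y \<in> {y \<in> \<gamma>. y > int j}"
      then have "\<bar>y\<bar> \<le> int n" using g angle_iff by auto
      then show "y \<in> int ` {i \<in> {j<..n}. int i \<in> \<gamma>}" using y
        by (intro image_eqI[where x = "nat y"]) auto
    qed auto
  qed
  then have 1: "card {y \<in> \<gamma>. y > int j} = card {i \<in> {j<..n}. int i \<in> \<gamma>}" by (simp add: card_image)
  have "card {i \<in> {j<..n}. int i \<in> \<gamma>} + npos n \<gamma> j = card ({i \<in> {j<..n}. int i \<in> \<gamma>} \<union> {i \<in> {j<..n}. int i \<notin> \<gamma>})"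
    unfolding npos_def by (rule card_Un_disjoint[symmetric]) auto
  also have "{i \<in> {j<..n}. int i \<in> \<gamma>} \<union> {i \<in> {j<..n}. int i \<notin> \<gamma>} = {j<..n}" by auto
  finally have 2: "card {i \<in> {j<..n}. int i \<in> \<gamma>} + npos n \<gamma> j = n - j" by simp
  have "card {y \<in> \<gamma>. y \<le> int j} + card {y \<in> \<gamma>. y > int j} = card ({y \<in> \<gamma>. y \<le> int j} \<union> {y \<in> \<gamma>. y > int j})"
    using f by (intro card_Un_disjoint[symmetric]) auto
  also have "{y \<in> \<gamma>. y \<le> int j} \<union> {y \<in> \<gamma>. y > int j} = \<gamma>" by auto
  finally show ?thesis using 1 2 g assms(2) by simp
qed

text \<open>Subsets of \<open>angle n\<close> change their counts only at these thresholds, strict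
  ones at negative and weak ones at nonnegative numbers. The predicate takes both counts so that
  they are compared at a common threshold.\<close>

lemma count_cases:
  assumes "\<alpha> \<subseteq> angle n" "\<beta> \<subseteq> angle n"
  shows "(\<forall>x. P (card {y \<in> \<alpha>. y \<le> x}) (card {y \<in> \<beta>. y \<le> x})) \<longleftrightarrow>
    (\<forall>j\<le>n. P (card {y \<in> \<alpha>. y < - int j}) (card {y \<in> \<beta>. y < - int j}) \<and>
      P (card {y \<in> \<alpha>. y \<le> int j}) (card {y \<in> \<beta>. y \<le> int j}))" (is "_ \<longleftrightarrow> ?R")
proof
  assume R: ?R
  show "\<forall>x. P (card {y \<in> \<alpha>. y \<le> x}) (card {y \<in> \<beta>. y \<le> x})"
  proof
  fix x
  have bd: "- int n \<le> y \<and> y \<le> int n" if "\<gamma> \<subseteq> angle n" "y \<in> \<gamma>" for \<gamma> y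
    using that by (auto simp: angle_def)
  have big: "{y \<in> \<gamma>. y \<le> x} = {y \<in> \<gamma>. y \<le> int n}" if "\<gamma> \<subseteq> angle n" "x \<ge> int n" for \<gamma>
    using bd[OF that(1)] that(2) by (intro Collect_cong) (meson order_trans)
  have small: "{y \<in> \<gamma>. y \<le> x} = {y \<in> \<gamma>. y < - int n}" if "\<gamma> \<subseteq> angle n" "x < - int n" for \<gamma>
    using bd[OF that(1)] that(2) by (intro Collect_cong) (meson order_trans not_le le_less_trans)
  consider "x \<ge> int n" | "x < - int n" | "0 \<le> x" "x \<le> int n" | "x < 0" "x \<ge> - int n" by linarith
  then show "P (card {y \<in> \<alpha>. y \<le> x}) (card {y \<in> \<beta>. y \<le> x})"
  proof cases
    case 1 then show ?thesis using R big assms by simp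
  next
    case 2 then show ?thesis using R small assms by simp
  next
    case 3 then show ?thesis using R[rule_format, of "nat x"] by simp
  next
    case 4
    have "{y \<in> \<gamma>. y < 1 + x} = {y \<in> \<gamma>. y \<le> x}" for \<gamma> by auto
    with 4 show ?thesis using R[rule_format, of "nat (- x - 1)"] by simp
  qed
  qed
next
  assume A: "\<forall>x. P (card {y \<in> \<alpha>. y \<le> x}) (card {y \<in> \<beta>. y \<le> x})"
  have "{y \<in> \<gamma>. y < - int j} = {y \<in> \<gamma>. y \<le> - int j - 1}" for \<gamma> j by auto
  then have "P (card {y \<in> \<alpha>. y < - int j}) (card {y \<in> \<beta>. y < - int j})" for j
    using A[rule_format, of "- int j - 1"] by (simp only:)
  then show ?R using A by blast
qed

text \<open>Counts below \<open>- int j\<close> are \<open>nneg\<close>, counts up to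
  \<open>int j\<close> are \<open>j + npos\<close>, and subtracting the level absorbs the slack b -
  a. If a > b, both sides fail, the right one at n.\<close>

lemma le_lv_iff:
  assumes "x \<in> LevPos d n" "y \<in> LevPos d n"
  shows "le_lv n x y \<longleftrightarrow> hI n y \<le> hI n x \<and> hJ n y \<le> hJ n x"
proof -
  obtain \<alpha> a \<beta> b where xy: "x = (\<alpha>, a)" "y = (\<beta>, b)" by (cases x, cases y)
  have ab: "\<alpha> \<in> nsub n" "\<beta> \<in> nsub n" using assms xy by (auto simp: LevPos_def)
  then have s: "\<alpha> \<subseteq> angle n" "card \<alpha> = n" "\<beta> \<subseteq> angle n" "card \<beta> = n" by (auto simp: nsub_def)
  show ?thesis
  proof (cases "a \<le> b")
    case True
    have "le_lv n x y \<longleftrightarrow> (\<forall>x. card {y \<in> \<beta>. y \<le> x} \<le> card {y \<in> \<alpha>. y \<le> x} + (b - a))"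
      unfolding le_lv_def xy prod.case using True elt_shift_le_iff[of \<alpha> \<beta> n "b - a"] ab s nsub_finite by simp
    also have "\<dots> \<longleftrightarrow> (\<forall>j\<le>n. nneg n \<beta> j \<le> nneg n \<alpha> j + (b - a) \<and> npos n \<beta> j \<le> npos n \<alpha> j + (b - a))"
      by (subst count_cases[OF s(3,1), where P = "\<lambda>p q. p \<le> q + (b - a)"])
        (use ab s in \<open>simp add: count_neg count_pos\<close>)
    also have "\<dots> \<longleftrightarrow> hI n y \<le> hI n x \<and> hJ n y \<le> hJ n x"
      using True by (force simp: le_fun_def hI_def hJ_def xy)
    finally show ?thesis .
  next
    case False
    then have "\<not> hI n y n \<le> hI n x n" by (simp add: xy)
    then have "\<not> hI n y \<le> hI n x" unfolding le_fun_def by blast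
    then show ?thesis using False by (simp add: le_lv_def xy)
  qed
qed

section \<open>Partitions, Northeast elements and the doset in terms of step functions\<close>

lemma symm_iff:
  assumes "x \<in> LevPos d n" shows "symm n (fst x) \<longleftrightarrow> hI n x = hJ n x"
proof
  assume s: "symm n (fst x)"
  then have "{i \<in> {j<..n}. - int i \<in> fst x} = {i \<in> {j<..n}. int i \<notin> fst x}" for j
    by (auto simp: symm_def)
  then show "hI n x = hJ n x" by (auto simp: hI_def hJ_def nneg_def npos_def)
next
  assume h: "hI n x = hJ n x"
  show "symm n (fst x)"
  proof (unfold symm_def, intro ballI)
    fix i assume i: "i \<in> {1..n}"
    obtain k where k: "i = Suc k" "k < n" using i by (cases i) auto
    have "nneg n (fst x) k = npos n (fst x) k" "nneg n (fst x) (Suc k) = npos n (fst x) (Suc k)"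
      using fun_cong[OF h, of k] fun_cong[OF h, of "Suc k"] k by (auto simp: hI_def hJ_def)
    then show "(int i \<in> fst x) \<noteq> (- int i \<in> fst x)"
      using nneg_step[OF k(2), of "fst x"] npos_step[OF k(2), of "fst x"] unfolding k by (auto split: if_splits)
  qed
qed

text \<open>All boxes with the same c - r are separated by the point which the lattice path reaches
  after n + c - r steps; the number of upward steps made until then decides. The threshold
  \<open>z\<close> has exactly n + c - r elements of \<open>angle n\<close> up to it.\<close>

lemma box_cut:
  assumes "\<gamma> \<in> nsub n" "1 \<le> r" "r \<le> n" "1 \<le> c" "c \<le> n"
    and z: "card {y \<in> angle n. y \<le> z} + r = n + c"
  shows "(r, c) \<in> box n \<gamma> \<longleftrightarrow> card {y \<in> \<gamma>. y \<le> z} + r \<le> n"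
proof -
  have g: "\<gamma> \<subseteq> angle n" "card \<gamma> = n" using assms(1) by (auto simp: nsub_def)
  have f: "finite \<gamma>" by (rule nsub_finite[OF assms(1)])
  let ?C = "angle n - \<gamma>"
  have cang: "card (angle n) = 2 * n"
    using card_Diff_singleton[of 0 "{- int n..int n}"] by (simp add: angle_def)
  have C: "finite ?C" "card ?C = n" using f g cang by (auto simp: card_Diff_subset)
  let ?e = "elt ?C c"
  have e: "?e \<le> w \<longleftrightarrow> c \<le> card {y \<in> ?C. y \<le> w}" for w using elt_le_iff[of ?C c w] C assms by simp
  have "{y \<in> angle n. y \<le> z} = {y \<in> \<gamma>. y \<le> z} \<union> {y \<in> ?C. y \<le> z}" using g by auto
  then have s: "card {y \<in> angle n. y \<le> z} = card {y \<in> \<gamma>. y \<le> z} + card {y \<in> ?C. y \<le> z}"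
    using f by (simp add: card_Un_disjoint disjoint_iff)
  have b: "(r, c) \<in> box n \<gamma> \<longleftrightarrow> card {x \<in> \<gamma>. x < ?e} + r \<le> n" using assms by (simp add: box_def)
  show ?thesis
  proof (cases "?e \<le> z")
    case True
    have "card {x \<in> \<gamma>. x < ?e} \<le> card {y \<in> \<gamma>. y \<le> z}" using True f by (intro card_mono) auto
    then show ?thesis using b True e s z by auto
  next
    case False
    have "card {y \<in> \<gamma>. y \<le> z} \<le> card {x \<in> \<gamma>. x < ?e}" using False f by (intro card_mono) auto
    then show ?thesis using b False e s z by auto
  qed
qed

lemma angle_count_pos: assumes "j \<le> n" shows "card {y \<in> angle n. y \<le> int j} = n + j"
proof -
  have "{y \<in> angle n. y \<le> int j} = {- int n..int j} - {0}" using assms by (auto simp: angle_def)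
  then show ?thesis by simp
qed

lemma angle_count_neg: assumes "j \<le> n" shows "card {y \<in> angle n. y < - int j} = n - j"
proof -
  have "{y \<in> angle n. y < - int j} = {- int n..<- int j}" using assms by (auto simp: angle_def)
  then show ?thesis using assms by simp
qed

text \<open>Diagonals on or to the right of the main one are cut at a nonnegative threshold, hence
  governed by \<open>npos\<close>; the others are cut at a negative one and governed by
  \<open>nneg\<close>.\<close>

lemma box_iff:
  assumes "\<gamma> \<in> nsub n" "1 \<le> r" "r \<le> n" "1 \<le> c" "c \<le> n"
  shows "(r, c) \<in> box n \<gamma> \<longleftrightarrow> (if r \<le> c then npos n \<gamma> (c - r) \<le> n - c else nneg n \<gamma> (r - c) \<le> n - r)"
proof (cases "r \<le> c")
  case True
  then show ?thesis using box_cut[OF assms, of "int (c - r)"] angle_count_pos[of "c - r" n]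
      count_pos[OF assms(1), of "c - r"] assms by (simp del: of_nat_diff) arith
next
  case False
  then show ?thesis using box_cut[OF assms, of "- int (r - c) - 1"] angle_count_neg[of "r - c" n]
      count_neg[of \<gamma> n "r - c"] assms by (simp add: nsub_def del: of_nat_diff) arith
qed

lemma box_range: "(r, c) \<in> box n \<gamma> \<Longrightarrow> 1 \<le> r \<and> r \<le> n \<and> 1 \<le> c \<and> c \<le> n"
  by (simp add: box_def)

lemma northeast_iff:
  assumes g: "\<gamma> \<in> nsub n" shows "northeast n \<gamma> \<longleftrightarrow> (\<forall>j\<le>n. npos n \<gamma> j \<le> nneg n \<gamma> j)"
proof
  assume ne: "northeast n \<gamma>"
  show "\<forall>j\<le>n. npos n \<gamma> j \<le> nneg n \<gamma> j"
  proof (intro allI impI, rule ccontr)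
    fix j assume j: "j \<le> n" and c: "\<not> npos n \<gamma> j \<le> nneg n \<gamma> j"
    have jn: "j \<noteq> 0" using c nsub_npos_0[OF g] by (cases j) auto
    \<comment> \<open>The lowest box of the partition on the diagonal r - c = j; its mirror image
      forces the inequality at j.\<close>
    define r where "r = n - nneg n \<gamma> j"
    have r: "j < r" "r \<le> n" using c npos_le[of n \<gamma> j] j by (auto simp: r_def)
    have "(r, r - j) \<in> box n \<gamma>" using box_iff[OF g, of r "r - j"] r jn
      by (simp add: r_def) (use nneg_le[of n \<gamma> j] in auto)
    then have "(r - j, r) \<in> box n \<gamma>" using ne r jn unfolding northeast_def by (metis diff_less gr0I le_less_trans less_le_trans not_less_zero)
    then have "npos n \<gamma> j \<le> n - r" using box_iff[OF g, of "r - j" r] r by auto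
    then show False using c nneg_le[of n \<gamma> j] r by (simp add: r_def)
  qed
next
  assume h: "\<forall>j\<le>n. npos n \<gamma> j \<le> nneg n \<gamma> j"
  show "northeast n \<gamma>" unfolding northeast_def
  proof (intro allI impI)
    fix r c assume rc: "(r, c) \<in> box n \<gamma> \<and> c < r"
    then have b: "1 \<le> r" "r \<le> n" "1 \<le> c" "c \<le> n" using box_range by blast+
    then have "nneg n \<gamma> (r - c) \<le> n - r" using rc box_iff[OF g] by auto
    then have "npos n \<gamma> (r - c) \<le> n - r" using h by (meson b diff_le_self le_trans)
    then show "(c, r) \<in> box n \<gamma>" using box_iff[OF g, of c r] b rc by simp
  qed
qed

text \<open>A diagram is determined by the lengths of its diagonals. The box set \<open>B\<close> is
  kept general so that both the intersection and the union with the transpose are covered. Boxes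
  exist only for thresholds k < n - j; this suffices because both numbers are at most n - j.\<close>

lemma box_eq_iff:
  assumes g: "g \<in> nsub n" and P0: "Pp 0 = Pn 0"
    and B: "\<And>r c. (r, c) \<in> B \<longleftrightarrow> 1 \<le> r \<and> r \<le> n \<and> 1 \<le> c \<and> c \<le> n \<and> (if r \<le> c then Pp (c - r) \<le> n - c else Pn (r - c) \<le> n - r)"
    and bound: "\<And>j. j \<le> n \<Longrightarrow> Pp j \<le> n - j" "\<And>j. j \<le> n \<Longrightarrow> Pn j \<le> n - j"
  shows "box n g = B \<longleftrightarrow> (\<forall>j\<le>n. npos n g j = Pp j \<and> nneg n g j = Pn j)"
proof
  assume e: "box n g = B"
  show "\<forall>j\<le>n. npos n g j = Pp j \<and> nneg n g j = Pn j"
  proof (intro allI impI)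
    fix j assume j: "j \<le> n"
    have 1: "npos n g j \<le> k \<longleftrightarrow> Pp j \<le> k" if "k < n - j" for k
    proof -
      define r c where "r = n - k - j" and "c = n - k"
      then have rc: "r + j = c" "c + k = n" "1 \<le> r" using that by auto
      then have "c - r = j" "n - c = k" "r \<le> c" "c \<le> n" by auto
      then show ?thesis using box_iff[OF g, of r c] B[of r c] e rc by auto
    qed
    have 2: "nneg n g j \<le> k \<longleftrightarrow> Pn j \<le> k" if "k < n - j" "j \<noteq> 0" for k
    proof -
      define c r where "c = n - k - j" and "r = n - k"
      then have rc: "c + j = r" "r + k = n" "1 \<le> c" using that by auto
      then have "r - c = j" "n - r = k" "\<not> r \<le> c" "r \<le> n" using that(2) by auto
      then show ?thesis using box_iff[OF g, of r c] B[of r c] e rc by auto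
    qed
    have a: "x = y" if "x \<le> m" "y \<le> m" "\<And>k. k < m \<Longrightarrow> x \<le> k \<longleftrightarrow> y \<le> k" for x y m :: nat
      using that by (metis le_antisym nat_le_linear le_neq_implies_less)
    have "npos n g j = Pp j" using a[OF npos_le bound(1)[OF j] 1] .
    moreover have "nneg n g j = Pn j"
    proof (cases "j = 0")
      case True then show ?thesis using calculation nsub_npos_0[OF g] P0 by simp
    next
      case False then show ?thesis using a[OF nneg_le bound(2)[OF j] 2] by simp
    qed
    ultimately show "npos n g j = Pp j \<and> nneg n g j = Pn j" ..
  qed
next
  assume h: "\<forall>j\<le>n. npos n g j = Pp j \<and> nneg n g j = Pn j"
  show "box n g = B"
  proof (rule Set.set_eqI, safe)
    fix r c
    show "(r, c) \<in> B" if "(r, c) \<in> box n g"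
      using that box_range[OF that] box_iff[OF g, of r c] h B[of r c] by (auto split: if_splits)
    show "(r, c) \<in> box n g" if "(r, c) \<in> B"
      using that box_iff[OF g, of r c] h B[of r c] by (auto split: if_splits)
  qed
qed

text \<open>Transposition exchanges \<open>npos\<close> and \<open>nneg\<close>. A larger count
  means fewer boxes on the diagonal, so the intersection gives the maximum and the union the
  minimum.\<close>

lemma pi_rel_iff:
  assumes g: "\<gamma> \<in> nsub n"
  shows "pi_rel n \<gamma> gh gc \<longleftrightarrow> gh \<in> nsub n \<and> gc \<in> nsub n \<and>
    (\<forall>j\<le>n. npos n gh j = max (npos n \<gamma> j) (nneg n \<gamma> j) \<and> nneg n gh j = max (npos n \<gamma> j) (nneg n \<gamma> j)) \<and>
    (\<forall>j\<le>n. npos n gc j = min (npos n \<gamma> j) (nneg n \<gamma> j) \<and> nneg n gc j = min (npos n \<gamma> j) (nneg n \<gamma> j))"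
proof -
  have t: "(r, c) \<in> transp (box n \<gamma>) \<longleftrightarrow> (c, r) \<in> box n \<gamma>" for r c by (simp add: transp_def)
  have r: "(r, c) \<in> box n \<gamma> \<longleftrightarrow> 1 \<le> r \<and> r \<le> n \<and> 1 \<le> c \<and> c \<le> n \<and> (if r \<le> c then npos n \<gamma> (c - r) \<le> n - c else nneg n \<gamma> (r - c) \<le> n - r)" for r c
    using box_range[of r c n \<gamma>] box_iff[OF g, of r c] by blast
  have "gh \<in> nsub n \<Longrightarrow> box n gh = box n \<gamma> \<inter> transp (box n \<gamma>) \<longleftrightarrow> (\<forall>j\<le>n. npos n gh j = max (npos n \<gamma> j) (nneg n \<gamma> j) \<and> nneg n gh j = max (npos n \<gamma> j) (nneg n \<gamma> j))"
    by (rule box_eq_iff) (use npos_le[of n \<gamma>] nneg_le[of n \<gamma>] nsub_npos_0[OF g] in \<open>auto simp: t r not_le le_antisym split: if_splits\<close>)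
  moreover have "gc \<in> nsub n \<Longrightarrow> box n gc = box n \<gamma> \<union> transp (box n \<gamma>) \<longleftrightarrow> (\<forall>j\<le>n. npos n gc j = min (npos n \<gamma> j) (nneg n \<gamma> j) \<and> nneg n gc j = min (npos n \<gamma> j) (nneg n \<gamma> j))"
    by (rule box_eq_iff) (use npos_le[of n \<gamma>] nneg_le[of n \<gamma>] nsub_npos_0[OF g] in \<open>auto simp: t r not_le min_le_iff_disj le_antisym intro: min.coboundedI1 split: if_splits\<close>)
  ultimately show ?thesis unfolding pi_rel_def by auto
qed

lemma PP_iff: "x \<in> PP d n \<longleftrightarrow> x \<in> LevPos d n \<and> hI n x = hJ n x"
  using symm_iff[of x d n] by (cases x) (auto simp: PP_def)

text \<open>For equal levels, agreement at 0 is equality of the Durfee squares. Conversely the two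
  functions together encode one set, the Northeast element of the fiber.\<close>

lemma Dos_iff:
  "(x, y) \<in> Dos d n \<longleftrightarrow> x \<in> PP d n \<and> y \<in> PP d n \<and> hI n y \<le> hI n x \<and> hI n x 0 = hI n y 0 \<and> hI n x n = hI n y n"
proof
  assume "(x, y) \<in> Dos d n"
  then obtain gh gc a \<gamma> where *: "x = (gh, a)" "y = (gc, a)" "a \<le> d" "\<gamma> \<in> nsub n" "pi_rel n \<gamma> gh gc"
    by (auto simp: Dos_def)
  then show "x \<in> PP d n \<and> y \<in> PP d n \<and> hI n y \<le> hI n x \<and> hI n x 0 = hI n y 0 \<and> hI n x n = hI n y n"
    using nsub_npos_0[OF *(4)] unfolding pi_rel_iff[OF *(4)] PP_iff
    by (auto simp: LevPos_def fun_eq_iff hI_def hJ_def le_fun_def)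
next
  assume h: "x \<in> PP d n \<and> y \<in> PP d n \<and> hI n y \<le> hI n x \<and> hI n x 0 = hI n y 0 \<and> hI n x n = hI n y n"
  then have L: "x \<in> LevPos d n" "y \<in> LevPos d n" "hI n x = hJ n x" "hI n y = hJ n y" by (auto simp: PP_iff)
  have sn: "snd x = snd y" using h by simp
  have p: "paired d n (hI n x) (hI n y)"
    using h paired_h[OF L(1)] paired_h[OF L(2)] by (auto simp: paired_def)
  define z where "z = dec n (hI n x) (hI n y)"
  note z = h_dec[OF p, folded z_def]
  have zs: "snd z = snd x" by (metis hI_end z(2) neg_equal_iff_equal of_nat_eq_iff)
  have g: "fst z \<in> nsub n" using z(1) by (auto simp: LevPos_def)
  have zxy: "(fst x, snd z) = x" "(fst y, snd z) = y" using zs sn by (simp_all add: prod_eq_iff)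
  have "hI n z = hI n (fst x, snd z)" "hJ n z = hI n (fst y, snd z)" "hJ n z = hJ n (fst y, snd z)" "hI n z = hJ n (fst x, snd z)"
    using z L by (simp_all add: zxy)
  moreover have "hI n (fst y, snd z) \<le> hI n (fst x, snd z)" using h by (simp add: zxy)
  ultimately have "\<forall>j\<le>n. nneg n (fst z) j = nneg n (fst x) j \<and> npos n (fst z) j = npos n (fst y) j
     \<and> npos n (fst z) j = nneg n (fst y) j \<and> nneg n (fst z) j = npos n (fst x) j \<and> nneg n (fst y) j \<le> nneg n (fst x) j"
    by (auto simp: fun_eq_iff hI_def hJ_def le_fun_def split: if_splits) 
  then have "pi_rel n (fst z) (fst x) (fst y)"
    unfolding pi_rel_iff[OF g] using L by (auto simp: LevPos_def)
  then show "(x, y) \<in> Dos d n" using g L sn unfolding Dos_def LevPos_def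
    by (cases x, cases y) auto
qed

text \<open>This eliminates the definite description: the conditions on the Northeast element
  prescribe both of its step functions, hence the element.\<close>

lemma pD_eq:
  assumes D: "(x, y) \<in> Dos d n"
  shows "paired d n (hI n x) (hI n y)" "pD n (x, y) = var (dec n (hI n x) (hI n y))"
proof -
  note h = D[unfolded Dos_iff PP_iff]
  show p: "paired d n (hI n x) (hI n y)"
    using h paired_h[of x d n] paired_h[of y d n] by (auto simp: paired_def)
  have sn: "snd x = snd y" using h by simp
  define z where "z = dec n (hI n x) (hI n y)"
  note z = h_dec[OF p, folded z_def]
  have zs: "snd z = snd x" by (metis hI_end z(2) neg_equal_iff_equal of_nat_eq_iff)
  have g: "fst z \<in> nsub n" using z(1) by (auto simp: LevPos_def)
  have xy: "hI n (fst x, snd x) = hI n x" "hI n (fst y, snd x) = hI n y" "hJ n (fst x, snd x) = hI n x" "hJ n (fst y, snd x) = hI n y"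
  proof -
    have c: "(fst x, snd x) = x" "(fst y, snd x) = y" using sn by (simp_all add: prod_eq_iff)
    show "hI n (fst x, snd x) = hI n x" "hI n (fst y, snd x) = hI n y" by (simp_all only: c)
    show "hJ n (fst x, snd x) = hI n x" "hJ n (fst y, snd x) = hI n y" using h by (simp_all only: c)
  qed
  have char: "\<gamma> \<in> nsub n \<and> northeast n \<gamma> \<and> pi_rel n \<gamma> (fst x) (fst y) \<longleftrightarrow>
     \<gamma> \<in> nsub n \<and> hI n (\<gamma>, snd x) = hI n x \<and> hJ n (\<gamma>, snd x) = hI n y" (is "?l \<longleftrightarrow> ?r") for \<gamma>
  proof
    assume l: ?l
    then have "\<forall>j\<le>n. nneg n (fst x) j = nneg n \<gamma> j \<and> nneg n (fst y) j = npos n \<gamma> j"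
      using northeast_iff[of \<gamma> n] pi_rel_iff[of \<gamma> n] by (auto simp: max_def min_def)
    then show ?r using l sn by (auto simp: fun_eq_iff hI_def hJ_def)
  next
    assume r: ?r
    have le: "hI n y \<le> hI n x" using h by blast
    have "nneg n (fst x) j = nneg n \<gamma> j \<and> nneg n (fst y) j = npos n \<gamma> j \<and> npos n (fst x) j = nneg n \<gamma> j \<and> npos n (fst y) j = npos n \<gamma> j \<and> npos n \<gamma> j \<le> nneg n \<gamma> j"
      if "j \<le> n" for j
    proof -
      have "hI n (\<gamma>, snd x) j = hI n x j" "hJ n (\<gamma>, snd x) j = hI n y j" using r by simp_all
      moreover have "hI n x j = hJ n x j" "hI n y j = hJ n y j" using h by (metis, metis)
      moreover have "hI n y j \<le> hI n x j" using le by (simp add: le_fun_def)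
      ultimately show ?thesis using that sn by (simp add: hI_def hJ_def)
    qed
    then show ?l using r h northeast_iff[of \<gamma> n] pi_rel_iff[of \<gamma> n] by (auto simp: LevPos_def)
  qed
  have "(THE \<gamma>. \<gamma> \<in> nsub n \<and> northeast n \<gamma> \<and> pi_rel n \<gamma> (fst x) (fst y)) = fst z"
  proof (rule the_equality)
    show "fst z \<in> nsub n \<and> northeast n (fst z) \<and> pi_rel n (fst z) (fst x) (fst y)"
      unfolding char using g z zs by (metis prod.collapse)
    fix \<gamma> assume "\<gamma> \<in> nsub n \<and> northeast n \<gamma> \<and> pi_rel n \<gamma> (fst x) (fst y)"
    then have "\<gamma> \<in> nsub n \<and> hI n (\<gamma>, snd x) = hI n x \<and> hJ n (\<gamma>, snd x) = hI n y" unfolding char .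
    then have "(\<gamma>, snd x) = z" using z(1) zs by (intro LevPos_eqI[of _ d n]) (auto simp: z LevPos_def)
    then show "\<gamma> = fst z" by auto
  qed
  then show "pD n (x, y) = var (dec n (hI n x) (hI n y))"
    unfolding pD_def z_def[symmetric] using zs by (simp add: prod_eq_iff[symmetric]) (metis prod.collapse)
qed

text \<open>Values of the middle element at 0 and n are squeezed between those of the outer ones, so
  equality for the outer pair amounts to equality for both inner pairs.\<close>

lemma is_doset_Dos: "is_doset (PP d n) (le_lv n) (Dos d n)"
proof -
  have le: "le_lv n x y \<longleftrightarrow> hI n y \<le> hI n x" if "x \<in> PP d n" "y \<in> PP d n" for x y
    using that le_lv_iff[of x d n y] by (auto simp: PP_iff)
  show ?thesis unfolding is_doset_def
  proof (intro conjI ballI impI)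
    fix x y z assume *: "x \<in> PP d n" "y \<in> PP d n" "z \<in> PP d n" "le_lv n x y \<and> le_lv n y z"
    then have "hI n z j \<le> hI n y j" "hI n y j \<le> hI n x j" for j using le by (auto simp: le_fun_def)
    from this[of 0] this[of n] show "(x, z) \<in> Dos d n \<longleftrightarrow> (x, y) \<in> Dos d n \<and> (y, z) \<in> Dos d n"
      using * le by (auto simp: Dos_iff)
  next
    fix p assume "p \<in> Dos d n"
    then show "case p of (x, y) \<Rightarrow> x \<in> PP d n \<and> y \<in> PP d n \<and> le_lv n x y"
      using le by (cases p) (auto simp: Dos_iff)
  qed (auto simp: Dos_iff)
qed

subsection \<open>Determinants of selected columns\<close>

definition cdet :: "nat \<Rightarrow> (nat \<Rightarrow> nat \<Rightarrow> 'a::comm_ring_1) \<Rightarrow> 'a" where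
  "cdet n f = det (mat n n (\<lambda>(i, j). f j i))"

text \<open>The list of columns may be unsorted or contain repetitions, which give 0; exchange
  formulas then need no case distinctions. The ring is general because polynomial matrices occur
  later.\<close>

definition minor :: "nat \<Rightarrow> (nat \<Rightarrow> int \<Rightarrow> 'a::comm_ring_1) \<Rightarrow> int list \<Rightarrow> 'a" where
  "minor n M cs = cdet n (\<lambda>j i. M i (cs ! j))"

lemma permutes_lt: "p permutes {0..<n} \<Longrightarrow> j < n \<Longrightarrow> p j < n" for n :: nat
  using permutes_in_image[of p "{0..<n}" j] by simp

lemma cdet_sum: "cdet n f = (\<Sum>p | p permutes {0..<n}. of_int (sign p) * (\<Prod>j<n. f j (p j)))"
proof -
  have "mat n n (\<lambda>(i, j). f j i) \<in> carrier_mat n n" by simp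
  from det_col[OF this] show ?thesis unfolding cdet_def
    by (auto intro!: sum.cong prod.cong arg_cong2[where f = times] simp: permutes_lt)
qed

lemma cdet_sum_rows: "cdet n f = (\<Sum>p | p permutes {0..<n}. of_int (sign p) * (\<Prod>i<n. f (p i) i))"
proof -
  have "mat n n (\<lambda>(i, j). f j i) \<in> carrier_mat n n" by simp
  from det_def'[OF this] show ?thesis unfolding cdet_def
    by (auto intro!: sum.cong prod.cong arg_cong2[where f = times] simp: lessThan_atLeast0 permutes_lt)
qed

lemma cdet_cong: "(\<And>j. j < n \<Longrightarrow> f j = g j) \<Longrightarrow> cdet n f = cdet n g"
  unfolding cdet_sum by (auto intro!: sum.cong prod.cong)

lemma cdet_linear:
  assumes "k < n"
  shows "cdet n (f(k := \<lambda>i. a i + w * b i)) = cdet n (f(k := a)) + w * cdet n (f(k := b))"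
proof -
  have P: "(\<Prod>j<n. (f(k := g)) j (p j)) = g (p k) * (\<Prod>j\<in>{..<n} - {k}. f j (p j))" for g p
    using assms by (subst prod.remove[of "{..<n}" k]) (auto intro!: prod.cong)
  show ?thesis unfolding cdet_sum P
    by (simp add: sum.distrib[symmetric] sum_distrib_left algebra_simps)
qed

lemma cdet_alt:
  assumes "i < n" "j < n" "i \<noteq> j" "f i = f j"
  shows "cdet n f = 0"
  unfolding cdet_def
  by (rule det_identical_columns[OF _ assms(3,1,2)]) (use assms in \<open>auto intro!: eq_vecI\<close>)

lemma cdet_permute:
  assumes p: "p permutes {0..<n}"
  shows "cdet n (\<lambda>j. f (p j)) = of_int (sign p) * cdet n f"
proof -
  have T: "cdet n g = det (mat n n (\<lambda>(i, j). g i j))" for g :: "nat \<Rightarrow> nat \<Rightarrow> 'a"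
  proof -
    have "mat n n (\<lambda>(i, j). g j i) = transpose_mat (mat n n (\<lambda>(i, j). g i j))" by (intro eq_matI) auto
    then show ?thesis unfolding cdet_def by (simp add: det_transpose[of _ n])
  qed
  have "cdet n (\<lambda>j. f (p j)) = det (mat n n (\<lambda>(i, j). mat n n (\<lambda>(i, j). f i j) $$ (p i, j)))"
    unfolding T using permutes_lt[OF p] by (intro arg_cong[of _ _ det] eq_matI) auto
  also have "\<dots> = of_int (sign p) * cdet n f"
    unfolding T using det_permute_rows[OF _ p, of "mat n n (\<lambda>(i, j). f i j)"] by simp
  finally show ?thesis .
qed

lemma plucker_eq_minor: "plucker n M \<alpha> = minor n M (sorted_list_of_set \<alpha>)"
  unfolding plucker_def minor_def cdet_sum_rows by (simp add: lessThan_atLeast0)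

lemma minor_cong: "(\<And>i x. i < n \<Longrightarrow> x \<in> set cs \<Longrightarrow> M i x = M' i x) \<Longrightarrow> length cs = n \<Longrightarrow> minor n M cs = minor n M' cs"
  unfolding minor_def cdet_def by (intro arg_cong[of _ _ det] eq_matI) auto

lemma minor_not_distinct:
  assumes "length cs = n" "\<not> distinct cs" shows "minor n M cs = 0"
proof -
  obtain i j where "i < n" "j < n" "i \<noteq> j" "cs ! i = cs ! j" using assms by (auto simp: distinct_conv_nth)
  then show ?thesis unfolding minor_def by (intro cdet_alt[of i n j]) auto
qed

lemma minor_permute:
  assumes "p permutes {0..<n}"
  shows "minor n M (map (\<lambda>j. cs ! p j) [0..<n]) = of_int (sign p) * minor n M cs"
proof -
  have "minor n M (map (\<lambda>j. cs ! p j) [0..<n]) = cdet n (\<lambda>j. (\<lambda>j i. M i (cs ! j)) (p j))"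
    unfolding minor_def by (rule cdet_cong) auto
  then show ?thesis using cdet_permute[OF assms, of "\<lambda>j i. M i (cs ! j)"] by (simp add: minor_def)
qed

section \<open>Signs of sorting, and column operations on Pluecker coordinates\<close>

lemma inversions_swap:
  assumes i: "Suc i < length xs" and d: "xs ! Suc i < xs ! i"
  defines "ys \<equiv> xs[i := xs ! Suc i, Suc i := xs ! i]"
  shows "inversions xs = Suc (inversions ys)"
proof -
  let ?t = "Transposition.transpose i (Suc i)"
  let ?I = "\<lambda>zs :: int list. {(j, k). j < k \<and> k < length zs \<and> zs ! k < zs ! j}"
  have fin: "finite (?I zs)" for zs
    by (rule finite_subset[of _ "{..<length zs} \<times> {..<length zs}"]) auto
  have len: "length ys = length xs" by (simp add: ys_def)
  have nth: "ys ! j = xs ! ?t j" if "j < length xs" for j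
    using that i by (auto simp: ys_def nth_list_update Transposition.transpose_def)
  have tl: "?t j < length xs \<longleftrightarrow> j < length xs" for j
    using i by (auto simp: Transposition.transpose_def)
  have tm: "?t j < ?t k" if "j < k" "(j, k) \<noteq> (i, Suc i)" for j k
    using that by (auto simp: Transposition.transpose_def)
  have "?I xs = insert (i, Suc i) (map_prod ?t ?t ` ?I ys)"
  proof (rule Set.set_eqI, safe)
    fix j k assume *: "j < k" "k < length xs" "xs ! k < xs ! j" "(j, k) \<notin> map_prod ?t ?t ` ?I ys"
    show "j = i"
    proof (rule ccontr)
      assume "j \<noteq> i"
      then have "(?t j, ?t k) \<in> ?I ys" using * tm[of j k] nth[of "?t j"] nth[of "?t k"] tl[of j] tl[of k] len by auto
      then have "map_prod ?t ?t (?t j, ?t k) \<in> map_prod ?t ?t ` ?I ys" by (rule imageI)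
      then show False using * by simp
    qed
    show "k = Suc i"
    proof (rule ccontr)
      assume "k \<noteq> Suc i"
      then have "(?t j, ?t k) \<in> ?I ys" using * tm[of j k] nth[of "?t j"] nth[of "?t k"] tl[of j] tl[of k] len by auto
      then have "map_prod ?t ?t (?t j, ?t k) \<in> map_prod ?t ?t ` ?I ys" by (rule imageI)
      then show False using * by simp
    qed
  next
    fix j k assume *: "j < k" "k < length ys" "ys ! k < ys ! j"
    have "(j, k) \<noteq> (i, Suc i)" using * d i by (auto simp: ys_def)
    then show "?t j < ?t k" using tm * by blast
    show "?t k < length xs" using * tl len by simp
    show "xs ! ?t k < xs ! ?t j" using * nth len by simp
  qed (use i d in auto)
  moreover have "(i, Suc i) \<notin> map_prod ?t ?t ` ?I ys"
  proof
    assume "(i, Suc i) \<in> map_prod ?t ?t ` ?I ys"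
    then obtain j k where jk: "j < k" "?t j = i" "?t k = Suc i" by auto
    then have "j = Suc i" "k = i" by (metis transpose_eq_iff)+
    then show False using jk by simp
  qed
  moreover have "inj (map_prod ?t ?t)" by (intro prod.inj_map) (auto intro!: inj_on_inverseI[where g = ?t])
  ultimately show ?thesis unfolding inversions_def
    by (simp add: fin card_image inj_on_subset)
qed

text \<open>Bubble sort: exchanging an adjacent descent removes exactly one inversion and changes
  the sign of the minor.\<close>

lemma minor_sortsign:
  fixes M :: "nat \<Rightarrow> int \<Rightarrow> complex"
  assumes "distinct xs" "length xs = n"
  shows "minor n M xs = sortsign xs * plucker n M (set xs)"
  using assms
proof (induction "inversions xs" arbitrary: xs rule: less_induct)
  case less
  show ?case
  proof (cases "\<exists>i. Suc i < length xs \<and> xs ! Suc i < xs ! i")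
    case True
    then obtain i where i: "Suc i < length xs" "xs ! Suc i < xs ! i" by blast
    define ys where "ys = xs[i := xs ! Suc i, Suc i := xs ! i]"
    have inv: "inversions xs = Suc (inversions ys)" using inversions_swap[OF i] by (simp add: ys_def)
    have ys: "set ys = set xs" "distinct ys" "length ys = length xs"
      using i less(2) by (auto simp: ys_def set_swap distinct_swap)
    have p: "Transposition.transpose i (Suc i) permutes {0..<n}"
      using i less by (intro permutes_swap_id) auto
    have "ys = map (\<lambda>j. xs ! Transposition.transpose i (Suc i) j) [0..<n]"
      using i less(3) by (intro nth_equalityI) (auto simp: ys_def nth_list_update Transposition.transpose_def)
    then have "minor n M ys = - minor n M xs"
      using minor_permute[OF p, of M xs] by (simp add: sign_swap_id)
    moreover have "minor n M ys = sortsign ys * plucker n M (set ys)"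
      using less(1)[of ys] inv ys less by auto
    ultimately show ?thesis using inv ys by (simp add: sortsign_def)
  next
    case False
    then have s: "sorted xs" unfolding sorted_iff_nth_Suc by (metis not_le_imp_less)
    then have "sorted_list_of_set (set xs) = xs"
      using less(2) by (simp add: sorted_list_of_set.idem_if_sorted_distinct)
    moreover have e: "{(j, k). j < k \<and> k < length xs \<and> xs ! k < xs ! j} = {}"
      using s by (auto simp: sorted_iff_nth_mono_less not_less[symmetric])
    have "inversions xs = 0" unfolding inversions_def e by simp
    ultimately show ?thesis by (simp add: plucker_eq_minor sortsign_def)
  qed
qed

lemma sortsign_cases: "sortsign xs = 1 \<or> sortsign xs = -1"
  unfolding sortsign_def by (cases "even (inversions xs)") auto

lemma nsub_sorted:
  assumes "\<gamma> \<in> nsub n"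
  shows "set (sorted_list_of_set \<gamma>) = \<gamma>" "length (sorted_list_of_set \<gamma>) = n" "distinct (sorted_list_of_set \<gamma>)"
  using assms nsub_finite[OF assms] by (auto simp: nsub_def)

lemma nsub_replace:
  assumes "l \<in> \<gamma>" "k \<notin> \<gamma>" "k \<in> angle n" "l \<in> angle n"
  shows "insert k (\<gamma> - {l}) \<in> nsub n \<longleftrightarrow> \<gamma> \<in> nsub n"
proof -
  have f: "finite (insert k (\<gamma> - {l})) \<longleftrightarrow> finite \<gamma>" by simp
  have "card (insert k (\<gamma> - {l})) = card \<gamma>" if "finite \<gamma>"
    using card.remove[OF that assms(1)] card_insert_disjoint[of "\<gamma> - {l}" k] that assms by simp
  moreover have "insert k (\<gamma> - {l}) \<subseteq> angle n \<longleftrightarrow> \<gamma> \<subseteq> angle n" using assms by auto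
  ultimately show ?thesis unfolding nsub_def using finite_subset[OF _ finite_angle] f by auto
qed

text \<open>Linearity in the column \<open>l\<close>. If \<open>k\<close> is present already, the
  additional determinant has two equal columns.\<close>

lemma minor_column_op:
  fixes M :: "nat \<Rightarrow> int \<Rightarrow> complex"
  assumes \<gamma>: "\<gamma> \<in> nsub n" and kl: "k \<noteq> l"
  defines "f \<equiv> \<lambda>x. if x = l then k else x"
  shows "plucker n (\<lambda>i x. if x = l then M i l + w * M i k else M i x) \<gamma> =
    plucker n M \<gamma> + (if l \<in> \<gamma> \<and> k \<notin> \<gamma> then w * minor n M (map f (sorted_list_of_set \<gamma>)) else 0)"
proof (cases "l \<in> \<gamma>")
  case False
  then have "minor n (\<lambda>i x. if x = l then M i l + w * M i k else M i x) (sorted_list_of_set \<gamma>) = minor n M (sorted_list_of_set \<gamma>)"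
    by (intro minor_cong) (use nsub_sorted[OF \<gamma>] in auto)
  then show ?thesis using False by (simp add: plucker_eq_minor)
next
  case True
  let ?xs = "sorted_list_of_set \<gamma>"
  note xs = nsub_sorted[OF \<gamma>]
  obtain p where p: "p < n" "?xs ! p = l" using True xs by (metis in_set_conv_nth)
  have ne: "?xs ! j \<noteq> l" if "j < n" "j \<noteq> p" for j
    using p xs that by (metis nth_eq_iff_index_eq)
  let ?g = "\<lambda>j i. M i (?xs ! j)"
  have "plucker n (\<lambda>i x. if x = l then M i l + w * M i k else M i x) \<gamma> = cdet n (?g(p := \<lambda>i. M i l + w * M i k))"
    unfolding plucker_eq_minor minor_def by (rule cdet_cong) (use p ne in auto)
  also have "\<dots> = cdet n (?g(p := \<lambda>i. M i l)) + w * cdet n (?g(p := \<lambda>i. M i k))"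
    by (rule cdet_linear[OF p(1)])
  also have "cdet n (?g(p := \<lambda>i. M i l)) = plucker n M \<gamma>"
    unfolding plucker_eq_minor minor_def by (rule cdet_cong) (use p in auto)
  also have "cdet n (?g(p := \<lambda>i. M i k)) = minor n M (map f ?xs)"
    unfolding minor_def by (rule cdet_cong) (use p ne xs in \<open>auto simp: f_def\<close>)
  also have "minor n M (map f ?xs) = (if k \<notin> \<gamma> then minor n M (map f ?xs) else 0)"
  proof -
    have "\<not> distinct (map f ?xs)" if "k \<in> \<gamma>"
      using that True kl xs by (auto simp: distinct_map inj_on_def f_def)
    then show ?thesis using minor_not_distinct[of "map f ?xs" n M] xs by auto
  qed
  finally show ?thesis using True by auto
qed

text \<open>By \<open>adj\<close> no other index lies between \<open>k\<close> and \<open>l\<close>,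
  so the replacement keeps the list of columns sorted and produces no sign.\<close>

lemma plucker_column_op_adjacent:
  fixes M :: "nat \<Rightarrow> int \<Rightarrow> complex"
  assumes \<gamma>: "\<gamma> \<in> nsub n" and kl: "k \<noteq> l"
    and adj: "\<And>x. x \<in> angle n \<Longrightarrow> x \<noteq> k \<Longrightarrow> x \<noteq> l \<Longrightarrow> x < k \<longleftrightarrow> x < l"
  shows "plucker n (\<lambda>i x. if x = l then M i l + w * M i k else M i x) \<gamma> =
    plucker n M \<gamma> + (if l \<in> \<gamma> \<and> k \<notin> \<gamma> then w * plucker n M (insert k (\<gamma> - {l})) else 0)"
proof (cases "l \<in> \<gamma> \<and> k \<notin> \<gamma>")
  case True
  let ?xs = "sorted_list_of_set \<gamma>"
  let ?f = "\<lambda>x. if x = l then k else x"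
  note xs = nsub_sorted[OF \<gamma>]
  have ang: "\<gamma> \<subseteq> angle n" using \<gamma> by (simp add: nsub_def)
  have m: "?f x < ?f y" if "x \<in> \<gamma>" "y \<in> \<gamma>" "x < y" for x y
  proof (cases "x = l")
    case True
    then have "y \<noteq> k" "y \<noteq> l" using that \<open>l \<in> \<gamma> \<and> k \<notin> \<gamma>\<close> by auto
    then show ?thesis using adj[of y] ang that True by auto
  next
    case False
    then have "x \<noteq> k" using that \<open>l \<in> \<gamma> \<and> k \<notin> \<gamma>\<close> by auto
    then show ?thesis using adj[of x] ang that False by auto
  qed
  have "sorted_wrt (<) (map ?f ?xs)"
    unfolding sorted_wrt_map
    by (rule sorted_wrt_mono_rel[OF _ sorted_list_of_set.strict_sorted_key_list_of_set]) (use m xs in auto)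
  then have s: "sorted (map ?f ?xs)" "distinct (map ?f ?xs)" by (auto simp: strict_sorted_iff)
  have "set (map ?f ?xs) = insert k (\<gamma> - {l})" using True xs by auto
  then have "sorted_list_of_set (insert k (\<gamma> - {l})) = map ?f ?xs"
    using sorted_list_of_set.idem_if_sorted_distinct[OF s] by simp
  then show ?thesis using minor_column_op[OF \<gamma> kl] True by (simp add: plucker_eq_minor)
next
  case False
  then show ?thesis using minor_column_op[OF \<gamma> kl] by auto
qed

text \<open>The largest index is replaced by the smallest one, which has to pass the n - 1 other
  columns; this is the origin of the sign.\<close>

lemma plucker_column_op_extreme:
  fixes M :: "nat \<Rightarrow> int \<Rightarrow> complex"
  assumes \<gamma>: "\<gamma> \<in> nsub n" and n: "n \<ge> 1"
  shows "plucker n (\<lambda>i x. if x = int n then M i (int n) + w * M i (- int n) else M i x) \<gamma> =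
    plucker n M \<gamma> + (if int n \<in> \<gamma> \<and> - int n \<notin> \<gamma> then (-1) ^ (n - 1) * w * plucker n M (insert (- int n) (\<gamma> - {int n})) else 0)"
proof (cases "int n \<in> \<gamma> \<and> - int n \<notin> \<gamma>")
  case True
  let ?xs = "sorted_list_of_set \<gamma>"
  let ?f = "\<lambda>x. if x = int n then - int n else x"
  note xs = nsub_sorted[OF \<gamma>]
  have ang: "\<gamma> \<subseteq> angle n" using \<gamma> by (simp add: nsub_def)
  have bd: "- int n < x \<and> x < int n" if "x \<in> \<gamma>" "x \<noteq> int n" for x
  proof -
    have "x \<noteq> - int n" using that True by auto
    moreover have "- int n \<le> x" "x \<le> int n" using that ang by (auto simp: angle_def)
    ultimately show ?thesis using that by linarith
  qed
  define ys where "ys = sorted_list_of_set (\<gamma> - {int n})"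
  have fin: "finite \<gamma>" using \<gamma> nsub_finite by blast
  have ys: "sorted ys" "distinct ys" "set ys = \<gamma> - {int n}" using fin by (auto simp: ys_def)
  have leny: "length ys = n - 1" using True \<gamma> fin unfolding ys_def by (simp add: nsub_def)
  have "sorted (ys @ [int n])" "distinct (ys @ [int n])" "set (ys @ [int n]) = \<gamma>"
    using ys bd True by (auto simp: sorted_append less_imp_le)
  then have xe: "?xs = ys @ [int n]" by (metis sorted_list_of_set.idem_if_sorted_distinct)
  have "map ?f ys = ys" by (rule map_idI) (use ys in auto)
  then have fm: "map ?f ?xs = ys @ [- int n]" unfolding xe by simp
  have inv: "{(j, k). j < k \<and> k < length (ys @ [- int n]) \<and> (ys @ [- int n]) ! k < (ys @ [- int n]) ! j} = {..<n - 1} \<times> {n - 1}"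
  proof -
    have "(j < k \<and> k < length (ys @ [- int n]) \<and> (ys @ [- int n]) ! k < (ys @ [- int n]) ! j) \<longleftrightarrow> j < n - 1 \<and> k = n - 1" for j k
    proof
      assume *: "j < k \<and> k < length (ys @ [- int n]) \<and> (ys @ [- int n]) ! k < (ys @ [- int n]) ! j"
      have "k = n - 1"
      proof (rule ccontr)
        assume "k \<noteq> n - 1"
        then have "k < n - 1" using * leny by auto
        then have "ys ! k < ys ! j" using * leny by (auto simp: nth_append)
        moreover have "ys ! j \<le> ys ! k" using ys(1) * \<open>k < n - 1\<close> leny by (simp add: sorted_iff_nth_mono)
        ultimately show False by simp
      qed
      then show "j < n - 1 \<and> k = n - 1" using * by auto
    next
      assume j: "j < n - 1 \<and> k = n - 1"
      have "ys ! j \<in> \<gamma>" "ys ! j \<noteq> int n" using j leny ys nth_mem[of j ys] by auto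
      then show "j < k \<and> k < length (ys @ [- int n]) \<and> (ys @ [- int n]) ! k < (ys @ [- int n]) ! j"
        using bd[of "ys ! j"] j leny by (auto simp: nth_append)
    qed
    then show ?thesis by auto
  qed
  have "inversions (ys @ [- int n]) = n - 1" unfolding inversions_def inv by simp
  moreover have "distinct (ys @ [- int n])" "length (ys @ [- int n]) = n" "set (ys @ [- int n]) = insert (- int n) (\<gamma> - {int n})"
    using ys True leny n by auto
  ultimately have "minor n M (map ?f ?xs) = (-1) ^ (n - 1) * plucker n M (insert (- int n) (\<gamma> - {int n}))"
    unfolding fm using minor_sortsign[of "ys @ [- int n]" n M] by (simp add: sortsign_def)
  then show ?thesis using minor_column_op[OF \<gamma>, of "- int n" "int n" M w] n True by simp
next
  case False
  then show ?thesis using minor_column_op[OF \<gamma>, of "- int n" "int n" M w] n by auto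
qed

subsection \<open>Isotropic rows and the linear forms\<close>

text \<open>The sum is one half of the symplectic form; its symmetry in the two rows is the
  vanishing of the form on them.\<close>

definition isotropic :: "nat \<Rightarrow> (nat \<Rightarrow> int \<Rightarrow> complex) \<Rightarrow> bool" where
  "isotropic n M \<longleftrightarrow> (\<forall>r<n. \<forall>r'<n. (\<Sum>i\<in>{1..n}. M r (- int i) * M r' (int i)) = (\<Sum>i\<in>{1..n}. M r' (- int i) * M r (int i)))"

text \<open>Expanded over permutations, the two leading columns contribute the half pairing of the
  rows assigned to them. Exchanging these rows reverses the sign of the permutation, while isotropy
  makes the pairing symmetric; the sum equals its own negative.\<close>

lemma isotropic_contraction:
  assumes iso: "isotropic n M" and \<beta>: "\<beta> \<subseteq> angle n" "card \<beta> + 2 = n"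
  shows "(\<Sum>i \<in> {i \<in> {1..n}. int i \<notin> \<beta> \<and> - int i \<notin> \<beta>}.
      sortsign ([- int i, int i] @ sorted_list_of_set \<beta>) * plucker n M (\<beta> \<union> {- int i, int i})) = 0"
proof -
  have f: "finite \<beta>" using \<beta> finite_subset[OF _ finite_angle] by blast
  define bs where "bs = sorted_list_of_set \<beta>"
  have bs: "set bs = \<beta>" "distinct bs" "length bs + 2 = n" using f \<beta> by (auto simp: bs_def)
  define L where "L i = [- int i, int i] @ bs" for i
  have len: "length (L i) = n" for i using bs by (simp add: L_def)
  have "(\<Sum>i \<in> {i \<in> {1..n}. int i \<notin> \<beta> \<and> - int i \<notin> \<beta>}.
      sortsign ([- int i, int i] @ sorted_list_of_set \<beta>) * plucker n M (\<beta> \<union> {- int i, int i}))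
    = (\<Sum>i \<in> {i \<in> {1..n}. int i \<notin> \<beta> \<and> - int i \<notin> \<beta>}. minor n M (L i))"
  proof (rule sum.cong[OF refl])
    fix i assume i: "i \<in> {i \<in> {1..n}. int i \<notin> \<beta> \<and> - int i \<notin> \<beta>}"
    have "distinct (L i)" "set (L i) = \<beta> \<union> {- int i, int i}" using i bs by (auto simp: L_def)
    then show "sortsign ([- int i, int i] @ sorted_list_of_set \<beta>) * plucker n M (\<beta> \<union> {- int i, int i}) = minor n M (L i)"
      using minor_sortsign[of "L i" n M] len by (simp add: L_def bs_def)
  qed
  also have "\<dots> = (\<Sum>i\<in>{1..n}. minor n M (L i))"
  proof (rule sum.mono_neutral_left)
    show "\<forall>i\<in>{1..n} - {i \<in> {1..n}. int i \<notin> \<beta> \<and> - int i \<notin> \<beta>}. minor n M (L i) = 0"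
      using bs len by (auto intro!: minor_not_distinct simp: L_def)
  qed auto
  also have "\<dots> = 0"
  proof -
    have n2: "n \<ge> 2" using \<beta> by simp
    let ?S = "\<lambda>r r'. \<Sum>i\<in>{1..n}. M r (- int i) * M r' (int i)"
    let ?G = "\<lambda>p. \<Prod>j\<in>{2..<n}. M (p j) (bs ! (j - 2))"
    let ?P = "{p. p permutes {0..<n}}"
    let ?F = "\<lambda>p. of_int (sign p) * (?S (p 0) (p 1) * ?G p)"
    let ?t = "Transposition.transpose 0 (1::nat)"
    have t: "?t permutes {0..<n}" using n2 by (intro permutes_swap_id) auto
    have pr: "(\<Prod>j<n. M (p j) (L i ! j)) = M (p 0) (- int i) * M (p 1) (int i) * ?G p" for p i
    proof -
      have "{..<n} = insert 0 (insert 1 {2..<n})" using n2 by auto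
      then have "(\<Prod>j<n. M (p j) (L i ! j)) = M (p 0) (L i ! 0) * (M (p 1) (L i ! 1) * (\<Prod>j\<in>{2..<n}. M (p j) (L i ! j)))"
        by simp
      also have "(\<Prod>j\<in>{2..<n}. M (p j) (L i ! j)) = ?G p"
        by (rule prod.cong) (auto simp: L_def nth_Cons' numeral_2_eq_2)
      finally show ?thesis by (simp add: L_def)
    qed
    have 1: "(\<Sum>i\<in>{1..n}. minor n M (L i)) = sum ?F ?P"
      unfolding minor_def cdet_sum pr
      by (subst sum.swap) (auto simp: sum_distrib_left sum_distrib_right algebra_simps intro!: sum.cong)
    have "sum ?F ?P = sum (\<lambda>p. ?F (p \<circ> ?t)) ?P"
      by (rule sum_permutations_compose_right[OF t])
    also have "\<dots> = sum (\<lambda>p. - ?F p) ?P"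
    proof (rule sum.cong[OF refl])
      fix p assume p: "p \<in> ?P"
      then have perm: "permutation p" "permutation ?t" using t permutation_permutes by (blast, auto intro: permutes_imp_permutation[of "{0..<n}"])
      have s: "sign (p \<circ> ?t) = - sign p" using sign_compose[OF perm] n2 by (simp add: sign_swap_id)
      have g: "?G (p \<circ> ?t) = ?G p" by (rule prod.cong) (auto simp: Transposition.transpose_def)
      have S: "?S (p 1) (p 0) = ?S (p 0) (p 1)"
        using iso p n2 permutes_lt[of p n 0] permutes_lt[of p n 1] unfolding isotropic_def by force
      show "?F (p \<circ> ?t) = - ?F p"
        unfolding s g using S by simp
    qed
    finally have "sum ?F ?P = - sum ?F ?P" by (simp add: sum_negf)
    then show ?thesis using 1 by simp
  qed
  finally show ?thesis .
qed

text \<open>The matrix with entries \<open>minor n M (a[i := x])\<close> is the adjugate of the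
  block of columns \<open>a\<close> times \<open>M\<close>. No division occurs, so polynomial
  entries and singular blocks are covered.\<close>

lemma cramer_minor:
  fixes M :: "nat \<Rightarrow> int \<Rightarrow> 'a::comm_ring_1"
  assumes a: "length a = n" and cs: "length cs = n"
  shows "minor n M a * minor n (\<lambda>i x. minor n M (a[i := x])) cs = minor n M a ^ n * minor n M cs"
proof -
  define A where "A = mat n n (\<lambda>(i, j). M i (a ! j))"
  define B where "B = mat n n (\<lambda>(i, j). M i (cs ! j))"
  have A: "A \<in> carrier_mat n n" and B: "B \<in> carrier_mat n n" by (auto simp: A_def B_def)
  note adj = adj_mat[OF A]
  \<comment> \<open>Laplace expansion along column i, whose cofactors do not involve the replaced
    column.\<close>
  have e: "(adj_mat A * B) $$ (i, j) = minor n M (a[i := cs ! j])" if ij: "i < n" "j < n" for i j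
  proof -
    define R where "R = mat n n (\<lambda>(i', j'). M i' (a[i := cs ! j] ! j'))"
    have R: "R \<in> carrier_mat n n" by (simp add: R_def)
    have "minor n M (a[i := cs ! j]) = det R" by (simp add: minor_def cdet_def R_def)
    also have "\<dots> = (\<Sum>k<n. R $$ (k, i) * cofactor R k i)" by (rule laplace_expansion_column[OF R ij(1)])
    also have "\<dots> = (\<Sum>k<n. cofactor A k i * B $$ (k, j))"
    proof (rule sum.cong[OF refl])
      fix k assume k: "k \<in> {..<n}"
      have "mat_delete R k i = mat_delete A k i"
        using a k ij by (intro eq_matI) (auto simp: mat_delete_def R_def A_def)
      then show "R $$ (k, i) * cofactor R k i = cofactor A k i * B $$ (k, j)"
        using k ij a by (simp add: cofactor_def R_def B_def)
    qed
    also have "\<dots> = (adj_mat A * B) $$ (i, j)"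
      using ij A B adj(1) by (auto simp: scalar_prod_def adj_mat_def lessThan_atLeast0 intro!: sum.cong)
    finally show ?thesis by simp
  qed
  have "minor n (\<lambda>i x. minor n M (a[i := x])) cs = det (adj_mat A * B)"
    unfolding minor_def[of n "\<lambda>i x. minor n M (a[i := x])"] cdet_def
    by (rule arg_cong[of _ _ det]) (use e adj(1) B in \<open>auto intro!: eq_matI\<close>)
  also have "\<dots> = det (adj_mat A) * det B" by (rule det_mult[OF adj(1) B])
  finally have 1: "minor n (\<lambda>i x. minor n M (a[i := x])) cs = det (adj_mat A) * det B" .
  have "det A * det (adj_mat A) = det (det A \<cdot>\<^sub>m 1\<^sub>m n)"
    using det_mult[OF A adj(1)] adj(2) by simp
  also have "\<dots> = det A ^ n" by simp
  finally have "det A * det (adj_mat A) * det B = det A ^ n * det B" by simp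
  moreover have "minor n M a = det A" "minor n M cs = det B" by (simp_all add: minor_def cdet_def A_def B_def)
  ultimately show ?thesis using 1 by (simp add: mult.assoc)
qed

subsection \<open>A family of Lagrangian maps\<close>

text \<open>Xop n j z is the action on Pluecker coordinates of the one-parameter subgroup of the j-th simple affine
  root of type C. For j = n it is the column operation with coefficient z t / s, which shifts the level.\<close>

definition col_add :: "int \<Rightarrow> int \<Rightarrow> complex \<Rightarrow> (lv \<Rightarrow> complex) \<Rightarrow> lv \<Rightarrow> complex" where
  "col_add k l w c x = c x + (if l \<in> fst x \<and> k \<notin> fst x then w * c (insert k (fst x - {l}), snd x) else 0)"

definition loop_add :: "nat \<Rightarrow> complex \<Rightarrow> (lv \<Rightarrow> complex) \<Rightarrow> lv \<Rightarrow> complex" where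
  "loop_add n z c x = c x + (if int n \<in> fst x \<and> - int n \<notin> fst x
     then (-1) ^ (n - 1) * z * c (insert (- int n) (fst x - {int n}), Suc (snd x)) else 0)"

definition Xop :: "nat \<Rightarrow> nat \<Rightarrow> complex \<Rightarrow> (lv \<Rightarrow> complex) \<Rightarrow> lv \<Rightarrow> complex" where
  "Xop n j z c = (if j = 0 then col_add 1 (-1) z c else if j = n then loop_add n z c
     else col_add (- int j) (- int (Suc j)) (- z) (col_add (int (Suc j)) (int j) z c))"

text \<open>The smallest step function, called top because the order of the poset is reversed; it
  encodes \<open>{1..n}\<close> at level d.\<close>

definition Wtop :: "nat \<Rightarrow> nat \<Rightarrow> nat \<Rightarrow> int" where
  "Wtop d n j = (if j \<le> n then - int d else 0)"

text \<open>A step raises the bound at one place where it stays a step function. The scalar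
  \<open>l\<close> makes the family a cone, which separates monomials of different degrees.\<close>

inductive Fam :: "nat \<Rightarrow> nat \<Rightarrow> (nat \<Rightarrow> int) \<Rightarrow> (lv \<Rightarrow> complex) \<Rightarrow> bool" for d n where
  base: "l \<noteq> 0 \<Longrightarrow> Fam d n (Wtop d n) (\<lambda>x. if x = ({1..int n}, d) then l else 0)"
| step: "Fam d n W c \<Longrightarrow> z \<noteq> 0 \<Longrightarrow> j \<le> n \<Longrightarrow> stp d n (W(j := W j + 1)) \<Longrightarrow>
    Fam d n (W(j := W j + 1)) (Xop n j z c)"

definition dcr :: "nat \<Rightarrow> (nat \<Rightarrow> int) \<Rightarrow> nat \<Rightarrow> int" where
  "dcr j U = U(j := U j - 1)"

text \<open>The corners of a graph, constant before j and dropping after j. Lowering there keeps a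
  step function, provided that at j = n the value was above -d.\<close>

definition canlow :: "nat \<Rightarrow> nat \<Rightarrow> (nat \<Rightarrow> int) \<Rightarrow> bool" where
  "canlow n j U \<longleftrightarrow> (j = 0 \<or> U (j - 1) = U j) \<and> (j = n \<or> U j = U (Suc j) + 1)"

lemma stp_Wtop: "stp d n (Wtop d n)"
  by (auto simp: stp_def Wtop_def)

lemma stp_antimono:
  assumes U: "stp d n U" and "i \<le> j" "j \<le> n" shows "U j \<le> U i"
  using assms(2,3)
proof (induction j rule: dec_induct)
  case (step j)
  have "U j = U (Suc j) \<or> U j = U (Suc j) + 1" using U step by (auto simp: stp_def)
  then show ?case using step by auto
qed simp

lemma stp_ge: "stp d n U \<Longrightarrow> Wtop d n \<le> U"
  unfolding le_fun_def
proof
  fix j assume U: "stp d n U"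
  show "Wtop d n j \<le> U j"
    using stp_antimono[OF U, of j n] U by (auto simp: Wtop_def stp_def not_le)
qed

lemma stp_dcr:
  assumes "stp d n U" "canlow n j U" "j \<le> n" "j = n \<Longrightarrow> - int d < U n"
  shows "stp d n (dcr j U)"
  unfolding stp_def
proof (intro conjI allI impI)
  fix i assume i: "i < n"
  have U: "U i = U (Suc i) \<or> U i = U (Suc i) + 1" using assms(1) i by (auto simp: stp_def)
  show "dcr j U i = dcr j U (Suc i) \<or> dcr j U i = dcr j U (Suc i) + 1"
    using assms(2) i U by (auto simp: dcr_def canlow_def)
next
  fix i assume "i > n" then show "dcr j U i = 0" using assms by (auto simp: dcr_def stp_def)
qed (use assms in \<open>auto simp: dcr_def stp_def\<close>)

lemma dec_Wtop: "dec n (Wtop d n) (Wtop d n) = ({1..int n}, d)"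
proof -
  have "{int i |i. 1 \<le> i \<and> i \<le> n} = {1..int n}"
  proof (rule Set.set_eqI)
    fix x show "x \<in> {int i |i. 1 \<le> i \<and> i \<le> n} \<longleftrightarrow> x \<in> {1..int n}"
      by (auto intro!: exI[of _ "nat x"])
  qed
  moreover have "Wtop d n (i - Suc 0) = Wtop d n i" if "i \<le> n" for i using that by (auto simp: Wtop_def)
  ultimately show ?thesis by (auto simp: dec_def Wtop_def cong: conj_cong)
qed

lemma nneg_replace:
  assumes "l \<in> \<gamma>" "k \<notin> \<gamma>" "i \<le> n"
  shows "int (nneg n (insert k (\<gamma> - {l})) i) = int (nneg n \<gamma> i)
     + (if k < 0 \<and> int i < - k \<and> - k \<le> int n then 1 else 0) - (if l < 0 \<and> int i < - l \<and> - l \<le> int n then 1 else 0)"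
  using assms(3)
proof (induction i rule: inc_induct)
  case (step i)
  have m: "- int (Suc i) \<in> insert k (\<gamma> - {l}) \<longleftrightarrow> k = - int (Suc i) \<or> (- int (Suc i) \<in> \<gamma> \<and> l \<noteq> - int (Suc i))" by auto
  show ?case unfolding nneg_step[OF step(2)] m of_nat_add step(3) using assms(1,2) step(2) by auto
qed simp

lemma npos_replace:
  assumes "l \<in> \<gamma>" "k \<notin> \<gamma>" "i \<le> n"
  shows "int (npos n (insert k (\<gamma> - {l})) i) = int (npos n \<gamma> i)
     - (if int i < k \<and> k \<le> int n then 1 else 0) + (if int i < l \<and> l \<le> int n then 1 else 0)"
  using assms(3)
proof (induction i rule: inc_induct)
  case (step i)
  have m: "int (Suc i) \<in> insert k (\<gamma> - {l}) \<longleftrightarrow> k = int (Suc i) \<or> (int (Suc i) \<in> \<gamma> \<and> l \<noteq> int (Suc i))" by auto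
  show ?case unfolding npos_step[OF step(2)] m of_nat_add step(3) using assms(1,2) step(2) by auto
qed simp

lemma h_replace_pos:
  assumes "int j \<in> \<gamma>" "int (Suc j) \<notin> \<gamma>" "1 \<le> j" "j < n"
  shows "hI n (insert (int (Suc j)) (\<gamma> - {int j}), a) = hI n (\<gamma>, a)"
    "hJ n (insert (int (Suc j)) (\<gamma> - {int j}), a) = dcr j (hJ n (\<gamma>, a))"
  using assms by (auto simp: fun_eq_iff hI_def hJ_def dcr_def nneg_replace npos_replace simp del: of_nat_Suc)

lemma h_replace_neg:
  assumes "- int (Suc j) \<in> \<gamma>" "- int j \<notin> \<gamma>" "1 \<le> j" "j < n"
  shows "hI n (insert (- int j) (\<gamma> - {- int (Suc j)}), a) = dcr j (hI n (\<gamma>, a))"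
    "hJ n (insert (- int j) (\<gamma> - {- int (Suc j)}), a) = hJ n (\<gamma>, a)"
  using assms by (auto simp: fun_eq_iff hI_def hJ_def dcr_def nneg_replace npos_replace simp del: of_nat_Suc)

lemma h_replace_0:
  assumes "-1 \<in> \<gamma>" "1 \<notin> \<gamma>" "1 \<le> n"
  shows "hI n (insert 1 (\<gamma> - {-1}), a) = dcr 0 (hI n (\<gamma>, a))"
    "hJ n (insert 1 (\<gamma> - {-1}), a) = dcr 0 (hJ n (\<gamma>, a))"
  using assms by (auto simp: fun_eq_iff hI_def hJ_def dcr_def nneg_replace npos_replace)

lemma h_replace_n:
  assumes "int n \<in> \<gamma>" "- int n \<notin> \<gamma>" "1 \<le> n"
  shows "hI n (insert (- int n) (\<gamma> - {int n}), Suc a) = dcr n (hI n (\<gamma>, a))"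
    "hJ n (insert (- int n) (\<gamma> - {int n}), Suc a) = dcr n (hJ n (\<gamma>, a))"
  using assms by (auto simp: fun_eq_iff hI_def hJ_def dcr_def nneg_replace npos_replace)

lemma mem_neg_iff: "i < n \<Longrightarrow> - int (Suc i) \<in> \<gamma> \<longleftrightarrow> hI n (\<gamma>, a) i = hI n (\<gamma>, a) (Suc i) + 1"
  using nneg_step[of i n \<gamma>] by (auto simp: hI_def simp del: of_nat_Suc)
lemma mem_neg_iff': "i < n \<Longrightarrow> - int (Suc i) \<notin> \<gamma> \<longleftrightarrow> hI n (\<gamma>, a) i = hI n (\<gamma>, a) (Suc i)"
  using nneg_step[of i n \<gamma>] by (auto simp: hI_def simp del: of_nat_Suc)
lemma mem_pos_iff: "i < n \<Longrightarrow> int (Suc i) \<in> \<gamma> \<longleftrightarrow> hJ n (\<gamma>, a) i = hJ n (\<gamma>, a) (Suc i)"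
  using npos_step[of i n \<gamma>] by (auto simp: hJ_def simp del: of_nat_Suc)
lemma mem_pos_iff': "i < n \<Longrightarrow> int (Suc i) \<notin> \<gamma> \<longleftrightarrow> hJ n (\<gamma>, a) i = hJ n (\<gamma>, a) (Suc i) + 1"
  using npos_step[of i n \<gamma>] by (auto simp: hJ_def simp del: of_nat_Suc)

lemma canlow_pos: "1 \<le> j \<Longrightarrow> j < n \<Longrightarrow> int j \<in> \<gamma> \<and> int (Suc j) \<notin> \<gamma> \<longleftrightarrow> canlow n j (hJ n (\<gamma>, a))"
  using mem_pos_iff[of "j - 1" n \<gamma> a] mem_pos_iff'[of j n \<gamma> a] by (auto simp: canlow_def)
lemma canlow_neg: "1 \<le> j \<Longrightarrow> j < n \<Longrightarrow> - int (Suc j) \<in> \<gamma> \<and> - int j \<notin> \<gamma> \<longleftrightarrow> canlow n j (hI n (\<gamma>, a))"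
  using mem_neg_iff'[of "j - 1" n \<gamma> a] mem_neg_iff[of j n \<gamma> a] by (auto simp: canlow_def)
lemma canlow_0: "1 \<le> n \<Longrightarrow> -1 \<in> \<gamma> \<and> 1 \<notin> \<gamma> \<longleftrightarrow> canlow n 0 (hI n (\<gamma>, a)) \<and> canlow n 0 (hJ n (\<gamma>, a))"
  using mem_neg_iff[of 0 n \<gamma> a] mem_pos_iff'[of 0 n \<gamma> a] by (auto simp: canlow_def)
lemma canlow_n: "1 \<le> n \<Longrightarrow> int n \<in> \<gamma> \<and> - int n \<notin> \<gamma> \<longleftrightarrow> canlow n n (hI n (\<gamma>, a)) \<and> canlow n n (hJ n (\<gamma>, a))"
  using mem_neg_iff'[of "n - 1" n \<gamma> a] mem_pos_iff[of "n - 1" n \<gamma> a] by (auto simp: canlow_def)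

lemma paired_dcr_left: "paired d n U V \<Longrightarrow> canlow n j U \<Longrightarrow> 1 \<le> j \<Longrightarrow> j < n \<Longrightarrow> paired d n (dcr j U) V"
  using stp_dcr[of d n U j] by (auto simp: paired_def dcr_def)
lemma paired_dcr_right: "paired d n U V \<Longrightarrow> canlow n j V \<Longrightarrow> 1 \<le> j \<Longrightarrow> j < n \<Longrightarrow> paired d n U (dcr j V)"
  using stp_dcr[of d n V j] by (auto simp: paired_def dcr_def)
lemma paired_dcr_both: "paired d n U V \<Longrightarrow> canlow n j U \<Longrightarrow> canlow n j V \<Longrightarrow> j \<le> n \<Longrightarrow> (j = n \<Longrightarrow> - int d < U n) \<Longrightarrow> paired d n (dcr j U) (dcr j V)"
  using stp_dcr[of d n V j] stp_dcr[of d n U j] by (auto simp: paired_def dcr_def)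

lemma LevPos_eq_dec: "y \<in> LevPos d n \<Longrightarrow> hI n y = U \<Longrightarrow> hJ n y = V \<Longrightarrow> y = dec n U V"
  by (metis dec_h)

lemma angle_int [simp]: "int i \<in> angle n \<longleftrightarrow> 1 \<le> i \<and> i \<le> n" "- int i \<in> angle n \<longleftrightarrow> 1 \<le> i \<and> i \<le> n"
  by (auto simp: angle_iff)

text \<open>Away from the ends the two step functions move independently: the operation on positive
  columns lowers \<open>V\<close>, the one on negative columns lowers \<open>U\<close>.\<close>

lemma Xop_interior:
  assumes p: "paired d n U V" and j: "1 \<le> j" "j < n"
  shows "Xop n j z c (dec n U V) = c (dec n U V)
     + (if canlow n j V then z * c (dec n U (dcr j V)) else 0)
     - (if canlow n j U then z * (c (dec n (dcr j U) V) + (if canlow n j V then z * c (dec n (dcr j U) (dcr j V)) else 0)) else 0)"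
proof -
  obtain \<gamma> a where x: "dec n U V = (\<gamma>, a)" by (cases "dec n U V")
  note h = h_dec[OF p, unfolded x]
  have g: "\<gamma> \<in> nsub n" "a \<le> d" using h(1) by (auto simp: LevPos_def)
  have cp: "int j \<in> \<gamma> \<and> int (Suc j) \<notin> \<gamma> \<longleftrightarrow> canlow n j V" using canlow_pos[OF j] h by metis
  have cn: "- int (Suc j) \<in> \<gamma> \<and> - int j \<notin> \<gamma> \<longleftrightarrow> canlow n j U" using canlow_neg[OF j] h by metis
  have 1: "(insert (int (Suc j)) (\<gamma> - {int j}), a) = dec n U (dcr j V)" if "canlow n j V"
  proof (rule LevPos_eq_dec)
    have *: "int j \<in> \<gamma>" "int (Suc j) \<notin> \<gamma>" using cp that by auto
    show "(insert (int (Suc j)) (\<gamma> - {int j}), a) \<in> LevPos d n"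
      using nsub_replace[OF *] j g by (simp add: LevPos_def del: of_nat_Suc)
  qed (use h_replace_pos[of j \<gamma> n a] cp that j h in auto)
  have 2: "(insert (- int j) (\<gamma> - {- int (Suc j)}), a) = dec n (dcr j U) V" if "canlow n j U"
  proof (rule LevPos_eq_dec)
    have *: "- int (Suc j) \<in> \<gamma>" "- int j \<notin> \<gamma>" using cn that by auto
    show "(insert (- int j) (\<gamma> - {- int (Suc j)}), a) \<in> LevPos d n"
      using nsub_replace[OF *] j g by (simp add: LevPos_def del: of_nat_Suc)
  qed (use h_replace_neg[of j \<gamma> n a] cn that j h in auto)
  have 3: "(insert (int (Suc j)) (insert (- int j) (\<gamma> - {- int (Suc j)}) - {int j}), a) = dec n (dcr j U) (dcr j V)"
    if "canlow n j U" "canlow n j V"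
  proof (rule LevPos_eq_dec)
    let ?g = "insert (- int j) (\<gamma> - {- int (Suc j)})"
    have *: "int j \<in> ?g" "int (Suc j) \<notin> ?g" using cp that by auto
    have **: "- int (Suc j) \<in> \<gamma>" "- int j \<notin> \<gamma>" using cn that by auto
    show "(insert (int (Suc j)) (?g - {int j}), a) \<in> LevPos d n"
      using nsub_replace[OF *] nsub_replace[OF **] j g by (simp add: LevPos_def del: of_nat_Suc)
    show "hI n (insert (int (Suc j)) (?g - {int j}), a) = dcr j U" "hJ n (insert (int (Suc j)) (?g - {int j}), a) = dcr j V"
      using h_replace_pos[OF * j, of a] h_replace_neg[OF ** j, of a] h by auto
  qed
  have m: "int j \<in> insert (- int j) (\<gamma> - {- int (Suc j)}) \<longleftrightarrow> int j \<in> \<gamma>"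
    "int (Suc j) \<in> insert (- int j) (\<gamma> - {- int (Suc j)}) \<longleftrightarrow> int (Suc j) \<in> \<gamma>" using j by auto
  have "Xop n j z c (\<gamma>, a) = col_add (- int j) (- int (Suc j)) (- z) (col_add (int (Suc j)) (int j) z c) (\<gamma>, a)"
    using j by (simp add: Xop_def)
  also have "\<dots> = c (\<gamma>, a) + (if canlow n j V then z * c (dec n U (dcr j V)) else 0)
     - (if canlow n j U then z * (c (dec n (dcr j U) V) + (if canlow n j V then z * c (dec n (dcr j U) (dcr j V)) else 0)) else 0)"
    unfolding col_add_def fst_conv snd_conv m cp cn using 1 2 3 by (simp del: of_nat_Suc)
  finally show ?thesis by (simp add: x)
qed

text \<open>At an end the two functions have a common value, and a single column operation lowers
  both.\<close>

lemma Xop_0: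
  assumes p: "paired d n U V" and n: "1 \<le> n"
  shows "Xop n 0 z c (dec n U V) = c (dec n U V)
     + (if canlow n 0 U \<and> canlow n 0 V then z * c (dec n (dcr 0 U) (dcr 0 V)) else 0)"
proof -
  obtain \<gamma> a where x: "dec n U V = (\<gamma>, a)" by (cases "dec n U V")
  note h = h_dec[OF p, unfolded x]
  have g: "\<gamma> \<in> nsub n" "a \<le> d" using h(1) by (auto simp: LevPos_def)
  have c: "-1 \<in> \<gamma> \<and> 1 \<notin> \<gamma> \<longleftrightarrow> canlow n 0 U \<and> canlow n 0 V" using canlow_0[OF n] h by metis
  have 1: "(insert 1 (\<gamma> - {-1}), a) = dec n (dcr 0 U) (dcr 0 V)" if "canlow n 0 U \<and> canlow n 0 V"
  proof (rule LevPos_eq_dec)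
    have *: "-1 \<in> \<gamma>" "1 \<notin> \<gamma>" using c that by auto
    show "(insert 1 (\<gamma> - {-1}), a) \<in> LevPos d n"
      using nsub_replace[OF *, of n] n g by (simp add: LevPos_def angle_iff)
  qed (use h_replace_0[of \<gamma> n a] c that n h in auto)
  show ?thesis unfolding x Xop_def col_add_def using c 1 by auto
qed

lemma Xop_n:
  assumes p: "paired d n U V" and n: "1 \<le> n" and supp: "\<forall>x. c x \<noteq> 0 \<longrightarrow> x \<in> LevPos d n"
  shows "Xop n n z c (dec n U V) = c (dec n U V)
     + (if canlow n n U \<and> canlow n n V \<and> - int d < U n then (-1) ^ (n - 1) * z * c (dec n (dcr n U) (dcr n V)) else 0)"
proof -
  obtain \<gamma> a where x: "dec n U V = (\<gamma>, a)" by (cases "dec n U V")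
  note h = h_dec[OF p, unfolded x]
  have g: "\<gamma> \<in> nsub n" "a \<le> d" using h(1) by (auto simp: LevPos_def)
  have c: "int n \<in> \<gamma> \<and> - int n \<notin> \<gamma> \<longleftrightarrow> canlow n n U \<and> canlow n n V" using canlow_n[OF n] h by metis
  have Un: "U n = - int a" using h(2) by auto
  have 1: "(insert (- int n) (\<gamma> - {int n}), Suc a) = dec n (dcr n U) (dcr n V)" if "canlow n n U \<and> canlow n n V" "- int d < U n"
  proof (rule LevPos_eq_dec)
    have *: "int n \<in> \<gamma>" "- int n \<notin> \<gamma>" using c that by auto
    show "(insert (- int n) (\<gamma> - {int n}), Suc a) \<in> LevPos d n"
      using nsub_replace[OF *, of n] n g that Un by (simp add: LevPos_def angle_iff)
  qed (use h_replace_n[of n \<gamma> a] c that n h in auto)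
  have 2: "c (insert (- int n) (\<gamma> - {int n}), Suc a) = 0" if "\<not> - int d < U n"
    using supp that Un g(2) by (force simp: LevPos_def)
  show ?thesis unfolding x Xop_def loop_add_def using c 1 2 n by auto
qed

definition supported :: "nat \<Rightarrow> nat \<Rightarrow> (nat \<Rightarrow> int) \<Rightarrow> (lv \<Rightarrow> complex) \<Rightarrow> bool" where
  "supported d n W c \<longleftrightarrow> (\<forall>x. c x \<noteq> 0 \<longrightarrow> x \<in> LevPos d n \<and> hI n x \<le> W \<and> hJ n x \<le> W)"

lemma supported_0:
  assumes "supported d n W c" "paired d n U V" "\<not> (U \<le> W \<and> V \<le> W)" shows "c (dec n U V) = 0"
  using assms(1,3) h_dec[OF assms(2)] unfolding supported_def by metis

lemma dcr_le: "dcr j U \<le> W \<longleftrightarrow> U \<le> W(j := W j + 1)"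
  by (auto simp: dcr_def le_fun_def)

lemma le_upd: "U \<le> W \<Longrightarrow> U \<le> W(j := W j + (1::int))"
  by (auto simp: le_fun_def intro: order_trans)

lemma Xop_outside:
  assumes supp: "\<forall>x. c x \<noteq> 0 \<longrightarrow> x \<in> LevPos d n" and "x \<notin> LevPos d n" "j \<le> n" "1 \<le> n"
  shows "Xop n j z c x = 0"
proof -
  have A: "col_add k l w c' y = 0" if c': "\<forall>x. c' x \<noteq> 0 \<longrightarrow> x \<in> LevPos d n" and y: "y \<notin> LevPos d n"
    and kl: "k \<in> angle n" "l \<in> angle n" for k l w c' y
  proof -
    have "(insert k (fst y - {l}), snd y) \<notin> LevPos d n" if "l \<in> fst y" "k \<notin> fst y"
      using nsub_replace[OF that kl] y by (cases y) (simp add: LevPos_def)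
    moreover have "c' y = 0" using c' y by blast
    ultimately show ?thesis unfolding col_add_def using c' by (cases "l \<in> fst y \<and> k \<notin> fst y") auto
  qed
  have B: "loop_add n z c x = 0"
  proof -
    have "(insert (- int n) (fst x - {int n}), Suc (snd x)) \<notin> LevPos d n" if "int n \<in> fst x" "- int n \<notin> fst x"
      using nsub_replace[OF that, of n] assms(2,4) by (cases x) (auto simp: LevPos_def)
    moreover have "c x = 0" using assms by blast
    ultimately show ?thesis unfolding loop_add_def using supp by (cases "int n \<in> fst x \<and> - int n \<notin> fst x") auto
  qed
  show ?thesis
  proof (cases "1 \<le> j \<and> j < n")
    case True
    have a: "int (Suc j) \<in> angle n" "- int (Suc j) \<in> angle n" "int j \<in> angle n" "- int j \<in> angle n"
      using True by (auto simp: angle_iff)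
    have "\<forall>y. col_add (int (Suc j)) (int j) z c y \<noteq> 0 \<longrightarrow> y \<in> LevPos d n" using A[OF supp] a by blast
    from A[OF this assms(2) a(4,2)] show ?thesis using True by (simp add: Xop_def del: of_nat_Suc)
  next
    case False
    then have "j = 0 \<or> j = n" using assms by auto
    then show ?thesis using B A[OF supp assms(2)] assms by (auto simp: Xop_def angle_iff)
  qed
qed

text \<open>Every term of the operator reads a coefficient whose functions are lowered at j by at
  most one, so the support grows by at most one at j.\<close>

lemma supported_Xop:
  assumes s: "supported d n W c" and j: "j \<le> n" and n: "1 \<le> n"
  shows "supported d n (W(j := W j + 1)) (Xop n j z c)"
  unfolding supported_def
proof (intro allI impI)
  fix x assume x: "Xop n j z c x \<noteq> 0"
  have supp: "\<forall>x. c x \<noteq> 0 \<longrightarrow> x \<in> LevPos d n" using s by (auto simp: supported_def)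
  have xL: "x \<in> LevPos d n" using Xop_outside[OF supp _ j n] x by blast
  define U V where "U = hI n x" and "V = hJ n x"
  have p: "paired d n U V" unfolding U_def V_def by (rule paired_h[OF xL])
  have xd: "x = dec n U V" by (simp add: U_def V_def dec_h[OF xL])
  let ?W = "W(j := W j + 1)"
  note z = supported_0[OF s]
  have "U \<le> ?W \<and> V \<le> ?W"
  proof (rule ccontr)
    assume c: "\<not> (U \<le> ?W \<and> V \<le> ?W)"
    have nU: "\<not> U \<le> W \<and> \<not> dcr j U \<le> W \<or> \<not> V \<le> W \<and> \<not> dcr j V \<le> W"
      using c le_upd[of U W j] le_upd[of V W j] dcr_le[of j U W] dcr_le[of j V W] by blast
    have c0: "c (dec n U V) = 0" using z[OF p] nU by blast
    consider "1 \<le> j" "j < n" | "j = 0" | "j = n" using j by linarith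
    then have "Xop n j z c x = 0"
    proof cases
      case 1
      have "c (dec n U (dcr j V)) = 0" if "canlow n j V" using z[OF paired_dcr_right[OF p that 1]] nU by blast
      moreover have "c (dec n (dcr j U) V) = 0" if "canlow n j U" using z[OF paired_dcr_left[OF p that 1]] nU by blast
      moreover have "c (dec n (dcr j U) (dcr j V)) = 0" if "canlow n j U" "canlow n j V"
        using z[OF paired_dcr_both[OF p that j]] 1 nU by blast
      ultimately show ?thesis unfolding xd Xop_interior[OF p 1] using c0 by simp
    next
      case 2
      have "c (dec n (dcr j U) (dcr j V)) = 0" if "canlow n j U" "canlow n j V"
        using z[OF paired_dcr_both[OF p that j]] 2 n nU by (metis not_one_le_zero)
      then show ?thesis unfolding xd 2 Xop_0[OF p n] using c0 2 by simp
    next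
      case 3
      have "c (dec n (dcr j U) (dcr j V)) = 0" if "canlow n j U" "canlow n j V" "- int d < U n"
        using z[OF paired_dcr_both[OF p that(1,2) j]] that nU by blast
      then show ?thesis unfolding xd 3 Xop_n[OF p n supp] using c0 3 by simp
    qed
    then show False using x by simp
  qed
  then show "x \<in> LevPos d n \<and> hI n x \<le> ?W \<and> hJ n x \<le> ?W" using xL by (simp add: U_def V_def)
qed

lemma Fam_stp: "Fam d n W c \<Longrightarrow> stp d n W"
  by (induction rule: Fam.induct) (rule stp_Wtop, assumption)

lemma Fam_supported: "Fam d n W c \<Longrightarrow> 1 \<le> n \<Longrightarrow> supported d n W c"
proof (induction rule: Fam.induct)
  case (base l)
  have p: "paired d n (Wtop d n) (Wtop d n)" by (simp add: paired_def stp_Wtop)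
  show ?case using h_dec[OF p] by (auto simp: supported_def dec_Wtop)
next
  case (step W c z j)
  then show ?case using supported_Xop by blast
qed

section \<open>Leading terms of the one-parameter subgroups\<close>

definition meetf :: "(nat \<Rightarrow> int) \<Rightarrow> (nat \<Rightarrow> int) \<Rightarrow> nat \<Rightarrow> int" where
  "meetf W U = (\<lambda>i. min (U i) (W i))"

text \<open>The power of z picked up by a pair: one factor for each function touching the raised
  bound at j. At 0 and n both functions touch together and one operation serves them, so they count
  once.\<close>

definition vex :: "nat \<Rightarrow> nat \<Rightarrow> (nat \<Rightarrow> int) \<Rightarrow> (nat \<Rightarrow> int) \<times> (nat \<Rightarrow> int) \<Rightarrow> nat" where
  "vex n j W p = (if j = 0 \<or> j = n then (if fst p j = W j then 1 else 0)
     else (if fst p j = W j then 1 else 0) + (if snd p j = W j then 1 else 0))"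

text \<open>The sign accompanying that power: the minus of the operation on negative columns for 0 <
  j < n, and the sign of moving the extreme column for j = n. The first function alone is tested; it
  dominates the second one where leading terms are taken.\<close>

definition vsg :: "nat \<Rightarrow> nat \<Rightarrow> (nat \<Rightarrow> int) \<Rightarrow> (nat \<Rightarrow> int) \<times> (nat \<Rightarrow> int) \<Rightarrow> complex" where
  "vsg n j W p = (if fst p j \<noteq> W j \<or> j = 0 then 1 else if j = n then (-1) ^ (n - 1) else - 1)"

lemma vsg_cases: "vsg n j W p = 1 \<or> vsg n j W p = -1"
  by (cases "even (n - 1)") (auto simp: vsg_def)

lemma meetf_below: "U \<le> W(j := W j + 1) \<Longrightarrow> U j \<noteq> W j + 1 \<Longrightarrow> meetf W U = U"
  unfolding meetf_def le_fun_def fun_eq_iff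
proof
  fix i assume h: "\<forall>x. U x \<le> (W(j := W j + 1)) x" "U j \<noteq> W j + 1"
  show "min (U i) (W i) = U i" using h(1)[rule_format, of i] h(2) by (cases "i = j") auto
qed

lemma below_le: "U \<le> W(j := W j + (1::int)) \<Longrightarrow> U j \<noteq> W j + 1 \<Longrightarrow> U \<le> W"
  unfolding le_fun_def
proof
  fix i assume h: "\<forall>x. U x \<le> (W(j := W j + 1)) x" "U j \<noteq> W j + 1"
  show "U i \<le> W i" using h(1)[rule_format, of i] h(2) by (cases "i = j") auto
qed

lemma meetf_top: "U \<le> W(j := W j + 1) \<Longrightarrow> U j = W j + 1 \<Longrightarrow> meetf W U = dcr j U"
  unfolding meetf_def dcr_def le_fun_def fun_eq_iff
proof
  fix i assume h: "\<forall>x. U x \<le> (W(j := W j + 1)) x" "U j = W j + 1"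
  show "min (U i) (W i) = (U(j := U j - 1)) i" using h(1)[rule_format, of i] h(2) by (cases "i = j") auto
qed

text \<open>Since \<open>W\<close> and its raise at j are both step functions, the raised graph has
  a corner at j, and so has any graph below it that touches it there.\<close>

lemma canlow_top:
  assumes W: "stp d n W" "stp d n (W(j := W j + 1))" and U: "stp d n U" "U \<le> W(j := W j + 1)" "U j = W j + 1" and j: "j \<le> n"
  shows "canlow n j U"
proof -
  have "U (j - 1) = U j" if "j \<noteq> 0"
  proof -
    have "U (j - 1) = U j \<or> U (j - 1) = U j + 1" using U(1) that j by (cases j) (auto simp: stp_def)
    moreover have "W (j - 1) = W j \<or> W (j - 1) = W j + 1" using W(1) that j by (cases j) (auto simp: stp_def)
    moreover have "U (j - 1) \<le> W (j - 1)" using le_funD[OF U(2), of "j - 1"] that by (cases j) auto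
    ultimately show ?thesis using U(3) by auto
  qed
  moreover have "U j = U (Suc j) + 1" if "j \<noteq> n"
  proof -
    have "U j = U (Suc j) \<or> U j = U (Suc j) + 1" using U(1) that j by (auto simp: stp_def)
    moreover have "W j + 1 = W (Suc j) \<or> W j + 1 = W (Suc j) + 1" using W(2) that j by (auto simp: stp_def dest!: spec[of _ j])
    moreover have "W j = W (Suc j) \<or> W j = W (Suc j) + 1" using W(1) that j by (auto simp: stp_def)
    moreover have "U (Suc j) \<le> W (Suc j)" using le_funD[OF U(2), of "Suc j"] by auto
    ultimately show ?thesis using U(3) by auto
  qed
  ultimately show ?thesis by (auto simp: canlow_def)
qed

text \<open>A coefficient with a function touching the raised bound is 0 in \<open>c\<close>, as it
  lies outside the old bound. The terms that survive lower every touching function, and this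
  lowering is the meet with \<open>W\<close>; all others carry additional factors z. For two equal
  touching functions there are no others.\<close>

lemma Xop_leading:
  assumes s: "supported d n W c" and W: "stp d n W" "stp d n (W(j := W j + 1))" and j: "j \<le> n" and n: "1 \<le> n"
    and p: "paired d n U V" and VU: "V \<le> U" and UW: "U \<le> W(j := W j + 1)"
  defines "W' \<equiv> W(j := W j + 1)"
  shows "\<exists>A B. \<forall>z. Xop n j z c (dec n U V) = vsg n j W' (U, V) * z ^ vex n j W' (U, V) *
      (c (dec n (meetf W U) (meetf W V)) + z * A + z ^ 2 * B)"
    and "U = V \<Longrightarrow> U j = W' j \<Longrightarrow> Xop n j z c (dec n U V) = vsg n j W' (U, V) * z ^ vex n j W' (U, V) * c (dec n (meetf W U) (meetf W V))"
proof -
  have supp: "\<forall>x. c x \<noteq> 0 \<longrightarrow> x \<in> LevPos d n" using s by (auto simp: supported_def)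
  note z = supported_0[OF s]
  have st: "stp d n U" "stp d n V" using p by (auto simp: paired_def)
  have VW: "V \<le> W(j := W j + 1)" using VU UW by (rule order_trans)
  have Wj: "W' j = W j + 1" by (simp add: W'_def)
  have UWj: "U j \<le> W j + 1" "V j \<le> U j" using le_funD[OF UW, of j] le_funD[OF VU, of j] by auto
  have nle: "\<not> X \<le> W" if "X j = W j + 1" for X :: "nat \<Rightarrow> int" using that by (auto simp: le_fun_def intro!: exI[of _ j])
  have nd: "- int d < U n" if "j = n" "U j = W j + 1" using that W(1) by (auto simp: stp_def)
  have main: "\<exists>A B. (\<forall>z. Xop n j z c (dec n U V) = vsg n j W' (U, V) * z ^ vex n j W' (U, V) *
      (c (dec n (meetf W U) (meetf W V)) + z * A + z ^ 2 * B)) \<and> (U = V \<and> U j = W' j \<longrightarrow> A = 0 \<and> B = 0)"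
  proof (cases "U j = W j + 1")
    case False
    then have V': "V j \<noteq> W j + 1" using UWj by auto
    have m: "meetf W U = U" "meetf W V = V" using meetf_below UW VW False V' by auto
    have e: "vex n j W' (U, V) = 0" "vsg n j W' (U, V) = 1" using False V' by (auto simp: vex_def vsg_def Wj)
    consider "1 \<le> j" "j < n" | "j = 0" | "j = n" using j by linarith
    then have "\<exists>A B. \<forall>z. Xop n j z c (dec n U V) = c (dec n U V) + z * A + z ^ 2 * B"
    proof cases
      case 1
      show ?thesis unfolding Xop_interior[OF p 1]
        by (rule exI[of _ "(if canlow n j V then c (dec n U (dcr j V)) else 0) - (if canlow n j U then c (dec n (dcr j U) V) else 0)"],
            rule exI[of _ "- (if canlow n j U \<and> canlow n j V then c (dec n (dcr j U) (dcr j V)) else 0)"])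
          (auto simp: algebra_simps power2_eq_square)
    next
      case 2
      show ?thesis unfolding 2 Xop_0[OF p n]
        by (rule exI[of _ "if canlow n 0 U \<and> canlow n 0 V then c (dec n (dcr 0 U) (dcr 0 V)) else 0"], rule exI[of _ 0]) auto
    next
      case 3
      show ?thesis unfolding 3 Xop_n[OF p n supp]
        by (rule exI[of _ "if canlow n n U \<and> canlow n n V \<and> - int d < U n then (-1) ^ (n - 1) * c (dec n (dcr n U) (dcr n V)) else 0"], rule exI[of _ 0]) auto
    qed
    then show ?thesis using False by (simp add: e m Wj)
  next
    case True
    have cU: "canlow n j U" by (rule canlow_top[OF W st(1) UW True j])
    have mU: "meetf W U = dcr j U" using meetf_top UW True by blast
    have c0: "c (dec n U V) = 0" using z[OF p] nle[of U, OF True] by blast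
    show ?thesis
    proof (cases "1 \<le> j \<and> j < n")
      case int: True
      then have j1: "1 \<le> j" "j < n" by auto
      have c1: "c (dec n U (dcr j V)) = 0" if "canlow n j V" using z[OF paired_dcr_right[OF p that j1]] nle[of U, OF True] by blast
      show ?thesis
      proof (cases "V j = W j + 1")
        case V: True
        have cV: "canlow n j V" by (rule canlow_top[OF W st(2) VW V j])
        have mV: "meetf W V = dcr j V" using meetf_top VW V by blast
        have c2: "c (dec n (dcr j U) V) = 0" using z[OF paired_dcr_left[OF p cU j1]] nle[of V, OF V] by blast
        show ?thesis unfolding Xop_interior[OF p j1]
          by (rule exI[of _ 0], rule exI[of _ 0])
            (use True V j1 cU cV c0 c1 c2 in \<open>simp add: vex_def vsg_def Wj mU mV power2_eq_square\<close>)
      next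
        case V: False
        have mV: "meetf W V = V" using meetf_below VW V by blast
        show ?thesis unfolding Xop_interior[OF p j1]
          by (rule exI[of _ "if canlow n j V then c (dec n (dcr j U) (dcr j V)) else 0"], rule exI[of _ 0])
            (use True V j1 cU c0 c1 in \<open>auto simp: vex_def vsg_def Wj mU mV algebra_simps\<close>)
      qed
    next
      case ext: False
      then have j0: "j = 0 \<or> j = n" using j by auto
      have V: "V j = W j + 1" using j0 True p by (auto simp: paired_def)
      have cV: "canlow n j V" by (rule canlow_top[OF W st(2) VW V j])
      have mV: "meetf W V = dcr j V" using meetf_top VW V by blast
      have "Xop n j z c (dec n U V) = vsg n j W' (U, V) * z * c (dec n (dcr j U) (dcr j V))" for z
      proof (cases "j = 0")
        case j00: True
        show ?thesis unfolding j00 Xop_0[OF p n] using cU cV c0 j00 by (simp add: vsg_def)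
      next
        case False
        then have jn: "j = n" using j0 by auto
        show ?thesis unfolding jn Xop_n[OF p n supp] using cU cV c0 nd True False jn Wj by (simp add: vsg_def)
      qed
      then show ?thesis
        by (intro exI[of _ 0]) (use True j0 in \<open>simp add: vex_def Wj mU mV\<close>)
    qed
  qed
  then show "\<exists>A B. \<forall>z. Xop n j z c (dec n U V) = vsg n j W' (U, V) * z ^ vex n j W' (U, V) *
      (c (dec n (meetf W U) (meetf W V)) + z * A + z ^ 2 * B)" by blast
  show "Xop n j z c (dec n U V) = vsg n j W' (U, V) * z ^ vex n j W' (U, V) * c (dec n (meetf W U) (meetf W V))" if "U = V" "U j = W' j"
    using main that by auto
qed

lemma Xop_leading_tendsto:
  assumes s: "supported d n W c" and W: "stp d n W" "stp d n (W(j := W j + 1))" and j: "j \<le> n" and n: "1 \<le> n"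
    and p: "paired d n U V" and VU: "V \<le> U" and UW: "U \<le> W(j := W j + 1)"
  defines "W' \<equiv> W(j := W j + 1)"
  shows "((\<lambda>z. Xop n j z c (dec n U V) / z ^ vex n j W' (U, V)) \<longlongrightarrow> vsg n j W' (U, V) * c (dec n (meetf W U) (meetf W V))) (at 0)"
proof -
  obtain A B where AB: "\<And>z. Xop n j z c (dec n U V) = vsg n j W' (U, V) * z ^ vex n j W' (U, V) *
      (c (dec n (meetf W U) (meetf W V)) + z * A + z ^ 2 * B)"
    using Xop_leading(1)[OF assms(1-8)] unfolding W'_def by blast
  have "((\<lambda>z. vsg n j W' (U, V) * (c (dec n (meetf W U) (meetf W V)) + z * A + z ^ 2 * B)) \<longlongrightarrow>
     vsg n j W' (U, V) * (c (dec n (meetf W U) (meetf W V)) + 0 * A + 0 ^ 2 * B)) (at 0)"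
    by (intro tendsto_intros)
  moreover have "\<forall>\<^sub>F z in at 0. Xop n j z c (dec n U V) / z ^ vex n j W' (U, V) =
      vsg n j W' (U, V) * (c (dec n (meetf W U) (meetf W V)) + z * A + z ^ 2 * B)"
    unfolding eventually_at_filter by (intro always_eventually allI impI) (simp add: AB)
  ultimately show ?thesis using tendsto_cong by fastforce
qed

text \<open>The leading term at equal functions is exact, so this coefficient is only multiplied by
  a sign and a power of a nonzero parameter.\<close>

lemma Fam_corner:
  assumes "Fam d n W c" "1 \<le> n" shows "c (dec n W W) \<noteq> 0"
  using assms
proof (induction rule: Fam.induct)
  case (base l)
  then show ?case by (simp add: dec_Wtop)
next
  case (step W c z j)
  let ?W = "W(j := W j + 1)"
  have st: "stp d n W" using step Fam_stp by blast
  have m: "meetf W ?W = W" by (auto simp: meetf_def fun_eq_iff)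
  have "Xop n j z c (dec n ?W ?W) = vsg n j ?W (?W, ?W) * z ^ vex n j ?W (?W, ?W) * c (dec n (meetf W ?W) (meetf W ?W))"
    by (rule Xop_leading(2)[OF Fam_supported[OF step(1,6)] st step(4,3,6)]) (use step(4) in \<open>auto simp: paired_def\<close>)
  moreover have "vsg n j ?W (?W, ?W) \<noteq> 0" using vsg_cases[of n j ?W "(?W, ?W)"] by auto
  ultimately show ?case unfolding m using step(2,5,6) by (simp del: fun_upd_apply)
qed

subsection \<open>Linear independence of standard monomials\<close>

type_synonym fpair = "(nat \<Rightarrow> int) \<times> (nat \<Rightarrow> int)"

definition FD :: "nat \<Rightarrow> nat \<Rightarrow> fpair set" where
  "FD d n = {(U, V). paired d n U V \<and> V \<le> U}"

definition evl :: "nat \<Rightarrow> (lv \<Rightarrow> complex) \<Rightarrow> fpair list \<Rightarrow> complex" where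
  "evl n c ps = prod_list (map (\<lambda>(U, V). c (dec n U V)) ps)"

definition fl :: "fpair list \<Rightarrow> (nat \<Rightarrow> int) list" where
  "fl ps = concat (map (\<lambda>(U, V). [U, V]) ps)"

definition dstd :: "fpair list \<Rightarrow> bool" where
  "dstd ps \<longleftrightarrow> sorted_wrt (\<lambda>A B. B \<le> A) (fl ps)"

definition below :: "(nat \<Rightarrow> int) \<Rightarrow> fpair list \<Rightarrow> bool" where
  "below W ps \<longleftrightarrow> (\<forall>p\<in>set ps. fst p \<le> W)"

definition mred :: "(nat \<Rightarrow> int) \<Rightarrow> fpair list \<Rightarrow> fpair list" where
  "mred W ps = map (\<lambda>(U, V). (meetf W U, meetf W V)) ps"

definition vexl :: "nat \<Rightarrow> nat \<Rightarrow> (nat \<Rightarrow> int) \<Rightarrow> fpair list \<Rightarrow> nat" where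
  "vexl n j W ps = sum_list (map (vex n j W) ps)"

definition vsgl :: "nat \<Rightarrow> nat \<Rightarrow> (nat \<Rightarrow> int) \<Rightarrow> fpair list \<Rightarrow> complex" where
  "vsgl n j W ps = prod_list (map (vsg n j W) ps)"

lemma fl_simps [simp]: "fl [] = []" "fl ((U, V) # ps) = U # V # fl ps"
  by (auto simp: fl_def)
lemma mred_simps [simp]: "mred W [] = []" "mred W ((U, V) # ps) = (meetf W U, meetf W V) # mred W ps"
  by (auto simp: mred_def)
lemma evl_simps [simp]: "evl n c [] = 1" "evl n c ((U, V) # ps) = c (dec n U V) * evl n c ps"
  by (auto simp: evl_def)

lemma length_fl: "length (fl ps) = 2 * length ps"
  by (induction ps) auto

lemma fl_inj: "fl ps = fl qs \<Longrightarrow> ps = qs"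
proof (induction ps arbitrary: qs)
  case Nil then show ?case by (cases qs) auto
next
  case (Cons p ps) then show ?case by (cases p; cases qs) auto
qed

lemma fl_mred: "fl (mred W ps) = map (meetf W) (fl ps)"
  by (induction ps) auto

lemma vsgl_cases: "vsgl n j W ps = 1 \<or> vsgl n j W ps = -1"
proof (induction ps)
  case (Cons p ps) then show ?case using vsg_cases[of n j W p] by (auto simp: vsgl_def)
qed (simp add: vsgl_def)

lemma vsgl_nonzero: "vsgl n j W ps \<noteq> 0" using vsgl_cases[of n j W ps] by auto
lemma vsgl_sq: "vsgl n j W ps * vsgl n j W ps = 1" using vsgl_cases[of n j W ps] by auto

lemma stp_meetf: "stp d n U \<Longrightarrow> stp d n W \<Longrightarrow> stp d n (meetf W U)"
  unfolding stp_def meetf_def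
proof (intro conjI allI impI; (elim conjE)?)
  fix j assume "j < n" "\<forall>j<n. U j = U (Suc j) \<or> U j = U (Suc j) + 1" "\<forall>j<n. W j = W (Suc j) \<or> W j = W (Suc j) + 1"
  then have "U j = U (Suc j) \<or> U j = U (Suc j) + 1" "W j = W (Suc j) \<or> W j = W (Suc j) + 1" by auto
  then show "min (U j) (W j) = min (U (Suc j)) (W (Suc j)) \<or> min (U j) (W j) = min (U (Suc j)) (W (Suc j)) + 1"
    by (auto simp: min_def)
qed auto

lemma meetf_mono: "U \<le> V \<Longrightarrow> meetf W U \<le> meetf W V"
  by (auto simp: meetf_def le_fun_def min.coboundedI1)

lemma meetf_le: "meetf W U \<le> W"
  by (auto simp: meetf_def le_fun_def)

lemma meetf_id: "U \<le> W \<Longrightarrow> meetf W U = U"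
  by (auto simp: meetf_def le_fun_def fun_eq_iff min_def)

lemma FD_meetf: "(U, V) \<in> FD d n \<Longrightarrow> stp d n W \<Longrightarrow> (meetf W U, meetf W V) \<in> FD d n"
  using stp_meetf[of d n] meetf_mono by (auto simp: FD_def paired_def) (auto simp: meetf_def)

lemma FD_mred: "set ps \<subseteq> FD d n \<Longrightarrow> stp d n W \<Longrightarrow> set (mred W ps) \<subseteq> FD d n"
  by (induction ps) (use FD_meetf in auto)

lemma below_mred: "below W (mred W ps)"
  unfolding below_def mred_def using meetf_le by auto

lemma dstd_mred: "dstd ps \<Longrightarrow> dstd (mred W ps)"
  unfolding dstd_def fl_mred sorted_wrt_map
  by (rule sorted_wrt_mono_rel) (auto simp: meetf_mono)

text \<open>As z tends to 0, the lowest-order coefficient of a monomial is, up to sign, the monomial in the meets of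
  its step functions with the smaller bound. A relation on one member of the family thus degenerates to
  relations on the preceding one.\<close>

lemma evl_leading:
  assumes s: "supported d n W c" and W: "stp d n W" "stp d n (W(j := W j + 1))" and j: "j \<le> n" and n: "1 \<le> n"
    and ps: "set ps \<subseteq> FD d n" "below (W(j := W j + 1)) ps"
  defines "W' \<equiv> W(j := W j + 1)"
  shows "((\<lambda>z. evl n (Xop n j z c) ps / z ^ vexl n j W' ps) \<longlongrightarrow> vsgl n j W' ps * evl n c (mred W ps)) (at 0)"
  using ps
proof (induction ps)
  case Nil
  then show ?case by (simp add: vexl_def vsgl_def)
next
  case (Cons p ps)
  obtain U V where p: "p = (U, V)" by (cases p)
  have pa: "paired d n U V" "V \<le> U" "U \<le> W(j := W j + 1)" using Cons p by (auto simp: FD_def below_def simp del: fun_upd_apply)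
  have "((\<lambda>z. (Xop n j z c (dec n U V) / z ^ vex n j W' (U, V)) * (evl n (Xop n j z c) ps / z ^ vexl n j W' ps)) \<longlongrightarrow>
     (vsg n j W' (U, V) * c (dec n (meetf W U) (meetf W V))) * (vsgl n j W' ps * evl n c (mred W ps))) (at 0)"
    using Xop_leading_tendsto[OF s W j n pa] Cons unfolding W'_def by (intro tendsto_mult) (auto simp: below_def simp del: fun_upd_apply)
  then show ?case by (simp add: p vexl_def vsgl_def power_add mult.assoc mult.left_commute)
qed

text \<open>Divide by \<open>z ^ e0\<close> and let z tend to 0: the monomials of exponent exactly
  \<open>e0\<close> survive. Terms with coefficient 0 are exempt from the bound, so
  \<open>e0\<close> may be the minimum over those that really occur.\<close>

lemma relation_leading:
  assumes W: "stp d n W" "stp d n (W(j := W j + 1))" and j: "j \<le> n" and n: "1 \<le> n"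
  defines "W' \<equiv> W(j := W j + 1)"
  assumes A: "finite A" "\<And>i. i \<in> A \<Longrightarrow> set (f i) \<subseteq> FD d n \<and> below W' (f i)"
    and rel: "\<And>c. Fam d n W' c \<Longrightarrow> (\<Sum>i\<in>A. C i * evl n c (f i)) = 0"
    and e0: "\<And>i. i \<in> A \<Longrightarrow> C i \<noteq> 0 \<Longrightarrow> e0 \<le> vexl n j W' (f i)"
    and c: "Fam d n W c"
  shows "(\<Sum>i\<in>{i\<in>A. vexl n j W' (f i) = e0}. C i * vsgl n j W' (f i) * evl n c (mred W (f i))) = 0"
proof -
  let ?t = "\<lambda>i. if vexl n j W' (f i) = e0 then C i * vsgl n j W' (f i) * evl n c (mred W (f i)) else 0"
  have s: "supported d n W c" by (rule Fam_supported[OF c n])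
  have "((\<lambda>z. C i * evl n (Xop n j z c) (f i) / z ^ e0) \<longlongrightarrow> ?t i) (at 0)" if i: "i \<in> A" for i
  proof (cases "C i = 0")
    case True then show ?thesis by simp
  next
    case False
    let ?e = "vexl n j W' (f i)"
    have l: "((\<lambda>z. evl n (Xop n j z c) (f i) / z ^ ?e) \<longlongrightarrow> vsgl n j W' (f i) * evl n c (mred W (f i))) (at 0)"
      using evl_leading[OF s W j n] A(2)[OF i] unfolding W'_def by auto
    have "((\<lambda>z. C i * (evl n (Xop n j z c) (f i) / z ^ ?e) * z ^ (?e - e0)) \<longlongrightarrow>
       C i * (vsgl n j W' (f i) * evl n c (mred W (f i))) * 0 ^ (?e - e0)) (at 0)"
      by (intro tendsto_intros l)
    moreover have "C i * (vsgl n j W' (f i) * evl n c (mred W (f i))) * 0 ^ (?e - e0) = ?t i"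
      using e0[OF i False] by (cases "?e = e0") auto
    moreover have "\<forall>\<^sub>F z in at 0. C i * (evl n (Xop n j z c) (f i) / z ^ ?e) * z ^ (?e - e0) = C i * evl n (Xop n j z c) (f i) / z ^ e0"
      unfolding eventually_at_filter
    proof (intro always_eventually allI impI)
      fix z :: complex assume "z \<noteq> 0"
      then show "C i * (evl n (Xop n j z c) (f i) / z ^ ?e) * z ^ (?e - e0) = C i * evl n (Xop n j z c) (f i) / z ^ e0"
        using e0[OF i False] by (simp add: power_diff)
    qed
    ultimately show ?thesis using tendsto_cong by fastforce
  qed
  then have "((\<lambda>z. \<Sum>i\<in>A. C i * evl n (Xop n j z c) (f i) / z ^ e0) \<longlongrightarrow> (\<Sum>i\<in>A. ?t i)) (at 0)"
    by (rule tendsto_sum)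
  moreover have "\<forall>\<^sub>F z in at 0. (\<Sum>i\<in>A. C i * evl n (Xop n j z c) (f i) / z ^ e0) = 0"
    unfolding eventually_at_filter
  proof (intro always_eventually allI impI)
    fix z :: complex assume "z \<noteq> 0"
    then have "Fam d n W' (Xop n j z c)" unfolding W'_def using c j W by (intro Fam.step)
    from rel[OF this] show "(\<Sum>i\<in>A. C i * evl n (Xop n j z c) (f i) / z ^ e0) = 0"
      by (simp add: sum_divide_distrib[symmetric])
  qed
  ultimately have "((\<lambda>z. 0) \<longlongrightarrow> (\<Sum>i\<in>A. ?t i)) (at (0::complex))"
    using tendsto_cong by fastforce
  then have "(\<Sum>i\<in>A. ?t i) = 0" by (rule tendsto_unique[OF at_neq_bot _ tendsto_const])
  then show ?thesis using A(1) by (simp add: sum.inter_filter)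
qed

text \<open>In each list \<open>P\<close> holds on an initial segment, so equal counts put it at the
  same positions, and there \<open>g\<close> and \<open>P\<close> determine the entry.\<close>

lemma list_eq_from_counts:
  assumes "map g xs = map g ys" "length (filter P xs) = length (filter P ys)"
    "sorted_wrt R xs" "sorted_wrt R ys"
    "\<And>x y. x \<in> set xs \<Longrightarrow> y \<in> set ys \<Longrightarrow> g x = g y \<Longrightarrow> P x = P y \<Longrightarrow> x = y"
    "\<And>x y. x \<in> set xs \<union> set ys \<Longrightarrow> y \<in> set xs \<union> set ys \<Longrightarrow> R x y \<Longrightarrow> P y \<Longrightarrow> P x"
  shows "xs = ys"
proof -
  have "length xs = length ys" using assms(1) by (metis length_map)
  then show ?thesis using assms
  proof (induction xs ys rule: list_induct2)
    case (Cons x xs y ys)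
    have none: "filter P zs = []" if "\<not> P z" "sorted_wrt R (z # zs)" "set (z # zs) \<subseteq> set (x # xs) \<union> set (y # ys)" for z zs
      using that Cons.prems(6)[of z] by (auto simp: filter_empty_conv) blast+
    have "P x = P y"
    proof (rule ccontr)
      assume "P x \<noteq> P y"
      then show False
        using Cons.prems(2) none[OF _ Cons.prems(3) Un_upper1] none[OF _ Cons.prems(4) Un_upper2] by (cases "P x") auto
    qed
    moreover from this have "x = y" using Cons.prems(1) Cons.prems(5)[of x y] by auto
    moreover have "xs = ys"
    proof (rule Cons.IH)
      show "length (filter P xs) = length (filter P ys)" using Cons.prems(2) \<open>P x = P y\<close> by (auto split: if_splits)
    qed (use Cons.prems in auto)
    ultimately show ?case by simp
  qed simp
qed

lemma vexl_count:
  assumes "set ps \<subseteq> FD d n"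
  shows "(if j = 0 \<or> j = n then 2 else 1) * vexl n j W ps = length (filter (\<lambda>U. U j = W j) (fl ps))"
  using assms
proof (induction ps)
  case (Cons p ps)
  obtain U V where p: "p = (U, V)" by (cases p)
  have "U 0 = V 0" "U n = V n" using Cons p by (auto simp: FD_def paired_def)
  then show ?case using Cons by (auto simp: p vexl_def vex_def split: if_splits)
qed (simp add: vexl_def)

lemma below_fl: "set ps \<subseteq> FD d n \<Longrightarrow> below W ps \<Longrightarrow> U \<in> set (fl ps) \<Longrightarrow> U \<le> W"
proof (induction ps)
  case (Cons p ps)
  obtain A B where p: "p = (A, B)" by (cases p)
  have "B \<le> A" "A \<le> W" using Cons p by (auto simp: FD_def below_def)
  then show ?case using Cons by (auto simp: p below_def)
qed simp

text \<open>The meet forgets only which functions touch the bound at j. In a standard list these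
  come first, and their number is known from the exponent.\<close>

lemma mred_inj:
  assumes "set ps \<subseteq> FD d n" "set qs \<subseteq> FD d n" "below (W(j := W j + 1)) ps" "below (W(j := W j + 1)) qs"
    "dstd ps" "dstd qs" "vexl n j (W(j := W j + 1)) ps = vexl n j (W(j := W j + 1)) qs" "mred W ps = mred W qs"
  shows "ps = qs"
proof (rule fl_inj, rule list_eq_from_counts[where g = "meetf W" and P = "\<lambda>U. U j = (W(j := W j + 1)) j" and R = "\<lambda>A B. B \<le> A"])
  let ?W = "W(j := W j + 1)"
  show "map (meetf W) (fl ps) = map (meetf W) (fl qs)" using assms(8) by (metis fl_mred)
  show "length (filter (\<lambda>U. U j = ?W j) (fl ps)) = length (filter (\<lambda>U. U j = ?W j) (fl qs))"
    using vexl_count[OF assms(1), of j ?W] vexl_count[OF assms(2), of j ?W] assms(7) by simp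
  show "sorted_wrt (\<lambda>A B. B \<le> A) (fl ps)" "sorted_wrt (\<lambda>A B. B \<le> A) (fl qs)"
    using assms by (auto simp: dstd_def)
  fix x y
  have le: "U \<le> ?W" if "U \<in> set (fl ps) \<union> set (fl qs)" for U
    using that below_fl[OF assms(1,3)] below_fl[OF assms(2,4)] by blast
  {
    assume xy: "x \<in> set (fl ps)" "y \<in> set (fl qs)" "meetf W x = meetf W y" "(x j = ?W j) = (y j = ?W j)"
    have l: "x \<le> ?W" "y \<le> ?W" using le xy by auto
    show "x = y"
    proof (cases "x j = W j + 1")
      case True
      then have "dcr j x = dcr j y" using meetf_top[OF l(1)] meetf_top[OF l(2)] xy by auto
      then show ?thesis using True xy by (auto simp: dcr_def fun_eq_iff split: if_splits) (metis)
    next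
      case False
      then show ?thesis using meetf_below[OF l(1)] meetf_below[OF l(2)] xy by auto
    qed
  }
  {
    assume "x \<in> set (fl ps) \<union> set (fl qs)" "y \<in> set (fl ps) \<union> set (fl qs)" "y \<le> x" "y j = ?W j"
    then show "x j = ?W j" using le_funD[OF le[of x], of j] le_funD[of y x j] by auto
  }
qed

lemma stp_step:
  assumes "stp d n U" "j \<noteq> 0" "j \<le> n" shows "U (j - 1) = U j \<or> U (j - 1) = U j + 1"
proof -
  have "j - 1 < n" "Suc (j - 1) = j" using assms by auto
  then show ?thesis using assms(1) unfolding stp_def by metis
qed

text \<open>Among the places with V < U take those with the largest value of \<open>U\<close>, and
  of these the last one. An equal right neighbour or a larger left neighbour would again be a place
  with V < U, so neither obstructs the lowering.\<close>

lemma exists_canlow: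
  assumes U: "stp d n U" and V: "stp d n V" and le: "V \<le> U" "V \<noteq> U"
  shows "\<exists>j\<le>n. canlow n j U \<and> V j < U j \<and> stp d n (dcr j U) \<and> V \<le> dcr j U"
proof -
  define K where "K = {j. j \<le> n \<and> V j < U j}"
  obtain i where i: "V i \<noteq> U i" using le by auto
  then have "V i < U i" using le_funD[OF le(1), of i] by auto
  moreover have "i \<le> n" by (rule ccontr) (use i U V in \<open>auto simp: stp_def not_le\<close>)
  ultimately have K: "finite K" "K \<noteq> {}" by (auto simp: K_def)
  define m where "m = Max (U ` K)"
  define L where "L = {j \<in> K. U j = m}"
  have "m \<in> U ` K" unfolding m_def using K by (intro Max_in) auto
  then have L: "finite L" "L \<noteq> {}" using K by (auto simp: L_def)
  define j where "j = Max L"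
  have jL: "j \<in> L" unfolding j_def using L by (rule Max_in)
  then have j: "j \<le> n" "V j < U j" "U j = m" by (auto simp: L_def K_def)
  have max: "U i \<le> m" if "i \<le> n" "V i < U i" for i
    unfolding m_def using K that by (intro Max_ge) (auto simp: K_def)
  have last: "U i \<noteq> m" if "i \<le> n" "V i < U i" "j < i" for i
  proof
    assume "U i = m"
    then have "i \<in> L" using that by (auto simp: L_def K_def)
    then have "i \<le> j" unfolding j_def using L by (intro Max_ge)
    then show False using that by simp
  qed
  have Vm: "V b \<le> V a" "U b \<le> U a" if "a \<le> b" "b \<le> n" for a b using stp_antimono[OF V that] stp_antimono[OF U that] by auto
  have "U j = U (Suc j) + 1" if "j \<noteq> n"
  proof (rule ccontr)
    assume "U j \<noteq> U (Suc j) + 1"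
    then have "j < n" using that j(1) by simp
    then have e: "U (Suc j) = U j" using U \<open>U j \<noteq> U (Suc j) + 1\<close> unfolding stp_def by metis
    have "V (Suc j) < U (Suc j)" using Vm(1)[of j "Suc j"] j that e by auto
    then show False using last[of "Suc j"] j that e by auto
  qed
  moreover have "U (j - 1) = U j" if "j \<noteq> 0"
  proof (rule ccontr)
    assume a: "U (j - 1) \<noteq> U j"
    have e: "U (j - 1) = U j + 1" using stp_step[OF U that j(1)] a by simp
    have "V (j - 1) \<le> V j + 1" using stp_step[OF V that j(1)] by auto
    then have "V (j - 1) < U (j - 1)" using j e by auto
    then show False using max[of "j - 1"] j e le_trans[OF diff_le_self[of j 1] j(1)] by auto
  qed
  ultimately have c: "canlow n j U" by (auto simp: canlow_def)
  have "stp d n (dcr j U)" by (rule stp_dcr[OF U c j(1)]) (use V j in \<open>auto simp: stp_def\<close>)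
  moreover have "V \<le> dcr j U" using le(1) j by (auto simp: le_fun_def dcr_def)
  ultimately show ?thesis using c j by blast
qed

lemma dcr_upd: "(dcr j W)(j := dcr j W j + 1) = W"
  by (auto simp: dcr_def)

lemma sum_dcr_less:
  assumes "j \<le> n" "stp d n (dcr j W)" "stp d n W"
  shows "nat (\<Sum>i\<le>n. dcr j W i + int d) < nat (\<Sum>i\<le>n. W i + int d)"
proof -
  have "(\<Sum>i\<le>n. W i + int d) = (\<Sum>i\<le>n. dcr j W i + int d) + (\<Sum>i\<le>n. if i = j then 1 else 0)"
    by (subst sum.distrib[symmetric]) (auto simp: dcr_def intro!: sum.cong)
  also have "(\<Sum>i\<le>n. if i = j then 1 else (0::int)) = 1" using assms(1) by simp
  finally have e: "(\<Sum>i\<le>n. W i + int d) = (\<Sum>i\<le>n. dcr j W i + int d) + 1" .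
  have "0 \<le> dcr j W i + int d" if "i \<le> n" for i
    using le_funD[OF stp_ge[OF assms(2)], of i] that by (simp add: Wtop_def)
  then have "0 \<le> (\<Sum>i\<le>n. dcr j W i + int d)" by (intro sum_nonneg) auto
  then show ?thesis using e by linarith
qed

lemma below_Wtop:
  assumes "set ps \<subseteq> FD d n" "below (Wtop d n) ps"
  shows "ps = replicate (length ps) (Wtop d n, Wtop d n)"
proof (rule replicate_eqI)
  fix p assume p: "p \<in> set ps"
  obtain U V where uv: "p = (U, V)" by (cases p)
  have *: "stp d n U" "stp d n V" "V \<le> U" "U \<le> Wtop d n" using assms p uv by (auto simp: FD_def paired_def below_def)
  have "U = Wtop d n" using * stp_ge order.antisym by blast
  moreover have "V = Wtop d n" using *(3,4) stp_ge[OF *(2)] by (intro order.antisym) auto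
  ultimately show "p = (Wtop d n, Wtop d n)" using uv by simp
qed simp

lemma evl_replicate: "evl n c (replicate k (U, V)) = c (dec n U V) ^ k"
  by (induction k) auto

text \<open>Induction on the area under the bound. Only monomials of one fixed exponent are
  degenerated together; this is what keeps distinct standard monomials distinct.\<close>

theorem independence:
  assumes "stp d n W" "1 \<le> n" "finite A" "inj_on f A"
    "\<And>i. i \<in> A \<Longrightarrow> set (f i) \<subseteq> FD d n \<and> dstd (f i) \<and> below W (f i)"
    "\<And>c. Fam d n W c \<Longrightarrow> (\<Sum>i\<in>A. C i * evl n c (f i)) = 0"
  shows "\<forall>i\<in>A. C i = 0"
  using assms
proof (induction "nat (\<Sum>i\<le>n. W i + int d)" arbitrary: W A f C rule: less_induct)
  case less
  show ?case
  proof (cases "W = Wtop d n")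
    case True
    \<comment> \<open>Under the smallest bound every monomial is a power of the same variable, and
      the free scalar of the family separates the powers.\<close>
    have rp: "f i = replicate (length (f i)) (Wtop d n, Wtop d n)" if "i \<in> A" for i
      using below_Wtop less.prems(5)[OF that] True by blast
    let ?k = "\<lambda>i. length (f i)"
    have inj: "inj_on ?k A" using less.prems(4) rp unfolding inj_on_def by metis
    have "(\<Sum>k\<in>?k ` A. l ^ k * C (the_inv_into A ?k k)) = 0" if "l \<noteq> 0" for l
    proof -
      let ?c = "\<lambda>x. if x = ({1..int n}, d) then l else 0"
      have "Fam d n (Wtop d n) ?c" by (rule Fam.base[OF that])
      then have "(\<Sum>i\<in>A. C i * evl n ?c (f i)) = 0" using less.prems(6) True by blast
      moreover have "evl n ?c (f i) = l ^ ?k i" if "i \<in> A" for i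
        by (subst rp[OF that]) (simp add: evl_replicate dec_Wtop)
      moreover have "(\<Sum>k\<in>?k ` A. l ^ k * C (the_inv_into A ?k k)) = (\<Sum>i\<in>A. C i * l ^ ?k i)"
        by (subst sum.reindex[OF inj]) (auto intro!: sum.cong simp: the_inv_into_f_f[OF inj])
      ultimately show ?thesis by simp
    qed
    then have "C (the_inv_into A ?k (?k i)) = 0" if "i \<in> A" for i
      using power_sum_zero_imp_coeff_zero[of "?k ` A" "\<lambda>k. C (the_inv_into A ?k k)" "?k i"] less.prems(3) that by blast
    then show ?thesis using the_inv_into_f_f[OF inj] by simp
  next
    case False
    then obtain j where j: "j \<le> n" "stp d n (dcr j W)"
      using exists_canlow[OF less.prems(1) stp_Wtop stp_ge[OF less.prems(1)]] by blast
    let ?V = "dcr j W"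
    have up: "?V(j := ?V j + 1) = W" by (rule dcr_upd)
    show ?thesis
    proof (rule ccontr)
      assume "\<not> (\<forall>i\<in>A. C i = 0)"
      then have ne: "{i \<in> A. C i \<noteq> 0} \<noteq> {}" by auto
      \<comment> \<open>The lowest exponent with a nonzero coefficient; the degenerate relation then
        contains a nonzero coefficient, against the induction hypothesis.\<close>
      define e0 where "e0 = Min ((\<lambda>i. vexl n j W (f i)) ` {i \<in> A. C i \<noteq> 0})"
      have fin: "finite {i \<in> A. C i \<noteq> 0}" using less.prems(3) by simp
      have le: "e0 \<le> vexl n j W (f i)" if "i \<in> A" "C i \<noteq> 0" for i
        unfolding e0_def using fin that by (intro Min_le) auto
      have "e0 \<in> (\<lambda>i. vexl n j W (f i)) ` {i \<in> A. C i \<noteq> 0}" unfolding e0_def using fin ne by (intro Min_in) auto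
      then obtain i0 where i0: "i0 \<in> A" "C i0 \<noteq> 0" "vexl n j W (f i0) = e0" by auto
      let ?A = "{i \<in> A. vexl n j W (f i) = e0}"
      have "\<forall>i\<in>?A. C i * vsgl n j W (f i) = 0"
      proof (rule less.hyps[of ?V ?A "\<lambda>i. mred ?V (f i)"])
        show "nat (\<Sum>i\<le>n. ?V i + int d) < nat (\<Sum>i\<le>n. W i + int d)" by (rule sum_dcr_less[OF j less.prems(1)])
        show "inj_on (\<lambda>i. mred ?V (f i)) ?A"
        proof (rule inj_onI)
          fix a b assume ab: "a \<in> ?A" "b \<in> ?A" "mred ?V (f a) = mred ?V (f b)"
          have "f a = f b"
            by (rule mred_inj[of "f a" d n "f b" ?V j]) (use ab less.prems(5) in \<open>auto simp: up\<close>)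
          then show "a = b" using less.prems(4) ab by (auto dest: inj_onD)
        qed
        fix i assume "i \<in> ?A"
        then show "set (mred ?V (f i)) \<subseteq> FD d n \<and> dstd (mred ?V (f i)) \<and> below ?V (mred ?V (f i))"
          using less.prems(5) FD_mred j below_mred dstd_mred by blast
      next
        fix c assume "Fam d n ?V c"
        then show "(\<Sum>i\<in>?A. C i * vsgl n j W (f i) * evl n c (mred ?V (f i))) = 0"
          using relation_leading[of d n ?V j A f C e0 c, unfolded up] j less.prems le by blast
      qed (use j less.prems in auto)
      then show False using i0 vsgl_nonzero by auto
    qed
  qed
qed

text \<open>The possibly nonstandard \<open>m\<close> enters as index \<open>None\<close> with
  coefficient -1. If a standard term had a smaller exponent, the lowest part would be a relation
  among standard monomials alone, which independence forbids.\<close>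

lemma standard_relation_leading:
  assumes W: "stp d n W" "stp d n (W(j := W j + 1))" and j: "j \<le> n" and n: "1 \<le> n"
  defines "W' \<equiv> W(j := W j + 1)"
  assumes A: "finite A" "inj_on f A" "\<And>i. i \<in> A \<Longrightarrow> set (f i) \<subseteq> FD d n \<and> dstd (f i) \<and> below W' (f i)"
    and m: "set m \<subseteq> FD d n" "below W' m"
    and rel: "\<And>c. Fam d n W' c \<Longrightarrow> evl n c m = (\<Sum>i\<in>A. C i * evl n c (f i))"
  shows "\<And>i. i \<in> A \<Longrightarrow> C i \<noteq> 0 \<Longrightarrow> vexl n j W' m \<le> vexl n j W' (f i)"
    and "\<And>c. Fam d n W c \<Longrightarrow> evl n c (mred W m) =
      (\<Sum>i\<in>{i\<in>A. vexl n j W' (f i) = vexl n j W' m}. (C i * vsgl n j W' (f i) * vsgl n j W' m) * evl n c (mred W (f i)))"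
proof -
  let ?B = "insert None (Some ` A)"
  let ?g = "\<lambda>b. case b of None \<Rightarrow> m | Some i \<Rightarrow> f i"
  let ?D = "\<lambda>b. case b of None \<Rightarrow> - 1 | Some i \<Rightarrow> C i"
  have g: "set (?g b) \<subseteq> FD d n \<and> below W' (?g b)" if "b \<in> ?B" for b using that A m by (auto split: option.splits)
  have relB: "(\<Sum>b\<in>?B. ?D b * evl n c (?g b)) = 0" if "Fam d n W' c" for c
    using A(1) rel[OF that] by (simp add: sum.reindex)
  have main: "(\<Sum>b\<in>{b\<in>?B. vexl n j W' (?g b) = e0}. ?D b * vsgl n j W' (?g b) * evl n c (mred W (?g b))) = 0"
    if "\<And>b. b \<in> ?B \<Longrightarrow> ?D b \<noteq> 0 \<Longrightarrow> e0 \<le> vexl n j W' (?g b)" "Fam d n W c" for e0 c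
    using relation_leading[OF W j n, folded W'_def, of ?B ?g ?D e0 c] A(1) g relB that by blast
  show le: "vexl n j W' m \<le> vexl n j W' (f i)" if "i \<in> A" "C i \<noteq> 0" for i
  proof (rule ccontr)
    assume lt: "\<not> vexl n j W' m \<le> vexl n j W' (f i)"
    define e0 where "e0 = Min ((\<lambda>i. vexl n j W' (f i)) ` {i \<in> A. C i \<noteq> 0})"
    have fin: "finite {i \<in> A. C i \<noteq> 0}" using A by simp
    have le: "e0 \<le> vexl n j W' (f i)" if "i \<in> A" "C i \<noteq> 0" for i
      unfolding e0_def using fin that by (intro Min_le) auto
    have "e0 \<in> (\<lambda>i. vexl n j W' (f i)) ` {i \<in> A. C i \<noteq> 0}" unfolding e0_def using fin that by (intro Min_in) auto
    then obtain i0 where i0: "i0 \<in> A" "C i0 \<noteq> 0" "vexl n j W' (f i0) = e0" by auto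
    have e0m: "e0 < vexl n j W' m" using le[OF that] lt by simp
    let ?A = "{i \<in> A. vexl n j W' (f i) = e0}"
    have set: "{b\<in>?B. vexl n j W' (?g b) = e0} = Some ` ?A" using e0m by auto
    have "\<forall>i\<in>?A. C i * vsgl n j W' (f i) = 0"
    proof (rule independence[OF W(1) n, of ?A "\<lambda>i. mred W (f i)"])
      show "inj_on (\<lambda>i. mred W (f i)) ?A"
      proof (rule inj_onI)
        fix a b assume ab: "a \<in> ?A" "b \<in> ?A" "mred W (f a) = mred W (f b)"
        have "f a = f b"
          by (rule mred_inj[of "f a" d n "f b" W j]) (use ab A(3) in \<open>auto simp: W'_def[symmetric]\<close>)
        then show "a = b" using A(2) ab by (auto dest: inj_onD)
      qed
      fix i assume "i \<in> ?A"
      then show "set (mred W (f i)) \<subseteq> FD d n \<and> dstd (mred W (f i)) \<and> below W (mred W (f i))"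
        using A(3) FD_mred W below_mred dstd_mred by blast
    next
      fix c assume c: "Fam d n W c"
      have p: "e0 \<le> vexl n j W' (?g b)" if "b \<in> ?B" "?D b \<noteq> 0" for b
        using that le e0m by (cases b) (auto simp: less_imp_le)
      have "(\<Sum>b\<in>Some ` ?A. ?D b * vsgl n j W' (?g b) * evl n c (mred W (?g b))) = 0"
        using main[OF p c] unfolding set .
      then show "(\<Sum>i\<in>?A. C i * vsgl n j W' (f i) * evl n c (mred W (f i))) = 0"
        by (simp add: sum.reindex)
    qed (use A in auto)
    then show False using i0 vsgl_nonzero by auto
  qed
  show "evl n c (mred W m) =
      (\<Sum>i\<in>{i\<in>A. vexl n j W' (f i) = vexl n j W' m}. (C i * vsgl n j W' (f i) * vsgl n j W' m) * evl n c (mred W (f i)))"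
    if c: "Fam d n W c" for c
  proof -
    let ?A = "{i\<in>A. vexl n j W' (f i) = vexl n j W' m}"
    have set: "{b\<in>?B. vexl n j W' (?g b) = vexl n j W' m} = insert None (Some ` ?A)" by auto
    have p: "vexl n j W' m \<le> vexl n j W' (?g b)" if "b \<in> ?B" "?D b \<noteq> 0" for b
      using that le by (cases b) auto
    have "(\<Sum>b\<in>insert None (Some ` ?A). ?D b * vsgl n j W' (?g b) * evl n c (mred W (?g b))) = 0"
      using main[OF p c] unfolding set .
    then have "(\<Sum>i\<in>?A. C i * vsgl n j W' (f i) * evl n c (mred W (f i))) = vsgl n j W' m * evl n c (mred W m)"
      using A(1) by (simp add: sum.reindex)
    then have "vsgl n j W' m * (\<Sum>i\<in>?A. C i * vsgl n j W' (f i) * evl n c (mred W (f i))) = evl n c (mred W m)"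
      using vsgl_sq[of n j W' m] by (metis mult.assoc mult_1)
    then show ?thesis by (simp add: sum_distrib_left algebra_simps)
  qed
qed

section \<open>Which standard monomials occur in an expansion, and the coefficient of a
  shuffle\<close>

lemma dstd_Cons_le: "dstd ((U, V) # ps) \<Longrightarrow> X \<in> set (fl ps) \<Longrightarrow> X \<le> V"
  by (auto simp: dstd_def)

lemma fst_in_fl: "p \<in> set ps \<Longrightarrow> fst p \<in> set (fl ps)"
  by (induction ps) (auto simp: fl_def)

lemma evl_not_below:
  assumes h: "Fam d n Z c" and n: "1 \<le> n" and ps: "set ps \<subseteq> FD d n" "\<not> below Z ps"
  shows "evl n c ps = 0"
proof -
  obtain q where q: "q \<in> set ps" "\<not> fst q \<le> Z" using ps(2) unfolding below_def by blast
  have "c (dec n (fst q) (snd q)) = 0"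
    using supported_0[OF Fam_supported[OF h n], of "fst q" "snd q"] q ps(1) by (auto simp: FD_def)
  then show ?thesis using q unfolding evl_def prod_list_zero_iff by (force simp: case_prod_beta)
qed

text \<open>Evaluate on members with bound \<open>Z\<close>. A factor of \<open>m\<close> not below
  \<open>Z\<close> makes \<open>m\<close> vanish there, and what remains is a relation among the
  standard monomials below \<open>Z\<close>, with a nonzero coefficient.\<close>

lemma first_entry:
  assumes n: "1 \<le> n" and A: "finite A" "inj_on f A" "\<And>i. i \<in> A \<Longrightarrow> set (f i) \<subseteq> FD d n \<and> dstd (f i)"
    and m: "set m \<subseteq> FD d n"
    and rel: "\<And>W c. Fam d n W c \<Longrightarrow> evl n c m = (\<Sum>i\<in>A. C i * evl n c (f i))"
    and i: "i \<in> A" "C i \<noteq> 0" "f i = (Z, V) # rest" and p: "p \<in> set m"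
  shows "fst p \<le> Z"
proof (rule ccontr)
  assume np: "\<not> fst p \<le> Z"
  have Z: "stp d n Z" "V \<le> Z" using A(3)[OF i(1)] i(3) by (auto simp: FD_def paired_def)
  have bel: "below Z (f i)" unfolding below_def i(3)
    using dstd_Cons_le[of Z V rest] A(3)[OF i(1)] i(3) fst_in_fl[of _ rest] Z by (auto intro: order_trans)
  note zero = evl_not_below[OF _ n]
  let ?A = "{i \<in> A. below Z (f i)}"
  have "\<forall>i\<in>?A. C i = 0"
  proof (rule independence[OF Z(1) n, of ?A f])
    show "inj_on f ?A" using A(2) by (rule inj_on_subset) auto
    fix c assume c: "Fam d n Z c"
    have "evl n c m = 0" using zero[OF c m] np p by (auto simp: below_def)
    then have "(\<Sum>i\<in>A. C i * evl n c (f i)) = 0" using rel[OF c] by simp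
    moreover have "(\<Sum>i\<in>A. C i * evl n c (f i)) = (\<Sum>i\<in>?A. C i * evl n c (f i))"
      using A(1,3) zero[OF c] by (intro sum.mono_neutral_right) auto
    ultimately show "(\<Sum>i\<in>?A. C i * evl n c (f i)) = 0" by simp
  qed (use A in auto)
  then show False using i bel by auto
qed

text \<open>The bound is lowered from the common first entry \<open>W\<close> to \<open>V\<close>,
  at interior places because the two agree at the ends. At each such place only the first function
  of the standard monomial touches the bound, so its exponent is 1. Hence \<open>m\<close> has
  exponent at most 1, which \<open>W\<close> already uses up; the other functions of
  \<open>m\<close> do not touch and pass unchanged to the lower bound. Finally \<open>W\<close> is
  \<open>V\<close>.\<close>

lemma second_entry:
  assumes "stp d n W" "V \<le> W" "V 0 = W 0" "V n = W n" "1 \<le> n"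
    and "finite A" "inj_on f A" "\<And>i. i \<in> A \<Longrightarrow> set (f i) \<subseteq> FD d n \<and> dstd (f i) \<and> below W (f i)"
    and "set [(W, Y), (X2, Y2)] \<subseteq> FD d n" "X2 \<le> W"
    and "\<And>c. Fam d n W c \<Longrightarrow> evl n c [(W, Y), (X2, Y2)] = (\<Sum>i\<in>A. C i * evl n c (f i))"
    and "i0 \<in> A" "C i0 \<noteq> 0" "f i0 = (W, V) # rest"
  shows "Y \<le> V \<and> X2 \<le> V"
  using assms
proof (induction "nat (\<Sum>i\<le>n. W i + int d)" arbitrary: W Y X2 Y2 A f C i0 rest rule: less_induct)
  case less
  have V: "stp d n V" using less.prems(8)[OF less.prems(12)] less.prems(14) by (auto simp: FD_def paired_def)
  show ?case
  proof (cases "V = W")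
    case True
    then show ?thesis using less.prems(9,10) by (auto simp: FD_def)
  next
    case False
    then obtain j where j: "j \<le> n" "V j < W j" "stp d n (dcr j W)" "V \<le> dcr j W"
      using exists_canlow[OF less.prems(1) V less.prems(2)] by blast
    have jint: "j \<noteq> 0" "j \<noteq> n" using j(2) less.prems(3,4) by (metis less_irrefl)+
    let ?W = "dcr j W"
    let ?m = "[(W, Y), (X2, Y2)]"
    have up: "?W(j := ?W j + 1) = W" by (rule dcr_upd)
    have Y2: "Y2 \<le> X2" "Y \<le> W" using less.prems(9) by (auto simp: FD_def)
    have bm: "below W ?m" using less.prems(10) by (auto simp: below_def)
    note SR = standard_relation_leading[OF j(3) _ j(1) less.prems(5), unfolded up, OF less.prems(1,6,7,8) _ bm less.prems(11)]
    have SR1: "vexl n j W ?m \<le> vexl n j W (f i)" if "i \<in> A" "C i \<noteq> 0" for i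
      using SR(1)[OF _ less.prems(9)] that by blast
    have SR2: "evl n c (mred ?W ?m) =
      (\<Sum>i\<in>{i\<in>A. vexl n j W (f i) = vexl n j W ?m}. (C i * vsgl n j W (f i) * vsgl n j W ?m) * evl n c (mred ?W (f i)))"
      if "Fam d n ?W c" for c using SR(2)[OF _ less.prems(9) _ that] by blast
    have "vex n j W p = 0" if "p \<in> set rest" for p
    proof -
      have "set rest \<subseteq> FD d n" "dstd (f i0)" using less.prems(8)[OF less.prems(12)] less.prems(14) by auto
      then have "fst p \<le> V" "snd p \<le> fst p" using dstd_Cons_le[of W V rest] fst_in_fl[OF that] less.prems(14) that by (auto simp: FD_def)
      then have "fst p j < W j" "snd p j < W j" using le_funD[of "fst p" V j] le_funD[of "snd p" "fst p" j] j(2) by auto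
      then show ?thesis by (simp add: vex_def)
    qed
    then have r0: "vexl n j W rest = 0" unfolding vexl_def by (induction rest) auto
    have v0: "vexl n j W (f i0) = 1" using r0 j(2) jint by (simp add: less.prems(14) vexl_def vex_def)
    have vm: "vexl n j W ?m \<le> 1" using SR1[OF less.prems(12,13)] v0 by simp
    have nY: "Y j \<noteq> W j" "X2 j \<noteq> W j" "vexl n j W ?m = 1" using vm jint by (auto simp: vexl_def vex_def split: if_splits)
    have Yl: "Y \<le> ?W" "X2 \<le> ?W"
      using below_le[of _ ?W j, unfolded up] Y2 less.prems(10) nY by (auto simp: dcr_def)
    have mW: "meetf ?W W = ?W" using meetf_top[of W ?W j, unfolded up] by (simp add: dcr_def)
    have mm: "mred ?W ?m = [(?W, Y), (X2, Y2)]"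
      using Yl Y2 by (simp add: mW meetf_id order_trans[OF Y2(1) Yl(2)])
    have rl: "mred ?W rest = rest"
    proof -
      have "meetf ?W (fst p) = fst p \<and> meetf ?W (snd p) = snd p" if "p \<in> set rest" for p
      proof -
        have "set rest \<subseteq> FD d n" "dstd (f i0)" using less.prems(8)[OF less.prems(12)] less.prems(14) by auto
        then have "fst p \<le> V" "snd p \<le> fst p" using dstd_Cons_le[of W V rest] fst_in_fl[OF that] less.prems(14) that by (auto simp: FD_def)
        then show ?thesis using j(4) by (meson meetf_id order_trans)
      qed
      then show ?thesis unfolding mred_def by (intro map_idI) (auto simp: case_prod_beta)
    qed
    let ?A = "{i\<in>A. vexl n j W (f i) = vexl n j W ?m}"
    show ?thesis
    proof (rule less.hyps[of ?W ?A "\<lambda>i. mred ?W (f i)" Y X2 Y2 "\<lambda>i. C i * vsgl n j W (f i) * vsgl n j W ?m" i0 rest])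
      show "nat (\<Sum>i\<le>n. ?W i + int d) < nat (\<Sum>i\<le>n. W i + int d)" by (rule sum_dcr_less[OF j(1,3) less.prems(1)])
      show "V 0 = ?W 0" "V n = ?W n" using less.prems(3,4) jint by (auto simp: dcr_def)
      show "inj_on (\<lambda>i. mred ?W (f i)) ?A"
      proof (rule inj_onI)
        fix a b assume ab: "a \<in> ?A" "b \<in> ?A" "mred ?W (f a) = mred ?W (f b)"
        have "f a = f b"
          by (rule mred_inj[of "f a" d n "f b" ?W j]) (use ab less.prems(8) in \<open>auto simp: up\<close>)
        then show "a = b" using less.prems(7) ab by (auto dest: inj_onD)
      qed
      show "set (mred ?W (f i)) \<subseteq> FD d n \<and> dstd (mred ?W (f i)) \<and> below ?W (mred ?W (f i))" if "i \<in> ?A" for i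
        using that less.prems(8) FD_mred j(3) below_mred dstd_mred by blast
      show "set [(?W, Y), (X2, Y2)] \<subseteq> FD d n" using FD_mred[OF less.prems(9) j(3)] unfolding mm .
      show "evl n c [(?W, Y), (X2, Y2)] = (\<Sum>i\<in>?A. (C i * vsgl n j W (f i) * vsgl n j W ?m) * evl n c (mred ?W (f i)))"
        if "Fam d n ?W c" for c using SR2[OF that] unfolding mm .
      show "mred ?W (f i0) = (?W, V) # rest" by (simp add: less.prems(14) mW meetf_id[OF j(4)] rl)
      show "C i0 * vsgl n j W (f i0) * vsgl n j W ?m \<noteq> 0" using less.prems(13) vsgl_nonzero by simp
      show "i0 \<in> ?A" using less.prems(12) v0 nY by simp
    qed (use j less.prems Yl in auto)
  qed
qed

text \<open>Exponents depend only on the multiset of functions, so a shuffle of \<open>m\<close>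
  keeps the exponent of \<open>m\<close> and remains a shuffle under meets. Under the smallest bound
  the two coincide and the coefficient is 1; each degeneration changes it by signs only.\<close>

lemma shuffle_coefficient:
  assumes "stp d n W" "1 \<le> n"
    and "finite A" "inj_on f A" "\<And>i. i \<in> A \<Longrightarrow> set (f i) \<subseteq> FD d n \<and> dstd (f i) \<and> below W (f i)"
    and "set m \<subseteq> FD d n" "below W m"
    and "\<And>c. Fam d n W c \<Longrightarrow> evl n c m = (\<Sum>i\<in>A. C i * evl n c (f i))"
    and "i0 \<in> A" "mset (fl m) = mset (fl (f i0))"
  shows "C i0 = 1 \<or> C i0 = -1"
  using assms
proof (induction "nat (\<Sum>i\<le>n. W i + int d)" arbitrary: W A f C m i0 rule: less_induct)
  case less
  show ?case
  proof (cases "W = Wtop d n")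
    case True
    have "length m = length (f i0)" using less.prems(10) by (metis length_fl mult_cancel1 size_mset zero_neq_numeral)
    then have mf: "m = f i0"
      using below_Wtop[OF less.prems(6)] below_Wtop[of "f i0" d n] less.prems(5)[OF less.prems(9)] less.prems(7) True by metis
    \<comment> \<open>Subtracting the trivial expansion of \<open>m\<close> as \<open>f i0\<close>
      leaves a relation among standard monomials.\<close>
    have "\<forall>i\<in>A. C i - (if i = i0 then 1 else 0) = 0"
    proof (rule independence[OF less.prems(1-5)])
      fix c assume "Fam d n W c"
      then have "evl n c m = (\<Sum>i\<in>A. C i * evl n c (f i))" by (rule less.prems(8))
      moreover have "(\<Sum>i\<in>A. (if i = i0 then 1 else 0) * evl n c (f i)) = evl n c m"
        using less.prems(3,9) mf by (simp add: if_distrib[of "\<lambda>x. x * _"] cong: if_cong)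
      ultimately show "(\<Sum>i\<in>A. (C i - (if i = i0 then 1 else 0)) * evl n c (f i)) = 0"
        by (simp add: left_diff_distrib sum_subtractf)
    qed
    then show ?thesis using less.prems(9) by force
  next
    case False
    then obtain j where j: "j \<le> n" "stp d n (dcr j W)"
      using exists_canlow[OF less.prems(1) stp_Wtop stp_ge[OF less.prems(1)]] by blast
    let ?W = "dcr j W"
    have up: "?W(j := ?W j + 1) = W" by (rule dcr_upd)
    have SR2: "evl n c (mred ?W m) =
      (\<Sum>i\<in>{i\<in>A. vexl n j W (f i) = vexl n j W m}. (C i * vsgl n j W (f i) * vsgl n j W m) * evl n c (mred ?W (f i)))"
      if "Fam d n ?W c" for c
      using standard_relation_leading(2)[OF j(2) _ j(1) less.prems(2), unfolded up, OF less.prems(1,3,4,5,6,7,8)] that by blast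
    have "length (filter (\<lambda>U. U j = W j) (fl m)) = length (filter (\<lambda>U. U j = W j) (fl (f i0)))"
      using less.prems(10) by (metis mset_filter size_mset)
    then have ve: "vexl n j W (f i0) = vexl n j W m"
      using vexl_count[OF less.prems(6), of j W] vexl_count[of "f i0" d n j W] less.prems(5)[OF less.prems(9)] by (auto split: if_splits)
    let ?A = "{i\<in>A. vexl n j W (f i) = vexl n j W m}"
    let ?C = "\<lambda>i. C i * vsgl n j W (f i) * vsgl n j W m"
    have "?C i0 = 1 \<or> ?C i0 = -1"
    proof (rule less.hyps[of ?W ?A "\<lambda>i. mred ?W (f i)" "mred ?W m"])
      show "nat (\<Sum>i\<le>n. ?W i + int d) < nat (\<Sum>i\<le>n. W i + int d)" by (rule sum_dcr_less[OF j less.prems(1)])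
      show "inj_on (\<lambda>i. mred ?W (f i)) ?A"
      proof (rule inj_onI)
        fix a b assume ab: "a \<in> ?A" "b \<in> ?A" "mred ?W (f a) = mred ?W (f b)"
        have "f a = f b"
          by (rule mred_inj[of "f a" d n "f b" ?W j]) (use ab less.prems(5) in \<open>auto simp: up\<close>)
        then show "a = b" using less.prems(4) ab by (auto dest: inj_onD)
      qed
      show "set (mred ?W (f i)) \<subseteq> FD d n \<and> dstd (mred ?W (f i)) \<and> below ?W (mred ?W (f i))" if "i \<in> ?A" for i
        using that less.prems(5) FD_mred j(2) below_mred dstd_mred by blast
      show "mset (fl (mred ?W m)) = mset (fl (mred ?W (f i0)))"
        using less.prems(10) by (simp add: fl_mred)
      show "i0 \<in> ?A" using less.prems(9) ve by simp
      show "set (mred ?W m) \<subseteq> FD d n" by (rule FD_mred[OF less.prems(6) j(2)])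
      show "below ?W (mred ?W m)" by (rule below_mred)
    qed (use j less.prems SR2 in auto)
    then show ?thesis using vsgl_cases[of n j W "f i0"] vsgl_cases[of n j W m]
      by (elim disjE) (auto simp: minus_equation_iff[of "C i0"])
  qed
qed

subsection \<open>The family consists of Lagrangian maps\<close>

text \<open>The matrix may vary with the point. A nonzero coordinate makes its rows independent, so
  that they span a Lagrangian subspace.\<close>

definition lag_at :: "nat \<Rightarrow> nat \<Rightarrow> (lv \<Rightarrow> complex) \<Rightarrow> complex \<Rightarrow> complex \<Rightarrow> bool" where
  "lag_at d n c s t \<longleftrightarrow> (\<exists>M. isotropic n M \<and> (\<forall>\<gamma>\<in>nsub n. pform d c \<gamma> s t = plucker n M \<gamma>))
     \<and> (\<exists>\<gamma>\<in>nsub n. pform d c \<gamma> s t \<noteq> 0)"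

definition col_op :: "int \<Rightarrow> int \<Rightarrow> complex \<Rightarrow> (nat \<Rightarrow> int \<Rightarrow> complex) \<Rightarrow> nat \<Rightarrow> int \<Rightarrow> complex" where
  "col_op k l w M = (\<lambda>i x. if x = l then M i l + w * M i k else M i x)"

lemma pform_col_add:
  "pform d (col_add k l w c) \<gamma> s t = pform d c \<gamma> s t
     + (if l \<in> \<gamma> \<and> k \<notin> \<gamma> then w * pform d c (insert k (\<gamma> - {l})) s t else 0)"
proof (cases "l \<in> \<gamma> \<and> k \<notin> \<gamma>")
  case True
  then show ?thesis by (simp add: pform_def col_add_def sum.distrib sum_distrib_left algebra_simps)
next
  case False
  then have "col_add k l w c (\<gamma>, a) = c (\<gamma>, a)" for a by (auto simp: col_add_def)
  then show ?thesis using False by (auto simp: pform_def)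
qed

text \<open>Shifting the level by one multiplies a form by t / s. The vanishing assumptions remove
  the coefficients that the shift would carry across the ends of the range 0..d.\<close>

lemma pform_loop_add:
  assumes s: "s \<noteq> 0" and c0: "\<And>\<gamma>. c (\<gamma>, 0) = 0" and cd: "\<And>\<gamma>. c (\<gamma>, Suc d) = 0"
  shows "pform d (loop_add n z c) \<gamma> s t = pform d c \<gamma> s t
     + (if int n \<in> \<gamma> \<and> - int n \<notin> \<gamma> then (-1) ^ (n - 1) * (z * t / s) * pform d c (insert (- int n) (\<gamma> - {int n})) s t else 0)"
proof -
  let ?g = "insert (- int n) (\<gamma> - {int n})"
  have e: "(\<Sum>a\<le>d. c (?g, Suc a) * s ^ a * t ^ (d - a)) = t / s * pform d c ?g s t"
  proof -
    have "(\<Sum>a\<le>d. c (?g, Suc a) * s ^ Suc a * t ^ (Suc d - Suc a)) = (\<Sum>a\<le>Suc d. c (?g, a) * s ^ a * t ^ (Suc d - a))"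
      by (subst sum.atMost_Suc_shift) (simp add: c0)
    also have "\<dots> = (\<Sum>a\<le>d. c (?g, a) * s ^ a * t ^ (Suc d - a))" by (simp add: cd)
    also have "\<dots> = t * pform d c ?g s t"
      unfolding pform_def sum_distrib_left by (intro sum.cong refl) (auto simp: Suc_diff_le algebra_simps)
    finally have "s * (\<Sum>a\<le>d. c (?g, Suc a) * s ^ a * t ^ (d - a)) = t * pform d c ?g s t"
      by (simp add: sum_distrib_left algebra_simps)
    then show ?thesis using s by (simp add: field_simps)
  qed
  have "pform d (loop_add n z c) \<gamma> s t = pform d c \<gamma> s t
     + (if int n \<in> \<gamma> \<and> - int n \<notin> \<gamma> then (-1) ^ (n - 1) * z * (\<Sum>a\<le>d. c (?g, Suc a) * s ^ a * t ^ (d - a)) else 0)"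
  proof (cases "int n \<in> \<gamma> \<and> - int n \<notin> \<gamma>")
    case True
    then show ?thesis by (simp add: pform_def loop_add_def sum.distrib sum_distrib_left algebra_simps)
  next
    case False
    then have "loop_add n z c (\<gamma>, a) = c (\<gamma>, a)" for a by (auto simp: loop_add_def)
    then show ?thesis using False by (auto simp: pform_def)
  qed
  then show ?thesis unfolding e by simp
qed

text \<open>The operation is unipotent: a coordinate changes by a multiple of one that is itself
  left fixed. If all new coordinates are 0, so are the old ones.\<close>

lemma nonzero_transfer:
  fixes p p' :: "int set \<Rightarrow> complex"
  assumes "\<And>\<gamma>. \<gamma> \<in> nsub n \<Longrightarrow> p' \<gamma> = p \<gamma> + (if l \<in> \<gamma> \<and> k \<notin> \<gamma> then w * p (insert k (\<gamma> - {l})) else 0)"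
    and "k \<noteq> l" "k \<in> angle n" "l \<in> angle n" "\<exists>\<gamma>\<in>nsub n. p \<gamma> \<noteq> 0"
  shows "\<exists>\<gamma>\<in>nsub n. p' \<gamma> \<noteq> 0"
proof (rule ccontr)
  assume "\<not> ?thesis"
  then have z: "p' \<gamma> = 0" if "\<gamma> \<in> nsub n" for \<gamma> using that by auto
  have 1: "p \<gamma> = 0" if "\<gamma> \<in> nsub n" "\<not> (l \<in> \<gamma> \<and> k \<notin> \<gamma>)" for \<gamma>
    using assms(1)[OF that(1)] z[OF that(1)] that(2) by simp
  have "p \<gamma> = 0" if "\<gamma> \<in> nsub n" for \<gamma>
  proof (cases "l \<in> \<gamma> \<and> k \<notin> \<gamma>")
    case True
    then have "insert k (\<gamma> - {l}) \<in> nsub n" using nsub_replace[of l \<gamma> k n] assms(3,4) that by auto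
    then have "p (insert k (\<gamma> - {l})) = 0" using 1 assms(2) by auto
    then show ?thesis using assms(1)[OF that] z[OF that] True by simp
  qed (use 1 that in auto)
  then show False using assms(5) by blast
qed

text \<open>Symplectic transvections: adding a multiple of the partner column changes the half
  pairing of two rows by a term symmetric in them.\<close>

lemma isotropic_long:
  assumes "isotropic n M" "i0 \<in> {1..n}"
  shows "isotropic n (col_op (int i0) (- int i0) w M)" "isotropic n (col_op (- int i0) (int i0) w M)"
proof -
  have split: "(\<Sum>i\<in>{1..n}. F i) = F i0 + (\<Sum>i\<in>{1..n} - {i0}. F i)" for F :: "nat \<Rightarrow> complex"
    using assms(2) by (intro sum.remove) auto
  note iso = assms(1)[unfolded isotropic_def split]
  show "isotropic n (col_op (int i0) (- int i0) w M)"
    unfolding isotropic_def split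
  proof (intro allI impI)
    fix r r' assume r: "r < n" "r' < n"
    have eq: "(\<Sum>i\<in>{1..n} - {i0}. col_op (int i0) (- int i0) w M a (- int i) * col_op (int i0) (- int i0) w M b (int i)) =
      (\<Sum>i\<in>{1..n} - {i0}. M a (- int i) * M b (int i))" for a b
      using assms(2) by (intro sum.cong) (auto simp: col_op_def)
    have "int i0 \<noteq> - int i0" using assms(2) by auto
    then show "col_op (int i0) (- int i0) w M r (- int i0) * col_op (int i0) (- int i0) w M r' (int i0) +
        (\<Sum>i\<in>{1..n} - {i0}. col_op (int i0) (- int i0) w M r (- int i) * col_op (int i0) (- int i0) w M r' (int i)) =
        col_op (int i0) (- int i0) w M r' (- int i0) * col_op (int i0) (- int i0) w M r (int i0) +
        (\<Sum>i\<in>{1..n} - {i0}. col_op (int i0) (- int i0) w M r' (- int i) * col_op (int i0) (- int i0) w M r (int i))"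
      unfolding eq using iso r by (simp add: col_op_def algebra_simps)
  qed
  show "isotropic n (col_op (- int i0) (int i0) w M)"
    unfolding isotropic_def split
  proof (intro allI impI)
    fix r r' assume r: "r < n" "r' < n"
    have eq: "(\<Sum>i\<in>{1..n} - {i0}. col_op (- int i0) (int i0) w M a (- int i) * col_op (- int i0) (int i0) w M b (int i)) =
      (\<Sum>i\<in>{1..n} - {i0}. M a (- int i) * M b (int i))" for a b
      using assms(2) by (intro sum.cong) (auto simp: col_op_def)
    have "- int i0 \<noteq> int i0" using assms(2) by auto
    then show "col_op (- int i0) (int i0) w M r (- int i0) * col_op (- int i0) (int i0) w M r' (int i0) +
        (\<Sum>i\<in>{1..n} - {i0}. col_op (- int i0) (int i0) w M r (- int i) * col_op (- int i0) (int i0) w M r' (int i)) =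
        col_op (- int i0) (int i0) w M r' (- int i0) * col_op (- int i0) (int i0) w M r (int i0) +
        (\<Sum>i\<in>{1..n} - {i0}. col_op (- int i0) (int i0) w M r' (- int i) * col_op (- int i0) (int i0) w M r (int i))"
      unfolding eq using iso r by (simp add: col_op_def algebra_simps)
  qed
qed

text \<open>The changes of the pairing caused by the two column operations cancel, which dictates
  their opposite coefficients.\<close>

lemma isotropic_short:
  assumes "isotropic n M" "1 \<le> j" "j < n"
  shows "isotropic n (col_op (- int j) (- int (Suc j)) (- z) (col_op (int (Suc j)) (int j) z M))" (is "isotropic n ?M")
proof -
  have split: "(\<Sum>i\<in>{1..n}. F i) = F j + F (Suc j) + (\<Sum>i\<in>{1..n} - {j, Suc j}. F i)" for F :: "nat \<Rightarrow> complex"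
  proof -
    have "(\<Sum>i\<in>{1..n}. F i) = F j + (\<Sum>i\<in>{1..n} - {j}. F i)" using assms by (intro sum.remove) auto
    also have "(\<Sum>i\<in>{1..n} - {j}. F i) = F (Suc j) + (\<Sum>i\<in>{1..n} - {j} - {Suc j}. F i)" using assms by (intro sum.remove) auto
    also have "{1..n} - {j} - {Suc j} = {1..n} - {j, Suc j}" by auto
    finally show ?thesis by (simp add: add.assoc)
  qed
  have "(\<Sum>i\<in>{1..n}. ?M a (- int i) * ?M b (int i)) = (\<Sum>i\<in>{1..n}. M a (- int i) * M b (int i))" for a b
  proof -
    have eq: "(\<Sum>i\<in>{1..n} - {j, Suc j}. ?M a (- int i) * ?M b (int i)) = (\<Sum>i\<in>{1..n} - {j, Suc j}. M a (- int i) * M b (int i))"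
      using assms by (intro sum.cong) (auto simp: col_op_def)
    have f: "?M a (- int j) = M a (- int j)" "?M b (int j) = M b (int j) + z * M b (int (Suc j))"
      "?M a (- int (Suc j)) = M a (- int (Suc j)) - z * M a (- int j)" "?M b (int (Suc j)) = M b (int (Suc j))"
      using assms by (auto simp: col_op_def)
    show ?thesis unfolding split eq f by (simp add: algebra_simps del: of_nat_Suc)
  qed
  then show ?thesis using assms(1) by (simp add: isotropic_def)
qed

lemma lag_at_col_add:
  assumes p: "\<forall>\<gamma>\<in>nsub n. pform d c \<gamma> s t = plucker n M \<gamma>" and kl: "k \<noteq> l" "k \<in> angle n" "l \<in> angle n"
    and adj: "\<And>x. x \<in> angle n \<Longrightarrow> x \<noteq> k \<Longrightarrow> x \<noteq> l \<Longrightarrow> x < k \<longleftrightarrow> x < l"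
  shows "\<forall>\<gamma>\<in>nsub n. pform d (col_add k l w c) \<gamma> s t = plucker n (col_op k l w M) \<gamma>"
proof
  fix \<gamma> assume g: "\<gamma> \<in> nsub n"
  have "insert k (\<gamma> - {l}) \<in> nsub n" if "l \<in> \<gamma>" "k \<notin> \<gamma>" using nsub_replace[OF that kl(2,3)] g by simp
  then show "pform d (col_add k l w c) \<gamma> s t = plucker n (col_op k l w M) \<gamma>"
    unfolding pform_col_add col_op_def using plucker_column_op_adjacent[OF g kl(1), of M w] adj p g by auto
qed

lemma nonzero_col_add:
  assumes "\<exists>\<gamma>\<in>nsub n. pform d c \<gamma> s t \<noteq> 0" "k \<noteq> l" "k \<in> angle n" "l \<in> angle n"
  shows "\<exists>\<gamma>\<in>nsub n. pform d (col_add k l w c) \<gamma> s t \<noteq> 0"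
  by (rule nonzero_transfer[where p = "\<lambda>\<gamma>. pform d c \<gamma> s t" and k = k and l = l and w = w])
    (use assms pform_col_add in auto)

lemma plucker_diagonal:
  fixes g :: "nat \<Rightarrow> complex"
  assumes "\<gamma> \<in> nsub n"
  shows "plucker n (\<lambda>i x. if x = int (Suc i) then g i else 0) \<gamma> = (if \<gamma> = {1..int n} then \<Prod>i<n. g i else 0)"
proof (cases "\<gamma> = {1..int n}")
  case True
  have s: "sorted_list_of_set \<gamma> = map (\<lambda>i. int (Suc i)) [0..<n]"
  proof -
    have "sorted (map (\<lambda>i. int (Suc i)) [0..<n])" "distinct (map (\<lambda>i. int (Suc i)) [0..<n])"
      by (auto simp: sorted_iff_nth_mono distinct_map inj_on_def)
    moreover have "set (map (\<lambda>i. int (Suc i)) [0..<n]) = \<gamma>"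
    proof (rule Set.set_eqI)
      fix x show "x \<in> set (map (\<lambda>i. int (Suc i)) [0..<n]) \<longleftrightarrow> x \<in> \<gamma>"
        unfolding True by (auto intro!: image_eqI[of _ _ "nat (x - 1)"])
    qed
    ultimately show ?thesis by (metis sorted_list_of_set.idem_if_sorted_distinct)
  qed
  let ?A = "mat n n (\<lambda>(i, j). if i = j then g i else 0)"
  have "plucker n (\<lambda>i x. if x = int (Suc i) then g i else 0) \<gamma> = det ?A"
    unfolding plucker_eq_minor minor_def cdet_def s
    by (intro arg_cong[of _ _ det] eq_matI) auto
  also have "\<dots> = prod_list (diag_mat ?A)" by (rule det_upper_triangular[of _ n]) auto
  also have "\<dots> = (\<Prod>i<n. g i)" by (simp add: diag_mat_def prod.list_conv_set_nth lessThan_atLeast0)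
  finally show ?thesis using True by simp
next
  case False
  have f: "finite \<gamma>" by (rule nsub_finite[OF assms])
  have "\<not> \<gamma> \<subseteq> {1..int n}"
  proof
    assume a: "\<gamma> \<subseteq> {1..int n}"
    have "card \<gamma> = card {1..int n}" using assms by (simp add: nsub_def)
    then show False using card_subset_eq[OF _ a] False by auto
  qed
  then obtain x where x: "x \<in> \<gamma>" "x \<notin> {1..int n}" by blast
  note xs = nsub_sorted[OF assms]
  obtain p where p: "p < n" "sorted_list_of_set \<gamma> ! p = x" using x xs by (metis in_set_conv_nth)
  have "(\<Prod>j<n. (if sorted_list_of_set \<gamma> ! j = int (Suc (q j)) then g (q j) else 0)) = 0" if "q permutes {0..<n}" for q
    by (rule prod_zero) (use p x permutes_lt[OF that p(1)] in \<open>auto intro!: bexI[of _ p]\<close>)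
  then have "plucker n (\<lambda>i x. if x = int (Suc i) then g i else 0) \<gamma> = (\<Sum>p | p permutes {0..<n}. 0)"
    unfolding plucker_eq_minor minor_def cdet_sum by (intro sum.cong) (simp_all only: mem_Collect_eq mult_zero_right)
  then show ?thesis using False by simp
qed

text \<open>The affine column operation has coefficient z t / s, so points with s = 0 are excluded
  here and reached by a limit.\<close>

lemma Fam_lag_at:
  assumes "Fam d n W c" "1 \<le> n" "s \<noteq> 0"
  shows "lag_at d n c s t"
  using assms
proof (induction rule: Fam.induct)
  case (base l)
  let ?c = "\<lambda>x. if x = ({1..int n}, d) then l else 0"
  \<comment> \<open>The coordinate subspace is spanned by unit vectors; the scalar
    \<open>l * s ^ d\<close> is put into one row.\<close>
  let ?g = "\<lambda>i. if i = 0 then l * s ^ d else (1::complex)"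
  have top: "{1..int n} \<in> nsub n" by (auto simp: nsub_def angle_iff)
  have pf: "pform d ?c \<gamma> s t = (if \<gamma> = {1..int n} then l * s ^ d else 0)" for \<gamma>
  proof -
    have "pform d ?c \<gamma> s t = (\<Sum>a\<le>d. if a = d then (if \<gamma> = {1..int n} then l * s ^ d else 0) else 0)"
      unfolding pform_def by (intro sum.cong) auto
    then show ?thesis by simp
  qed
  have "(\<Prod>i<n. ?g i) = l * s ^ d"
    using base(2) by (subst prod.remove[of _ 0]) auto
  then have "\<forall>\<gamma>\<in>nsub n. pform d ?c \<gamma> s t = plucker n (\<lambda>i x. if x = int (Suc i) then ?g i else 0) \<gamma>"
    using plucker_diagonal[of _ n ?g] pf by auto
  moreover have "isotropic n (\<lambda>i x. if x = int (Suc i) then ?g i else 0)"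
    unfolding isotropic_def by (auto intro!: sum.cong)
  moreover have "\<exists>\<gamma>\<in>nsub n. pform d ?c \<gamma> s t \<noteq> 0" using pf top base by (intro bexI[of _ "{1..int n}"]) auto
  ultimately show ?case unfolding lag_at_def by blast
next
  case (step W c z j)
  have n: "1 \<le> n" and s: "s \<noteq> 0" using step by auto
  obtain M where M: "isotropic n M" "\<forall>\<gamma>\<in>nsub n. pform d c \<gamma> s t = plucker n M \<gamma>" and nz: "\<exists>\<gamma>\<in>nsub n. pform d c \<gamma> s t \<noteq> 0"
    using step.IH[OF n s] unfolding lag_at_def by blast
  consider "1 \<le> j" "j < n" | "j = 0" | "j = n" "j \<noteq> 0" using step(3) by linarith
  then show ?case
  proof cases
    case 1
    have a: "int (Suc j) \<in> angle n" "- int (Suc j) \<in> angle n" "int j \<in> angle n" "- int j \<in> angle n"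
      using 1 by (auto simp: angle_iff)
    have X: "Xop n j z c = col_add (- int j) (- int (Suc j)) (- z) (col_add (int (Suc j)) (int j) z c)"
      using 1 by (simp add: Xop_def)
    have p1: "\<forall>\<gamma>\<in>nsub n. pform d (col_add (int (Suc j)) (int j) z c) \<gamma> s t = plucker n (col_op (int (Suc j)) (int j) z M) \<gamma>"
      by (rule lag_at_col_add[OF M(2) _ a(1,3)]) auto
    have p2: "\<forall>\<gamma>\<in>nsub n. pform d (Xop n j z c) \<gamma> s t = plucker n (col_op (- int j) (- int (Suc j)) (- z) (col_op (int (Suc j)) (int j) z M)) \<gamma>"
      unfolding X by (rule lag_at_col_add[OF p1 _ a(4,2)]) auto
    have "\<exists>\<gamma>\<in>nsub n. pform d (Xop n j z c) \<gamma> s t \<noteq> 0"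
      unfolding X by (intro nonzero_col_add nz a) auto
    then show ?thesis unfolding lag_at_def using p2 isotropic_short[OF M(1) 1] by blast
  next
    case 2
    have a: "1 \<in> angle n" "-1 \<in> angle n" using n by (auto simp: angle_iff)
    have X: "Xop n j z c = col_add 1 (-1) z c" using 2 by (simp add: Xop_def)
    have p: "\<forall>\<gamma>\<in>nsub n. pform d (col_add 1 (-1) z c) \<gamma> s t = plucker n (col_op 1 (-1) z M) \<gamma>"
      by (rule lag_at_col_add[OF M(2) _ a]) (auto simp: angle_iff)
    have "\<exists>\<gamma>\<in>nsub n. pform d (col_add 1 (-1) z c) \<gamma> s t \<noteq> 0" by (intro nonzero_col_add nz a) auto
    moreover have "isotropic n (col_op 1 (-1) z M)" using isotropic_long(1)[OF M(1), of 1 z] n by simp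
    ultimately show ?thesis unfolding lag_at_def X using p by blast
  next
    case 3
    have X: "Xop n j z c = loop_add n z c" using 3 by (simp add: Xop_def)
    have supp: "supported d n W c" using Fam_supported step(1) n by blast
    \<comment> \<open>The bound is raised at n and still at most 0 afterwards; hence
      \<open>c\<close> has no coefficients of level 0, as the level shift requires.\<close>
    have "W n < 0" using step(4) 3 by (auto simp: stp_def)
    then have c0: "c (\<gamma>, 0) = 0" for \<gamma>
      using supp le_funD[of "hI n (\<gamma>, 0)" W n] unfolding supported_def by (metis hI_end snd_conv neg_0_equal_iff_equal of_nat_0 not_le)
    have cd: "c (\<gamma>, Suc d) = 0" for \<gamma> using supp unfolding supported_def by (force simp: LevPos_def)
    have pl: "pform d (loop_add n z c) \<gamma> s t = pform d c \<gamma> s t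
     + (if int n \<in> \<gamma> \<and> - int n \<notin> \<gamma> then (-1) ^ (n - 1) * (z * t / s) * pform d c (insert (- int n) (\<gamma> - {int n})) s t else 0)" for \<gamma>
      by (rule pform_loop_add[OF s c0 cd])
    have "\<forall>\<gamma>\<in>nsub n. pform d (loop_add n z c) \<gamma> s t = plucker n (col_op (- int n) (int n) (z * t / s) M) \<gamma>"
    proof
      fix \<gamma> assume g: "\<gamma> \<in> nsub n"
      have "insert (- int n) (\<gamma> - {int n}) \<in> nsub n" if "int n \<in> \<gamma>" "- int n \<notin> \<gamma>" using nsub_replace[OF that, of n] g n by simp
      then show "pform d (loop_add n z c) \<gamma> s t = plucker n (col_op (- int n) (int n) (z * t / s) M) \<gamma>"
        unfolding pl col_op_def plucker_column_op_extreme[OF g n] using M(2) g by auto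
    qed
    moreover have "\<exists>\<gamma>\<in>nsub n. pform d (loop_add n z c) \<gamma> s t \<noteq> 0"
      by (rule nonzero_transfer[where p = "\<lambda>\<gamma>. pform d c \<gamma> s t" and k = "- int n" and l = "int n" and w = "(-1) ^ (n - 1) * (z * t / s)"])
        (use nz pl n in \<open>auto simp: angle_iff\<close>)
    moreover have "isotropic n (col_op (- int n) (int n) (z * t / s) M)"
      using isotropic_long(2)[OF M(1), of n "z * t / s"] n by simp
    ultimately show ?thesis unfolding lag_at_def X by blast
  qed
qed

text \<open>By Cramer's rule a Pluecker vector is recovered, polynomially and up to a power of one of
  its coordinates, from the coordinates adjacent to that one; hence being a Pluecker vector
  passes to limits.\<close>

definition sform :: "nat \<Rightarrow> nat \<Rightarrow> (lv \<Rightarrow> complex) \<Rightarrow> int list \<Rightarrow> complex \<Rightarrow> complex \<Rightarrow> complex" where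
  "sform d n c xs s t = (if distinct xs \<and> length xs = n then sortsign xs * pform d c (set xs) s t else 0)"

lemma sform_minor:
  assumes "\<forall>\<gamma>\<in>nsub n. pform d c \<gamma> s t = plucker n M \<gamma>" "length xs = n" "set xs \<subseteq> angle n"
  shows "sform d n c xs s t = minor n M xs"
proof (cases "distinct xs")
  case True
  then have "set xs \<in> nsub n" using assms by (auto simp: nsub_def distinct_card)
  then show ?thesis using True assms minor_sortsign[OF True assms(2)] by (simp add: sform_def)
next
  case False
  then show ?thesis using minor_not_distinct[OF assms(2)] by (simp add: sform_def)
qed

lemma sform_cramer:
  assumes "\<forall>\<gamma>\<in>nsub n. pform d c \<gamma> s t = plucker n M \<gamma>" "length a = n" "set a \<subseteq> angle n" "length cs = n" "set cs \<subseteq> angle n"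
  shows "sform d n c a s t * minor n (\<lambda>i x. sform d n c (a[i := x]) s t) cs = sform d n c a s t ^ n * sform d n c cs s t"
proof -
  have "minor n (\<lambda>i x. sform d n c (a[i := x]) s t) cs = minor n (\<lambda>i x. minor n M (a[i := x])) cs"
  proof (rule minor_cong)
    fix i x assume "i < n" "x \<in> set cs"
    then show "sform d n c (a[i := x]) s t = minor n M (a[i := x])"
      using assms set_update_subset_insert[of a i x] by (intro sform_minor[OF assms(1)]) auto
  qed (use assms in auto)
  then show ?thesis using cramer_minor[OF assms(2,4), of M] sform_minor[OF assms(1,2,3)] sform_minor[OF assms(1,4,5)] by simp
qed

lemma isCont_pform: "isCont (\<lambda>s. pform d c \<gamma> s t) x"
  unfolding pform_def by (intro continuous_intros)

lemma isCont_sform: "isCont (\<lambda>s. sform d n c xs s t) x"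
  unfolding sform_def by (cases "distinct xs \<and> length xs = n") (auto intro!: continuous_intros isCont_pform)

lemma plucker_limit:
  assumes n: "1 \<le> n" and p: "\<And>s. s \<noteq> 0 \<Longrightarrow> \<exists>M. \<forall>\<gamma>\<in>nsub n. pform d c \<gamma> s t = plucker n M \<gamma>"
    and nz: "\<exists>\<gamma>\<in>nsub n. pform d c \<gamma> 0 t \<noteq> 0"
  shows "\<exists>M. \<forall>\<gamma>\<in>nsub n. pform d c \<gamma> 0 t = plucker n M \<gamma>"
proof -
  obtain \<gamma>0 where g0: "\<gamma>0 \<in> nsub n" "pform d c \<gamma>0 0 t \<noteq> 0" using nz by blast
  define a where "a = sorted_list_of_set \<gamma>0"
  have a: "length a = n" "set a \<subseteq> angle n" "distinct a" "set a = \<gamma>0"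
    using nsub_sorted[OF g0(1)] g0(1) by (auto simp: a_def nsub_def)
  let ?q = "sform d n c a 0 t"
  have q: "?q \<noteq> 0" using g0 a sortsign_cases[of a] by (auto simp: sform_def)
  have lim: "?q * minor n (\<lambda>i x. sform d n c (a[i := x]) 0 t) cs = ?q ^ n * sform d n c cs 0 t"
    if cs: "length cs = n" "set cs \<subseteq> angle n" for cs
  proof -
    let ?L = "\<lambda>s. sform d n c a s t * minor n (\<lambda>i x. sform d n c (a[i := x]) s t) cs"
    let ?R = "\<lambda>s. sform d n c a s t ^ n * sform d n c cs s t"
    have "isCont ?L 0" unfolding minor_def cdet_sum by (intro continuous_intros isCont_sform)
    then have L: "(?L \<longlongrightarrow> ?L 0) (at 0)" by (simp add: isCont_def)
    have "isCont ?R 0" by (intro continuous_intros isCont_sform)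
    then have R: "(?R \<longlongrightarrow> ?R 0) (at 0)" by (simp add: isCont_def)
    have "?L s = ?R s" if "s \<noteq> 0" for s
    proof -
      obtain M where "\<forall>\<gamma>\<in>nsub n. pform d c \<gamma> s t = plucker n M \<gamma>" using p[OF \<open>s \<noteq> 0\<close>] by blast
      from sform_cramer[OF this a(1,2) cs] show ?thesis .
    qed
    then have ev: "\<forall>\<^sub>F s in at 0. ?L s = ?R s" unfolding eventually_at_filter by (intro always_eventually) auto
    have "(?R \<longlongrightarrow> ?L 0) (at 0)" using L tendsto_cong[OF ev] by blast
    then show ?thesis using tendsto_unique[OF at_neq_bot _ R] by blast
  qed
  let ?P = "\<lambda>i x. sform d n c (a[i := x]) 0 t"
  \<comment> \<open>The determinant of the neighbouring coordinates is \<open>?q ^ (n - 1)\<close>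
    times the wanted one; dividing a single row compensates.\<close>
  let ?M = "\<lambda>i x. if i = 0 then (1 / ?q ^ (n - 1)) * ?P i x else ?P i x"
  have "pform d c \<gamma> 0 t = plucker n ?M \<gamma>" if g: "\<gamma> \<in> nsub n" for \<gamma>
  proof -
    let ?cs = "sorted_list_of_set \<gamma>"
    have cs: "length ?cs = n" "set ?cs \<subseteq> angle n" "distinct ?cs" "set ?cs = \<gamma>"
      using nsub_sorted[OF g] g by (auto simp: nsub_def)
    have "sorted ?cs" by simp
    then have e: "{(j, k). j < k \<and> k < length ?cs \<and> ?cs ! k < ?cs ! j} = {}"
      by (auto simp: sorted_iff_nth_mono_less not_less[symmetric])
    have "inversions ?cs = 0" unfolding inversions_def e by simp
    then have sf: "sform d n c ?cs 0 t = pform d c \<gamma> 0 t" using cs by (simp add: sform_def sortsign_def)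
    have "?q * plucker n ?P \<gamma> = ?q ^ n * pform d c \<gamma> 0 t"
      using lim[OF cs(1,2)] unfolding sf plucker_eq_minor .
    also have "?q ^ n = ?q * ?q ^ (n - 1)" using n by (cases n) auto
    finally have "plucker n ?P \<gamma> = ?q ^ (n - 1) * pform d c \<gamma> 0 t" using q by simp
    then show ?thesis unfolding plucker_scale_row[OF n] using q by simp
  qed
  then show ?thesis by blast
qed

text \<open>The condition on \<open>W n\<close> excludes a base point at s = 0: there only
  coefficients of level 0 survive, and the nonzero corner coefficient at \<open>dec n W W\<close> is
  one of them.\<close>

lemma Fam_MapCone:
  assumes F: "Fam d n W c" and n: "1 \<le> n" and W: "W n = 0"
  shows "c \<in> MapCone d n"
  unfolding MapCone_def mem_Collect_eq
proof (intro allI impI)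
  fix s t :: complex assume st: "(s, t) \<noteq> (0, 0)"
  have lag: "lag_at d n c s t" if "s \<noteq> 0" for s by (rule Fam_lag_at[OF F n that])
  have pl: "\<exists>M. \<forall>\<gamma>\<in>nsub n. pform d c \<gamma> s t = plucker n M \<gamma>" if "s \<noteq> 0" for s
    using lag[OF that] unfolding lag_at_def by blast
  show "(\<exists>\<alpha>\<in>nsub n. pform d c \<alpha> s t \<noteq> 0) \<and> (\<exists>M. \<forall>\<alpha>\<in>nsub n. pform d c \<alpha> s t = plucker n M \<alpha>)"
  proof (cases "s = 0")
    case False
    then show ?thesis using lag unfolding lag_at_def by blast
  next
    case True
    then have t: "t \<noteq> 0" using st by auto
    have stW: "stp d n W" by (rule Fam_stp[OF F])
    then have p: "paired d n W W" by (simp add: paired_def)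
    have s0: "snd (dec n W W) = 0" by (simp add: dec_def W)
    have "pform d c (fst (dec n W W)) 0 t = c (dec n W W) * t ^ d"
    proof -
      have "pform d c (fst (dec n W W)) 0 t = (\<Sum>a\<le>d. if a = 0 then c (fst (dec n W W), 0) * t ^ d else 0)"
        unfolding pform_def by (intro sum.cong) auto
      also have "\<dots> = c (fst (dec n W W), 0) * t ^ d" by simp
      also have "(fst (dec n W W), 0) = dec n W W" using s0 by (metis prod.collapse)
      finally show ?thesis .
    qed
    moreover have "fst (dec n W W) \<in> nsub n" using h_dec(1)[OF p] by (auto simp: LevPos_def)
    ultimately have nz: "\<exists>\<gamma>\<in>nsub n. pform d c \<gamma> 0 t \<noteq> 0" using Fam_corner[OF F n] t by (metis mult_eq_0_iff power_not_zero)
    then show ?thesis using plucker_limit[OF n pl nz] True by simp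
  qed
qed

text \<open>The contraction vanishes at (s, 1) for every nonzero s; being a polynomial in s, it
  vanishes coefficientwise, that is, at every level.\<close>

lemma Fam_lform:
  assumes F: "Fam d n W c" and n: "1 \<le> n" and b: "\<beta> \<subseteq> angle n" "card \<beta> + 2 = n" and a: "a \<le> d"
  shows "peval c (lform n \<beta> a) = 0"
proof -
  let ?I = "{i \<in> {1..n}. int i \<notin> \<beta> \<and> - int i \<notin> \<beta>}"
  let ?e = "\<lambda>i. sortsign ([- int i, int i] @ sorted_list_of_set \<beta>)"
  let ?C = "\<lambda>a. \<Sum>i\<in>?I. ?e i * c (\<beta> \<union> {- int i, int i}, a)"
  have pv: "peval c (lform n \<beta> a) = ?C a" for a
    by (simp add: lform_def peval_sum peval_mult)
  have "(\<Sum>a\<in>{..d}. s ^ a * ?C a) = 0" if s: "s \<noteq> 0" for s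
  proof -
    obtain M where M: "isotropic n M" "\<forall>\<gamma>\<in>nsub n. pform d c \<gamma> s 1 = plucker n M \<gamma>"
      using Fam_lag_at[OF F n s] unfolding lag_at_def by blast
    have ns: "\<beta> \<union> {- int i, int i} \<in> nsub n" if "i \<in> ?I" for i
    proof -
      have "finite \<beta>" using b(1) finite_subset[OF _ finite_angle] by blast
      then have "card (insert (- int i) (insert (int i) \<beta>)) = n" using that b(2) by (auto simp: card_insert_if)
      then show ?thesis using that b(1) by (auto simp: nsub_def)
    qed
    have "(\<Sum>a\<in>{..d}. s ^ a * ?C a) = (\<Sum>i\<in>?I. ?e i * pform d c (\<beta> \<union> {- int i, int i}) s 1)"
      unfolding pform_def sum_distrib_left by (subst sum.swap) (simp add: algebra_simps)
    also have "\<dots> = (\<Sum>i\<in>?I. ?e i * plucker n M (\<beta> \<union> {- int i, int i}))"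
      using M(2) ns by (intro sum.cong) auto
    also have "\<dots> = 0" by (rule isotropic_contraction[OF M(1) b])
    finally show ?thesis .
  qed
  from power_sum_zero_imp_coeff_zero[OF _ this, of a] show ?thesis using a pv by auto
qed

section \<open>Vanishing of a polynomial passes to smaller bounds\<close>

lemma isCont_col_add: "isCont (\<lambda>z. c z y) x \<Longrightarrow> isCont (\<lambda>z. c z (insert k (fst y - {l}), snd y)) x \<Longrightarrow> isCont w x \<Longrightarrow>
   isCont (\<lambda>z. col_add k l (w z) (c z) y) (x::complex)"
  unfolding col_add_def by (cases "l \<in> fst y \<and> k \<notin> fst y") (auto intro!: continuous_intros)

lemma isCont_Xop: "isCont (\<lambda>z. Xop n j z c y) x"
proof -
  have c: "isCont (\<lambda>z. c y) x" for y by simp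
  have 1: "isCont (\<lambda>z. col_add k l z c y) x" for k l y by (intro isCont_col_add c) simp
  have 2: "isCont (\<lambda>z. loop_add n z c y) x"
    unfolding loop_add_def by (cases "int n \<in> fst y \<and> - int n \<notin> fst y") (auto intro!: continuous_intros)
  have 3: "isCont (\<lambda>z. col_add k' l' (- z) (col_add k l z c) y) x" for k l k' l'
    by (intro isCont_col_add 1 continuous_intros)
  show ?thesis unfolding Xop_def using 1 2 3 by (cases "j = 0"; cases "j = n") simp_all
qed

lemma Xop_zero: "Xop n j 0 c = c"
  by (auto simp: Xop_def col_add_def loop_add_def fun_eq_iff)

lemma isCont_peval:
  assumes "\<And>y. isCont (\<lambda>z. c z y) x" shows "isCont (\<lambda>z. peval (c z) f) (x::complex)"
  unfolding peval_def by (intro continuous_intros assms)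

text \<open>The operator is the identity at z = 0 and leads into the family with the raised bound
  for z \<noteq> 0, so the claim is a limit.\<close>

lemma Fam_vanish_step:
  assumes v: "\<And>c. Fam d n (W(j := W j + 1)) c \<Longrightarrow> peval c f = 0" and j: "j \<le> n" "stp d n (W(j := W j + 1))" and c: "Fam d n W c"
  shows "peval c f = 0"
proof -
  have z: "peval (Xop n j z c) f = 0" if "z \<noteq> 0" for z
    using v Fam.step[OF c that j] by blast
  have "isCont (\<lambda>z. peval (Xop n j z c) f) 0" by (intro isCont_peval isCont_Xop)
  then have "((\<lambda>z. peval (Xop n j z c) f) \<longlongrightarrow> peval c f) (at 0)" by (simp add: isCont_def Xop_zero)
  moreover have "\<forall>\<^sub>F z in at 0. peval (Xop n j z c) f = 0"
    unfolding eventually_at_filter using z by (intro always_eventually) auto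
  ultimately have "((\<lambda>z::complex. 0) \<longlongrightarrow> peval c f) (at 0)" using tendsto_cong by fastforce
  then show ?thesis by (rule tendsto_unique[OF at_neq_bot _ tendsto_const])
qed

subsection \<open>Quadratic relations on the Grassmannian of maps\<close>

text \<open>A determinant indexed by a finite set, kept as a sum over permutations because
  \<open>S\<close> will be a set of positions in a list.\<close>

definition altsum :: "nat set \<Rightarrow> (nat \<Rightarrow> nat \<Rightarrow> 'r::comm_ring_1) \<Rightarrow> 'r" where
  "altsum S E = (\<Sum>\<pi> | \<pi> permutes S. of_int (sign \<pi>) * (\<Prod>j\<in>S. E j (\<pi> j)))"

lemma altsum_linear:
  assumes "finite S" "k \<in> S"
  shows "altsum S (E(k := \<lambda>i. a i + w * b i)) = altsum S (E(k := a)) + w * altsum S (E(k := b))"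
proof -
  have P: "(\<Prod>j\<in>S. (E(k := g)) j (p j)) = g (p k) * (\<Prod>j\<in>S - {k}. E j (p j))" for g p
    using assms by (subst prod.remove[of S k]) (auto intro!: prod.cong)
  show ?thesis unfolding altsum_def P
    by (simp add: sum.distrib[symmetric] sum_distrib_left algebra_simps)
qed

lemma altsum_alt:
  fixes E :: "nat \<Rightarrow> nat \<Rightarrow> 'r::{idom, ring_char_0}"
  assumes S: "finite S" "i \<in> S" "j \<in> S" "i \<noteq> j" "E i = E j"
  shows "altsum S E = 0"
proof -
  let ?t = "Transposition.transpose i j"
  have t: "?t permutes S" using S by (intro permutes_swap_id) auto
  have E: "E (?t l) = E l" for l using S(5) by (auto simp: Transposition.transpose_def)
  have "altsum S E = (\<Sum>\<pi> | \<pi> permutes S. of_int (sign (\<pi> \<circ> ?t)) * (\<Prod>l\<in>S. E l ((\<pi> \<circ> ?t) l)))"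
    unfolding altsum_def by (rule sum_permutations_compose_right[OF t])
  also have "\<dots> = (\<Sum>\<pi> | \<pi> permutes S. - (of_int (sign \<pi>) * (\<Prod>l\<in>S. E l (\<pi> l))))"
  proof (rule sum.cong[OF refl])
    fix \<pi> assume p: "\<pi> \<in> {\<pi>. \<pi> permutes S}"
    have perm: "permutation \<pi>" "permutation ?t" using p t S(1) permutation_permutes by (blast, blast)
    have s: "sign (\<pi> \<circ> ?t) = - sign \<pi>" using sign_compose[OF perm] S(4) by (simp add: sign_swap_id)
    have "(\<Prod>l\<in>S. E l ((\<pi> \<circ> ?t) l)) = (\<Prod>l\<in>S. E (?t l) (\<pi> (?t l)))" by (simp add: E)
    also have "\<dots> = (\<Prod>l\<in>S. E l (\<pi> l))" using prod.permute[OF t, of "\<lambda>l. E l (\<pi> l)"] by (simp add: o_def)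
    finally show "of_int (sign (\<pi> \<circ> ?t)) * (\<Prod>l\<in>S. E l ((\<pi> \<circ> ?t) l)) = - (of_int (sign \<pi>) * (\<Prod>l\<in>S. E l (\<pi> l)))"
      unfolding s by simp
  qed
  also have "\<dots> = - altsum S E" by (simp add: altsum_def sum_negf)
  finally show ?thesis by (simp add: eq_neg_iff_add_eq_0 mult_2[symmetric])
qed

text \<open>Subtract row \<open>g j\<close> from each row j in \<open>J\<close>. Rows
  \<open>g j\<close> lie outside \<open>J\<close> and stay intact, so every row of \<open>J\<close>
  yields one factor \<open>e\<close>.\<close>

lemma altsum_dvd:
  fixes E :: "nat \<Rightarrow> nat \<Rightarrow> 'r::{idom, ring_char_0}"
  assumes S: "finite S" "J \<subseteq> S" and g: "\<And>j. j \<in> J \<Longrightarrow> g j \<in> S - J"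
    and E: "\<And>j. j \<in> J \<Longrightarrow> E j = (\<lambda>x. E (g j) x + e * Q j x)"
  shows "e ^ card J dvd altsum S E"
proof -
  have "altsum S E = e ^ card K * altsum S (\<lambda>j. if j \<in> K then Q j else E j)" if "K \<subseteq> J" for K
  proof -
    have "finite K" by (rule finite_subset[OF order_trans[OF that S(2)] S(1)])
    then show ?thesis using that
    proof (induction K rule: finite_induct)
      case (insert i K)
      let ?F = "\<lambda>j. if j \<in> K then Q j else E j"
      have i: "i \<in> J" "i \<in> S" using insert S by auto
      have "altsum S ?F = altsum S (?F(i := \<lambda>x. E (g i) x + e * Q i x))"
        using E[OF i(1)] insert(2) by (intro arg_cong[of _ _ "altsum S"]) (auto simp: fun_eq_iff)
      also have "\<dots> = altsum S (?F(i := E (g i))) + e * altsum S (?F(i := Q i))"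
        by (rule altsum_linear[OF S(1) i(2)])
      also have "altsum S (?F(i := E (g i))) = 0"
        by (rule altsum_alt[OF S(1) i(2), of "g i"]) (use g[OF i(1)] i insert in auto)
      also have "?F(i := Q i) = (\<lambda>j. if j \<in> insert i K then Q j else E j)" by (auto simp: fun_eq_iff)
      finally show ?case using insert by (simp add: algebra_simps)
    qed simp
  qed
  from this[of J] show ?thesis by simp
qed

text \<open>\<open>Y\<close> lists the columns of a product of two minors; \<open>L1\<close> and
  \<open>L2\<close> are the columns of the first and second factor after permuting
  positions.\<close>

definition L1 :: "nat \<Rightarrow> int list \<Rightarrow> (nat \<Rightarrow> nat) \<Rightarrow> int list" where
  "L1 n Y \<pi> = map (\<lambda>j. Y ! \<pi> j) [0..<n]"

definition L2 :: "nat \<Rightarrow> int list \<Rightarrow> (nat \<Rightarrow> nat) \<Rightarrow> int list" where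
  "L2 n Y \<pi> = map (\<lambda>j. Y ! \<pi> (n + j)) [0..<n]"

lemma prod_halves:
  fixes F G :: "nat \<Rightarrow> 'r::comm_ring_1"
  shows "(\<Prod>j<n. F j) * (\<Prod>j<n. G (n + j)) = (\<Prod>j<2 * n. if j < n then F j else G j)"
proof -
  have "{..<2 * n} = {..<n} \<union> (+) n ` {..<n}"
  proof (rule Set.set_eqI)
    fix x show "x \<in> {..<2 * n} \<longleftrightarrow> x \<in> {..<n} \<union> (+) n ` {..<n}"
      by (cases "x < n") (auto intro!: image_eqI[of _ _ "x - n"])
  qed
  moreover have "{..<n} \<inter> (+) n ` {..<n} = {}" by auto
  ultimately have "(\<Prod>j<2 * n. if j < n then F j else G j) = (\<Prod>j<n. if j < n then F j else G j) * (\<Prod>j\<in>(+) n ` {..<n}. if j < n then F j else G j)"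
    by (simp only: prod.union_disjoint finite_lessThan finite_imageI)
  then show ?thesis by (simp add: prod.reindex)
qed

text \<open>Alternating over n + k columns a product of two minors, at least k rows of the second matrix meet their
  counterpart in the first one; if the two matrices agree modulo e, subtracting these rows yields k factors e.\<close>

lemma minor_product_dvd:
  fixes M M' Q :: "nat \<Rightarrow> int \<Rightarrow> 'r::{idom, ring_char_0}"
  assumes M': "\<And>i x. M' i x = M i x + e * Q i x" and S: "S \<subseteq> {..<2 * n}" "card S = n + k"
  shows "e ^ k dvd (\<Sum>\<pi> | \<pi> permutes S. of_int (sign \<pi>) * (minor n M (L1 n Y \<pi>) * minor n M' (L2 n Y \<pi>)))"
proof -
  let ?P = "{\<tau>. \<tau> permutes {0..<n}}"
  define E where "E \<tau> \<rho> = (\<lambda>j x. if j < n then M (\<tau> j) (Y ! x) else M' (\<rho> (j - n)) (Y ! x))" for \<tau> \<rho>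
  have fS: "finite S" using S(1) finite_subset by blast
  define C where "C \<tau> \<rho> = (\<Prod>j\<in>{..<2 * n} - S. E \<tau> \<rho> j j)" for \<tau> \<rho>
  have pr: "minor n M (L1 n Y \<pi>) * minor n M' (L2 n Y \<pi>) =
     (\<Sum>\<tau>\<in>?P. \<Sum>\<rho>\<in>?P. of_int (sign \<tau>) * of_int (sign \<rho>) * C \<tau> \<rho> * (\<Prod>j\<in>S. E \<tau> \<rho> j (\<pi> j)))"
    if p: "\<pi> permutes S" for \<pi>
  proof -
    have "(\<Prod>j<n. M (\<tau> j) (L1 n Y \<pi> ! j)) * (\<Prod>j<n. M' (\<rho> j) (L2 n Y \<pi> ! j)) = C \<tau> \<rho> * (\<Prod>j\<in>S. E \<tau> \<rho> j (\<pi> j))" for \<tau> \<rho>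
    proof -
      have "(\<Prod>j<n. M (\<tau> j) (L1 n Y \<pi> ! j)) * (\<Prod>j<n. M' (\<rho> j) (L2 n Y \<pi> ! j)) =
        (\<Prod>j<n. M (\<tau> j) (Y ! \<pi> j)) * (\<Prod>j<n. M' (\<rho> ((n + j) - n)) (Y ! \<pi> (n + j)))"
        by (simp add: L1_def L2_def)
      also have "\<dots> = (\<Prod>j<2 * n. E \<tau> \<rho> j (\<pi> j))" unfolding prod_halves[of "\<lambda>j. M (\<tau> j) (Y ! \<pi> j)" n "\<lambda>j. M' (\<rho> (j - n)) (Y ! \<pi> j)"]
        by (intro prod.cong) (auto simp: E_def)
      also have "\<dots> = (\<Prod>j\<in>{..<2 * n} - S. E \<tau> \<rho> j (\<pi> j)) * (\<Prod>j\<in>S. E \<tau> \<rho> j (\<pi> j))"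
        using S(1) by (intro prod.subset_diff) auto
      also have "(\<Prod>j\<in>{..<2 * n} - S. E \<tau> \<rho> j (\<pi> j)) = C \<tau> \<rho>"
        unfolding C_def using permutes_not_in[OF p] by (intro prod.cong) auto
      finally show ?thesis .
    qed
    then show ?thesis unfolding minor_def cdet_sum sum_product
      by (intro sum.cong refl) (simp add: mult_ac)
  qed
  have "(\<Sum>\<pi> | \<pi> permutes S. of_int (sign \<pi>) * (minor n M (L1 n Y \<pi>) * minor n M' (L2 n Y \<pi>))) =
     (\<Sum>\<pi> | \<pi> permutes S. \<Sum>\<tau>\<in>?P. \<Sum>\<rho>\<in>?P. of_int (sign \<tau>) * of_int (sign \<rho>) * C \<tau> \<rho> * (of_int (sign \<pi>) * (\<Prod>j\<in>S. E \<tau> \<rho> j (\<pi> j))))"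
    by (intro sum.cong refl) (simp add: pr sum_distrib_left mult_ac)
  also have "\<dots> = (\<Sum>\<tau>\<in>?P. \<Sum>\<rho>\<in>?P. of_int (sign \<tau>) * of_int (sign \<rho>) * C \<tau> \<rho> * altsum S (E \<tau> \<rho>))"
    unfolding altsum_def sum_distrib_left
    by (subst sum.swap, rule sum.cong[OF refl], rule sum.swap)
  finally have eq: "(\<Sum>\<pi> | \<pi> permutes S. of_int (sign \<pi>) * (minor n M (L1 n Y \<pi>) * minor n M' (L2 n Y \<pi>))) =
     (\<Sum>\<tau>\<in>?P. \<Sum>\<rho>\<in>?P. of_int (sign \<tau>) * of_int (sign \<rho>) * C \<tau> \<rho> * altsum S (E \<tau> \<rho>))" .
  have "e ^ k dvd altsum S (E \<tau> \<rho>)" if t: "\<tau> permutes {0..<n}" "\<rho> permutes {0..<n}" for \<tau> \<rho>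
  proof -
    \<comment> \<open>Positions belonging to the first and the second factor. They carry n + k row
      indices below n altogether, so at least k rows of the second factor repeat a row of the first;
      \<open>J\<close> collects these.\<close>
    define S1 where "S1 = {j \<in> S. j < n}"
    define S2 where "S2 = {j \<in> S. n \<le> j}"
    define T where "T = \<tau> ` S1"
    define f where "f j = \<rho> (j - n)" for j
    define J where "J = {j \<in> S2. f j \<in> T}"
    have fin: "finite S1" "finite S2" "finite T" "finite J" using fS by (auto simp: S1_def S2_def T_def J_def)
    have "S = S1 \<union> S2" "S1 \<inter> S2 = {}" by (auto simp: S1_def S2_def)
    then have c12: "card S1 + card S2 = n + k" using S(2) fin by (metis card_Un_disjoint)
    have cT: "card T = card S1" unfolding T_def by (rule card_image) (rule permutes_inj_on[OF t(1)])
    have fi: "inj_on f S2"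
    proof (rule inj_onI)
      fix x y assume xy: "x \<in> S2" "y \<in> S2" "f x = f y"
      then have "x - n = y - n" using permutes_inj[OF t(2)] by (auto simp: f_def dest: injD)
      then show "x = y" using xy by (auto simp: S2_def)
    qed
    have sub: "f ` S2 \<union> T \<subseteq> {0..<n}"
      using S(1) permutes_lt[OF t(1)] permutes_lt[OF t(2)] by (auto simp: f_def S2_def S1_def T_def)
    have "card (f ` S2 \<union> T) \<le> n" using card_mono[OF _ sub] by simp
    moreover have "card (f ` S2) + card T = card (f ` S2 \<union> T) + card (f ` S2 \<inter> T)"
      using fin by (intro card_Un_Int) auto
    moreover have "f ` S2 \<inter> T = f ` J" by (auto simp: J_def)
    moreover have "card (f ` J) = card J" using fi by (intro card_image) (auto intro: inj_on_subset simp: J_def)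
    ultimately have kJ: "k \<le> card J" using c12 cT card_image[OF fi] by simp
    define g where "g j = (SOME i. i \<in> S1 \<and> \<tau> i = f j)" for j
    have g: "g j \<in> S1 \<and> \<tau> (g j) = f j" if "j \<in> J" for j
      unfolding g_def by (rule someI_ex) (use that in \<open>auto simp: J_def T_def\<close>)
    have "e ^ card J dvd altsum S (E \<tau> \<rho>)"
    proof (rule altsum_dvd[OF fS, where g = g and Q = "\<lambda>j x. Q (f j) (Y ! x)"])
      fix j assume j: "j \<in> J"
      show "g j \<in> S - J" using g[OF j] by (auto simp: J_def S1_def S2_def)
      show "E \<tau> \<rho> j = (\<lambda>x. E \<tau> \<rho> (g j) x + e * Q (f j) (Y ! x))"
        using g[OF j] j M' by (auto simp: E_def J_def S1_def S2_def f_def fun_eq_iff)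
    qed (auto simp: J_def S2_def)
    then show ?thesis using kJ le_imp_power_dvd dvd_trans by blast
  qed
  then show ?thesis unfolding eq by (intro dvd_sum dvd_mult) auto
qed

section \<open>Pairs of minors of a map near the diagonal\<close>

definition scf :: "nat \<Rightarrow> (lv \<Rightarrow> complex) \<Rightarrow> int list \<Rightarrow> nat \<Rightarrow> complex" where
  "scf n c xs b = (if distinct xs \<and> length xs = n then sortsign xs * c (set xs, b) else 0)"

definition SP :: "nat \<Rightarrow> nat \<Rightarrow> (lv \<Rightarrow> complex) \<Rightarrow> int list \<Rightarrow> complex poly" where
  "SP d n c xs = (\<Sum>b\<le>d. monom (scf n c xs b) b)"

lemma sform_scf: "sform d n c xs s 1 = (\<Sum>a\<le>d. scf n c xs a * s ^ a)"
proof (cases "distinct xs \<and> length xs = n")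
  case True
  then show ?thesis by (simp add: scf_def sform_def pform_def sum_distrib_left mult.assoc)
next
  case False
  then have "scf n c xs a = 0" for a by (auto simp: scf_def)
  then show ?thesis using False by (auto simp: sform_def)
qed

lemma poly_SP: "poly (SP d n c xs) x = sform d n c xs x 1"
  by (simp add: SP_def sform_scf poly_sum poly_monom)

lemma poly_minor: "poly (minor n Q cs) x = minor n (\<lambda>i y. poly (Q i y) x) cs"
  unfolding minor_def cdet_sum by (simp add: poly_sum poly_prod)

lemma minor_const: "minor n (\<lambda>i y. [:C i y:]) cs = [:minor n C cs:]" for C :: "nat \<Rightarrow> int \<Rightarrow> complex"
  by (rule poly_ext) (simp add: poly_minor)

lemma smult_sum_right: "smult m (\<Sum>i\<in>S. f i) = (\<Sum>i\<in>S. smult m (f i))"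
  by (induction S rule: infinite_finite_induct) (simp_all add: smult_add_right)

lemma linear_power_dvd_cancel:
  fixes q G :: "complex poly"
  assumes q: "poly q s \<noteq> 0" and d: "[:- s, 1:] ^ k dvd q ^ n * G"
  shows "[:- s, 1:] ^ k dvd G"
proof (cases "G = 0")
  case False
  have qn: "q ^ n \<noteq> 0" using q by auto
  have "order s (q ^ n) = 0" using q by (intro order_0I) simp
  then have "order s (q ^ n * G) = order s G" using order_mult[of "q ^ n" G s] qn False by simp
  moreover have "q ^ n * G \<noteq> 0" using qn False by simp
  ultimately show ?thesis using d unfolding order_divides by metis
qed simp

text \<open>Choose a coordinate \<open>q\<close> that is nonzero at s. The coordinates adjacent to
  it form a polynomial matrix \<open>N\<close> that represents the map up to powers of
  \<open>q\<close>, and \<open>N0\<close> is its value at s. The two agree modulo X - s, so the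
  alternating sum for their minors is divisible; the powers of \<open>q\<close> are prime to X - s
  and cancel.\<close>

lemma MapCone_local_dvd:
  assumes c: "c \<in> MapCone d n" and Y: "length Y = 2 * n" "set Y \<subseteq> angle n"
    and S: "S \<subseteq> {..<2 * n}" "card S = n + k"
  shows "[:- s, 1:] ^ k dvd (\<Sum>\<pi> | \<pi> permutes S. of_int (sign \<pi>) * (smult (sform d n c (L1 n Y \<pi>) s 1) (SP d n c (L2 n Y \<pi>))))"
    (is "_ dvd ?G")
proof -
  have mc: "\<exists>\<alpha>\<in>nsub n. pform d c \<alpha> x 1 \<noteq> 0" "\<exists>M. \<forall>\<alpha>\<in>nsub n. pform d c \<alpha> x 1 = plucker n M \<alpha>" for x
    using c unfolding MapCone_def mem_Collect_eq by (metis prod.inject zero_neq_one)+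
  obtain \<gamma>0 where g0: "\<gamma>0 \<in> nsub n" "pform d c \<gamma>0 s 1 \<noteq> 0" using mc(1) by blast
  define a where "a = sorted_list_of_set \<gamma>0"
  have a: "length a = n" "set a \<subseteq> angle n" "distinct a" "set a = \<gamma>0"
    using nsub_sorted[OF g0(1)] g0(1) by (auto simp: a_def nsub_def)
  define q where "q = SP d n c a"
  have q: "poly q s \<noteq> 0" using g0 a sortsign_cases[of a] by (auto simp: q_def poly_SP sform_def)
  define N where "N i x = SP d n c (a[i := x])" for i x
  define N0 where "N0 i x = [:poly (N i x) s:]" for i x
  have cr: "q * minor n N cs = q ^ n * SP d n c cs" if cs: "length cs = n" "set cs \<subseteq> angle n" for cs
  proof (rule poly_ext)
    fix x
    obtain M where "\<forall>\<alpha>\<in>nsub n. pform d c \<alpha> x 1 = plucker n M \<alpha>" using mc(2) by blast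
    from sform_cramer[OF this a(1,2) cs]
    show "poly (q * minor n N cs) x = poly (q ^ n * SP d n c cs) x"
      by (simp add: poly_minor q_def poly_SP N_def)
  qed
  have cr0: "[:poly q s:] * minor n N0 cs = [:poly q s ^ n * sform d n c cs s 1:]"
    if cs: "length cs = n" "set cs \<subseteq> angle n" for cs
  proof -
    have "minor n N0 cs = [:poly (minor n N cs) s:]" unfolding N0_def minor_const poly_minor ..
    moreover have "poly (q * minor n N cs) s = poly (q ^ n * SP d n c cs) s" using cr[OF cs] by simp
    ultimately show ?thesis by (simp add: poly_SP mult.commute)
  qed
  have len: "length (L1 n Y \<pi>) = n" "length (L2 n Y \<pi>) = n" for \<pi> by (auto simp: L1_def L2_def)
  have sub: "set (L1 n Y \<pi>) \<subseteq> angle n" "set (L2 n Y \<pi>) \<subseteq> angle n" if "\<pi> permutes S" for \<pi>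
  proof -
    have "\<pi> j < 2 * n" if "j < 2 * n" for j
      using permutes_subset[OF \<open>\<pi> permutes S\<close> S(1)] that permutes_in_image[of \<pi> "{..<2 * n}" j] by simp
    then show "set (L1 n Y \<pi>) \<subseteq> angle n" "set (L2 n Y \<pi>) \<subseteq> angle n"
      using Y nth_mem[of _ Y] by (auto simp: L1_def L2_def)
  qed
  define Q where "Q i x = (N i x - N0 i x) div [:- s, 1:]" for i x
  have Q: "N i x = N0 i x + [:- s, 1:] * Q i x" for i x
  proof -
    have "[:- s, 1:] dvd N i x - N0 i x" by (simp add: poly_eq_0_iff_dvd[symmetric] N0_def)
    then have "[:- s, 1:] * Q i x = N i x - N0 i x" unfolding Q_def by (rule dvd_mult_div_cancel)
    then show ?thesis by simp
  qed
  let ?H = "\<Sum>\<pi> | \<pi> permutes S. of_int (sign \<pi>) * (minor n N0 (L1 n Y \<pi>) * minor n N (L2 n Y \<pi>))"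
  have H: "[:- s, 1:] ^ k dvd ?H" by (rule minor_product_dvd[OF Q S])
  have "[:poly q s:] * q * ?H = (\<Sum>\<pi> | \<pi> permutes S. of_int (sign \<pi>) * (([:poly q s:] * minor n N0 (L1 n Y \<pi>)) * (q * minor n N (L2 n Y \<pi>))))"
    by (simp only: sum_distrib_left) (intro sum.cong refl, simp only: mult_ac)
  also have "\<dots> = (\<Sum>\<pi> | \<pi> permutes S. of_int (sign \<pi>) * ([:poly q s ^ n * sform d n c (L1 n Y \<pi>) s 1:] * (q ^ n * SP d n c (L2 n Y \<pi>))))"
    by (intro sum.cong refl) (simp only: cr0[OF len(1) sub(1)] cr[OF len(2) sub(2)] mem_Collect_eq)
  also have "\<dots> = smult (poly q s ^ n) (q ^ n * ?G)"
    unfolding sum_distrib_left smult_sum_right by (intro sum.cong refl) (simp add: mult_ac)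
  finally have eq: "[:poly q s:] * q * ?H = smult (poly q s ^ n) (q ^ n * ?G)" .
  have "[:- s, 1:] ^ k dvd [:poly q s:] * q * ?H" by (rule dvd_mult[OF H])
  then have "[:- s, 1:] ^ k dvd smult (poly q s ^ n) (q ^ n * ?G)" unfolding eq .
  then have d: "[:- s, 1:] ^ k dvd q ^ n * ?G" using q by (simp add: dvd_smult_iff)
  show ?thesis by (rule linear_power_dvd_cancel[OF q d])
qed

fun euler_ops :: "complex list \<Rightarrow> complex poly \<Rightarrow> complex poly" where
  "euler_ops [] g = g"
| "euler_ops (x # xs) g = euler_ops xs (pCons 0 (pderiv g) - smult x g)"

lemma coeff_euler_ops: "coeff (euler_ops xs g) b = (\<Prod>x\<leftarrow>xs. of_nat b - x) * coeff g b"
proof (induction xs arbitrary: g)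
  case (Cons x xs)
  have "coeff (pCons 0 (pderiv g) - smult x g) b = (of_nat b - x) * coeff g b"
    by (cases b) (auto simp: coeff_pderiv algebra_simps)
  then show ?case using Cons by (simp add: mult_ac)
qed simp

lemma euler_ops_root: "[:- s, 1:] ^ Suc (length xs) dvd g \<Longrightarrow> poly (euler_ops xs g) s = 0"
proof (induction xs arbitrary: g)
  case Nil
  then show ?case by (simp add: poly_eq_0_iff_dvd)
next
  case (Cons x xs)
  define l where "l = [:- s, 1:]"
  let ?m = "length xs"
  obtain h where h: "g = l ^ Suc (Suc ?m) * h" using Cons.prems by (auto elim!: dvdE simp: l_def)
  have pl: "pderiv l = 1" by (simp add: pderiv_pCons l_def)
  have "pderiv g = l ^ Suc ?m * (l * pderiv h + smult (of_nat (Suc (Suc ?m))) h)"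
    unfolding h pderiv_mult pderiv_power_Suc pl by (simp add: algebra_simps)
  then have "l ^ Suc ?m dvd pderiv g" by simp
  then have "l ^ Suc ?m dvd pCons 0 (pderiv g)"
    using dvd_mult[of "l ^ Suc ?m" "pderiv g" "[:0, 1:]"] by simp
  moreover have "l ^ Suc ?m dvd smult x g" unfolding h by (intro dvd_smult) simp
  ultimately have "l ^ Suc ?m dvd pCons 0 (pderiv g) - smult x g" by (rule dvd_diff)
  then show ?case using Cons.IH by (simp add: l_def)
qed

lemma poly_sum_coeff: fixes g :: "complex poly" shows "(\<And>b. b > d \<Longrightarrow> coeff g b = 0) \<Longrightarrow> poly g x = (\<Sum>b\<le>d. coeff g b * x ^ b)"
proof -
  assume z: "\<And>b. b > d \<Longrightarrow> coeff g b = 0"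
  then have "degree g \<le> d" by (intro degree_le) auto
  then show "poly g x = (\<Sum>b\<le>d. coeff g b * x ^ b)"
    unfolding poly_altdef by (intro sum.mono_neutral_left) (auto simp: coeff_eq_0)
qed

text \<open>The order of vanishing on the diagonal is turned into linear conditions by the operators X d/dX - x,
  each of which lowers it by at most one.\<close>

lemma MapCone_quadratic:
  assumes c: "c \<in> MapCone d n" and Y: "length Y = 2 * n" "set Y \<subseteq> angle n"
    and S: "S \<subseteq> {..<2 * n}" "card S = n + Suc (length xs)"
  defines "f \<equiv> \<lambda>a b. \<Sum>\<pi> | \<pi> permutes S. of_int (sign \<pi>) * (scf n c (L1 n Y \<pi>) a * scf n c (L2 n Y \<pi>) b)"
  shows "(\<Sum>p\<in>{p\<in>{..d} \<times> {..d}. fst p + snd p = m}. (\<Prod>x\<leftarrow>xs. of_nat (snd p) - x) * f (fst p) (snd p)) = 0"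
proof (cases "m \<le> 2 * d")
  case True
  define l where "l b = (\<Prod>x\<leftarrow>xs. of_nat b - x)" for b
  have "(\<Sum>m\<in>{..2 * d}. s ^ m * (\<Sum>p\<in>{p\<in>{..d} \<times> {..d}. fst p + snd p = m}. l (snd p) * f (fst p) (snd p))) = 0" for s
  proof -
    \<comment> \<open>For fixed s this is a polynomial in X. Applying the operators and then setting
      X = s turns it into a polynomial in s whose coefficients are the sums in question.\<close>
    define G where "G = (\<Sum>\<pi> | \<pi> permutes S. of_int (sign \<pi>) * (smult (sform d n c (L1 n Y \<pi>) s 1) (SP d n c (L2 n Y \<pi>))))"
    note sf = sform_scf[of d n c _ s]
    have cSP: "coeff (SP d n c ys) b = (if b \<le> d then scf n c ys b else 0)" for ys b
      by (simp add: SP_def coeff_sum)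
    have cs: "coeff (of_int k * p) b = of_int k * coeff p b" for k and p :: "complex poly" and b
      by (simp add: of_int_poly)
    have cG: "coeff G b = (if b \<le> d then \<Sum>a\<le>d. f a b * s ^ a else 0)" for b
    proof -
      have "coeff G b = (\<Sum>\<pi> | \<pi> permutes S. of_int (sign \<pi>) * (sform d n c (L1 n Y \<pi>) s 1 * coeff (SP d n c (L2 n Y \<pi>)) b))"
        by (simp add: G_def coeff_sum cs mult.left_commute)
      also have "\<dots> = (if b \<le> d then \<Sum>a\<le>d. f a b * s ^ a else 0)"
      proof (cases "b \<le> d")
        case True
        then show ?thesis unfolding f_def sf cSP sum_distrib_left sum_distrib_right
          by (simp, subst sum.swap) (intro sum.cong refl, simp add: mult_ac)
      qed (simp add: cSP)
      finally show ?thesis .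
    qed
    have "[:- s, 1:] ^ Suc (length xs) dvd G" unfolding G_def by (rule MapCone_local_dvd[OF c Y S])
    then have "0 = poly (euler_ops xs G) s" by (simp add: euler_ops_root)
    also have "\<dots> = (\<Sum>b\<le>d. coeff (euler_ops xs G) b * s ^ b)"
      by (rule poly_sum_coeff) (simp add: coeff_euler_ops cG)
    also have "\<dots> = (\<Sum>b\<le>d. \<Sum>a\<le>d. s ^ (a + b) * (l b * f a b))"
      by (intro sum.cong refl) (simp add: coeff_euler_ops cG l_def sum_distrib_left sum_distrib_right power_add mult_ac)
    also have "\<dots> = (\<Sum>p\<in>{..d} \<times> {..d}. s ^ (fst p + snd p) * (l (snd p) * f (fst p) (snd p)))"
      by (subst sum.swap) (simp add: sum.cartesian_product case_prod_beta)
    also have "\<dots> = (\<Sum>m\<in>{..2 * d}. \<Sum>p\<in>{p\<in>{..d} \<times> {..d}. fst p + snd p = m}. s ^ (fst p + snd p) * (l (snd p) * f (fst p) (snd p)))"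
      by (rule sum.group[symmetric]) auto
    also have "\<dots> = (\<Sum>m\<in>{..2 * d}. s ^ m * (\<Sum>p\<in>{p\<in>{..d} \<times> {..d}. fst p + snd p = m}. l (snd p) * f (fst p) (snd p)))"
      by (intro sum.cong refl) (auto simp: sum_distrib_left intro!: sum.cong)
    finally show ?thesis by simp
  qed
  from power_sum_zero_imp_coeff_zero[OF _ this, of m] show ?thesis using True by (simp add: l_def)
next
  case False
  then have "{p\<in>{..d} \<times> {..d}. fst p + snd p = m} = {}" by auto
  then show ?thesis by (simp only: sum.empty)
qed

definition svar :: "nat \<Rightarrow> int list \<Rightarrow> nat \<Rightarrow> pol" where
  "svar n xs a = (if distinct xs \<and> length xs = n then const (sortsign xs) * var (set xs, a) else 0)"

lemma peval_svar: "peval c (svar n xs a) = scf n c xs a"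
  by (simp add: svar_def scf_def peval_mult)

lemma Ring_svar: "set xs \<subseteq> angle n \<Longrightarrow> a \<le> d \<Longrightarrow> svar n xs a \<in> Ring d n"
  by (auto simp: svar_def LevPos_def nsub_def distinct_card intro!: Ring_mult Ring_var)

lemma quadratic_in_Iid:
  assumes Y: "length Y = 2 * n" "set Y \<subseteq> angle n"
    and S: "S \<subseteq> {..<2 * n}" "card S = n + Suc (length xs)"
  shows "(\<Sum>p\<in>{p\<in>{..d} \<times> {..d}. fst p + snd p = m}. const (\<Prod>x\<leftarrow>xs. of_nat (snd p) - x) *
      (\<Sum>\<pi> | \<pi> permutes S. const (of_int (sign \<pi>)) * (svar n (L1 n Y \<pi>) (fst p) * svar n (L2 n Y \<pi>) (snd p)))) \<in> Iid d n"
  unfolding Iid_def mem_Collect_eq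
proof
  have sub: "set (L1 n Y \<pi>) \<subseteq> angle n" "set (L2 n Y \<pi>) \<subseteq> angle n" if "\<pi> permutes S" for \<pi>
  proof -
    have "\<pi> j < 2 * n" if "j < 2 * n" for j
      using permutes_subset[OF \<open>\<pi> permutes S\<close> S(1)] that permutes_in_image[of \<pi> "{..<2 * n}" j] by simp
    then show "set (L1 n Y \<pi>) \<subseteq> angle n" "set (L2 n Y \<pi>) \<subseteq> angle n"
      using Y nth_mem[of _ Y] by (auto simp: L1_def L2_def)
  qed
  show "(\<Sum>p\<in>{p\<in>{..d} \<times> {..d}. fst p + snd p = m}. const (\<Prod>x\<leftarrow>xs. of_nat (snd p) - x) *
      (\<Sum>\<pi> | \<pi> permutes S. const (of_int (sign \<pi>)) * (svar n (L1 n Y \<pi>) (fst p) * svar n (L2 n Y \<pi>) (snd p)))) \<in> Ring d n"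
    by (intro Ring_sum Ring_mult Ring_const Ring_svar) (use sub in auto)
  show "\<forall>c\<in>MapCone d n. peval c (\<Sum>p\<in>{p\<in>{..d} \<times> {..d}. fst p + snd p = m}. const (\<Prod>x\<leftarrow>xs. of_nat (snd p) - x) *
      (\<Sum>\<pi> | \<pi> permutes S. const (of_int (sign \<pi>)) * (svar n (L1 n Y \<pi>) (fst p) * svar n (L2 n Y \<pi>) (snd p)))) = 0"
    using MapCone_quadratic[OF _ Y S] by (simp add: peval_sum peval_mult peval_svar)
qed

subsection \<open>Straightening in the Grassmannian of maps\<close>

text \<open>The linear span of \<open>B\<close> in the quotient ring, described by representatives
  so that no quotient type is needed.\<close>

inductive_set modspan :: "nat \<Rightarrow> nat \<Rightarrow> pol set \<Rightarrow> pol set" for d n B where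
  ideal: "f \<in> Jid d n \<Longrightarrow> f \<in> modspan d n B"
| gen: "f \<in> B \<Longrightarrow> f \<in> modspan d n B"
| add: "f \<in> modspan d n B \<Longrightarrow> g \<in> modspan d n B \<Longrightarrow> f + g \<in> modspan d n B"
| scale: "f \<in> modspan d n B \<Longrightarrow> const a * f \<in> modspan d n B"

lemma modspan_0: "0 \<in> modspan d n B"
  by (rule modspan.ideal[OF Jid_0])
lemma modspan_uminus: "f \<in> modspan d n B \<Longrightarrow> - f \<in> modspan d n B"
  using modspan.scale[of f d n B "-1"] by (simp add: const_uminus)
lemma modspan_diff: "f \<in> modspan d n B \<Longrightarrow> g \<in> modspan d n B \<Longrightarrow> f - g \<in> modspan d n B"
  using modspan.add[of f d n B "-g"] modspan_uminus by simp
lemma modspan_sum: "(\<And>x. x \<in> A \<Longrightarrow> F x \<in> modspan d n B) \<Longrightarrow> sum F A \<in> modspan d n B"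
  by (induction A rule: infinite_finite_induct) (auto simp: modspan_0 modspan.add)
lemma modspan_subset: assumes "B \<subseteq> modspan d n B'" shows "modspan d n B \<subseteq> modspan d n B'"
proof
  fix f assume "f \<in> modspan d n B"
  then show "f \<in> modspan d n B'"
    by (induction rule: modspan.induct) (use assms in \<open>auto intro: modspan.intros\<close>)
qed
lemma modspan_mono: "B \<subseteq> B' \<Longrightarrow> modspan d n B \<subseteq> modspan d n B'"
  by (rule modspan_subset) (auto intro: modspan.gen)
lemma modspan_mult:
  assumes "f \<in> modspan d n B" "r \<in> Ring d n" "\<And>g. g \<in> B \<Longrightarrow> r * g \<in> modspan d n B'"
  shows "r * f \<in> modspan d n B'"
  using assms(1)
proof (induction rule: modspan.induct)
  case (ideal f) then show ?case using assms(2) by (intro modspan.ideal Jid_mult)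
next
  case (gen f) then show ?case by (rule assms(3))
next
  case (add f g) then show ?case by (simp add: distrib_left modspan.add)
next
  case (scale f a)
  show ?case unfolding mult.left_commute[of r] by (rule modspan.scale[OF scale(2)])
qed
lemma modspan_cong: "f - g \<in> Jid d n \<Longrightarrow> g \<in> modspan d n B \<Longrightarrow> f \<in> modspan d n B"
  using modspan.add[of "f - g" d n B g] modspan.ideal by simp

section \<open>Signs in an exchange of columns\<close>

lemma minor_indicator:
  assumes "distinct as" "length as = n"
  shows "minor n (\<lambda>i x. if x = as ! i then 1 else (0::complex)) as = 1"
proof -
  have "mat n n (\<lambda>(i, j). if as ! j = as ! i then 1 else (0::complex)) = 1\<^sub>m n"
    using assms by (intro eq_matI) (auto simp: nth_eq_iff_index_eq)
  then show ?thesis by (simp add: minor_def cdet_def)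
qed

text \<open>Compare two evaluations of a permuted minor of the unit matrix: by sorting its columns
  and by permuting them.\<close>

lemma sortsign_permute:
  assumes as: "sorted as" "distinct as" "length as = n" and p: "p permutes {0..<n}"
  shows "sortsign (map (\<lambda>j. as ! p j) [0..<n]) = of_int (sign p)"
proof -
  let ?M = "\<lambda>i x. if x = as ! i then 1 else (0::complex)"
  let ?xs = "map (\<lambda>j. as ! p j) [0..<n]"
  have "inj_on p {0..<n}" by (rule permutes_inj_on[OF p])
  moreover have "inj_on ((!) as) (p ` {0..<n})"
    using inj_on_nth[OF as(2), of "p ` {0..<n}"] permutes_lt[OF p] as(3) by auto
  ultimately have d: "distinct ?xs"
    using comp_inj_on[of p "{0..<n}" "(!) as"] by (simp add: distinct_map o_def)
  have "set ?xs = (!) as ` (p ` {0..<n})" by auto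
  also have "p ` {0..<n} = {0..<n}" by (rule permutes_image[OF p])
  also have "(!) as ` {0..<n} = set as" using as(3) by (auto simp: set_conv_nth)
  finally have s: "set ?xs = set as" .
  have "sorted_list_of_set (set as) = as" using as by (simp add: sorted_list_of_set.idem_if_sorted_distinct)
  then have "plucker n ?M (set as) = 1" using minor_indicator[OF as(2,3)] by (simp add: plucker_eq_minor)
  then have "minor n ?M ?xs = sortsign ?xs" using minor_sortsign[OF d, of n ?M] s by simp
  moreover have "minor n ?M ?xs = of_int (sign p)"
    using minor_permute[OF p, of ?M as] minor_indicator[OF as(2,3)] by simp
  ultimately show ?thesis by simp
qed

text \<open>Preserving the first half forces preservation of the second. The part \<open>q\<close>
  moving the second half is a transport of \<open>p2\<close> and has the same sign.\<close>

lemma sign_split: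
  fixes p :: "nat \<Rightarrow> nat"
  assumes p: "p permutes {..<2 * n}" and pr: "\<And>j. j < n \<Longrightarrow> p j < n"
  shows "\<exists>p1 p2. p1 permutes {0..<n} \<and> p2 permutes {0..<n} \<and> sign p = sign p1 * sign p2 \<and>
    (\<forall>j<n. p j = p1 j) \<and> (\<forall>j<n. p (n + j) = n + p2 j)"
proof -
  define p1 where "p1 j = (if j < n then p j else j)" for j
  define q where "q j = (if j < n then j else p j)" for j
  define p2 where "p2 j = (if j < n then p (n + j) - n else j)" for j
  have inj: "inj p" using permutes_inj[OF p] .
  have img: "p ` {0..<n} = {0..<n}"
    by (rule endo_inj_surj) (use pr inj in \<open>auto intro: inj_on_subset\<close>)
  have up: "n \<le> p j" if "n \<le> j" for j
  proof (rule ccontr)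
    assume "\<not> n \<le> p j"
    then have "p j \<in> p ` {0..<n}" unfolding img by simp
    then obtain i where "i < n" "p i = p j" by auto
    then have "i = j" using injD[OF inj] by blast
    then show False using \<open>i < n\<close> that by simp
  qed
  have lt: "p j < 2 * n" if "j < 2 * n" for j using permutes_in_image[OF p, of j] that by simp
  have p1: "p1 permutes {0..<n}"
  proof (rule bij_imp_permutes)
    show "bij_betw p1 {0..<n} {0..<n}"
      using img inj by (auto simp: bij_betw_def p1_def inj_on_def image_def dest: injD)
  qed (auto simp: p1_def)
  have inj2: "inj_on p2 {0..<n}"
  proof (rule inj_onI)
    fix x y assume xy: "x \<in> {0..<n}" "y \<in> {0..<n}" "p2 x = p2 y"
    then have "p (n + x) = p (n + y)" using up[of "n + x"] up[of "n + y"] by (auto simp: p2_def)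
    then have "n + x = n + y" using injD[OF inj] by blast
    then show "x = y" by simp
  qed
  have p2: "p2 permutes {0..<n}"
  proof (rule bij_imp_permutes)
    have "p2 ` {0..<n} \<subseteq> {0..<n}" using lt up by (auto simp: p2_def) (metis add_diff_inverse_nat add_less_cancel_left le_add1 mult_2 nat_add_left_cancel_less not_le)
    then show "bij_betw p2 {0..<n} {0..<n}" using inj2 endo_inj_surj[of "{0..<n}" p2] by (auto simp: bij_betw_def)
  qed (auto simp: p2_def)
  have e2: "p (n + j) = n + p2 j" if "j < n" for j using up[of "n + j"] that by (simp add: p2_def)
  have qm: "q = map_permutation {0..<n} ((+) n) p2"
  proof (rule ext)
    fix x
    show "q x = map_permutation {0..<n} ((+) n) p2 x"
    proof (cases "x \<in> (+) n ` {0..<n}")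
      case True
      then obtain j where "j \<in> {0..<n}" "x = n + j" by (rule imageE)
      then have j: "j < n" "x = n + j" by auto
      have "inv_into {0..<n} ((+) n) (n + j) = j" using j by (intro inv_into_f_f) auto
      then show ?thesis using True j e2 by (simp add: map_permutation_def restrict_id_def q_def)
    next
      case False
      then have "x < n \<or> 2 * n \<le> x" by (cases "x < n") (auto simp: image_iff intro!: bexI[of _ "x - n"])
      then have "q x = x" using permutes_not_in[OF p, of x] by (auto simp: q_def)
      moreover have "map_permutation {0..<n} ((+) n) p2 x = x"
        unfolding map_permutation_def restrict_id_def using False by (rule if_not_P)
      ultimately show ?thesis by simp
    qed
  qed
  have sq: "sign q = sign p2" unfolding qm by (rule sign_map_permutation[OF _ p2]) auto
  have qp: "q permutes (+) n ` {0..<n}" unfolding qm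
    by (rule map_permutation_permutes[OF _ p2]) (auto simp: bij_betw_def)
  have "p x = (p1 \<circ> q) x" for x using up[of x] by (cases "x < n") (auto simp: p1_def q_def)
  then have "p = p1 \<circ> q" by (rule ext)
  moreover have "permutation p1" "permutation q" using p1 qp permutation_permutes by (blast, metis finite_atLeastLessThan finite_imageI)
  ultimately have "sign p = sign p1 * sign p2" using sign_compose sq by metis
  then show ?thesis using p1 p2 e2 by (intro exI[of _ p1] exI[of _ p2]) (auto simp: p1_def)
qed

text \<open>The alternation runs over \<alpha>_i, ..., \<alpha>_n and \<beta>_1, ..., \<beta>_(D+i),
  altogether n + D + 1 columns, and each of these entries of \<beta> is less than each of these
  entries of \<alpha>. A term either restores \<alpha> in the first factor, and then its signs
  cancel, or it strictly lowers the sum of the first set.\<close>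

lemma straighten_exchange:
  assumes \<alpha>: "\<alpha> \<in> nsub n" and \<beta>: "\<beta> \<in> nsub n" and i: "1 \<le> i" "i + D \<le> n" and lt: "elt \<beta> (D + i) < elt \<alpha> i"
  defines "Y \<equiv> sorted_list_of_set \<alpha> @ sorted_list_of_set \<beta>"
  defines "S \<equiv> {i - 1..<n + D + i}"
  assumes \<pi>: "\<pi> permutes S"
  shows "set (L1 n Y \<pi>) = \<alpha> \<Longrightarrow> const (of_int (sign \<pi>)) * (svar n (L1 n Y \<pi>) a * svar n (L2 n Y \<pi>) b) = var (\<alpha>, a) * var (\<beta>, b)"
    and "distinct (L1 n Y \<pi>) \<Longrightarrow> set (L1 n Y \<pi>) \<noteq> \<alpha> \<Longrightarrow> sum id (set (L1 n Y \<pi>)) < sum id \<alpha>"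
    and "set (L1 n Y \<pi>) \<subseteq> angle n" "set (L2 n Y \<pi>) \<subseteq> angle n"
proof -
  let ?as = "sorted_list_of_set \<alpha>"
  let ?bs = "sorted_list_of_set \<beta>"
  note as = nsub_sorted[OF \<alpha>] and bs = nsub_sorted[OF \<beta>]
  have ang: "\<alpha> \<subseteq> angle n" "\<beta> \<subseteq> angle n" using \<alpha> \<beta> by (auto simp: nsub_def)
  have fin: "finite \<alpha>" "finite \<beta>" using \<alpha> \<beta> nsub_finite by auto
  have ca: "card \<alpha> = n" using \<alpha> by (simp add: nsub_def)
  have srt: "sorted ?as" "sorted ?bs" by auto
  have S2: "S \<subseteq> {..<2 * n}" using i by (auto simp: S_def)
  have p2n: "\<pi> permutes {..<2 * n}" by (rule permutes_subset[OF \<pi> S2])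
  have lt2: "\<pi> j < 2 * n" if "j < 2 * n" for j using permutes_in_image[OF p2n, of j] that by simp
  have lenY: "length Y = 2 * n" "set Y \<subseteq> angle n" using as bs ang by (auto simp: Y_def)
  show sub: "set (L1 n Y \<pi>) \<subseteq> angle n" "set (L2 n Y \<pi>) \<subseteq> angle n"
    using lenY lt2 nth_mem[of _ Y] by (auto simp: L1_def L2_def)
  let ?h = "elt \<alpha> i"
  have low: "Y ! j < ?h" if "j \<in> S" "n \<le> j" for j
  proof -
    have "Y ! j = ?bs ! (j - n)" using that as by (simp add: Y_def nth_append)
    also have "\<dots> \<le> ?bs ! (D + i - 1)" using that i bs srt by (intro sorted_nth_mono) (auto simp: S_def)
    also have "\<dots> = elt \<beta> (D + i)" by (simp add: elt_def)
    finally show ?thesis using lt by simp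
  qed
  have high: "?h \<le> Y ! j" "Y ! j \<in> \<alpha>" if "i - 1 \<le> j" "j < n" for j
  proof -
    have e: "Y ! j = ?as ! j" using that as by (simp add: Y_def nth_append)
    have "?as ! (i - 1) \<le> ?as ! j" using that as srt by (intro sorted_nth_mono) auto
    then show "?h \<le> Y ! j" "Y ! j \<in> \<alpha>" using e that as nth_mem[of j ?as] by (auto simp: elt_def)
  qed
  have pre: "L1 n Y \<pi> ! j = ?as ! j" if "j < i - 1" "j < n" for j
    using permutes_not_in[OF \<pi>, of j] that as by (simp add: L1_def S_def Y_def nth_append)
  have small: "\<exists>j<i - 1. j < n \<and> x = L1 n Y \<pi> ! j" if "x \<in> \<alpha>" "x < ?h" for x
  proof -
    have "x \<in> set ?as" using that(1) as(1) by simp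
    then obtain j where "j < length ?as" "?as ! j = x" unfolding in_set_conv_nth by blast
    then have j: "j < n" "?as ! j = x" using as(2) by auto
    have "j < i - 1"
    proof (rule ccontr)
      assume "\<not> j < i - 1"
      then have "?h \<le> Y ! j" using high j by auto
      then show False using that j as by (simp add: Y_def nth_append)
    qed
    then show ?thesis using pre j by auto
  qed
  have lenL: "length (L1 n Y \<pi>) = n" "length (L2 n Y \<pi>) = n" by (auto simp: L1_def L2_def)
  show "sum id (set (L1 n Y \<pi>)) < sum id \<alpha>" if d: "distinct (L1 n Y \<pi>)" and ne: "set (L1 n Y \<pi>) \<noteq> \<alpha>"
  proof -
    let ?P = "set (L1 n Y \<pi>)"
    have cP: "card ?P = n" using d lenL by (simp add: distinct_card)
    have c: "card (?P - \<alpha>) = card (\<alpha> - ?P)"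
      using card_Diff_subset_Int[of ?P \<alpha>] card_Diff_subset_Int[of \<alpha> ?P] cP ca fin by (simp add: Int_commute)
    have nonempty: "\<alpha> - ?P \<noteq> {}"
    proof
      assume "\<alpha> - ?P = {}"
      then have "\<alpha> \<subseteq> ?P" by auto
      then have "\<alpha> = ?P" using card_subset_eq[of ?P \<alpha>] cP ca by auto
      then show False using ne by simp
    qed
    have A: "x \<le> ?h - 1" if x: "x \<in> ?P - \<alpha>" for x
    proof -
      obtain j where j: "j < n" "x = Y ! \<pi> j" using x by (auto simp: L1_def)
      have jS: "j \<in> S"
      proof (rule ccontr)
        assume "j \<notin> S"
        then have "x = ?as ! j" "j < n" using j permutes_not_in[OF \<pi>] as by (auto simp: Y_def nth_append)
        then show False using x as nth_mem[of j ?as] by auto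
      qed
      then have pS: "\<pi> j \<in> S" using permutes_in_image[OF \<pi>] by simp
      have "\<not> \<pi> j < n" using high(2)[of "\<pi> j"] pS x j by (auto simp: S_def)
      then show ?thesis using low[OF pS] j by simp
    qed
    have B: "?h \<le> x" if x: "x \<in> \<alpha> - ?P" for x
    proof (rule ccontr)
      assume "\<not> ?h \<le> x"
      then obtain j where "j < n" "x = L1 n Y \<pi> ! j" using small[of x] x by auto
      then show False using x lenL by auto
    qed
    have "sum id (?P - \<alpha>) \<le> of_nat (card (?P - \<alpha>)) * (?h - 1)" by (rule sum_bounded_above) (use A in auto)
    also have "\<dots> < of_nat (card (\<alpha> - ?P)) * ?h" using nonempty fin unfolding c by (simp add: card_gt_0_iff algebra_simps)
    also have "\<dots> \<le> sum id (\<alpha> - ?P)" by (rule sum_bounded_below) (use B in auto)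
    finally have "sum id (?P - \<alpha>) < sum id (\<alpha> - ?P)" .
    moreover have "sum id ?P = sum id (?P - \<alpha>) + sum id (?P \<inter> \<alpha>)"
      using sum.Int_Diff[of ?P id \<alpha>] by simp
    moreover have "sum id \<alpha> = sum id (\<alpha> - ?P) + sum id (?P \<inter> \<alpha>)"
      using sum.Int_Diff[of \<alpha> id ?P] fin by (simp add: Int_commute)
    ultimately show ?thesis by simp
  qed
  show "const (of_int (sign \<pi>)) * (svar n (L1 n Y \<pi>) a * svar n (L2 n Y \<pi>) b) = var (\<alpha>, a) * var (\<beta>, b)"
    if s1: "set (L1 n Y \<pi>) = \<alpha>"
  proof -
    have d1: "distinct (L1 n Y \<pi>)" by (rule card_distinct) (simp add: s1 ca lenL)
    \<comment> \<open>An entry of \<beta> in the first factor would be an element of \<alpha> below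
      \<alpha>_i; such elements already occupy the fixed leading positions, so it would occur
      twice.\<close>
    have pr: "\<pi> j < n" if "j < n" for j
    proof (cases "j \<in> S")
      case False
      then show ?thesis using permutes_not_in[OF \<pi>] that by simp
    next
      case True
      show ?thesis
      proof (rule ccontr)
        assume "\<not> \<pi> j < n"
        then have "Y ! \<pi> j < ?h" using low[of "\<pi> j"] permutes_in_image[OF \<pi>] True by auto
        moreover have "Y ! \<pi> j \<in> \<alpha>" using s1 that by (auto simp: L1_def)
        ultimately obtain j' where j': "j' < i - 1" "j' < n" "Y ! \<pi> j = L1 n Y \<pi> ! j'" using small by blast
        have "L1 n Y \<pi> ! j = L1 n Y \<pi> ! j'" using j' that by (simp add: L1_def)
        then have "j = j'" using d1 lenL that j' by (simp add: nth_eq_iff_index_eq)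
        then show False using True j' by (auto simp: S_def)
      qed
    qed
    obtain p1 p2 where p: "p1 permutes {0..<n}" "p2 permutes {0..<n}" "sign \<pi> = sign p1 * sign p2"
      "\<And>j. j < n \<Longrightarrow> \<pi> j = p1 j" "\<And>j. j < n \<Longrightarrow> \<pi> (n + j) = n + p2 j"
      using sign_split[OF p2n pr] by blast
    have e1: "L1 n Y \<pi> = map (\<lambda>j. ?as ! p1 j) [0..<n]"
      unfolding L1_def using p(4) permutes_lt[OF p(1)] as by (auto simp: Y_def nth_append)
    have e2: "L2 n Y \<pi> = map (\<lambda>j. ?bs ! p2 j) [0..<n]"
      unfolding L2_def using p(5) permutes_lt[OF p(2)] as by (auto simp: Y_def nth_append)
    have g1: "sortsign (L1 n Y \<pi>) = of_int (sign p1)" unfolding e1 by (rule sortsign_permute[OF srt(1) as(3,2) p(1)])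
    have g2: "sortsign (L2 n Y \<pi>) = of_int (sign p2)" unfolding e2 by (rule sortsign_permute[OF srt(2) bs(3,2) p(2)])
    have "set (L2 n Y \<pi>) = (!) ?bs ` (p2 ` {0..<n})" unfolding e2 by auto
    also have "p2 ` {0..<n} = {0..<n}" by (rule permutes_image[OF p(2)])
    also have "(!) ?bs ` {0..<n} = \<beta>" using nth_image[of n ?bs] bs by simp
    finally have s2: "set (L2 n Y \<pi>) = \<beta>" .
    have d2: "distinct (L2 n Y \<pi>)" by (rule card_distinct) (use \<beta> s2 lenL in \<open>simp add: nsub_def\<close>)
    have "const (of_int (sign \<pi>)) * (const (of_int (sign p1)) * const (of_int (sign p2))) = 1"
      unfolding p(3) const_mult[symmetric] of_int_mult[symmetric] by (simp add: mult_ac)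
    then have "const (of_int (sign \<pi>)) * ((const (of_int (sign p1)) * var (\<alpha>, a)) * (const (of_int (sign p2)) * var (\<beta>, b))) = var (\<alpha>, a) * var (\<beta>, b)"
      by (metis (no_types, lifting) mult.assoc mult.left_commute mult_1)
    then show ?thesis using d1 d2 s1 s2 lenL g1 g2 by (simp add: svar_def)
  qed
qed

lemma svar_cases:
  assumes "set xs \<subseteq> angle n" "a \<le> d" shows "svar n xs a = 0 \<or> (distinct xs \<and> (set xs, a) \<in> LevPos d n \<and> svar n xs a = const (sortsign xs) * var (set xs, a))"
  using assms by (auto simp: svar_def LevPos_def nsub_def distinct_card)

text \<open>The progress made by an exchange, measured on the factor of smaller level: smaller
  level, or equal level and smaller entry sum. The total level is preserved.\<close>

definition lower_pairs :: "nat \<Rightarrow> nat \<Rightarrow> int set \<Rightarrow> nat \<Rightarrow> nat \<Rightarrow> pol set" where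
  "lower_pairs d n \<alpha> a b = {var x * var y |x y. x \<in> LevPos d n \<and> y \<in> LevPos d n \<and> snd x \<le> snd y \<and>
     snd x + snd y = a + b \<and> (snd x < a \<or> snd x = a \<and> sum id (fst x) < sum id \<alpha>)}"

text \<open>Among the level pairs with sum a + b, the weights annihilate those whose second level b'
  satisfies a \<le> b' < b. Apart from (a, b) itself, each remaining pair has a member below
  a.\<close>

lemma straighten_grassmannian:
  assumes \<alpha>: "\<alpha> \<in> nsub n" and \<beta>: "\<beta> \<in> nsub n" and ab: "a \<le> b" "b \<le> d"
    and i: "1 \<le> i" "i + (b - a) \<le> n" and lt: "elt \<beta> (b - a + i) < elt \<alpha> i"
  shows "var (\<alpha>, a) * var (\<beta>, b) \<in> modspan d n (lower_pairs d n \<alpha> a b)"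
proof -
  define D where "D = b - a"
  define Y where "Y = sorted_list_of_set \<alpha> @ sorted_list_of_set \<beta>"
  define S where "S = {i - 1..<n + D + i}"
  \<comment> \<open>The zeros of the weight. There are b - a of them, exactly as many as n + D + 1
    alternated columns allow.\<close>
  define xs where "xs = map (of_nat :: nat \<Rightarrow> complex) [a..<b]"
  define l where "l b' = (\<Prod>x\<leftarrow>xs. of_nat b' - x)" for b' :: nat
  define T where "T \<pi> a' b' = const (of_int (sign \<pi>)) * (svar n (L1 n Y \<pi>) a' * svar n (L2 n Y \<pi>) b')" for \<pi> a' b'
  let ?P = "{\<pi>. \<pi> permutes S}"
  let ?B = "lower_pairs d n \<alpha> a b"
  have iD: "i + D \<le> n" using i by (simp add: D_def)
  have ltD: "elt \<beta> (D + i) < elt \<alpha> i" using lt by (simp add: D_def)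
  note SE = straighten_exchange[OF \<alpha> \<beta> i(1) iD ltD, folded Y_def S_def]
  have ang: "\<alpha> \<subseteq> angle n" "\<beta> \<subseteq> angle n" using \<alpha> \<beta> by (auto simp: nsub_def)
  have lenY: "length Y = 2 * n" "set Y \<subseteq> angle n" using nsub_sorted[OF \<alpha>] nsub_sorted[OF \<beta>] ang by (auto simp: Y_def)
  have S2: "S \<subseteq> {..<2 * n}" "card S = n + Suc (length xs)" using i by (auto simp: S_def xs_def D_def)
  have fS: "finite S" by (simp add: S_def)
  let ?I = "{p\<in>{..d} \<times> {..d}. fst p + snd p = a + b}"
  let ?t = "\<lambda>p. const (l (snd p)) * (\<Sum>\<pi>\<in>?P. T \<pi> (fst p) (snd p))"
  have rel: "(\<Sum>p\<in>?I. ?t p) \<in> modspan d n ?B"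
    using quadratic_in_Iid[OF lenY S2, of d "a + b"] unfolding T_def l_def
    by (intro modspan.ideal Iid_Jid)
  have l0: "l b' = 0" if "a \<le> b'" "b' < b" for b'
    unfolding l_def xs_def using that by (auto simp: prod_list_zero_iff intro!: image_eqI[of _ _ b'])
  have lb: "l b \<noteq> 0" unfolding l_def xs_def by (auto simp: prod_list_zero_iff)
  have T0: "T \<pi> a' b' \<in> modspan d n ?B" if p: "\<pi> \<in> ?P" and a': "a' \<le> d" "b' \<le> d" "a' + b' = a + b" and ne: "a' < a \<or> b' < a" for \<pi> a' b'
  proof -
    have p': "\<pi> permutes S" using p by simp
    note sub = SE(3,4)[OF p']
    show ?thesis
    proof (cases "svar n (L1 n Y \<pi>) a' = 0 \<or> svar n (L2 n Y \<pi>) b' = 0")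
      case True
      then show ?thesis by (auto simp: T_def modspan_0)
    next
      case False
      let ?x = "(set (L1 n Y \<pi>), a')" and ?y = "(set (L2 n Y \<pi>), b')"
      have xy: "?x \<in> LevPos d n" "?y \<in> LevPos d n" "svar n (L1 n Y \<pi>) a' = const (sortsign (L1 n Y \<pi>)) * var ?x"
         "svar n (L2 n Y \<pi>) b' = const (sortsign (L2 n Y \<pi>)) * var ?y"
        using svar_cases[OF sub(1) a'(1)] svar_cases[OF sub(2) a'(2)] False by auto
      have "var ?x * var ?y \<in> ?B"
      proof (cases "a' < a")
        case True
        then have "snd ?x \<le> snd ?y" using a' ab by simp
        then show ?thesis unfolding lower_pairs_def using xy a' True by auto
      next
        case False
        then have "b' < a" using ne by simp
        then have "snd ?y \<le> snd ?x" "snd ?y + snd ?x = a + b" using a' ab by auto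
        then have "var ?y * var ?x \<in> ?B" unfolding lower_pairs_def using xy \<open>b' < a\<close>
          by (intro CollectI exI[of _ ?y] exI[of _ ?x]) auto
        then show ?thesis by (simp only: mult.commute)
      qed
      then have "const (of_int (sign \<pi>)) * (const (sortsign (L1 n Y \<pi>)) * (const (sortsign (L2 n Y \<pi>)) * (var ?x * var ?y))) \<in> modspan d n ?B"
        by (intro modspan.scale modspan.gen)
      moreover have "T \<pi> a' b' = const (of_int (sign \<pi>)) * (const (sortsign (L1 n Y \<pi>)) * (const (sortsign (L2 n Y \<pi>)) * (var ?x * var ?y)))"
        unfolding T_def xy by (simp only: mult_ac)
      ultimately show ?thesis by simp
    qed
  qed
  have inI: "(a, b) \<in> ?I" using ab by auto
  have finI: "finite ?I" by (rule finite_subset[of _ "{..d} \<times> {..d}"]) auto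
  have others: "?t p \<in> modspan d n ?B" if p: "p \<in> ?I - {(a, b)}" for p
  proof (cases "a \<le> snd p \<and> snd p < b")
    case True
    then show ?thesis using l0 by (simp add: modspan_0)
  next
    case False
    then have "fst p < a \<or> snd p < a" using p by (cases p) auto
    then show ?thesis using p by (intro modspan.scale modspan_sum T0) auto
  qed
  have "(\<Sum>p\<in>?I. ?t p) = ?t (a, b) + (\<Sum>p\<in>?I - {(a, b)}. ?t p)" by (rule sum.remove[OF finI inI])
  then have main: "const (l b) * (\<Sum>\<pi>\<in>?P. T \<pi> a b) \<in> modspan d n ?B"
    using modspan_diff[OF rel modspan_sum[of "?I - {(a, b)}" ?t, OF others]] by simp
  let ?PA = "{\<pi> \<in> ?P. set (L1 n Y \<pi>) = \<alpha>}"
  have finP: "finite ?P" by (rule finite_permutations[OF fS])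
  have rest: "T \<pi> a b \<in> modspan d n ?B" if p: "\<pi> \<in> ?P - ?PA" for \<pi>
  proof -
    have p': "\<pi> permutes S" and ne: "set (L1 n Y \<pi>) \<noteq> \<alpha>" using p by auto
    note sub = SE(3,4)[OF p']
    show ?thesis
    proof (cases "svar n (L1 n Y \<pi>) a = 0 \<or> svar n (L2 n Y \<pi>) b = 0")
      case True
      then show ?thesis by (auto simp: T_def modspan_0)
    next
      case False
      let ?x = "(set (L1 n Y \<pi>), a)" and ?y = "(set (L2 n Y \<pi>), b)"
      have xy: "?x \<in> LevPos d n" "?y \<in> LevPos d n" "svar n (L1 n Y \<pi>) a = const (sortsign (L1 n Y \<pi>)) * var ?x"
         "svar n (L2 n Y \<pi>) b = const (sortsign (L2 n Y \<pi>)) * var ?y" "distinct (L1 n Y \<pi>)"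
        using svar_cases[OF sub(1), of a d] svar_cases[OF sub(2), of b d] False ab by auto
      have "sum id (set (L1 n Y \<pi>)) < sum id \<alpha>" by (rule SE(2)[OF p' xy(5) ne])
      then have "var ?x * var ?y \<in> ?B" unfolding lower_pairs_def using xy ab
        by (intro CollectI exI[of _ ?x] exI[of _ ?y]) auto
      then have "const (of_int (sign \<pi>)) * (const (sortsign (L1 n Y \<pi>)) * (const (sortsign (L2 n Y \<pi>)) * (var ?x * var ?y))) \<in> modspan d n ?B"
        by (intro modspan.scale modspan.gen)
      moreover have "T \<pi> a b = const (of_int (sign \<pi>)) * (const (sortsign (L1 n Y \<pi>)) * (const (sortsign (L2 n Y \<pi>)) * (var ?x * var ?y)))"
        unfolding T_def xy by (simp only: mult_ac)
      ultimately show ?thesis by simp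
    qed
  qed
  let ?v = "var (\<alpha>, a) * var (\<beta>, b)"
  have "(\<Sum>\<pi>\<in>?P. T \<pi> a b) = (\<Sum>\<pi>\<in>?P - ?PA. T \<pi> a b) + (\<Sum>\<pi>\<in>?PA. T \<pi> a b)"
    by (rule sum.subset_diff[OF _ finP]) auto
  also have "(\<Sum>\<pi>\<in>?PA. T \<pi> a b) = (\<Sum>\<pi>\<in>?PA. ?v)"
    using SE(1) unfolding T_def by (intro sum.cong refl) auto
  also have "\<dots> = const (of_nat (card ?PA)) * ?v"
  proof -
    have fin: "(\<Sum>x\<in>F. ?v) = const (of_nat (card F)) * ?v" if "finite F" for F :: "(nat \<Rightarrow> nat) set"
      using that by (induction F rule: finite_induct) (auto simp: const_add algebra_simps)
    have "finite ?PA" using finP by (rule rev_finite_subset) auto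
    then show ?thesis by (rule fin)
  qed
  finally have eq: "(\<Sum>\<pi>\<in>?P. T \<pi> a b) = (\<Sum>\<pi>\<in>?P - ?PA. T \<pi> a b) + const (of_nat (card ?PA)) * ?v" .
  \<comment> \<open>The identity is one of the permutations restoring \<alpha>, so the multiplicity
    of the product is a positive integer.\<close>
  have "L1 n Y id = sorted_list_of_set \<alpha>"
    using nsub_sorted[OF \<alpha>] by (intro nth_equalityI) (auto simp: L1_def Y_def nth_append)
  then have "id \<in> ?PA" using nsub_sorted[OF \<alpha>] permutes_id by auto
  moreover have "finite ?PA" using finP by (rule rev_finite_subset) auto
  ultimately have c0: "card ?PA \<noteq> 0" unfolding card_eq_0_iff by blast
  have "const (l b) * (\<Sum>\<pi>\<in>?P - ?PA. T \<pi> a b) \<in> modspan d n ?B"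
    using rest by (intro modspan.scale modspan_sum)
  from modspan_diff[OF main this] have "const (l b) * (const (of_nat (card ?PA)) * ?v) \<in> modspan d n ?B"
    unfolding eq by (simp add: distrib_left)
  then have "const (1 / (l b * of_nat (card ?PA))) * (const (l b) * (const (of_nat (card ?PA)) * ?v)) \<in> modspan d n ?B"
    by (rule modspan.scale)
  moreover have "const (1 / (l b * of_nat (card ?PA))) * (const (l b) * (const (of_nat (card ?PA)) * ?v)) = ?v"
    unfolding mult.assoc[symmetric] const_mult[symmetric] using lb c0 by simp
  ultimately show ?thesis by simp
qed

subsection \<open>Consequences of the linear relations\<close>

lemma inversions_Cons: "inversions (x # ys) = length (filter (\<lambda>y. y < x) ys) + inversions ys"
proof -
  let ?I = "\<lambda>zs :: int list. {(j, k). j < k \<and> k < length zs \<and> zs ! k < zs ! j}"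
  have fin: "finite (?I zs)" for zs
    by (rule finite_subset[of _ "{..<length zs} \<times> {..<length zs}"]) auto
  have "?I (x # ys) = (\<lambda>k. (0, Suc k)) ` {k. k < length ys \<and> ys ! k < x} \<union> map_prod Suc Suc ` ?I ys"
  proof (rule Set.set_eqI)
    fix p show "p \<in> ?I (x # ys) \<longleftrightarrow> p \<in> (\<lambda>k. (0, Suc k)) ` {k. k < length ys \<and> ys ! k < x} \<union> map_prod Suc Suc ` ?I ys"
    proof (cases p)
      case (Pair j k)
      show ?thesis unfolding Pair by (cases j; cases k) (auto simp: image_iff)
    qed
  qed
  moreover have "(\<lambda>k. (0, Suc k)) ` {k. k < length ys \<and> ys ! k < x} \<inter> map_prod Suc Suc ` ?I ys = {}" by auto
  moreover have "card ((\<lambda>k. (0::nat, Suc k)) ` {k. k < length ys \<and> ys ! k < x}) = length (filter (\<lambda>y. y < x) ys)"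
    by (subst card_image) (auto simp: inj_on_def length_filter_conv_card)
  moreover have "card (map_prod Suc Suc ` ?I ys) = card (?I ys)"
    by (rule card_image) (auto simp: inj_on_def)
  ultimately show ?thesis unfolding inversions_def
    by (simp add: card_Un_disjoint fin)
qed

lemma inversions_sorted: "sorted xs \<Longrightarrow> inversions xs = 0"
proof (induction xs)
  case (Cons x xs)
  then have "filter (\<lambda>y. y < x) xs = []" by (auto simp: filter_empty_conv)
  then show ?case using Cons by (simp add: inversions_Cons)
qed (simp add: inversions_def)

text \<open>Elements of \<beta> below \<open>- int i\<close> are inverted with both leading entries
  and do not affect the sign; those strictly between are inverted with one.\<close>

lemma sortsign_pair:
  assumes f: "finite \<beta>" and "int i \<notin> \<beta>" "- int i \<notin> \<beta>" "1 \<le> i"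
  shows "sortsign ([- int i, int i] @ sorted_list_of_set \<beta>) = (-1) ^ card {b \<in> \<beta>. - int i < b \<and> b < int i}"
proof -
  let ?bs = "sorted_list_of_set \<beta>"
  have l: "length (filter P ?bs) = card {b \<in> \<beta>. P b}" for P
  proof -
    have "length (filter P ?bs) = card (set (filter P ?bs))" by (rule distinct_card[symmetric]) simp
    then show ?thesis using f by simp
  qed
  have "{b \<in> \<beta>. b < int i} = {b \<in> \<beta>. b < - int i} \<union> {b \<in> \<beta>. - int i < b \<and> b < int i}" using assms by (auto simp: not_less order.strict_iff_order)
  then have "card {b \<in> \<beta>. b < int i} = card {b \<in> \<beta>. b < - int i} + card {b \<in> \<beta>. - int i < b \<and> b < int i}"
    using f by (simp add: card_Un_disjoint disjoint_iff)
  then have "inversions ([- int i, int i] @ ?bs) = 2 * card {b \<in> \<beta>. b < - int i} + card {b \<in> \<beta>. - int i < b \<and> b < int i}"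
    using assms(4) by (simp add: inversions_Cons l inversions_sorted)
  then show ?thesis by (simp add: sortsign_def power_add power_mult)
qed

text \<open>All subsets with a fixed part S0 containing no pair of opposite elements: they have the form
  G A, where A is an m-element subset of the set T of the 2m indices not occurring in S0.  The sign in q makes
  all signs in the linear relations equal.\<close>

locale weight_space =
  fixes d n a :: nat and S0 :: "int set" and T :: "nat set" and m :: nat
  assumes ad: "a \<le> d" and T: "T \<subseteq> {1..n}" "card T = 2 * m" and S0: "S0 \<subseteq> angle n" "card S0 + 2 * m = n"
    and dis: "\<And>i. i \<in> T \<Longrightarrow> int i \<notin> S0 \<and> - int i \<notin> S0"
    and single: "\<And>i. i \<in> {1..n} - T \<Longrightarrow> (int i \<in> S0) \<noteq> (- int i \<in> S0)"
begin

definition G :: "nat set \<Rightarrow> int set" where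
  "G A = S0 \<union> int ` A \<union> (\<lambda>i. - int i) ` A"

definition sg :: "nat \<Rightarrow> complex" where
  "sg i = (-1) ^ card {x \<in> S0. - int i < x \<and> x < int i}"

definition q :: "nat set \<Rightarrow> pol" where
  "q A = const (\<Prod>i\<in>A. sg i) * var (G A, a)"

lemma finT: "finite T" using T(1) finite_subset by blast
lemma finS0: "finite S0" using S0(1) finite_subset[OF _ finite_angle] by blast

lemma T_pos: "i \<in> T \<Longrightarrow> 1 \<le> i \<and> i \<le> n" using T(1) by auto

lemma sg_cases: "sg i = 1 \<or> sg i = -1"
  unfolding sg_def by (cases "even (card {x \<in> S0. - int i < x \<and> x < int i})") auto

lemma sg_prod_cases: "(\<Prod>i\<in>A. sg i) = 1 \<or> (\<Prod>i\<in>A. sg i) = -1"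
proof (induction A rule: infinite_finite_induct)
  case (insert x F) then show ?case using sg_cases[of x] by auto
qed auto

lemma finite_G: "A \<subseteq> T \<Longrightarrow> finite (G A)"
  using finT finS0 finite_subset by (auto simp: G_def)

lemma mem_G:
  assumes "A \<subseteq> T" "i \<in> {1..n}"
  shows "int i \<in> G A \<longleftrightarrow> i \<in> A \<or> int i \<in> S0" "- int i \<in> G A \<longleftrightarrow> i \<in> A \<or> - int i \<in> S0"
  using assms T_pos by (auto simp: G_def)

text \<open>Opposite elements cancel. Thus the linear relations do not disturb the entry sum on
  which the straightening induction runs.\<close>

lemma sum_G:
  assumes "A \<subseteq> T" shows "sum id (G A) = sum id S0"
proof -
  have fA: "finite A" using assms finT finite_subset by blast
  have d1: "S0 \<inter> int ` A = {}" "(S0 \<union> int ` A) \<inter> (\<lambda>i. - int i) ` A = {}"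
    using assms dis T_pos by (auto) (force+)
  have "sum id (G A) = sum id S0 + sum id (int ` A) + sum id ((\<lambda>i. - int i) ` A)"
    unfolding G_def using fA finS0 d1 by (simp add: sum.union_disjoint)
  also have "sum id (int ` A) = (\<Sum>i\<in>A. int i)" by (simp add: sum.reindex inj_on_def)
  also have "sum id ((\<lambda>i. - int i) ` A) = - (\<Sum>i\<in>A. int i)" by (simp add: sum.reindex inj_on_def sum_negf)
  finally show ?thesis by simp
qed

lemma card_G:
  assumes "A \<subseteq> T" shows "card (G A) = card S0 + 2 * card A"
proof -
  have fA: "finite A" using assms finT finite_subset by blast
  have d1: "S0 \<inter> int ` A = {}" "(S0 \<union> int ` A) \<inter> (\<lambda>i. - int i) ` A = {}"
    using assms dis T_pos by (auto) (force+)
  have "card (G A) = card S0 + card (int ` A) + card ((\<lambda>i. - int i) ` A)"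
    unfolding G_def using fA finS0 d1 by (simp add: card_Un_disjoint)
  then show ?thesis by (simp add: card_image inj_on_def)
qed

lemma G_angle: "A \<subseteq> T \<Longrightarrow> G A \<subseteq> angle n"
  using S0(1) T_pos by (auto simp: G_def)

lemma G_nsub: "A \<subseteq> T \<Longrightarrow> card A = m \<Longrightarrow> G A \<in> nsub n"
  using G_angle card_G S0 by (simp add: nsub_def)

text \<open>The linear form for \<open>G C\<close>. The opposite pairs in \<open>G C\<close> put an
  even number of elements between -i and i, so the sign depends on \<open>S0\<close> alone and is
  absorbed by \<open>q\<close>.\<close>

lemma basic_relation:
  assumes C: "C \<subseteq> T" "card C + 1 = m"
  shows "(\<Sum>i\<in>T - C. q (insert i C)) \<in> Jid d n"
proof -
  have fC: "finite C" using C finT finite_subset by blast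
  have idx: "{i \<in> {1..n}. int i \<notin> G C \<and> - int i \<notin> G C} = T - C"
  proof (rule Set.set_eqI)
    fix i
    show "i \<in> {i \<in> {1..n}. int i \<notin> G C \<and> - int i \<notin> G C} \<longleftrightarrow> i \<in> T - C"
    proof (cases "i \<in> {1..n}")
      case True
      then show ?thesis using mem_G[OF C(1) True] dis[of i] single[of i] by auto
    next
      case False
      then show ?thesis using T(1) by auto
    qed
  qed
  have gen: "lform n (G C) a \<in> Jid d n"
  proof (rule Lgens_Jid)
    have "card (G C) + 2 = n" using card_G[OF C(1)] C(2) S0(2) by simp
    then show "lform n (G C) a \<in> Lgens d n" unfolding Lgens_def using G_angle[OF C(1)] ad by auto
  qed
  have sgn: "sortsign ([- int i, int i] @ sorted_list_of_set (G C)) = sg i" if i: "i \<in> T - C" for i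
  proof -
    have iT: "i \<in> {1..n}" "i \<in> T" "i \<notin> C" using i T(1) by auto
    have ni: "int i \<notin> G C" "- int i \<notin> G C" using mem_G[OF C(1) iT(1)] dis[OF iT(2)] iT(3) by auto
    let ?C = "{c \<in> C. c < i}"
    have e: "{b \<in> G C. - int i < b \<and> b < int i} = {x \<in> S0. - int i < x \<and> x < int i} \<union> int ` ?C \<union> (\<lambda>c. - int c) ` ?C"
      using iT C(1) T_pos by (auto simp: G_def)
    have d1: "{x \<in> S0. - int i < x \<and> x < int i} \<inter> int ` ?C = {}"
      "({x \<in> S0. - int i < x \<and> x < int i} \<union> int ` ?C) \<inter> (\<lambda>c. - int c) ` ?C = {}"
      using C(1) dis T_pos by (auto) (force+)
    have "card {b \<in> G C. - int i < b \<and> b < int i} = card {x \<in> S0. - int i < x \<and> x < int i} + card (int ` ?C) + card ((\<lambda>c. - int c) ` ?C)"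
      unfolding e using fC finS0 d1 by (simp add: card_Un_disjoint)
    also have "\<dots> = card {x \<in> S0. - int i < x \<and> x < int i} + 2 * card ?C"
      by (simp add: card_image inj_on_def)
    finally show ?thesis using sortsign_pair[OF finite_G[OF C(1)] ni] iT by (simp add: sg_def power_add power_mult)
  qed
  have "const (\<Prod>i\<in>C. sg i) * lform n (G C) a = (\<Sum>i\<in>T - C. q (insert i C))"
    unfolding lform_def idx sum_distrib_left
  proof (rule sum.cong[OF refl])
    fix i assume i: "i \<in> T - C"
    have G: "G C \<union> {- int i, int i} = G (insert i C)" by (auto simp: G_def)
    have "(\<Prod>i\<in>insert i C. sg i) = (\<Prod>i\<in>C. sg i) * sg i" using i fC by (simp add: mult.commute)
    then show "const (\<Prod>i\<in>C. sg i) * (const (sortsign ([- int i, int i] @ sorted_list_of_set (G C))) * var (G C \<union> {- int i, int i}, a)) = q (insert i C)"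
      unfolding sgn[OF i] G q_def by (simp add: const_mult mult.assoc)
  qed
  then show ?thesis using Jid_const_mult[OF gen] by metis
qed

definition fam :: "nat set \<Rightarrow> nat set \<Rightarrow> nat set set" where
  "fam C E = {A. A \<subseteq> T \<and> card A = m \<and> C \<subseteq> A \<and> A \<inter> E = {}}"

lemma fin_fam: "finite (fam C E)"
  by (rule finite_subset[of _ "Pow T"]) (use finT in \<open>auto simp: fam_def\<close>)

text \<open>Summing over all ways to enlarge \<open>C\<close> by one element counts each member of
  the family m - card C times.\<close>

lemma relation_containing:
  assumes "C \<subseteq> T" "card C < m"
  shows "(\<Sum>A\<in>fam C {}. q A) \<in> Jid d n"
  using assms
proof (induction "m - card C" arbitrary: C rule: less_induct)
  case less
  have fC: "finite C" using less.prems finT finite_subset by blast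
  show ?case
  proof (cases "card C + 1 = m")
    case True
    have "fam C {} = (\<lambda>i. insert i C) ` (T - C)"
    proof (rule Set.set_eqI)
      fix A show "A \<in> fam C {} \<longleftrightarrow> A \<in> (\<lambda>i. insert i C) ` (T - C)"
      proof
        assume A: "A \<in> fam C {}"
        then have fA: "finite A" "C \<subseteq> A" "card A = m" "A \<subseteq> T" using finT finite_subset by (auto simp: fam_def)
        then have "card (A - C) = 1" using True fC by (simp add: card_Diff_subset)
        then obtain i where "A - C = {i}" by (auto simp: card_1_singleton_iff)
        then have "A = insert i C" "i \<in> T - C" using fA by auto
        then show "A \<in> (\<lambda>i. insert i C) ` (T - C)" by blast
      next
        assume "A \<in> (\<lambda>i. insert i C) ` (T - C)"
        then show "A \<in> fam C {}" using less.prems(1) True fC by (auto simp: fam_def)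
      qed
    qed
    moreover have "inj_on (\<lambda>i. insert i C) (T - C)" by (auto simp: inj_on_def)
    ultimately have "(\<Sum>A\<in>fam C {}. q A) = (\<Sum>i\<in>T - C. q (insert i C))" by (simp add: sum.reindex)
    then show ?thesis using basic_relation[OF less.prems(1) True] by simp
  next
    case False
    then have lt: "card C + 1 < m" using less.prems(2) by simp
    have ih: "(\<Sum>A\<in>fam (insert e C) {}. q A) \<in> Jid d n" if e: "e \<in> T - C" for e
      by (rule less.hyps) (use e fC lt less.prems in auto)
    have "(\<Sum>e\<in>T - C. \<Sum>A\<in>fam (insert e C) {}. q A) = (\<Sum>e\<in>T - C. \<Sum>A\<in>fam C {}. if e \<in> A then q A else 0)"
    proof (rule sum.cong[OF refl])
      fix e
      have "fam (insert e C) {} = {A \<in> fam C {}. e \<in> A}" by (auto simp: fam_def)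
      then show "(\<Sum>A\<in>fam (insert e C) {}. q A) = (\<Sum>A\<in>fam C {}. if e \<in> A then q A else 0)"
        using fin_fam by (simp add: sum.inter_filter)
    qed
    also have "\<dots> = (\<Sum>A\<in>fam C {}. \<Sum>e\<in>T - C. if e \<in> A then q A else 0)" by (rule sum.swap)
    also have "\<dots> = (\<Sum>A\<in>fam C {}. const (of_nat (m - card C)) * q A)"
    proof (rule sum.cong[OF refl])
      fix A assume "A \<in> fam C {}"
      then have A: "C \<subseteq> A" "card A = m" "A \<subseteq> T" by (auto simp: fam_def)
      then have "{e \<in> T - C. e \<in> A} = A - C" by auto
      moreover have "card (A - C) = m - card C" using A fC by (simp add: card_Diff_subset)
      moreover have "(\<Sum>e\<in>X. q A) = const (of_nat (card X)) * q A" if "finite X" for X :: "nat set"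
        using that by (induction X rule: finite_induct) (auto simp: const_add algebra_simps)
      moreover have "finite (A - C)" using A finT finite_subset by blast
      ultimately show "(\<Sum>e\<in>T - C. if e \<in> A then q A else 0) = const (of_nat (m - card C)) * q A"
        using finT by (simp add: sum.inter_filter[symmetric] del: sum_constant)
    qed
    also have "\<dots> = const (of_nat (m - card C)) * (\<Sum>A\<in>fam C {}. q A)" by (simp add: sum_distrib_left)
    finally have "const (of_nat (m - card C)) * (\<Sum>A\<in>fam C {}. q A) \<in> Jid d n"
      using Jid_sum[of "T - C" "\<lambda>e. \<Sum>A\<in>fam (insert e C) {}. q A", OF ih] by simp
    then have "const (1 / of_nat (m - card C)) * (const (of_nat (m - card C)) * (\<Sum>A\<in>fam C {}. q A)) \<in> Jid d n"
      by (rule Jid_const_mult)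
    moreover have "const (1 / of_nat (m - card C)) * (const (of_nat (m - card C)) * (\<Sum>A\<in>fam C {}. q A)) = (\<Sum>A\<in>fam C {}. q A)"
      unfolding mult.assoc[symmetric] const_mult[symmetric] using lt by simp
    ultimately show ?thesis by simp
  qed
qed

lemma fam_split:
  assumes "e \<notin> C" "e \<notin> E"
  shows "(\<Sum>A\<in>fam C E. q A) = (\<Sum>A\<in>fam (insert e C) E. q A) + (\<Sum>A\<in>fam C (insert e E). q A)"
proof -
  have "fam C E = fam (insert e C) E \<union> fam C (insert e E)" using assms by (auto simp: fam_def)
  moreover have "fam (insert e C) E \<inter> fam C (insert e E) = {}" by (auto simp: fam_def)
  ultimately show ?thesis by (simp add: sum.union_disjoint fin_fam)
qed

text \<open>Sets avoiding e are obtained by subtracting those containing e; a forbidden element uses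
  up the bound m just as a required one.\<close>

lemma relation_between:
  assumes "finite E" "C \<subseteq> T" "E \<subseteq> T" "C \<inter> E = {}" "card C + card E < m"
  shows "(\<Sum>A\<in>fam C E. q A) \<in> Jid d n"
  using assms
proof (induction E arbitrary: C rule: finite_induct)
  case empty
  then show ?case using relation_containing by simp
next
  case (insert e E)
  have fC: "finite C" using insert.prems(1) finT finite_subset by blast
  have "(\<Sum>A\<in>fam C E. q A) \<in> Jid d n" by (rule insert.IH) (use insert in auto)
  moreover have "(\<Sum>A\<in>fam (insert e C) E. q A) \<in> Jid d n" by (rule insert.IH) (use insert fC in auto)
  moreover have "(\<Sum>A\<in>fam C (insert e E). q A) = (\<Sum>A\<in>fam C E. q A) - (\<Sum>A\<in>fam (insert e C) E. q A)"
    using fam_split[of e C E] insert by auto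
  ultimately show ?case by (simp add: Jid_diff)
qed

text \<open>The elements of \<open>A\<close> are turned from required into forbidden one at a time.
  At each change the other m - 1 conditions define a relation, whose two parts have opposite
  classes; at the end only \<open>T - A\<close> is left.\<close>

lemma complement_relation:
  assumes A: "A \<subseteq> T" "card A = m"
  shows "q (T - A) - const ((-1) ^ m) * q A \<in> Jid d n"
proof -
  have fA: "finite A" using A finT finite_subset by blast
  have "(\<Sum>X\<in>fam (A - K) K. q X) - const ((-1) ^ card K) * q A \<in> Jid d n" if "K \<subseteq> A" for K
  proof -
    have "finite K" using that fA finite_subset by blast
    then show ?thesis using that
    proof (induction K rule: finite_induct)
      case empty
      have "fam A {} = {A}"
      proof (rule Set.set_eqI)
        fix X
        have "A = X" if "X \<subseteq> T" "card X = m" "A \<subseteq> X"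
          using card_subset_eq[of X A] that A(2) finite_subset[OF _ finT] by auto
        then show "X \<in> fam A {} \<longleftrightarrow> X \<in> {A}" using A by (auto simp: fam_def)
      qed
      then show ?case by (simp add: Jid_0)
    next
      case (insert x K)
      let ?C = "A - insert x K"
      have C: "insert x ?C = A - K" using insert by auto
      have "card (?C \<union> K) = card ?C + card K" using fA insert by (intro card_Un_disjoint) auto
      moreover have "?C \<union> K = A - {x}" using insert by auto
      moreover have "Suc (card (A - {x})) = m" using card_Suc_Diff1[OF fA, of x] insert.prems A(2) by simp
      ultimately have "card ?C + card K < m" by simp
      then have r: "(\<Sum>X\<in>fam ?C K. q X) \<in> Jid d n"
        using insert A by (intro relation_between) auto
      have "(\<Sum>X\<in>fam ?C K. q X) = (\<Sum>X\<in>fam (A - K) K. q X) + (\<Sum>X\<in>fam ?C (insert x K). q X)"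
        using fam_split[of x ?C K] insert unfolding C by simp
      then have "(\<Sum>X\<in>fam ?C (insert x K). q X) - const ((-1) ^ card (insert x K)) * q A =
         (\<Sum>X\<in>fam ?C K. q X) - ((\<Sum>X\<in>fam (A - K) K. q X) - const ((-1) ^ card K) * q A)"
        using insert by (simp add: const_uminus algebra_simps)
      then show ?case using r insert by (simp add: Jid_diff)
    qed
  qed
  from this[of A] have "(\<Sum>X\<in>fam {} A. q X) - const ((-1) ^ m) * q A \<in> Jid d n" using A by simp
  moreover have "fam {} A = {T - A}"
  proof (rule Set.set_eqI)
    fix X
    have c: "card (T - A) = m" using A T fA by (simp add: card_Diff_subset)
    show "X \<in> fam {} A \<longleftrightarrow> X \<in> {T - A}"
    proof
      assume "X \<in> fam {} A"
      then have "X \<subseteq> T - A" "card X = m" by (auto simp: fam_def)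
      then have "X = T - A" using card_subset_eq[of "T - A" X] c finT by auto
      then show "X \<in> {T - A}" by simp
    next
      assume "X \<in> {T - A}"
      then show "X \<in> fam {} A" using c by (auto simp: fam_def)
    qed
  qed
  ultimately show ?thesis by simp
qed

text \<open>The Northeast condition for \<open>G A\<close>: indices outside \<open>T\<close>
  contribute equally to \<open>nneg\<close> and \<open>npos\<close>.\<close>

definition ballot :: "nat set \<Rightarrow> bool" where
  "ballot A \<longleftrightarrow> (\<forall>j. card {i \<in> T - A. j < i} \<le> card {i \<in> A. j < i})"

text \<open>If the condition fails at j, requiring the elements of \<open>A\<close> beyond j and
  forbidding the missing ones up to j imposes fewer than m conditions. Every other set in the
  resulting relation trades elements up to j for larger ones, so its sum increases.\<close>

lemma ballot_span:
  assumes "A \<subseteq> T" "card A = m"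
  shows "q A \<in> modspan d n {q B |B. B \<subseteq> T \<and> card B = m \<and> ballot B}"
  using assms
proof (induction "\<Sum>T - \<Sum>A" arbitrary: A rule: less_induct)
  case less
  let ?M = "modspan d n {q B |B. B \<subseteq> T \<and> card B = m \<and> ballot B}"
  have fA: "finite A" using less.prems finT finite_subset by blast
  show ?case
  proof (cases "ballot A")
    case True
    then show ?thesis using less.prems by (intro modspan.gen) auto
  next
    case False
    then obtain j where j: "card {i \<in> A. j < i} < card {i \<in> T - A. j < i}" by (auto simp: ballot_def not_le)
    let ?C = "{i \<in> A. j < i}" and ?E = "{i \<in> T - A. i \<le> j}"
    have "card {i \<in> T - A. j < i} + card ?E = card ({i \<in> T - A. j < i} \<union> ?E)"
      using finT by (intro card_Un_disjoint[symmetric]) auto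
    also have "{i \<in> T - A. j < i} \<union> ?E = T - A" by auto
    also have "card (T - A) = m" using less.prems T fA by (simp add: card_Diff_subset)
    finally have "card ?C + card ?E < m" using j by simp
    then have r: "(\<Sum>X\<in>fam ?C ?E. q X) \<in> Jid d n"
      using less.prems finT by (intro relation_between) auto
    have Af: "A \<in> fam ?C ?E" using less.prems by (auto simp: fam_def)
    have rest: "q X \<in> ?M" if X: "X \<in> fam ?C ?E - {A}" for X
    proof (rule less.hyps)
      have X': "X \<subseteq> T" "card X = m" "?C \<subseteq> X" "X \<inter> ?E = {}" "X \<noteq> A" using X by (auto simp: fam_def)
      show "X \<subseteq> T" "card X = m" using X' by auto
      have fX: "finite X" using X' finT finite_subset by blast
      have c: "card (X - A) = card (A - X)"
        using card_Diff_subset_Int[of X A] card_Diff_subset_Int[of A X] X' less.prems fA fX by (simp add: Int_commute)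
      have ne: "A - X \<noteq> {}"
      proof
        assume "A - X = {}"
        then have "A \<subseteq> X" by auto
        then show False using card_subset_eq[OF fX, of A] X' less.prems by auto
      qed
      have "sum id (A - X) \<le> of_nat (card (A - X)) * j" by (rule sum_bounded_above) (use X'(3) in auto)
      also have "\<dots> < of_nat (card (X - A)) * (j + 1)" using ne fA unfolding c by (simp add: card_gt_0_iff)
      also have "\<dots> \<le> sum id (X - A)" by (rule sum_bounded_below) (use X' in auto)
      finally have "sum id (A - X) < sum id (X - A)" .
      then have "sum id A < sum id X"
        using sum.Int_Diff[of A id X] sum.Int_Diff[of X id A] fA fX by (simp add: Int_commute)
      moreover have "sum id X \<le> sum id T" using X' finT by (intro sum_mono2) auto
      ultimately show "\<Sum>T - \<Sum>X < \<Sum>T - \<Sum>A" by (simp add: id_def)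
    qed
    have "(\<Sum>X\<in>fam ?C ?E. q X) = q A + (\<Sum>X\<in>fam ?C ?E - {A}. q X)"
      by (rule sum.remove[OF fin_fam Af])
    then have "q A = (\<Sum>X\<in>fam ?C ?E. q X) - (\<Sum>X\<in>fam ?C ?E - {A}. q X)" by simp
    also have "\<dots> \<in> ?M" by (rule modspan_diff[OF modspan.ideal[OF r] modspan_sum[OF rest]])
    finally show ?thesis .
  qed
qed

lemma nneg_G:
  assumes "A \<subseteq> T" shows "nneg n (G A) j = card {i \<in> A. j < i} + card {i \<in> {j<..n} - T. - int i \<in> S0}"
proof -
  have fA: "finite A" using assms finT finite_subset by blast
  have "{i \<in> {j<..n}. - int i \<in> G A} = {i \<in> A. j < i} \<union> {i \<in> {j<..n} - T. - int i \<in> S0}"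
  proof (rule Set.set_eqI)
    fix i show "i \<in> {i \<in> {j<..n}. - int i \<in> G A} \<longleftrightarrow> i \<in> {i \<in> A. j < i} \<union> {i \<in> {j<..n} - T. - int i \<in> S0}"
      using mem_G(2)[OF assms, of i] T_pos[of i] dis[of i] assms by auto
  qed
  then show ?thesis unfolding nneg_def using fA assms by (simp add: card_Un_disjoint disjoint_iff subset_iff)
qed

lemma npos_G:
  assumes "A \<subseteq> T" shows "npos n (G A) j = card {i \<in> T - A. j < i} + card {i \<in> {j<..n} - T. - int i \<in> S0}"
proof -
  have "{i \<in> {j<..n}. int i \<notin> G A} = {i \<in> T - A. j < i} \<union> {i \<in> {j<..n} - T. - int i \<in> S0}"
  proof (rule Set.set_eqI)
    fix i show "i \<in> {i \<in> {j<..n}. int i \<notin> G A} \<longleftrightarrow> i \<in> {i \<in> T - A. j < i} \<union> {i \<in> {j<..n} - T. - int i \<in> S0}"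
      using mem_G(1)[OF assms, of i] T_pos[of i] dis[of i] single[of i] assms by auto
  qed
  then show ?thesis unfolding npos_def using finT by (simp add: card_Un_disjoint disjoint_iff)
qed

lemma var_eq_q: "\<exists>e. (e = 1 \<or> e = - 1) \<and> var (G A, a) = const e * q A"
proof (intro exI[of _ "\<Prod>i\<in>A. sg i"] conjI)
  have "const (\<Prod>i\<in>A. sg i) * q A = const ((\<Prod>i\<in>A. sg i) * (\<Prod>i\<in>A. sg i)) * var (G A, a)"
    by (simp add: q_def const_mult mult.assoc)
  also have "(\<Prod>i\<in>A. sg i) * (\<Prod>i\<in>A. sg i) = 1" using sg_prod_cases[of A] by auto
  finally show "var (G A, a) = const (\<Prod>i\<in>A. sg i) * q A" by simp
qed (rule sg_prod_cases)

end

section \<open>From weight spaces to single variables\<close>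

lemma weight_space_exists:
  assumes x: "x \<in> LevPos d n"
  obtains S0 T m A where "weight_space d n (snd x) S0 T m" "A \<subseteq> T" "card A = m" "weight_space.G S0 A = fst x"
proof -
  obtain \<gamma> a where xe: "x = (\<gamma>, a)" by (cases x)
  have g: "\<gamma> \<in> nsub n" and ad: "a \<le> d" using x xe by (auto simp: LevPos_def)
  have ga: "\<gamma> \<subseteq> angle n" "card \<gamma> = n" using g by (auto simp: nsub_def)
  have fg: "finite \<gamma>" using finite_subset[OF ga(1) finite_angle] .
  \<comment> \<open>\<open>S0\<close> consists of the elements whose opposite is absent;
    \<open>A\<close> and \<open>B\<close> index the opposite pairs that are contained in and missing
    from the set. They are equinumerous because the set has n elements.\<close>
  define S0 where "S0 = {y \<in> \<gamma>. - y \<notin> \<gamma>}"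
  define A where "A = {i \<in> {1..n}. int i \<in> \<gamma> \<and> - int i \<in> \<gamma>}"
  define B where "B = {i \<in> {1..n}. int i \<notin> \<gamma> \<and> - int i \<notin> \<gamma>}"
  define T where "T = A \<union> B"
  define K where "K = {i \<in> {1..n}. - int i \<in> \<gamma> \<and> int i \<notin> \<gamma>}"
  have fin: "finite A" "finite B" "finite K" by (auto simp: A_def B_def K_def)
  have "nneg n \<gamma> 0 = card A + card K"
    unfolding nneg_def by (subst card_Un_disjoint[symmetric]) (auto simp: A_def K_def intro!: arg_cong[of _ _ card])
  moreover have "npos n \<gamma> 0 = card B + card K"
    unfolding npos_def by (subst card_Un_disjoint[symmetric]) (auto simp: B_def K_def intro!: arg_cong[of _ _ card])
  ultimately have cAB: "card A = card B" using nsub_npos_0[OF g] by simp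
  have cT: "card T = 2 * card A" unfolding T_def using fin cAB by (subst card_Un_disjoint) (auto simp: A_def B_def)
  have gG: "S0 \<union> int ` A \<union> (\<lambda>i. - int i) ` A = \<gamma>"
  proof (rule Set.set_eqI)
    fix y
    show "y \<in> S0 \<union> int ` A \<union> (\<lambda>i. - int i) ` A \<longleftrightarrow> y \<in> \<gamma>"
    proof
      assume y: "y \<in> \<gamma>"
      show "y \<in> S0 \<union> int ` A \<union> (\<lambda>i. - int i) ` A"
      proof (cases "- y \<in> \<gamma>")
        case True
        have b: "y \<noteq> 0" "\<bar>y\<bar> \<le> int n" using y ga angle_iff by auto
        show ?thesis
        proof (cases "y > 0")
          case True
          then have "nat y \<in> A" "y = int (nat y)" using b y \<open>- y \<in> \<gamma>\<close> by (auto simp: A_def)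
          then show ?thesis by blast
        next
          case False
          then have "nat (- y) \<in> A" "y = - int (nat (- y))" using b y \<open>- y \<in> \<gamma>\<close> by (auto simp: A_def)
          then show ?thesis by blast
        qed
      qed (use y in \<open>simp add: S0_def\<close>)
    qed (auto simp: S0_def A_def)
  qed
  have "card \<gamma> = card S0 + card (int ` A) + card ((\<lambda>i. - int i) ` A)"
  proof -
    have "finite S0" using fg by (simp add: S0_def)
    moreover have "S0 \<inter> int ` A = {}" by (auto simp: S0_def A_def)
    moreover have "(S0 \<union> int ` A) \<inter> (\<lambda>i. - int i) ` A = {}" by (auto simp: S0_def A_def)
    ultimately show ?thesis unfolding gG[symmetric] using fin by (simp add: card_Un_disjoint)
  qed
  then have cS: "card S0 + 2 * card A = n" using ga by (simp add: card_image inj_on_def)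
  have ws: "weight_space d n a S0 T (card A)"
  proof
    show "T \<subseteq> {1..n}" by (auto simp: T_def A_def B_def)
    show "S0 \<subseteq> angle n" using ga by (auto simp: S0_def)
    show "int i \<notin> S0 \<and> - int i \<notin> S0" if "i \<in> T" for i using that by (auto simp: T_def S0_def A_def B_def)
    show "(int i \<in> S0) \<noteq> (- int i \<in> S0)" if "i \<in> {1..n} - T" for i using that by (auto simp: T_def S0_def A_def B_def)
  qed (use ad cT cS in auto)
  show thesis
  proof (rule that)
    show "weight_space d n (snd x) S0 T (card A)" using ws xe by simp
    show "weight_space.G S0 A = fst x" unfolding weight_space.G_def[OF ws] gG xe by simp
  qed (auto simp: T_def)
qed

text \<open>Replacing \<open>A\<close> by its complement in \<open>T\<close> exchanges the two step
  functions, that is, transposes the partition.\<close>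

lemma var_transpose:
  assumes x: "x \<in> LevPos d n"
  shows "\<exists>e. (e = 1 \<or> e = - 1) \<and> var x - const e * var (dec n (hJ n x) (hI n x)) \<in> Jid d n"
    "sum id (fst (dec n (hJ n x) (hI n x))) = sum id (fst x)"
proof -
  obtain S0 T m A where ws: "weight_space d n (snd x) S0 T m" and A: "A \<subseteq> T" "card A = m" "weight_space.G S0 A = fst x"
    using weight_space_exists[OF x] .
  interpret weight_space d n "snd x" S0 T m by (rule ws)
  have xe: "x = (G A, snd x)" using A by simp
  have fA: "finite A" using A finT finite_subset by blast
  have TA: "T - A \<subseteq> T" "card (T - A) = m" "T - (T - A) = A" using A T fA by (auto simp: card_Diff_subset)
  have y: "(G (T - A), snd x) = dec n (hJ n x) (hI n x)"
  proof (rule LevPos_eq_dec[of _ d])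
    show "(G (T - A), snd x) \<in> LevPos d n" using G_nsub[OF TA(1,2)] ad by (simp add: LevPos_def)
    show "hI n (G (T - A), snd x) = hJ n x"
      by (subst (2) xe) (auto simp: hI_def hJ_def fun_eq_iff nneg_G[OF TA(1)] npos_G[OF A(1)])
    show "hJ n (G (T - A), snd x) = hI n x"
      by (subst (2) xe) (auto simp: hI_def hJ_def fun_eq_iff npos_G[OF TA(1)] nneg_G[OF A(1)] TA(3))
  qed
  show "sum id (fst (dec n (hJ n x) (hI n x))) = sum id (fst x)"
    unfolding y[symmetric] fst_conv using sum_G[OF TA(1)] sum_G[OF A(1)] A(3) by simp
  obtain e1 where e1: "e1 = 1 \<or> e1 = - 1" "var (G A, snd x) = const e1 * q A" using var_eq_q by blast
  obtain e2 where e2: "e2 = 1 \<or> e2 = - 1" "var (G (T - A), snd x) = const e2 * q (T - A)" using var_eq_q by blast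
  have r: "q (T - A) - const ((-1) ^ m) * q A \<in> Jid d n" by (rule complement_relation[OF A(1,2)])
  define s where "s = (-1 :: complex) ^ m"
  have s: "s = 1 \<or> s = -1" unfolding s_def by (cases "even m") auto
  define e where "e = e1 * s * e2"
  have ee: "e = 1 \<or> e = -1" using e1(1) e2(1) s by (auto simp: e_def)
  have sq: "e2 * e2 = 1" "s * s = 1" using e2(1) s by auto
  have "var x - const e * var (dec n (hJ n x) (hI n x)) = const e1 * q A - const e * (const e2 * q (T - A))"
    using e1(2) e2(2) y xe by metis
  also have "const e * (const e2 * q (T - A)) = const (e1 * s) * q (T - A)"
    unfolding mult.assoc[symmetric] const_mult[symmetric] e_def using sq by (simp add: mult.assoc)
  also have "const e1 * q A = const (e1 * s) * (const s * q A)"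
    unfolding mult.assoc[symmetric] const_mult[symmetric] using sq by (simp add: mult.assoc)
  also have "const (e1 * s) * (const s * q A) - const (e1 * s) * q (T - A) = - (const (e1 * s) * (q (T - A) - const s * q A))"
    by (simp add: algebra_simps)
  also have "\<dots> \<in> Jid d n" using r unfolding s_def by (intro Jid_uminus Jid_const_mult)
  finally show "\<exists>e. (e = 1 \<or> e = - 1) \<and> var x - const e * var (dec n (hJ n x) (hI n x)) \<in> Jid d n"
    using ee by blast
qed

text \<open>Level and entry sum are recorded in the spanning set because the quadratic straightening
  inducts on them.\<close>

lemma northeast_span:
  assumes x: "x \<in> LevPos d n"
  shows "var x \<in> modspan d n {var y |y. y \<in> LevPos d n \<and> hJ n y \<le> hI n y \<and> snd y = snd x \<and> sum id (fst y) = sum id (fst x)}"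
    (is "_ \<in> modspan d n ?B")
proof -
  obtain S0 T m A where ws: "weight_space d n (snd x) S0 T m" and A: "A \<subseteq> T" "card A = m" "weight_space.G S0 A = fst x"
    using weight_space_exists[OF x] .
  interpret weight_space d n "snd x" S0 T m by (rule ws)
  have xe: "x = (G A, snd x)" using A by simp
  have "q B \<in> modspan d n ?B" if B: "B \<subseteq> T" "card B = m" "ballot B" for B
  proof -
    let ?y = "(G B, snd x)"
    have "?y \<in> LevPos d n" using G_nsub[OF B(1,2)] ad by (simp add: LevPos_def)
    moreover have "hJ n ?y \<le> hI n ?y"
      using B(3) by (auto simp: le_fun_def hI_def hJ_def nneg_G[OF B(1)] npos_G[OF B(1)] ballot_def)
    moreover have "sum id (fst ?y) = sum id (fst x)" using sum_G[OF B(1)] sum_G[OF A(1)] A(3) by simp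
    ultimately have "var ?y \<in> ?B" by (intro CollectI exI[of _ ?y]) simp
    then have "const (\<Prod>i\<in>B. sg i) * var ?y \<in> modspan d n ?B" by (intro modspan.scale modspan.gen)
    then show ?thesis by (simp add: q_def)
  qed
  then have "{q B |B. B \<subseteq> T \<and> card B = m \<and> ballot B} \<subseteq> modspan d n ?B" by blast
  from modspan_subset[OF this] have "q A \<in> modspan d n ?B" using ballot_span[OF A(1,2)] by blast
  moreover obtain e where "var (G A, snd x) = const e * q A" using var_eq_q by blast
  ultimately have "var (G A, snd x) \<in> modspan d n ?B" using modspan.scale by simp
  moreover have "(G A, snd x) = x" using A(3) by simp
  ultimately show ?thesis by metis
qed

subsection \<open>The defining ideal vanishes on the families\<close>

text \<open>The largest step function; it encodes the set of all negative elements at level 0, the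
  bottom of the poset.\<close>

definition Wbot :: "nat \<Rightarrow> nat \<Rightarrow> int" where
  "Wbot n j = (if j \<le> n then int (n - j) else 0)"

lemma stp_Wbot: "stp d n (Wbot n)"
  by (auto simp: stp_def Wbot_def)

lemma stp_le_Wbot: assumes U: "stp d n U" shows "U \<le> Wbot n"
  unfolding le_fun_def
proof
  fix j
  have "U j \<le> int (n - j)" if "j \<le> n"
    using that
  proof (induction j rule: inc_induct)
    case base
    then show ?case using U by (simp add: stp_def)
  next
    case (step j)
    then have "U j \<le> U (Suc j) + 1" using U unfolding stp_def by force
    then show ?case using step by simp
  qed
  then show "U j \<le> Wbot n j" using U by (auto simp: Wbot_def stp_def)
qed

lemma Jid_vanish_Wbot:
  assumes f: "f \<in> Jid d n" and n: "1 \<le> n" and c: "Fam d n (Wbot n) c"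
  shows "peval c f = 0"
  using f
proof (induction rule: Jid_induct)
  case (add g h f)
  have "peval c h = 0"
  proof (cases "h \<in> Iid d n")
    case True
    then show ?thesis using Fam_MapCone[OF c n] by (simp add: Iid_def Wbot_def)
  next
    case False
    then have "h \<in> Lgens d n" using add by auto
    then show ?thesis using Fam_lform[OF c n] by (auto simp: Lgens_def)
  qed
  then show ?case using add by (simp add: peval_add peval_mult)
qed simp

text \<open>The generators are checked at \<open>Wbot\<close>, whose members are maps without base
  points; any other bound is reached from there by lowering one place at a time.\<close>

lemma Jid_vanish:
  assumes f: "f \<in> Jid d n" and n: "1 \<le> n" and c: "Fam d n W c"
  shows "peval c f = 0"
proof -
  have "peval c f = 0" if "stp d n U" "W \<le> U" "\<forall>c. Fam d n U c \<longrightarrow> peval c f = 0" "Fam d n W c" for U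
    using that
  proof (induction "nat (\<Sum>i\<le>n. U i + int d)" arbitrary: U rule: less_induct)
    case less
    show ?case
    proof (cases "W = U")
      case True
      then show ?thesis using less by blast
    next
      case False
      obtain j where j: "j \<le> n" "stp d n (dcr j U)" "W \<le> dcr j U"
        using exists_canlow[OF less.prems(1) Fam_stp[OF less.prems(4)] less.prems(2) False] by blast
      have up: "(dcr j U)(j := dcr j U j + 1) = U" by (rule dcr_upd)
      have "peval c' f = 0" if "Fam d n (dcr j U) c'" for c'
        by (rule Fam_vanish_step[OF _ j(1) _ that]) (use less.prems(1,3) in \<open>simp_all only: up simp_thms\<close>)
      then have van: "\<forall>c. Fam d n (dcr j U) c \<longrightarrow> peval c f = 0" by blast
      show ?thesis
        by (rule less.hyps[OF sum_dcr_less[OF j(1,2) less.prems(1)] j(2,3) van less.prems(4)])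
    qed
  qed
  from this[OF stp_Wbot stp_le_Wbot[OF Fam_stp[OF c]] _ c] show ?thesis using Jid_vanish_Wbot[OF f n] by blast
qed

subsection \<open>Encoding of doset elements by pairs of step functions\<close>

definition encp :: "nat \<Rightarrow> lv \<times> lv \<Rightarrow> fpair" where
  "encp n u = (hI n (fst u), hI n (snd u))"

lemma Dos_PP: "u \<in> Dos d n \<Longrightarrow> fst u \<in> PP d n \<and> snd u \<in> PP d n \<and> le_lv n (fst u) (snd u)"
  using is_doset_Dos[of d n] by (cases u) (auto simp: is_doset_def)

lemma le_PP: "x \<in> PP d n \<Longrightarrow> y \<in> PP d n \<Longrightarrow> le_lv n x y \<longleftrightarrow> hI n y \<le> hI n x"
  using le_lv_iff[of x d n y] by (auto simp: PP_iff)

lemma PP_eqI: "x \<in> PP d n \<Longrightarrow> y \<in> PP d n \<Longrightarrow> hI n x = hI n y \<Longrightarrow> x = y"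
  using LevPos_eqI[of x d n y] by (auto simp: PP_iff)

lemma encp_FD: "u \<in> Dos d n \<Longrightarrow> encp n u \<in> FD d n"
  using pD_eq(1)[of "fst u" "snd u" d n] Dos_iff[of "fst u" "snd u" d n] by (simp add: encp_def FD_def)

lemma pD_encp: "u \<in> Dos d n \<Longrightarrow> pD n u = var (case_prod (dec n) (encp n u))"
  using pD_eq(2)[of "fst u" "snd u" d n] by (simp add: encp_def)

lemma inj_encp: "inj_on (encp n) (Dos d n)"
proof (rule inj_onI)
  fix u v assume "u \<in> Dos d n" "v \<in> Dos d n" "encp n u = encp n v"
  then show "u = v"
    using Dos_PP[of u] Dos_PP[of v] PP_eqI[of "fst u" d n "fst v"] PP_eqI[of "snd u" d n "snd v"]
    by (simp add: encp_def prod_eq_iff)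
qed

lemma Dos_of_paired:
  assumes p: "paired d n U V" and le: "V \<le> U"
  obtains u where "u \<in> Dos d n" "encp n u = (U, V)" "pD n u = var (dec n U V)"
proof -
  have pU: "paired d n U U" and pV: "paired d n V V" using p by (auto simp: paired_def)
  note hU = h_dec[OF pU] and hV = h_dec[OF pV]
  let ?u = "(dec n U U, dec n V V)"
  have D: "?u \<in> Dos d n" unfolding Dos_iff PP_iff using hU hV le p by (simp add: paired_def)
  have e: "encp n ?u = (U, V)" by (simp add: encp_def hU hV)
  show thesis by (rule that[OF D e]) (simp add: pD_encp[OF D] e)
qed

lemma pD_Ring: "u \<in> Dos d n \<Longrightarrow> pD n u \<in> Ring d n"
  using pD_eq[of "fst u" "snd u" d n] h_dec(1) by (auto intro!: Ring_var)

lemma mono_Ring: "set ps \<subseteq> Dos d n \<Longrightarrow> mono n ps \<in> Ring d n"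
  unfolding mono_def by (rule Ring_prod_list) (auto simp: pD_Ring)

lemma mono_simps [simp]: "mono n [] = 1" "mono n (u # ps) = pD n u * mono n ps" "mono n (ps @ qs) = mono n ps * mono n qs"
  by (simp_all add: mono_def)

lemma peval_mono: "set ps \<subseteq> Dos d n \<Longrightarrow> peval c (mono n ps) = evl n c (map (encp n) ps)"
proof (induction ps)
  case Nil
  show ?case using peval_const[of c 1] by simp
next
  case (Cons u ps)
  then show ?case using pD_encp[of u d n] by (simp add: peval_mult encp_def)
qed

lemma fl_encp: "fl (map (encp n) ps) = map (hI n) (flat ps)"
  by (induction ps) (auto simp: encp_def flat_def)

lemma flat_simps [simp]: "flat [] = []" "flat (u # ps) = fst u # snd u # flat ps" "flat (ps @ qs) = flat ps @ flat qs"
  by (auto simp: flat_def split: prod.splits)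

lemma flat_PP: "set ps \<subseteq> Dos d n \<Longrightarrow> set (flat ps) \<subseteq> PP d n"
proof (induction ps)
  case (Cons u ps)
  then show ?case using Dos_PP[of u d n] by auto
qed simp

lemma standard_dstd:
  assumes "set ps \<subseteq> Dos d n"
  shows "standard n ps \<longleftrightarrow> dstd (map (encp n) ps)"
proof -
  have "successively (le_lv n) xs \<longleftrightarrow> sorted_wrt (\<lambda>A B. B \<le> A) (map (hI n) xs)" if "set xs \<subseteq> PP d n" for xs
  proof -
    have "successively (le_lv n) xs \<longleftrightarrow> successively (\<lambda>A B. B \<le> A) (map (hI n) xs)"
      using that by (induction xs rule: induct_list012) (auto simp: le_PP[of _ d n])
    also have "\<dots> \<longleftrightarrow> sorted_wrt (\<lambda>A B. B \<le> A) (map (hI n) xs)"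
      by (rule successively_conv_sorted_wrt) (auto simp: transp_def)
    finally show ?thesis .
  qed
  from this[OF flat_PP[OF assms]] show ?thesis by (simp add: standard_def dstd_def fl_encp)
qed

lemma StdSeqs_FD: "s \<in> StdSeqs d n \<Longrightarrow> set (map (encp n) s) \<subseteq> FD d n \<and> dstd (map (encp n) s) \<and> below (Wbot n) (map (encp n) s)"
proof -
  assume s: "s \<in> StdSeqs d n"
  then have D: "set s \<subseteq> Dos d n" by (simp add: StdSeqs_def)
  have F: "set (map (encp n) s) \<subseteq> FD d n" using D encp_FD by auto
  moreover have "below (Wbot n) (map (encp n) s)"
    using F stp_le_Wbot unfolding below_def FD_def paired_def by fastforce
  ultimately show ?thesis using s standard_dstd[OF D] by (simp add: StdSeqs_def)
qed

lemma StdSeqs_inj: "S \<subseteq> StdSeqs d n \<Longrightarrow> inj_on (map (encp n)) S"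
  by (rule inj_on_mapI, rule inj_on_subset[OF inj_encp[of n d]]) (auto simp: StdSeqs_def)

lemma peval_lincomb:
  assumes "S \<subseteq> StdSeqs d n"
  shows "peval c (lincomb n S C) = (\<Sum>s\<in>S. C s * evl n c (map (encp n) s))"
  unfolding lincomb_def peval_sum
  by (rule sum.cong[OF refl]) (use assms peval_mono[of _ d n c] in \<open>auto simp: peval_mult StdSeqs_def\<close>)

lemma expansion_relation:
  assumes "1 \<le> n" "set ps \<subseteq> Dos d n" "S \<subseteq> StdSeqs d n" "mono n ps - lincomb n S C \<in> Jid d n" "Fam d n W c"
  shows "evl n c (map (encp n) ps) = (\<Sum>s\<in>S. C s * evl n c (map (encp n) s))"
  using Jid_vanish[OF assms(4,1,5)] peval_mono[OF assms(2)] peval_lincomb[OF assms(3)] by (simp add: peval_diff)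

lemma standard_independent:
  assumes n: "1 \<le> n" and S: "finite S" "S \<subseteq> StdSeqs d n" and J: "lincomb n S C \<in> Jid d n"
  shows "\<forall>s\<in>S. C s = 0"
proof (rule independence[OF stp_Wbot n S(1) StdSeqs_inj[OF S(2)]])
  show "set (map (encp n) s) \<subseteq> FD d n \<and> dstd (map (encp n) s) \<and> below (Wbot n) (map (encp n) s)" if "s \<in> S" for s
    using StdSeqs_FD S(2) that by blast
  show "(\<Sum>s\<in>S. C s * evl n c (map (encp n) s)) = 0" if "Fam d n (Wbot n) c" for c
    using Jid_vanish[OF J n that] peval_lincomb[OF S(2)] by simp
qed

subsection \<open>Quadratic straightening\<close>

lemma modspan_lincomb:
  assumes "f \<in> modspan d n (mono n ` T)"
  shows "\<exists>S c. finite S \<and> S \<subseteq> T \<and> f - lincomb n S c \<in> Jid d n"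
  using assms
proof (induction rule: modspan.induct)
  case (ideal f)
  then show ?case by (intro exI[of _ "{}"]) (simp add: lincomb_def)
next
  case (gen f)
  then obtain s where "s \<in> T" "f = mono n s" by blast
  then show ?case by (intro exI[of _ "{s}"] exI[of _ "\<lambda>_. 1"]) (simp add: lincomb_def Jid_0)
next
  case (add f g)
  obtain S c where S: "finite S" "S \<subseteq> T" "f - lincomb n S c \<in> Jid d n" using add by blast
  obtain S' c' where S': "finite S'" "S' \<subseteq> T" "g - lincomb n S' c' \<in> Jid d n" using add by blast
  let ?c = "\<lambda>s. (if s \<in> S then c s else 0) + (if s \<in> S' then c' s else 0)"
  have ext: "lincomb n R b = (\<Sum>s\<in>S \<union> S'. const (if s \<in> R then b s else 0) * mono n s)" if "R \<subseteq> S \<union> S'" for R b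
    unfolding lincomb_def using S(1) S'(1) that by (intro sum.mono_neutral_cong_left) auto
  have "lincomb n (S \<union> S') ?c = lincomb n S c + lincomb n S' c'"
    unfolding ext[of S c, OF Un_upper1] ext[of S' c', OF Un_upper2] sum.distrib[symmetric]
    by (simp only: lincomb_def const_add distrib_right)
  then have "f + g - lincomb n (S \<union> S') ?c = (f - lincomb n S c) + (g - lincomb n S' c')" by simp
  also have "\<dots> \<in> Jid d n" using S S' by (intro Jid_add)
  finally show ?case using S S' by (intro exI[of _ "S \<union> S'"] exI[of _ ?c]) auto
next
  case (scale f a)
  then obtain S c where S: "finite S" "S \<subseteq> T" "f - lincomb n S c \<in> Jid d n" by blast
  have "const a * f - lincomb n S (\<lambda>s. a * c s) = const a * (f - lincomb n S c)"
    by (simp add: lincomb_def const_mult sum_distrib_left right_diff_distrib mult.assoc)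
  then show ?case using S Jid_const_mult by metis
qed

lemma sum_nsub_ge: "\<alpha> \<in> nsub n \<Longrightarrow> - int (n * n) \<le> sum id \<alpha>"
proof -
  assume a: "\<alpha> \<in> nsub n"
  have "of_nat (card \<alpha>) * (- int n) \<le> sum id \<alpha>"
    by (rule sum_bounded_below) (use a angle_iff in \<open>force simp: nsub_def\<close>)
  then show ?thesis using a by (simp add: nsub_def)
qed

definition std2 :: "nat \<Rightarrow> nat \<Rightarrow> pol set" where
  "std2 d n = mono n ` {s \<in> StdSeqs d n. length s = 2}"

lemma standard_product:
  assumes x: "x \<in> LevPos d n" "hJ n x \<le> hI n x" and y: "y \<in> LevPos d n" "hJ n y \<le> hI n y" and le: "hI n y \<le> hJ n x"
  shows "var x * var y \<in> std2 d n"
proof -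
  obtain u where u: "u \<in> Dos d n" "encp n u = (hI n x, hJ n x)" "pD n u = var x"
    using Dos_of_paired[OF paired_h[OF x(1)] x(2)] dec_h[OF x(1)] by metis
  obtain v where v: "v \<in> Dos d n" "encp n v = (hI n y, hJ n y)" "pD n v = var y"
    using Dos_of_paired[OF paired_h[OF y(1)] y(2)] dec_h[OF y(1)] by metis
  have D: "set [u, v] \<subseteq> Dos d n" using u v by simp
  note le' = order_trans[OF le x(2)] order_trans[OF y(2) le]
  have "sorted_wrt (\<lambda>A B. B \<le> A) [hI n x, hJ n x, hI n y, hJ n y]"
    unfolding sorted_wrt.simps using x(2) y(2) le le' order_trans[OF y(2) le'(1)] by auto
  then have "standard n [u, v]" unfolding standard_dstd[OF D] dstd_def list.map u(2) v(2) fl_simps .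
  then have "[u, v] \<in> {s \<in> StdSeqs d n. length s = 2}" using u v by (simp add: StdSeqs_def)
  then have "mono n [u, v] \<in> std2 d n" unfolding std2_def by (rule imageI)
  then show ?thesis using u(3) v(3) by simp
qed

lemma modspan_bilinear:
  assumes f: "f \<in> modspan d n B" "f \<in> Ring d n" and g: "g \<in> modspan d n B'"
    and B: "B \<subseteq> Ring d n" and BB: "\<And>a b. a \<in> B \<Longrightarrow> b \<in> B' \<Longrightarrow> a * b \<in> modspan d n C"
    and B': "B' \<subseteq> Ring d n"
  shows "f * g \<in> modspan d n C"
proof (rule modspan_mult[OF g f(2)])
  fix b assume b: "b \<in> B'"
  have "b * f \<in> modspan d n C"
    by (rule modspan_mult[OF f(1)]) (use b B' BB in \<open>auto simp: mult.commute\<close>)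
  then show "f * b \<in> modspan d n C" by (simp add: mult.commute)
qed

text \<open>Replacing x by its transpose, which changes var x only by a sign, turns any failure of standardness
  into a failure of comparability in the Grassmannian poset.\<close>

lemma straighten_northeast:
  assumes x: "x \<in> LevPos d n" and y: "y \<in> LevPos d n" and xy: "snd x \<le> snd y" and nle: "\<not> hI n y \<le> hJ n x"
  shows "var x * var y \<in> modspan d n (lower_pairs d n (fst x) (snd x) (snd y))"
proof -
  let ?x = "dec n (hJ n x) (hI n x)"
  have px: "paired d n (hJ n x) (hI n x)" using paired_h[OF x] by (auto simp: paired_def)
  note hx = h_dec[OF px]
  have sx: "snd ?x = snd x" using hI_end[of n ?x] hJ_end[of n x] unfolding hx(2) by simp
  have "\<not> le_lv n ?x y" using nle le_lv_iff[OF hx(1) y] hx(2) by simp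
  then obtain i where i: "1 \<le> i" "i + (snd y - snd x) \<le> n" "elt (fst y) (snd y - snd x + i) < elt (fst ?x) i"
    using xy unfolding le_lv_def case_prod_beta sx not_le[symmetric] by blast
  have "var (fst ?x, snd x) * var (fst y, snd y) \<in> modspan d n (lower_pairs d n (fst ?x) (snd x) (snd y))"
    by (rule straighten_grassmannian[OF _ _ xy _ i]) (use hx(1) y in \<open>auto simp: LevPos_def\<close>)
  then have m: "var ?x * var y \<in> modspan d n (lower_pairs d n (fst x) (snd x) (snd y))"
  proof -
    have "lower_pairs d n (fst ?x) (snd x) (snd y) = lower_pairs d n (fst x) (snd x) (snd y)"
      by (simp only: lower_pairs_def var_transpose(2)[OF x])
    moreover have "(fst ?x, snd x) = ?x" unfolding sx[symmetric] by (rule prod.collapse)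
    ultimately show ?thesis using \<open>var (fst ?x, snd x) * _ \<in> _\<close> by (metis prod.collapse)
  qed
  obtain e where e: "var x - const e * var ?x \<in> Jid d n" using var_transpose(1)[OF x] by blast
  have "var y * (var x - const e * var ?x) \<in> Jid d n" by (rule Jid_mult[OF e Ring_var[OF y]])
  then have "var x * var y - const e * (var ?x * var y) \<in> Jid d n" by (simp add: algebra_simps)
  then show ?thesis by (rule modspan_cong) (rule modspan.scale[OF m])
qed

text \<open>Induction on level and entry sum of the factor of smaller level. Passing to Northeast
  variables changes neither; a Northeast pair is then standard or a combination of pairs smaller in
  this measure.\<close>

lemma quadratic_span_le:
  assumes "x \<in> LevPos d n" "y \<in> LevPos d n" "snd x \<le> snd y"
  shows "var x * var y \<in> modspan d n (std2 d n)"
  using assms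
proof (induction x arbitrary: y rule: wf_induct_rule[OF wf_measures[of "[snd, \<lambda>x. nat (sum id (fst x) + int (n * n))]"]])
  case (1 x)
  have down: "var x' * var y' \<in> modspan d n (std2 d n)"
    if "x' \<in> LevPos d n" "y' \<in> LevPos d n" "snd x' \<le> snd y'"
      "snd x' < snd x \<or> snd x' = snd x \<and> sum id (fst x') < sum id (fst x)" for x' y'
  proof (rule "1.IH"[OF _ that(1-3)])
    have "fst x' \<in> nsub n" using that(1) by (auto simp: LevPos_def)
    then show "(x', x) \<in> measures [snd, \<lambda>x. nat (sum id (fst x) + int (n * n))]"
      using that(4) sum_nsub_ge[of "fst x'" n] by auto
  qed
  let ?B = "\<lambda>x. {var y |y. y \<in> LevPos d n \<and> hJ n y \<le> hI n y \<and> snd y = snd x \<and> sum id (fst y) = sum id (fst x)}"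
  show ?case
  proof (rule modspan_bilinear[OF northeast_span Ring_var northeast_span])
    fix a b assume "a \<in> ?B x" "b \<in> ?B y"
    then obtain x' y' where ab: "a = var x'" "b = var y'"
      and x': "x' \<in> LevPos d n" "hJ n x' \<le> hI n x'" "snd x' = snd x" "sum id (fst x') = sum id (fst x)"
      and y': "y' \<in> LevPos d n" "hJ n y' \<le> hI n y'" "snd y' = snd y" by blast
    show "a * b \<in> modspan d n (std2 d n)"
    proof (cases "hI n y' \<le> hJ n x'")
      case True
      then show ?thesis unfolding ab using standard_product[OF x'(1,2) y'(1,2)] by (intro modspan.gen)
    next
      case False
      have "lower_pairs d n (fst x') (snd x') (snd y') \<subseteq> modspan d n (std2 d n)"
        using x' by (auto simp: lower_pairs_def intro: down)
      then show ?thesis unfolding ab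
        using modspan_subset straighten_northeast[OF x'(1) y'(1) _ False] x'(3) y'(3) "1.prems"(3) by (metis subsetD)
    qed
  qed (use "1.prems" in \<open>auto intro: Ring_var\<close>)
qed

lemma quadratic_span:
  assumes "u \<in> Dos d n" "v \<in> Dos d n"
  shows "mono n [u, v] \<in> modspan d n (std2 d n)"
proof -
  obtain x y where x: "x \<in> LevPos d n" "pD n u = var x" and y: "y \<in> LevPos d n" "pD n v = var y"
    using pD_eq[of "fst u" "snd u" d n] pD_eq[of "fst v" "snd v" d n] assms h_dec(1) by (metis prod.collapse)
  have "var x * var y \<in> modspan d n (std2 d n)"
  proof (cases "snd x \<le> snd y")
    case True
    then show ?thesis using quadratic_span_le x y by blast
  next
    case False
    then show ?thesis using quadratic_span_le[OF y(1) x(1)] by (simp add: mult.commute)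
  qed
  then show ?thesis using x y by simp
qed

subsection \<open>The straightening law\<close>

text \<open>The given expansion carries no order information, so it is evaluated on the family. The
  first function of an occurring standard pair dominates those of \<open>u\<close> and
  \<open>v\<close>; if it equals the first one of \<open>u\<close>, the second function dominates
  too, and equality also there would make \<open>[u, v]\<close> standard.\<close>

lemma lexless_quadratic:
  assumes n: "1 \<le> n" and uv: "u \<in> Dos d n" "v \<in> Dos d n" and ns: "\<not> standard n [u, v]"
    and S: "finite S" "S \<subseteq> {s \<in> StdSeqs d n. length s = 2}" and J: "mono n [u, v] - lincomb n S C \<in> Jid d n"
    and s: "s \<in> S" "C s \<noteq> 0"
  shows "\<exists>z w t. s = [(z, w), t] \<and> (less_lv n z (fst u) \<or> z = fst u \<and> less_lv n w (snd u))"
proof -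
  have Std: "S \<subseteq> StdSeqs d n" using S by auto
  have D: "set [u, v] \<subseteq> Dos d n" using uv by simp
  have "length s = 2" using s(1) S(2) by auto
  then obtain p t where "s = [p, t]" by (auto simp: numeral_2_eq_2 length_Suc_conv)
  then obtain z w where st: "s = [(z, w), t]" by (cases p) auto
  have zw: "(z, w) \<in> Dos d n" "t \<in> Dos d n" using Std s(1) st by (auto simp: StdSeqs_def)
  have P: "z \<in> PP d n" "w \<in> PP d n" "le_lv n z w" using Dos_PP[OF zw(1)] by auto
  have Pu: "fst u \<in> PP d n" "snd u \<in> PP d n" "fst v \<in> PP d n" "snd v \<in> PP d n"
    "le_lv n (fst u) (snd u)" "le_lv n (fst v) (snd v)" using Dos_PP[OF uv(1)] Dos_PP[OF uv(2)] by auto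
  let ?A = "{s \<in> S. C s \<noteq> 0}"
  have A: "finite ?A" "inj_on (map (encp n)) ?A"
    "\<And>i. i \<in> ?A \<Longrightarrow> set (map (encp n) i) \<subseteq> FD d n \<and> dstd (map (encp n) i)"
    using S(1) inj_on_subset[OF StdSeqs_inj[OF Std], of ?A] Std StdSeqs_FD[of _ d n] by (auto simp del: set_map)
  have rel: "evl n c (map (encp n) [u, v]) = (\<Sum>i\<in>?A. C i * evl n c (map (encp n) i))" if "Fam d n W c" for W c
    unfolding expansion_relation[OF n D Std J that] using S(1) by (intro sum.mono_neutral_right) auto
  have m: "set (map (encp n) [u, v]) \<subseteq> FD d n" using encp_FD uv by auto
  have sA: "s \<in> ?A" using s by simp
  have se: "map (encp n) s = (hI n z, hI n w) # [encp n t]" by (simp add: st encp_def)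
  have first: "fst p \<le> hI n z" if "p \<in> set (map (encp n) [u, v])" for p
    by (rule first_entry[OF n A m rel sA s(2) se that])
  have zu: "hI n (fst u) \<le> hI n z" "hI n (fst v) \<le> hI n z"
    using first[of "encp n u"] first[of "encp n v"] by (simp_all add: encp_def)
  show ?thesis
  proof (cases "z = fst u")
    case False
    then have "less_lv n z (fst u)" using zu(1) le_PP[OF P(1) Pu(1)] by (simp add: less_lv_def)
    then show ?thesis using st by blast
  next
    case True
    \<comment> \<open>Members with bound \<open>hI n z\<close> kill all monomials not below it; what
      is left has the form needed to compare second entries.\<close>
    let ?B = "{i \<in> ?A. below (hI n z) (map (encp n) i)}"
    have W: "stp d n (hI n z)" using P(1) paired_h[of z d n] by (auto simp: PP_iff paired_def)
    have rel': "evl n c [(hI n z, hI n (snd u)), (hI n (fst v), hI n (snd v))] = (\<Sum>i\<in>?B. C i * evl n c (map (encp n) i))"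
      if c: "Fam d n (hI n z) c" for c
    proof -
      have "evl n c (map (encp n) i) = 0" if i: "i \<in> ?A" "\<not> below (hI n z) (map (encp n) i)" for i
        by (rule evl_not_below[OF c n _ i(2)]) (use A(3)[OF i(1)] in blast)
      then have "(\<Sum>i\<in>?A. C i * evl n c (map (encp n) i)) = (\<Sum>i\<in>?B. C i * evl n c (map (encp n) i))"
        using A(1) by (intro sum.mono_neutral_right) auto
      then show ?thesis using rel[OF c] True by (simp add: encp_def)
    qed
    have bs: "below (hI n z) (map (encp n) s)"
    proof -
      have "hI n (fst t) \<le> hI n z"
        using A(3)[OF sA] unfolding se by (auto simp: dstd_def encp_def)
      then show ?thesis by (simp add: below_def st encp_def)
    qed
    have "hI n (snd u) \<le> hI n w \<and> hI n (fst v) \<le> hI n w"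
    proof (rule second_entry[OF W _ _ _ n _ _ _ _ zu(2) rel' _ s(2) se])
      show "hI n w \<le> hI n z" "hI n w 0 = hI n z 0" "hI n w n = hI n z n" using zw(1) by (auto simp only: Dos_iff)
      show "finite ?B" by (rule finite_subset[OF _ A(1)]) auto
      show "inj_on (map (encp n)) ?B" using A(2) by (rule inj_on_subset) auto
      show "set [(hI n z, hI n (snd u)), (hI n (fst v), hI n (snd v))] \<subseteq> FD d n" using m True by (simp add: encp_def)
      show "s \<in> ?B" using sA bs by simp
    qed (use A(3) in auto)
    then have le: "le_lv n w (snd u)" "le_lv n w (fst v)" using le_PP P Pu by blast+
    have "w \<noteq> snd u"
    proof
      assume "w = snd u"
      then have "standard n [u, v]" using le Pu by (simp add: standard_def)
      then show False using ns by contradiction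
    qed
    then have "less_lv n w (snd u)" using le by (simp add: less_lv_def)
    then show ?thesis using st True by blast
  qed
qed

definition PP_less :: "nat \<Rightarrow> nat \<Rightarrow> (lv \<times> lv) set" where
  "PP_less d n = {(x, y). x \<in> PP d n \<and> y \<in> PP d n \<and> less_lv n x y}"

lemma PP_less_iff: "(x, y) \<in> PP_less d n \<longleftrightarrow> x \<in> PP d n \<and> y \<in> PP d n \<and> hI n y < hI n x"
  using le_PP[of x d n y] PP_eqI[of x d n y] by (auto simp: PP_less_def less_lv_def order.strict_iff_order)

lemma trans_PP_less: "trans (PP_less d n)"
  unfolding trans_def PP_less_iff by (blast intro: less_trans)

text \<open>The area between the graph and the constant n is a nonnegative integer that grows along
  the order.\<close>

lemma wf_PP_less: "wf (PP_less d n)"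
proof (rule wf_subset[OF wf_measure])
  show "PP_less d n \<subseteq> measure (\<lambda>x. nat (\<Sum>j\<le>n. int n - hI n x j))"
  proof (rule subrelI)
    fix x y assume "(x, y) \<in> PP_less d n"
    then have P: "x \<in> PP d n" "y \<in> PP d n" and lt: "hI n y < hI n x" by (auto simp: PP_less_iff)
    have le: "hI n y j \<le> hI n x j" for j by (rule le_funD[OF less_imp_le[OF lt]])
    have "\<not> hI n x \<le> hI n y" using lt by (simp add: less_le_not_le)
    then obtain j where j: "hI n y j < hI n x j" by (auto simp: le_fun_def not_le)
    then have "j \<le> n" by (rule contrapos_pp) (simp add: hI_def)
    then have "(\<Sum>j\<le>n. int n - hI n x j) < (\<Sum>j\<le>n. int n - hI n y j)"
      using le j by (intro sum_strict_mono_ex1) auto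
    moreover have "0 \<le> (\<Sum>j\<le>n. int n - hI n x j)"
    proof (rule sum_nonneg)
      fix j assume "j \<in> {..n}"
      have "stp d n (hI n x)" using P paired_h[of x d n] by (auto simp: PP_iff paired_def)
      from le_funD[OF stp_le_Wbot[OF this], of j] show "0 \<le> int n - hI n x j"
        using \<open>j \<in> {..n}\<close> by (simp add: Wbot_def)
    qed
    ultimately show "(x, y) \<in> measure (\<lambda>x. nat (\<Sum>j\<le>n. int n - hI n x j))"
      unfolding in_measure by linarith
  qed
qed

lemma lex_lexless: "(xs, ys) \<in> lex (PP_less d n) \<Longrightarrow> lexless n xs ys"
proof -
  assume a: "(xs, ys) \<in> lex (PP_less d n)"
  then obtain i where "i < length xs" "take i xs = take i ys" "(xs ! i, ys ! i) \<in> PP_less d n" by (rule lex_take_index)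
  moreover have "length xs = length ys" using a by (simp add: lex_conv)
  ultimately show ?thesis by (auto simp: lexless_def PP_less_def)
qed

lemma nonstandard_pair:
  assumes "set ps \<subseteq> Dos d n" "\<not> standard n ps"
  shows "\<exists>as u v bs. ps = as @ u # v # bs \<and> \<not> standard n [u, v]"
  using assms
proof (induction ps rule: induct_list012)
  case 1
  then show ?case by (simp add: standard_def)
next
  case (2 u)
  then show ?case using Dos_PP[of u d n] by (simp add: standard_def)
next
  case (3 u v ps)
  show ?case
  proof (cases "standard n [u, v]")
    case False
    then show ?thesis by (intro exI[of _ "[]"]) auto
  next
    case True
    then have "\<not> standard n (v # ps)" using "3.prems"(2) by (auto simp: standard_def)
    then obtain as u' v' bs where "v # ps = as @ u' # v' # bs" "\<not> standard n [u', v']" using 3 by auto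
    then show ?thesis by (intro exI[of _ "u # as"]) auto
  qed
qed

definition lower_std :: "nat \<Rightarrow> nat \<Rightarrow> (lv \<times> lv) list \<Rightarrow> (lv \<times> lv) list set" where
  "lower_std d n ps = {s \<in> StdSeqs d n. length s = length ps \<and> (s = ps \<or> (flat s, flat ps) \<in> lex (PP_less d n))}"

text \<open>Replacing an adjacent pair lowers one of its first two entries without touching earlier
  ones, so later entries do not matter; lengths stay equal, which makes the lexicographic order
  well-founded.\<close>

lemma straightening:
  assumes n: "1 \<le> n" and "set ps \<subseteq> Dos d n"
  shows "mono n ps \<in> modspan d n (mono n ` lower_std d n ps)"
  using assms(2)
proof (induction ps rule: wf_induct_rule[OF wf_inv_image[OF wf_lex[OF wf_PP_less[of d n]], of flat]])
  case (1 ps)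
  show ?case
  proof (cases "standard n ps")
    case True
    then show ?thesis using "1.prems" by (intro modspan.gen imageI) (simp add: lower_std_def StdSeqs_def)
  next
    case False
    obtain as u v bs where ps: "ps = as @ u # v # bs" and ns: "\<not> standard n [u, v]"
      using nonstandard_pair[OF "1.prems" False] by blast
    have D: "u \<in> Dos d n" "v \<in> Dos d n" "set as \<subseteq> Dos d n" "set bs \<subseteq> Dos d n" using "1.prems" ps by auto
    obtain S C where S: "finite S" "S \<subseteq> {s \<in> StdSeqs d n. length s = 2}" and J: "mono n [u, v] - lincomb n S C \<in> Jid d n"
      using modspan_lincomb[OF quadratic_span[OF D(1,2), unfolded std2_def]] by blast
    have ext: "mono n (as @ s @ bs) \<in> modspan d n (mono n ` lower_std d n ps)" if s: "s \<in> S" "C s \<noteq> 0" for s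
    proof -
      obtain z w t where st: "s = [(z, w), t]" and lt: "less_lv n z (fst u) \<or> z = fst u \<and> less_lv n w (snd u)"
        using lexless_quadratic[OF n D(1,2) ns S J s] by blast
      have Ds: "(z, w) \<in> Dos d n" "t \<in> Dos d n" using S(2) s(1) st by (auto simp: StdSeqs_def)
      have "(z, fst u) \<in> PP_less d n \<or> z = fst u \<and> (w, snd u) \<in> PP_less d n"
        using lt Dos_PP[OF Ds(1)] Dos_PP[OF D(1)] by (simp add: PP_less_def)
      then have "(flat s, flat [u, v]) \<in> lex (PP_less d n)" by (auto simp: st)
      then have "(flat as @ flat s @ flat bs, flat as @ flat [u, v] @ flat bs) \<in> lex (PP_less d n)"
        by (intro lex_append_leftI lex_append_rightI) auto
      then have l: "(flat (as @ s @ bs), flat ps) \<in> lex (PP_less d n)" by (simp add: ps)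
      have "set (as @ s @ bs) \<subseteq> Dos d n" using D Ds st by auto
      then have "mono n (as @ s @ bs) \<in> modspan d n (mono n ` lower_std d n (as @ s @ bs))"
        using "1.IH"[of "as @ s @ bs"] l by (simp add: inv_image_def)
      moreover have "lower_std d n (as @ s @ bs) \<subseteq> lower_std d n ps"
        using transD[OF lex_transI[OF trans_PP_less] _ l] l by (auto simp: lower_std_def ps st)
      ultimately show ?thesis by (rule subsetD[OF modspan_mono[OF image_mono], rotated])
    qed
    have e1: "mono n ps = (mono n as * mono n bs) * mono n [u, v]" by (simp add: ps ac_simps)
    have e2: "(\<Sum>s\<in>S. const (C s) * mono n (as @ s @ bs)) = (mono n as * mono n bs) * lincomb n S C"
      unfolding lincomb_def sum_distrib_left by (rule sum.cong[OF refl]) (simp add: ac_simps)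
    have "mono n ps - (\<Sum>s\<in>S. const (C s) * mono n (as @ s @ bs)) = (mono n as * mono n bs) * (mono n [u, v] - lincomb n S C)"
      unfolding e1 e2 by (rule right_diff_distrib[symmetric])
    also have "\<dots> \<in> Jid d n" by (intro Jid_mult J Ring_mult mono_Ring D)
    finally show ?thesis
    proof (rule modspan_cong, intro modspan_sum)
      fix s assume "s \<in> S"
      then show "const (C s) * mono n (as @ s @ bs) \<in> modspan d n (mono n ` lower_std d n ps)"
        using ext by (cases "C s = 0") (auto intro: modspan.scale modspan_0)
    qed
  qed
qed

lemma straightening_expansion:
  assumes "1 \<le> n" "set ps \<subseteq> Dos d n"
  obtains S c where "finite S" "S \<subseteq> lower_std d n ps" "mono n ps - lincomb n S c \<in> Jid d n"
  using modspan_lincomb[OF straightening[OF assms]] by blast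

lemma lower_std_StdSeqs: "lower_std d n ps \<subseteq> StdSeqs d n"
  by (auto simp: lower_std_def)

lemma lincomb_superset: "finite R \<Longrightarrow> S \<subseteq> R \<Longrightarrow> lincomb n S c = lincomb n R (\<lambda>s. if s \<in> S then c s else 0)"
  unfolding lincomb_def by (intro sum.mono_neutral_cong_left) auto

lemma lincomb_diff: "lincomb n S (\<lambda>s. c s - c' s) = lincomb n S c - lincomb n S c'"
  unfolding lincomb_def sum_subtractf[symmetric]
  by (rule sum.cong[OF refl]) (metis const_add diff_add_cancel distrib_right add_diff_cancel_right')

text \<open>The straightening axiom speaks of every standard expansion. Independence transfers the
  bound to it from the one that was constructed.\<close>

lemma expansion_unique:
  assumes n: "1 \<le> n" and S: "finite S" "S \<subseteq> StdSeqs d n" "f - lincomb n S c \<in> Jid d n"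
    and S': "finite S'" "S' \<subseteq> StdSeqs d n" "f - lincomb n S' c' \<in> Jid d n" and s: "s \<in> S" "c s \<noteq> 0"
  shows "s \<in> S'"
proof (rule ccontr)
  assume "s \<notin> S'"
  let ?R = "S \<union> S'"
  have "lincomb n ?R (\<lambda>s. (if s \<in> S then c s else 0) - (if s \<in> S' then c' s else 0)) = lincomb n S c - lincomb n S' c'"
    unfolding lincomb_diff using S(1) S'(1) by (simp add: lincomb_superset[of ?R S] lincomb_superset[of ?R S'])
  also have "\<dots> = (f - lincomb n S' c') - (f - lincomb n S c)" by simp
  also have "\<dots> \<in> Jid d n" by (rule Jid_diff[OF S'(3) S(3)])
  finally have "\<forall>s\<in>?R. (if s \<in> S then c s else 0) - (if s \<in> S' then c' s else 0) = 0"
    using S S' by (intro standard_independent[OF n]) auto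
  from bspec[OF this, of s] show False using s \<open>s \<notin> S'\<close> by simp
qed

lemma Ring_standard_span:
  assumes n: "1 \<le> n" and f: "f \<in> Ring d n"
  shows "f \<in> modspan d n (mono n ` StdSeqs d n)"
  using f
proof (induction rule: Ring_induct)
  case (const a)
  have "[] \<in> StdSeqs d n" by (simp add: StdSeqs_def standard_def)
  then have "mono n [] \<in> modspan d n (mono n ` StdSeqs d n)" by (intro modspan.gen imageI)
  from modspan.scale[OF this, of a] show ?case by simp
next
  case (var x)
  have "{var y |y. y \<in> LevPos d n \<and> hJ n y \<le> hI n y \<and> snd y = snd x \<and> sum id (fst y) = sum id (fst x)}
    \<subseteq> modspan d n (mono n ` StdSeqs d n)"
  proof safe
    fix y assume y: "y \<in> LevPos d n" "hJ n y \<le> hI n y"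
    obtain u where u: "u \<in> Dos d n" "pD n u = var y"
      using Dos_of_paired[OF paired_h[OF y(1)] y(2)] dec_h[OF y(1)] by metis
    then have "[u] \<in> StdSeqs d n" using Dos_PP[of u d n] by (simp add: StdSeqs_def standard_def)
    then have "mono n [u] \<in> modspan d n (mono n ` StdSeqs d n)" by (intro modspan.gen imageI)
    then show "var y \<in> modspan d n (mono n ` StdSeqs d n)" using u by simp
  qed
  from modspan_subset[OF this] show ?case using northeast_span[OF var] by blast
next
  case (add f g)
  then show ?case by (intro modspan.add)
next
  case (mult f g)
  have R: "mono n ` StdSeqs d n \<subseteq> Ring d n" using mono_Ring by (auto simp: StdSeqs_def)
  show ?case
  proof (rule modspan_bilinear[OF mult(3,1,4) R _ R])
    fix a b assume "a \<in> mono n ` StdSeqs d n" "b \<in> mono n ` StdSeqs d n"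
    then obtain s t where st: "s \<in> StdSeqs d n" "t \<in> StdSeqs d n" "a * b = mono n (s @ t)" by auto
    have "set (s @ t) \<subseteq> Dos d n" using st by (auto simp: StdSeqs_def)
    from straightening[OF n this] show "a * b \<in> modspan d n (mono n ` StdSeqs d n)"
      unfolding st(3) by (rule subsetD[OF modspan_mono[OF image_mono[OF lower_std_StdSeqs]]])
  qed
qed

lemma pD_inj_mod:
  assumes n: "1 \<le> n" and uv: "u \<in> Dos d n" "v \<in> Dos d n" "u \<noteq> v"
  shows "pD n u - pD n v \<notin> Jid d n"
proof
  assume J: "pD n u - pD n v \<in> Jid d n"
  have std: "[w] \<in> StdSeqs d n" if "w \<in> Dos d n" for w
    using that Dos_PP[OF that] by (simp add: StdSeqs_def standard_def)
  have "lincomb n {[u], [v]} (\<lambda>s. if s = [u] then 1 else -1) = pD n u - pD n v"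
    using uv(3) by (simp add: lincomb_def const_uminus)
  then have "\<forall>s\<in>{[u], [v]}. (if s = [u] then 1 else -1 :: complex) = 0"
    using J std uv by (intro standard_independent[OF n]) auto
  then show False by auto
qed

text \<open>At 0 and n the two members of a doset element have equal values. Sorting two such equal
  pairs puts equal values side by side, hence the sorted pairs again lie in the doset.\<close>

lemma sorted_pairing:
  fixes a1 :: int
  assumes "a1 \<ge> a2" "a2 \<ge> a3" "a3 \<ge> a4" and m: "mset [p, p, q, q] = mset [a1, a2, a3, a4]"
  shows "a1 = a2 \<and> a3 = a4"
proof -
  define x where "x = min p q"
  define y where "y = max p q"
  have "mset [x, x, y, y] = mset [p, p, q, q]" by (cases "p \<le> q") (auto simp: x_def y_def)
  then have "mset [x, x, y, y] = mset [a4, a3, a2, a1]" using m by simp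
  moreover have "sorted [x, x, y, y]" by (simp add: x_def y_def)
  moreover have "sorted [a4, a3, a2, a1]" using assms by simp
  ultimately have "[x, x, y, y] = [a4, a3, a2, a1]" by (metis properties_for_sort)
  then show ?thesis by simp
qed

lemma quadratic_shuffle:
  assumes n: "1 \<le> n" and le: "le_lv n x1 x2" "le_lv n x2 x3" "le_lv n x3 x4"
    and \<sigma>: "mset [y1, y2, y3, y4] = mset [x1, x2, x3, x4]"
    and D: "(y1, y2) \<in> Dos d n" "(y3, y4) \<in> Dos d n"
  shows "(x1, x2) \<in> Dos d n \<and> (x3, x4) \<in> Dos d n \<and> (\<exists>\<epsilon>\<in>{1, -1}. \<exists>S c. finite S \<and>
     S \<subseteq> {s \<in> StdSeqs d n. length s = 2} - {[(x1, x2), (x3, x4)]} \<and>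
     pD n (y1, y2) * pD n (y3, y4) - const \<epsilon> * (pD n (x1, x2) * pD n (x3, x4)) - lincomb n S c \<in> Jid d n)"
proof -
  have "set [y1, y2, y3, y4] = set [x1, x2, x3, x4]" using \<sigma> by (metis set_mset_mset)
  moreover have "set [y1, y2, y3, y4] \<subseteq> PP d n" using Dos_PP[OF D(1)] Dos_PP[OF D(2)] by simp
  ultimately have "set [x1, x2, x3, x4] \<subseteq> PP d n" by simp
  then have P: "x1 \<in> PP d n" "x2 \<in> PP d n" "x3 \<in> PP d n" "x4 \<in> PP d n" by auto
  have h: "hI n x2 \<le> hI n x1" "hI n x3 \<le> hI n x2" "hI n x4 \<le> hI n x3" using le le_PP P by blast+
  have e: "hI n x1 j = hI n x2 j \<and> hI n x3 j = hI n x4 j" if j: "j = 0 \<or> j = n" for j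
  proof (rule sorted_pairing)
    show "hI n x2 j \<le> hI n x1 j" "hI n x3 j \<le> hI n x2 j" "hI n x4 j \<le> hI n x3 j" using h by (auto simp: le_fun_def)
    have y: "hI n y2 j = hI n y1 j" "hI n y4 j = hI n y3 j" using D j unfolding Dos_iff by auto
    have "image_mset (\<lambda>x. hI n x j) (mset [y1, y2, y3, y4]) = image_mset (\<lambda>x. hI n x j) (mset [x1, x2, x3, x4])"
      by (rule arg_cong[OF \<sigma>])
    then show "mset [hI n y1 j, hI n y1 j, hI n y3 j, hI n y3 j] = mset [hI n x1 j, hI n x2 j, hI n x3 j, hI n x4 j]"
      unfolding mset_map[symmetric] by (simp only: list.map y)
  qed
  have X: "(x1, x2) \<in> Dos d n" "(x3, x4) \<in> Dos d n" unfolding Dos_iff using P h e[of 0] e[of n] by blast+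
  let ?s = "[(x1, x2), (x3, x4)]" and ?m = "[(y1, y2), (y3, y4)]"
  have s0: "?s \<in> {s \<in> StdSeqs d n. length s = 2}" using X le by (simp add: StdSeqs_def standard_def flat_def)
  have mD: "set ?m \<subseteq> Dos d n" using D by simp
  obtain S0 C0 where S0: "finite S0" "S0 \<subseteq> {s \<in> StdSeqs d n. length s = 2}" "mono n ?m - lincomb n S0 C0 \<in> Jid d n"
    using modspan_lincomb[OF quadratic_span[OF D, unfolded std2_def]] by blast
  \<comment> \<open>The sorted pair is added with coefficient 0 if it did not occur, so that it is
    an index whose coefficient can be computed; the computation then shows that it does
    occur.\<close>
  define S where "S = insert ?s S0"
  define C where "C = (\<lambda>s. if s \<in> S0 then C0 s else 0)"
  have S: "finite S" "S \<subseteq> {s \<in> StdSeqs d n. length s = 2}" using S0 s0 by (auto simp: S_def)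
  have J: "mono n ?m - lincomb n S C \<in> Jid d n"
    using S0(3) lincomb_superset[of S S0 n C0] S(1) by (simp add: C_def S_def subset_insertI)
  have Std: "S \<subseteq> StdSeqs d n" using S by auto
  have eps: "C ?s = 1 \<or> C ?s = - 1"
  proof (rule shuffle_coefficient[OF stp_Wbot n S(1) StdSeqs_inj[OF Std]])
    show "set (map (encp n) s) \<subseteq> FD d n \<and> dstd (map (encp n) s) \<and> below (Wbot n) (map (encp n) s)" if "s \<in> S" for s
      using StdSeqs_FD Std that by blast
    show F: "set (map (encp n) ?m) \<subseteq> FD d n" using encp_FD mD by auto
    show "below (Wbot n) (map (encp n) ?m)"
      using F stp_le_Wbot unfolding below_def FD_def paired_def by fastforce
    show "evl n c (map (encp n) ?m) = (\<Sum>s\<in>S. C s * evl n c (map (encp n) s))" if "Fam d n (Wbot n) c" for c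
      by (rule expansion_relation[OF n mD Std J that])
    show "?s \<in> S" by (simp add: S_def)
    have "mset (flat ?m) = mset (flat ?s)" using \<sigma> by simp
    then show "mset (fl (map (encp n) ?m)) = mset (fl (map (encp n) ?s))"
      unfolding fl_encp mset_map by (rule arg_cong)
  qed
  have "lincomb n S C = const (C ?s) * mono n ?s + lincomb n (S - {?s}) C"
    unfolding lincomb_def by (rule sum.remove[OF S(1)]) (simp add: S_def)
  then have "pD n (y1, y2) * pD n (y3, y4) - const (C ?s) * (pD n (x1, x2) * pD n (x3, x4)) - lincomb n (S - {?s}) C = mono n ?m - lincomb n S C"
    by simp
  then have J': "pD n (y1, y2) * pD n (y3, y4) - const (C ?s) * (pD n (x1, x2) * pD n (x3, x4)) - lincomb n (S - {?s}) C \<in> Jid d n"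
    using J by (simp only:)
  have "finite (S - {?s})" "S - {?s} \<subseteq> {s \<in> StdSeqs d n. length s = 2} - {?s}" using S by auto
  moreover have "C ?s \<in> {1, -1}" using eps by auto
  ultimately show ?thesis by (intro conjI X bexI[of _ "C ?s"] exI[of _ "S - {?s}"] exI[of _ C] J')
qed

theorem theorem5p9:
  fixes n d :: nat
  assumes "n \<ge> 1"
  shows "is_ASL d n"
  unfolding is_ASL_def Let_def
proof (intro conjI ballI allI impI)
  note n = assms
  show "is_doset (PP d n) (le_lv n) (Dos d n)" by (rule is_doset_Dos)
  show "homcomp k f \<in> Jid d n" if "f \<in> Jid d n" for f k by (rule Jid_homogeneous[OF n that])
  show "pD n u \<in> Ring d n" if "u \<in> Dos d n" for u by (rule pD_Ring[OF that])
  show "pD n u - pD n v \<notin> Jid d n" if "u \<in> Dos d n" "v \<in> Dos d n" "u \<noteq> v" for u v by (rule pD_inj_mod[OF n that])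
  have span: "\<exists>S c. finite S \<and> S \<subseteq> StdSeqs d n \<and> f - lincomb n S c \<in> Jid d n" if "f \<in> Ring d n" for f
    by (rule modspan_lincomb[OF Ring_standard_span[OF n that]])
  show "\<exists>S c. finite S \<and> S \<subseteq> StdSeqs d n \<and> f - lincomb n S c \<in> Jid d n" if "f \<in> Ring d n" for f by (rule span[OF that])
  show "\<exists>S c. finite S \<and> (\<forall>s\<in>S. set s \<subseteq> Dos d n) \<and> f - lincomb n S c \<in> Jid d n" if "f \<in> Ring d n" for f
    using span[OF that] unfolding StdSeqs_def by blast
  show "c s = 0" if "finite S \<and> S \<subseteq> StdSeqs d n \<and> lincomb n S c \<in> Jid d n" "s \<in> S" for S c s
    using standard_independent[OF n] that by blast
  show "lexless n (flat s) (flat ps)"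
    if ps: "set ps \<subseteq> Dos d n \<and> \<not> standard n ps"
      and S: "finite S \<and> S \<subseteq> StdSeqs d n \<and> mono n ps - lincomb n S c \<in> Jid d n" and s: "s \<in> S" "c s \<noteq> 0" for ps S c s
  proof -
    have psD: "set ps \<subseteq> Dos d n" using ps by simp
    obtain S' c' where S': "finite S'" "S' \<subseteq> lower_std d n ps" "mono n ps - lincomb n S' c' \<in> Jid d n"
      using straightening_expansion[OF n psD] .
    have S'': "S' \<subseteq> StdSeqs d n" using S'(2) lower_std_StdSeqs by blast
    have S0: "finite S" "S \<subseteq> StdSeqs d n" "mono n ps - lincomb n S c \<in> Jid d n" using S by auto
    have "s \<in> S'" by (rule expansion_unique[OF n S0 S'(1) S'' S'(3) s])
    moreover have "s \<noteq> ps" using ps S s by (auto simp: StdSeqs_def)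
    ultimately show ?thesis using S'(2) lex_lexless by (auto simp: lower_std_def)
  qed
  fix x1 x2 x3 x4 :: lv and \<sigma> :: "nat \<Rightarrow> nat"
  let ?xs = "[x1, x2, x3, x4]"
  assume a: "le_lv n x1 x2 \<and> le_lv n x2 x3 \<and> le_lv n x3 x4 \<and> \<sigma> permutes {..<4} \<and>
    (?xs ! \<sigma> 0, ?xs ! \<sigma> 1) \<in> Dos d n \<and> (?xs ! \<sigma> 2, ?xs ! \<sigma> 3) \<in> Dos d n"
  have "length ?xs = 4" by simp
  then have "\<sigma> permutes {..<length ?xs}" using a by (simp only:)
  then have "mset (permute_list \<sigma> ?xs) = mset ?xs" by (rule mset_permute_list)
  moreover have "permute_list \<sigma> ?xs = [?xs ! \<sigma> 0, ?xs ! \<sigma> 1, ?xs ! \<sigma> 2, ?xs ! \<sigma> 3]"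
    unfolding permute_list_def by (simp add: upt_rec numeral_2_eq_2 numeral_3_eq_3)
  ultimately have m: "mset [?xs ! \<sigma> 0, ?xs ! \<sigma> 1, ?xs ! \<sigma> 2, ?xs ! \<sigma> 3] = mset ?xs" by simp
  note q = quadratic_shuffle[OF n _ _ _ m, of d]
  show "(x1, x2) \<in> Dos d n" "(x3, x4) \<in> Dos d n"
    and "\<exists>\<epsilon>\<in>{1, - 1}. \<exists>S c. finite S \<and> S \<subseteq> {s \<in> StdSeqs d n. length s = 2} - {[(x1, x2), (x3, x4)]} \<and>
      pD n (?xs ! \<sigma> 0, ?xs ! \<sigma> 1) * pD n (?xs ! \<sigma> 2, ?xs ! \<sigma> 3) - const \<epsilon> * (pD n (x1, x2) * pD n (x3, x4)) - lincomb n S c \<in> Jid d n"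
    using q a by blast+
qed

end
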